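(* Let $(M,g)$ be a compact connected Riemannian manifold of dimension $\geq 3$ with boundary $\Sigma$, and let $\Sigma_1,\dots,\Sigma_b$ ($b\geq 1$) be the connected components of $\Sigma$. (i) For every neighborhood $V$ of $\Sigma$ in $M$, there exists a one-parameter family of Riemannian metrics $g_\varepsilon$ on $M$ (indexed by all sufficiently small $\varepsilon>0$), each conformal to $g$ and coinciding with $g$ on $\Sigma$ and in $M\setminus V$, such that $$\sigma_{b+1}(M,g_\varepsilon)\to\infty\quad\text{as}\quad \varepsilon\to 0.$$ (ii) There exists a one-parameter family of Riemannian metrics $g_\varepsilon$ on $M$ (indexed by all sufficiently small $\varepsilon>0$), each conformal to $g$ and coinciding with $g$ on $\Sigma$, such that $$\sigma_2(M,g_\varepsilon)\to\infty\quad\text{as}\quad \varepsilon\to 0.$$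
   Context: Manifolds and Riemannian metrics are smooth. A metric $g'$ is conformal to $g$ if $g'=h^2g$ for some smooth positive function $h$ on $M$. Steklov eigenvalues: for a smooth compact connected Riemannian manifold $(M,g)$ with nonempty boundary $\Sigma$, these are the real numbers $\sigma$ for which there is a non-zero function $f:M\to\mathbb{R}$, harmonic with respect to $g$, with $\partial_\nu f=\sigma f$ on $\Sigma$, where $\partial_\nu$ is the outward normal derivative. They form a discrete sequence, indexed from $1$ and repeated according to multiplicity, $0=\sigma_1<\sigma_2\le\sigma_3\le\cdots\nearrow\infty$, with $\sigma_k=\sigma_k(M,g)$. Equivalently, $$\sigma_k(M,g)=\min_{E}\max_{0\neq f\in E}\frac{\int_M|df|_g^2\,dv_g}{\int_\Sigma f^2\,dv_g},$$ where $E$ ranges over $k$-dimensional linear subspaces of $C^\infty(M)$, the integral over $\Sigma$ is with respect to the Riemannian measure induced by $g$ on $\Sigma$, and the quotient is $+\infty$ if $f$ is nonzero and vanishes on $\Sigma$. *)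

theory Defs
  imports "HOL-Analysis.Analysis" "HOL-Library.Function_Algebras" "HOL-Library.Extended_Real"
begin

subsection \<open>Smooth maps\<close>

primrec Ck_on :: "nat \<Rightarrow> ('a::real_normed_vector \<Rightarrow> 'b::real_normed_vector) \<Rightarrow> 'a set \<Rightarrow> bool" where
  "Ck_on 0 F W \<longleftrightarrow> continuous_on W F"
| "Ck_on (Suc k) F W \<longleftrightarrow>
     F differentiable_on W \<and> (\<forall>v. Ck_on k (\<lambda>x. frechet_derivative F (at x) v) W)"

text \<open>\<^const>\<open>Ck_on\<close> is meant for open sets. A map on an arbitrary set (here: a relatively open
  subset of a half-space) is smooth if it extends locally to a smooth map on an open set.\<close>

definition smooth_on :: "'a::real_normed_vector set \<Rightarrow> ('a \<Rightarrow> 'b::real_normed_vector) \<Rightarrow> bool" where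
  "smooth_on S F \<longleftrightarrow>
     (\<forall>x\<in>S. \<exists>W F'. open W \<and> x \<in> W \<and> (\<forall>k. Ck_on k F' W) \<and> (\<forall>y\<in>S \<inter> W. F' y = F y))"


subsection \<open>Smooth manifolds with boundary\<close>

text \<open>The model space has coordinates indexed by \<^typ>\<open>'m option\<close>, where \<^const>\<open>None\<close> is the
  coordinate normal to the boundary. The dimension is CARD('m option) = CARD('m) + 1, which can be
  any integer \<open>n \<ge> 2\<close>. A chart is a pair of its domain and its coordinate map, and a
  manifold is a subset of a Hausdorff space, with the subspace topology, together with an atlas
  (not necessarily a maximal one). Second countability is not
  required because only compact manifolds are considered.\<close>

type_synonym 'm model = "real ^ ('m option)"
type_synonym ('a, 'm) chart = "'a set \<times> ('a \<Rightarrow> 'm model)"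

definition half_space :: "('m::finite) model set" where
  "half_space = {x. 0 \<le> x $ None}"

abbreviation chart_image :: "('a, 'm::finite) chart \<Rightarrow> 'm model set" where
  "chart_image c \<equiv> snd c ` fst c"

abbreviation chart_inv :: "('a, 'm::finite) chart \<Rightarrow> 'm model \<Rightarrow> 'a" where
  "chart_inv c \<equiv> inv_into (fst c) (snd c)"

definition is_chart :: "'a::t2_space set \<Rightarrow> ('a, 'm::finite) chart \<Rightarrow> bool" where
  "is_chart M c \<longleftrightarrow>
     openin (top_of_set M) (fst c) \<and>
     openin (top_of_set half_space) (chart_image c) \<and>
     homeomorphism (fst c) (chart_image c) (snd c) (chart_inv c)"

definition transition :: "('a, 'm::finite) chart \<Rightarrow> ('a, 'm) chart \<Rightarrow> 'm model \<Rightarrow> 'm model" where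
  "transition c d = snd d \<circ> chart_inv c"

definition smooth_manifold :: "'a::t2_space set \<Rightarrow> ('a, 'm::finite) chart set \<Rightarrow> bool" where
  "smooth_manifold M A \<longleftrightarrow>
     (\<forall>c\<in>A. is_chart M c) \<and> M = (\<Union>c\<in>A. fst c) \<and>
     (\<forall>c\<in>A. \<forall>d\<in>A. smooth_on (snd c ` (fst c \<inter> fst d)) (transition c d))"

definition boundary :: "('a, 'm::finite) chart set \<Rightarrow> 'a set" where
  "boundary A = {p. \<exists>c\<in>A. p \<in> fst c \<and> snd c p $ None = 0}"

definition smooth_fun :: "('a, 'm::finite) chart set \<Rightarrow> ('a \<Rightarrow> real) \<Rightarrow> bool" where
  "smooth_fun A f \<longleftrightarrow> (\<forall>c\<in>A. smooth_on (chart_image c) (f \<circ> chart_inv c))"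


subsection \<open>Riemannian metrics\<close>

text \<open>A metric is given by its components: \<open>g c p\<close> is the Gram matrix \<open>(g\<^sub>i\<^sub>j)\<close> at the point
  \<open>p\<close> in the coordinates of the chart \<open>c\<close>. Only the values with \<open>c\<close> in the atlas and \<open>p\<close> in
  the domain of \<open>c\<close> are meaningful. Derivatives are taken within the half-space, so that they are
  one-sided in the normal direction at boundary points; they are unique there.\<close>

type_synonym ('a, 'm) metric = "('a, 'm) chart \<Rightarrow> 'a \<Rightarrow> real ^ ('m option) ^ ('m option)"

definition jacobian_transition ::
    "('a, 'm::finite) chart \<Rightarrow> ('a, 'm) chart \<Rightarrow> 'a \<Rightarrow> real ^ ('m option) ^ ('m option)" where
  "jacobian_transition c d p =
     matrix (frechet_derivative (transition c d) (at (snd c p) within half_space))"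

definition riemannian_metric :: "('a, 'm::finite) chart set \<Rightarrow> ('a, 'm) metric \<Rightarrow> bool" where
  "riemannian_metric A g \<longleftrightarrow>
     (\<forall>c\<in>A. \<forall>p\<in>fst c. transpose (g c p) = g c p \<and> (\<forall>v. v \<noteq> 0 \<longrightarrow> 0 < v \<bullet> (g c p *v v))) \<and>
     (\<forall>c\<in>A. \<forall>d\<in>A. \<forall>p\<in>fst c \<inter> fst d.
        g c p = transpose (jacobian_transition c d p) ** g d p ** jacobian_transition c d p) \<and>
     (\<forall>c\<in>A. smooth_on (chart_image c) (g c \<circ> chart_inv c))"

definition conformal :: "('a, 'm::finite) chart set \<Rightarrow> ('a, 'm) metric \<Rightarrow> ('a, 'm) metric \<Rightarrow> bool" where
  "conformal A g' g \<longleftrightarrow>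
     (\<exists>h. smooth_fun A h \<and> (\<forall>c\<in>A. \<forall>p\<in>fst c. 0 < h p \<and> g' c p = (h p)\<^sup>2 *\<^sub>R g c p))"

definition metrics_coincide_on ::
    "('a, 'm::finite) chart set \<Rightarrow> 'a set \<Rightarrow> ('a, 'm) metric \<Rightarrow> ('a, 'm) metric \<Rightarrow> bool" where
  "metrics_coincide_on A S g' g \<longleftrightarrow> (\<forall>c\<in>A. \<forall>p\<in>fst c \<inter> S. g' c p = g c p)"


subsection \<open>Laplace--Beltrami operator and normal derivative\<close>

definition partial_deriv :: "'m::finite option \<Rightarrow> ('m model \<Rightarrow> real) \<Rightarrow> 'm model \<Rightarrow> real" where
  "partial_deriv i F x = frechet_derivative F (at x within half_space) (axis i 1)"

text \<open>In the coordinates of the chart \<open>c\<close>, the gradient is \<open>(grad f)\<^sup>i = g\<^sup>i\<^sup>j \<partial>\<^sub>j f\<close> and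
  the Laplacian is \<open>(det g)\<^sup>-\<^sup>1\<^sup>/\<^sup>2 \<partial>\<^sub>i ((det g)\<^sup>1\<^sup>/\<^sup>2 (grad f)\<^sup>i)\<close>.\<close>

definition gradient :: "('a, 'm::finite) metric \<Rightarrow> ('a, 'm) chart \<Rightarrow> ('a \<Rightarrow> real) \<Rightarrow> 'm model \<Rightarrow> 'm model" where
  "gradient g c f x =
     matrix_inv (g c (chart_inv c x)) *v (\<chi> j. partial_deriv j (f \<circ> chart_inv c) x)"

definition laplacian :: "('a, 'm::finite) metric \<Rightarrow> ('a, 'm) chart \<Rightarrow> ('a \<Rightarrow> real) \<Rightarrow> 'a \<Rightarrow> real" where
  "laplacian g c f p =
     (\<Sum>i\<in>UNIV. partial_deriv i
        (\<lambda>x. sqrt (det (g c (chart_inv c x))) * gradient g c f x $ i) (snd c p))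
     / sqrt (det (g c p))"

definition harmonic :: "('a, 'm::finite) chart set \<Rightarrow> ('a, 'm) metric \<Rightarrow> ('a \<Rightarrow> real) \<Rightarrow> bool" where
  "harmonic A g f \<longleftrightarrow> smooth_fun A f \<and> (\<forall>c\<in>A. \<forall>p\<in>fst c. laplacian g c f p = 0)"

text \<open>In a chart, the tangent space of the boundary is \<open>{v. v $ None = 0}\<close>, and the outward
  vectors are those with negative normal coordinate.\<close>

definition outward_normal :: "('a, 'm::finite) metric \<Rightarrow> ('a, 'm) chart \<Rightarrow> 'a \<Rightarrow> 'm model" where
  "outward_normal g c p =
     (THE \<nu>. (\<forall>v. v $ None = 0 \<longrightarrow> v \<bullet> (g c p *v \<nu>) = 0) \<and> \<nu> \<bullet> (g c p *v \<nu>) = 1 \<and> \<nu> $ None < 0)"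

definition normal_deriv :: "('a, 'm::finite) metric \<Rightarrow> ('a, 'm) chart \<Rightarrow> ('a \<Rightarrow> real) \<Rightarrow> 'a \<Rightarrow> real" where
  "normal_deriv g c f p =
     frechet_derivative (f \<circ> chart_inv c) (at (snd c p) within half_space) (outward_normal g c p)"


subsection \<open>Steklov eigenvalues\<close>

text \<open>Functions on \<open>M\<close> are represented by functions on the ambient type that vanish outside \<open>M\<close>.
  A real number is a Steklov eigenvalue if this space is non-zero, and its multiplicity is the
  dimension of this (always finite-dimensional) space.\<close>

definition steklov_eigenspace ::
    "'a set \<Rightarrow> ('a, 'm::finite) chart set \<Rightarrow> ('a, 'm) metric \<Rightarrow> real \<Rightarrow> ('a \<Rightarrow> real) set" where
  "steklov_eigenspace M A g s =
     {f. (\<forall>p. p \<notin> M \<longrightarrow> f p = 0) \<and> harmonic A g f \<and>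
         (\<forall>c\<in>A. \<forall>p\<in>fst c \<inter> boundary A. normal_deriv g c f p = s * f p)}"

definition steklov_multiplicity ::
    "'a set \<Rightarrow> ('a, 'm::finite) chart set \<Rightarrow> ('a, 'm) metric \<Rightarrow> real \<Rightarrow> nat" where
  "steklov_multiplicity M A g s =
     vector_space.dim (\<lambda>(r::real) (f::'a \<Rightarrow> real). \<lambda>p. r * f p) (steklov_eigenspace M A g s)"

text \<open>The \<open>k\<close>-th eigenvalue (\<open>k \<ge> 1\<close>) is the least \<open>t\<close> such that at least \<open>k\<close> eigenvalues
  are \<open>\<le> t\<close>, counted with multiplicity. The infimum is attained and finite because the spectrum
  is discrete and infinite.\<close>

definition steklov_eigenvalue ::
    "'a set \<Rightarrow> ('a, 'm::finite) chart set \<Rightarrow> ('a, 'm) metric \<Rightarrow> nat \<Rightarrow> ereal" where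
  "steklov_eigenvalue M A g k =
     Inf {ereal t | t. \<exists>S. finite S \<and> S \<subseteq> {..t} \<and> k \<le> (\<Sum>s\<in>S. steklov_multiplicity M A g s)}"

end

theory Submission
  imports Defs
begin

text \<open>Take \<open>g\<^sub>\<epsilon> = (1 + \<phi>/\<epsilon>)\<^sup>2 g\<close> with a smooth \<open>\<phi> \<ge> 0\<close> that vanishes on \<open>\<Sigma>\<close>, has nonzero normal
  derivative there, and is positive near \<open>\<Sigma>\<close> off \<open>\<Sigma>\<close> (off \<open>V\<close> it vanishes in part (i); in part (ii) it is
  positive in the whole interior). Only lower bounds for eigenvalues are needed, and the maximum
  principle gives them without integration.

  The Dirichlet-to-Neumann operator is accretive in the supremum norm, so on a combination of \<open>k\<close>
  Steklov eigenfunctions with eigenvalues at most \<open>t\<close> and supremum norm 1 it is bounded by \<open>t 3\<^sup>k\<close>. If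
  there are more eigenvalues than boundary components (respectively, at least two), some combination
  \<open>f\<close> of norm 1 vanishes at a chosen point of each component (respectively, at one boundary point), and
  after a change of sign \<open>f = 1\<close> at a boundary point \<open>q\<close>. The function \<open>v = 1 - f \<ge> 0\<close> has bounded normal
  derivative, vanishes at \<open>q\<close> and equals 1 at the chosen point. The barrier \<open>2 sqrt \<epsilon> sqrt (\<epsilon> + \<phi>)\<close> shows that
  \<open>v\<close> changes by \<open>O(sqrt \<epsilon>)\<close> between \<open>\<Sigma>\<close> and a level set of \<open>\<phi>\<close> near \<open>\<Sigma>\<close>. On compact connected sets where
  \<open>\<phi> > 0\<close> the Laplace equation of \<open>g\<^sub>\<epsilon>\<close> has bounded coefficients as \<open>\<epsilon>\<close> tends to 0, hence a Harnack inequality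
  uniform in \<open>\<epsilon>\<close>, which bounds \<open>v(q)\<close> away from 0: a contradiction.\<close>

section \<open>Smooth functions on open sets\<close>

text \<open>All the metrics agree on \<Sigma>, so the boundary condition does not depend on
  \<epsilon>. Only the equation changes: it acquires the drift (n - 2) grad \<phi> / (\<epsilon> +
  \<phi>), which points away from \<Sigma> and blows up there as \<epsilon> tends to 0. A solution
  with bounded normal derivative is thereby tied to its values slightly inside. For n = 2 the
  Laplace equation is conformally invariant and the eigenvalues would not move at all. The obstacle
  to working without integrals is the absence of orthogonality: a combination of norm 1 may have
  huge coefficients, so bounds on the eigenvalues do not at once bound its normal derivative. The
  bound t 3^k is purely algebraic and independent of \<epsilon>; \<epsilon> is made small only
  afterwards. In part (i) the potential vanishes off V, and near such zeros the drift is not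
  uniformly bounded. Each boundary component therefore gets its own Harnack chain and its own
  normalising point, which costs b linear conditions. Only a weak Harnack statement enters: v lies
  between 0 and 2, reaches 1/2 somewhere, and must stay above some constant. A gradient bound and a
  Gaussian comparison function suffice for this.\<close>

lemma Ck_on_SucD: "Ck_on (Suc k) F W \<Longrightarrow> Ck_on k F W"
proof (induction k arbitrary: F)
  case 0 then show ?case by (auto intro: differentiable_imp_continuous_on)
next
  case (Suc k)
  from Suc.prems have "F differentiable_on W" "\<And>v. Ck_on (Suc k) (\<lambda>x. frechet_derivative F (at x) v) W"
    by (auto simp only: Ck_on.simps)
  then show ?case using Suc.IH by simp
qed

lemma Ck_on_subset: "Ck_on k F W \<Longrightarrow> V \<subseteq> W \<Longrightarrow> Ck_on k F V"
  by (induction k arbitrary: F) (auto intro: continuous_on_subset differentiable_on_subset)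

lemma Ck_on_has_derivative:
  assumes "Ck_on (Suc k) F W" "open W" "x \<in> W"
  shows "(F has_derivative frechet_derivative F (at x)) (at x)"
  using assms by (auto simp: differentiable_on_eq_differentiable_at frechet_derivative_works)

lemma frechet_derivative_cong_open:
  assumes "open W" "x \<in> W" "\<And>y. y \<in> W \<Longrightarrow> F y = G y"
  shows "frechet_derivative F (at x) = frechet_derivative G (at x)"
proof -
  have "(F has_derivative D) (at x) \<longleftrightarrow> (G has_derivative D) (at x)" for D
    using assms by (metis has_derivative_transform_within_open)
  then show ?thesis unfolding frechet_derivative_def by simp
qed

lemma Ck_on_cong:
  assumes "open W" "\<And>y. y \<in> W \<Longrightarrow> F y = G y"
  shows "Ck_on k F W \<longleftrightarrow> Ck_on k G W"
  using assms(2)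
proof (induction k arbitrary: F G)
  case 0 then show ?case by (simp cong: continuous_on_cong)
next
  case (Suc k)
  have 1: "F differentiable_on W \<longleftrightarrow> G differentiable_on W"
    using Suc.prems by (metis differentiable_on_def differentiable_transform_within zero_less_one)
  have 2: "Ck_on k (\<lambda>x. frechet_derivative F (at x) v) W \<longleftrightarrow> Ck_on k (\<lambda>x. frechet_derivative G (at x) v) W" for v
    by (rule Suc.IH) (metis frechet_derivative_cong_open assms(1) Suc.prems)
  show ?case using 1 2 by simp
qed

text \<open>\<open>frechet_derivative\<close> is a choice operator and awkward to compute with; here
  any explicit derivative formula may stand in for it. The closure rules below rest on this.\<close>

lemma Ck_on_SucI:
  assumes "open W" "\<And>x. x \<in> W \<Longrightarrow> (F has_derivative D x) (at x)" "\<And>v. Ck_on k (\<lambda>x. D x v) W"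
  shows "Ck_on (Suc k) F W"
proof -
  have "frechet_derivative F (at x) = D x" if "x \<in> W" for x
    using assms(2)[OF that] frechet_derivative_at by metis
  then have "Ck_on k (\<lambda>x. frechet_derivative F (at x) v) W" for v
    using Ck_on_cong[OF assms(1), of "\<lambda>x. frechet_derivative F (at x) v" "\<lambda>x. D x v"] assms(3) by simp
  moreover have "F differentiable_on W"
    using assms(1,2) by (meson differentiable_def differentiable_at_imp_differentiable_on)
  ultimately show ?thesis by simp
qed

lemma Ck_on_local:
  assumes "\<And>x. x \<in> W \<Longrightarrow> \<exists>V. open V \<and> x \<in> V \<and> Ck_on k F V"
  shows "Ck_on k F W"
  using assms
proof (induction k arbitrary: F)
  case 0
  then show ?case
    by (metis Ck_on.simps(1) continuous_at_imp_continuous_on continuous_on_eq_continuous_at)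
next
  case (Suc k)
  have "F differentiable_on W"
    using Suc.prems by (metis Ck_on.simps(2) differentiable_at_imp_differentiable_on differentiable_on_eq_differentiable_at)
  moreover have "Ck_on k (\<lambda>x. frechet_derivative F (at x) v) W" for v
    by (rule Suc.IH) (metis Suc.prems Ck_on.simps(2))
  ultimately show ?case by simp
qed

lemma Ck_on_const: "open W \<Longrightarrow> Ck_on k (\<lambda>x. c) W"
proof (induction k arbitrary: c)
  case (Suc k)
  show ?case by (rule Ck_on_SucI[where D="\<lambda>x v. 0"]) (use Suc in auto)
qed simp

lemma Ck_on_linear_comp:
  assumes "bounded_linear h" "open W" "Ck_on k F W"
  shows "Ck_on k (\<lambda>x. h (F x)) W"
  using assms(3)
proof (induction k arbitrary: F)
  case 0 then show ?case using assms(1) by (simp add: bounded_linear.continuous_on)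
next
  case (Suc k)
  show ?case
  proof (rule Ck_on_SucI[OF assms(2)])
    show "((\<lambda>x. h (F x)) has_derivative (\<lambda>v. h (frechet_derivative F (at x) v))) (at x)" if "x \<in> W" for x
      using bounded_linear.has_derivative[OF assms(1) Ck_on_has_derivative[OF Suc.prems assms(2) that]] .
    show "Ck_on k (\<lambda>x. h (frechet_derivative F (at x) v)) W" for v
      using Suc by simp
  qed
qed

lemma Ck_on_id: "open W \<Longrightarrow> Ck_on k (\<lambda>x. x) W"
proof (cases k)
  case (Suc k) assume "open W"
  then show ?thesis unfolding Suc
    by (intro Ck_on_SucI[where D="\<lambda>x v. v"] Ck_on_const) auto
qed simp

lemma Ck_on_linear: "bounded_linear h \<Longrightarrow> open W \<Longrightarrow> Ck_on k h W"
  using Ck_on_linear_comp[OF _ _ Ck_on_id] by blast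

lemma Ck_on_add:
  assumes "open W" "Ck_on k F W" "Ck_on k G W"
  shows "Ck_on k (\<lambda>x. F x + G x) W"
  using assms(2,3)
proof (induction k arbitrary: F G)
  case 0 then show ?case by (simp add: continuous_on_add)
next
  case (Suc k)
  show ?case
  proof (rule Ck_on_SucI[OF assms(1)])
    show "((\<lambda>x. F x + G x) has_derivative (\<lambda>v. frechet_derivative F (at x) v + frechet_derivative G (at x) v)) (at x)" if "x \<in> W" for x
      using Suc.prems that by (intro has_derivative_add Ck_on_has_derivative[OF _ assms(1)])
    show "Ck_on k (\<lambda>x. frechet_derivative F (at x) v + frechet_derivative G (at x) v) W" for v
      using Suc by simp
  qed
qed

lemma Ck_on_bilinear:
  assumes "bounded_bilinear p" "open W" "Ck_on k F W" "Ck_on k G W"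
  shows "Ck_on k (\<lambda>x. p (F x) (G x)) W"
  using assms(3,4)
proof (induction k arbitrary: F G)
  case 0 then show ?case using bounded_bilinear.continuous_on[OF assms(1)] by simp
next
  case (Suc k)
  have FG: "Ck_on k F W" "Ck_on k G W" using Suc.prems Ck_on_SucD by blast+
  show ?case
  proof (rule Ck_on_SucI[OF assms(2)])
    show "((\<lambda>x. p (F x) (G x)) has_derivative (\<lambda>v. p (F x) (frechet_derivative G (at x) v) + p (frechet_derivative F (at x) v) (G x))) (at x)" if "x \<in> W" for x
      using Suc.prems that by (intro bounded_bilinear.FDERIV[OF assms(1)] Ck_on_has_derivative[OF _ assms(2)])
    show "Ck_on k (\<lambda>x. p (F x) (frechet_derivative G (at x) v) + p (frechet_derivative F (at x) v) (G x)) W" for v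
      using Suc FG by (intro Ck_on_add assms(2) Suc.IH) auto
  qed
qed

lemmas Ck_on_scaleR = Ck_on_bilinear[OF bounded_bilinear_scaleR]
lemmas Ck_on_mult = Ck_on_bilinear[OF bounded_bilinear_mult]

lemma Ck_on_minus: "open W \<Longrightarrow> Ck_on k F W \<Longrightarrow> Ck_on k (\<lambda>x. - F x) W"
  by (rule Ck_on_linear_comp[where h=uminus]) (auto intro: bounded_linear_minus bounded_linear_ident)

lemma Ck_on_diff: "open W \<Longrightarrow> Ck_on k F W \<Longrightarrow> Ck_on k G W \<Longrightarrow> Ck_on k (\<lambda>x. F x - G x) W"
  using Ck_on_add[of W k F "\<lambda>x. - G x"] Ck_on_minus[of W k G] by simp

lemma Ck_on_sum: "open W \<Longrightarrow> (\<And>i. i \<in> I \<Longrightarrow> Ck_on k (F i) W) \<Longrightarrow> Ck_on k (\<lambda>x. \<Sum>i\<in>I. F i x) W"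
  by (induction I rule: infinite_finite_induct) (simp_all add: Ck_on_const Ck_on_add)

lemma Ck_on_prod:
  fixes F :: "'i \<Rightarrow> 'a::real_normed_vector \<Rightarrow> real"
  shows "open W \<Longrightarrow> (\<And>i. i \<in> I \<Longrightarrow> Ck_on k (F i) W) \<Longrightarrow> Ck_on k (\<lambda>x. \<Prod>i\<in>I. F i x) W"
  by (induction I rule: infinite_finite_induct) (simp_all add: Ck_on_const Ck_on_mult)

lemma Ck_on_power:
  fixes F :: "'a::real_normed_vector \<Rightarrow> real"
  shows "open W \<Longrightarrow> Ck_on k F W \<Longrightarrow> Ck_on k (\<lambda>x. F x ^ m) W"
  by (induction m) (simp_all add: Ck_on_const Ck_on_mult)

text \<open>The chain rule applies the derivative of \<open>G\<close> in a direction that varies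
  with x, whereas \<open>Ck_on\<close> speaks of fixed directions only. Expanding that direction in
  \<open>Basis\<close> reduces to fixed ones, which is why the middle space is Euclidean.\<close>

lemma Ck_on_compose:
  fixes F :: "'a::real_normed_vector \<Rightarrow> 'b::euclidean_space" and G :: "'b \<Rightarrow> 'c::real_normed_vector"
  assumes "open W" "open V" "F ` W \<subseteq> V" "Ck_on k F W" "Ck_on k G V"
  shows "Ck_on k (\<lambda>x. G (F x)) W"
  using assms(4,5)
proof (induction k arbitrary: G)
  case 0
  have "continuous_on (F ` W) G" using 0 assms(3) continuous_on_subset by auto
  with 0 show ?case using continuous_on_compose2[of "F ` W" G W F] by auto
next
  case (Suc k)
  show ?case
  proof (rule Ck_on_SucI[OF assms(1)])
    fix x assume x: "x \<in> W"
    then have Fx: "F x \<in> V" using assms(3) by blast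
    have dG: "(G has_derivative frechet_derivative G (at (F x))) (at (F x))"
      using Ck_on_has_derivative[OF Suc.prems(2) assms(2) Fx] .
    have dF: "(F has_derivative frechet_derivative F (at x)) (at x)"
      using Ck_on_has_derivative[OF Suc.prems(1) assms(1) x] .
    have lin: "linear (frechet_derivative G (at (F x)))"
      using dG has_derivative_linear by blast
    have "frechet_derivative G (at (F x)) w = (\<Sum>b\<in>Basis. (w \<bullet> b) *\<^sub>R frechet_derivative G (at (F x)) b)" for w
      by (subst euclidean_representation[of w, symmetric]) (simp add: linear_sum[OF lin] linear_cmul[OF lin])
    note rep = this
    have "frechet_derivative G (at (F x)) \<circ> frechet_derivative F (at x)
      = (\<lambda>v. \<Sum>b\<in>Basis. (frechet_derivative F (at x) v \<bullet> b) *\<^sub>R frechet_derivative G (at (F x)) b)"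
      by (rule ext, unfold o_def, rule rep)
    then show "((\<lambda>x. G (F x)) has_derivative (\<lambda>v. \<Sum>b\<in>Basis. (frechet_derivative F (at x) v \<bullet> b) *\<^sub>R frechet_derivative G (at (F x)) b)) (at x)"
      using diff_chain_at[OF dF dG] by (simp add: o_def)
  next
    fix v
    have "Ck_on k (\<lambda>x. frechet_derivative F (at x) v \<bullet> b) W" for b
      using Suc.prems(1) by (intro Ck_on_linear_comp[OF bounded_linear_inner_left assms(1)]) simp
    moreover have "Ck_on k (\<lambda>x. frechet_derivative G (at (F x)) b) W" for b
      using Suc.IH[OF Ck_on_SucD[OF Suc.prems(1)], of "\<lambda>y. frechet_derivative G (at y) b"] Suc.prems(2) by simp
    ultimately show "Ck_on k (\<lambda>x. \<Sum>b\<in>Basis. (frechet_derivative F (at x) v \<bullet> b) *\<^sub>R frechet_derivative G (at (F x)) b) W"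
      using assms(1) by (intro Ck_on_sum Ck_on_scaleR) auto
  qed
qed

section \<open>Reciprocal, square root and exponential\<close>

lemma Ck_on_Suc_real:
  assumes "open W" "\<And>x. x \<in> W \<Longrightarrow> (f has_real_derivative f' x) (at x)" "Ck_on k f' W"
  shows "Ck_on (Suc k) f W"
proof (rule Ck_on_SucI[OF assms(1)])
  show "(f has_derivative (\<lambda>v. f' x * v)) (at x)" if "x \<in> W" for x
    using assms(2)[OF that] by (simp add: has_field_derivative_def)
  show "Ck_on k (\<lambda>x. f' x * v) W" for v
    by (rule Ck_on_mult[OF assms(1) assms(3) Ck_on_const[OF assms(1)]])
qed

lemma Ck_on_inverse_real: "Ck_on k (\<lambda>x::real. inverse x) (- {0})"
proof (induction k)
  case 0 then show ?case by (auto intro!: continuous_intros)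
next
  case (Suc k)
  show ?case
  proof (rule Ck_on_Suc_real)
    show "Ck_on k (\<lambda>x::real. - (inverse x * inverse x)) (- {0})"
      by (rule Ck_on_minus[OF _ Ck_on_mult[OF _ Suc Suc]]) auto
    show "(inverse has_real_derivative - (inverse x * inverse x)) (at x)" if "x \<in> -{0}" for x :: real
      using that DERIV_inverse[of x] by (simp add: power2_eq_square)
  qed auto
qed

lemma Ck_on_inverse:
  fixes F :: "'a::real_normed_vector \<Rightarrow> real"
  assumes "open W" "Ck_on k F W" "\<And>x. x \<in> W \<Longrightarrow> F x \<noteq> 0"
  shows "Ck_on k (\<lambda>x. inverse (F x)) W"
  by (rule Ck_on_compose[OF assms(1) _ _ assms(2) Ck_on_inverse_real]) (use assms(3) in auto)

lemma Ck_on_sqrt_real: "Ck_on k sqrt {0<..}"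
proof (induction k)
  case 0 then show ?case by (auto intro!: continuous_intros)
next
  case (Suc k)
  show ?case
  proof (rule Ck_on_Suc_real)
    show "Ck_on k (\<lambda>x::real. inverse (sqrt x) * (1/2)) {0<..}"
      by (rule Ck_on_mult[OF _ Ck_on_inverse[OF _ Suc] Ck_on_const]) auto
    show "(sqrt has_real_derivative inverse (sqrt x) * (1/2)) (at x)" if "x \<in> {0<..}" for x :: real
      using that DERIV_real_sqrt[of x] by (simp add: field_simps)
  qed auto
qed

lemma Ck_on_sqrt:
  fixes F :: "'a::real_normed_vector \<Rightarrow> real"
  assumes "open W" "Ck_on k F W" "\<And>x. x \<in> W \<Longrightarrow> F x > 0"
  shows "Ck_on k (\<lambda>x. sqrt (F x)) W"
  by (rule Ck_on_compose[OF assms(1) _ _ assms(2) Ck_on_sqrt_real]) (use assms(3) in auto)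

lemma Ck_on_exp_real: "Ck_on k (exp :: real \<Rightarrow> real) UNIV"
proof (induction k)
  case (Suc k)
  show ?case by (rule Ck_on_Suc_real[where f'=exp]) (use Suc in auto)
qed (auto intro!: continuous_intros)

lemma Ck_on_exp:
  fixes F :: "'a::real_normed_vector \<Rightarrow> real"
  assumes "open W" "Ck_on k F W"
  shows "Ck_on k (\<lambda>x. exp (F x)) W"
  by (rule Ck_on_compose[OF assms(1) _ _ assms(2) Ck_on_exp_real]) auto

section \<open>The flat function exp(-1/t) and its derivatives\<close>

definition flat_exp :: "nat \<Rightarrow> real \<Rightarrow> real" where
  "flat_exp m t = (if 0 < t then inverse t ^ m * exp (- inverse t) else 0)"

text \<open>The exponential series dominates its term of order \<open>m + 2\<close>. With y = 1/t
  this leaves a factor t^2, one power more than continuity at 0 requires; the extra power gives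
  derivative 0 there.\<close>

lemma flat_exp_le: "\<bar>flat_exp m t\<bar> \<le> fact (m + 2) * t\<^sup>2"
proof (cases "0 < t")
  case True
  let ?y = "inverse t"
  have y: "0 < ?y" using True by simp
  have "?y ^ (m+2) / fact (m+2) \<le> exp ?y"
  proof -
    have "(\<Sum>k\<in>{m+2}. ?y ^ k /\<^sub>R fact k) \<le> (\<Sum>k. ?y ^ k /\<^sub>R fact k)"
      using y by (intro sum_le_suminf summable_exp_generic) auto
    then show ?thesis by (simp add: exp_def divide_inverse mult.commute)
  qed
  then have "?y ^ (m + 2) \<le> fact (m+2) * exp ?y"
    by (simp only: pos_divide_le_eq[OF fact_gt_zero] mult.commute)
  then have "?y ^ m * ?y\<^sup>2 \<le> fact (m+2) * exp ?y"
    by (simp only: power_add)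
  then have "?y ^ m * ?y\<^sup>2 * exp (- ?y) * t\<^sup>2 \<le> fact (m+2) * exp ?y * exp (- ?y) * t\<^sup>2"
    by (intro mult_right_mono) auto
  then have "?y ^ m * exp (- ?y) * (?y * t)\<^sup>2 \<le> fact (m+2) * (exp ?y * exp (- ?y)) * t\<^sup>2"
    by (simp add: power_mult_distrib mult_ac)
  then show ?thesis using True y by (simp add: flat_exp_def exp_minus)
qed (simp add: flat_exp_def)

text \<open>The derivative is a combination of members of the same family, so one induction over all
  \<open>m\<close> proves smoothness. The member \<open>m = 0\<close> later serves as the profile of
  the bumps that build \<phi>.\<close>

lemma flat_exp_deriv: "(flat_exp m has_real_derivative flat_exp (m+2) t - real m * flat_exp (m+1) t) (at t)"
proof -
  consider "t > 0" | "t < 0" | "t = 0" by linarith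
  then show ?thesis
  proof cases
    case 1
    have "((\<lambda>t. inverse t ^ m * exp (- inverse t)) has_real_derivative
       flat_exp (m+2) t - real m * flat_exp (m+1) t) (at t)"
    proof -
      have a: "((\<lambda>t. inverse t) has_real_derivative - (inverse t)\<^sup>2) (at t)"
      proof -
        have "t \<noteq> 0" using 1 by simp
        then show ?thesis using DERIV_inverse[of t UNIV] by (simp only: numeral_2_eq_2 not_False_eq_True True_implies_equals)
      qed
      define y e where "y = inverse t" and "e = exp (- y)"
      have "((\<lambda>t. inverse t ^ m * exp (- inverse t)) has_real_derivative
        (real m * (- y\<^sup>2 * y ^ (m - Suc 0))) * e + (e * - (- y\<^sup>2)) * y ^ m) (at t)"
        using DERIV_mult[OF DERIV_power[OF a, of m] DERIV_fun_exp[OF DERIV_minus[OF a]]]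
        unfolding y_def e_def .
      moreover have "real m * (y\<^sup>2 * y ^ (m - Suc 0)) = real m * y ^ (m+1)"
        by (cases m) (simp_all add: power2_eq_square)
      then have "(real m * (- y\<^sup>2 * y ^ (m - Suc 0))) * e + (e * - (- y\<^sup>2)) * y ^ m
        = y ^ (m+2) * e - real m * (y ^ (m+1) * e)"
        by (simp add: power_add power2_eq_square mult_ac)
      moreover have "flat_exp k t = y ^ k * e" for k
        using 1 by (simp add: flat_exp_def y_def e_def)
      ultimately show ?thesis by simp
    qed
    then show ?thesis
      by (rule has_field_derivative_transform_within_open[where S="{0<..}"]) (use 1 in \<open>auto simp: flat_exp_def\<close>)
  next
    case 2
    have "((\<lambda>t. 0) has_real_derivative flat_exp (m+2) t - real m * flat_exp (m+1) t) (at t)"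
      using 2 by (auto simp: flat_exp_def)
    then show ?thesis
      by (rule has_field_derivative_transform_within_open[where S="{..<0}"]) (use 2 in \<open>auto simp: flat_exp_def\<close>)
  next
    case 3
    have "((\<lambda>h. flat_exp m h / h) \<longlongrightarrow> 0) (at 0)"
    proof (rule Lim_null_comparison)
      show "\<forall>\<^sub>F h in at 0. norm (flat_exp m h / h) \<le> fact (m+2) * \<bar>h\<bar>"
        unfolding eventually_at
      proof (intro exI[of _ 1] conjI ballI impI)
        fix h :: real assume "h \<noteq> 0 \<and> dist h 0 < 1"
        then have "0 < \<bar>h\<bar>" by simp
        moreover have "\<bar>flat_exp m h\<bar> \<le> fact (m+2) * \<bar>h\<bar> * \<bar>h\<bar>"
          using flat_exp_le[of m h] by (simp only: power2_eq_square abs_mult_self_eq mult.assoc)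
        ultimately show "norm (flat_exp m h / h) \<le> fact (m+2) * \<bar>h\<bar>"
          by (simp only: real_norm_def abs_divide pos_divide_le_eq)
      qed simp
      show "((\<lambda>h::real. fact (m+2) * \<bar>h\<bar>) \<longlongrightarrow> 0) (at 0)"
        by (rule tendsto_eq_intros | simp)+
    qed
    then show ?thesis using 3 by (simp add: DERIV_def flat_exp_def)
  qed
qed

lemma Ck_on_flat_exp: "Ck_on k (flat_exp m) UNIV"
proof (induction k arbitrary: m)
  case 0 show ?case
    unfolding Ck_on.simps continuous_on_eq_continuous_at[OF open_UNIV]
    using DERIV_isCont[OF flat_exp_deriv] by blast
next
  case (Suc k)
  show ?case
    by (rule Ck_on_Suc_real[where f'="\<lambda>t. flat_exp (m+2) t - real m * flat_exp (m+1) t"])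
      (rule open_UNIV flat_exp_deriv Ck_on_diff Ck_on_mult Ck_on_const Suc)+
qed

section \<open>Smooth maps on open sets: closure properties\<close>

definition Cinf :: "'a::real_normed_vector set \<Rightarrow> ('a \<Rightarrow> 'b::real_normed_vector) \<Rightarrow> bool" where
  "Cinf W F \<longleftrightarrow> open W \<and> (\<forall>k. Ck_on k F W)"

lemma Cinf_open: "Cinf W F \<Longrightarrow> open W"
  and Cinf_const [intro, simp]: "open W \<Longrightarrow> Cinf W (\<lambda>x. c)"
  and Cinf_add: "Cinf W F \<Longrightarrow> Cinf W G \<Longrightarrow> Cinf W (\<lambda>x. F x + G x)"
  and Cinf_diff: "Cinf W F \<Longrightarrow> Cinf W G \<Longrightarrow> Cinf W (\<lambda>x. F x - G x)"
  and Cinf_minus: "Cinf W F \<Longrightarrow> Cinf W (\<lambda>x. - F x)"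
  by (auto simp: Cinf_def intro: Ck_on_const Ck_on_add Ck_on_diff Ck_on_minus)

lemma Cinf_scaleR: "Cinf W f \<Longrightarrow> Cinf W G \<Longrightarrow> Cinf W (\<lambda>x. f x *\<^sub>R G x)"
  by (simp add: Cinf_def Ck_on_scaleR)

lemma Cinf_linear_comp: "bounded_linear h \<Longrightarrow> Cinf W F \<Longrightarrow> Cinf W (\<lambda>x. h (F x))"
  by (simp add: Cinf_def Ck_on_linear_comp)

lemma Cinf_mult: "Cinf W F \<Longrightarrow> Cinf W G \<Longrightarrow> Cinf W (\<lambda>x. F x * G x :: real)"
  by (simp add: Cinf_def Ck_on_mult)

lemma Cinf_sum: "open W \<Longrightarrow> (\<And>i. i \<in> I \<Longrightarrow> Cinf W (F i)) \<Longrightarrow> Cinf W (\<lambda>x. \<Sum>i\<in>I. F i x)"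
  by (simp add: Cinf_def Ck_on_sum)

lemma Cinf_prod: "open W \<Longrightarrow> (\<And>i. i \<in> I \<Longrightarrow> Cinf W (F i)) \<Longrightarrow> Cinf W (\<lambda>x. \<Prod>i\<in>I. F i x :: real)"
  by (simp add: Cinf_def Ck_on_prod)

lemma Cinf_power: "Cinf W F \<Longrightarrow> Cinf W (\<lambda>x. F x ^ m :: real)"
  by (simp add: Cinf_def Ck_on_power)

lemma Cinf_inverse: "Cinf W F \<Longrightarrow> (\<And>x. x \<in> W \<Longrightarrow> F x \<noteq> 0) \<Longrightarrow> Cinf W (\<lambda>x. inverse (F x) :: real)"
  by (simp add: Cinf_def Ck_on_inverse)

lemma Cinf_divide: "Cinf W F \<Longrightarrow> Cinf W G \<Longrightarrow> (\<And>x. x \<in> W \<Longrightarrow> G x \<noteq> 0) \<Longrightarrow> Cinf W (\<lambda>x. F x / G x :: real)"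
  unfolding divide_inverse by (intro Cinf_mult Cinf_inverse)

lemma Cinf_sqrt: "Cinf W F \<Longrightarrow> (\<And>x. x \<in> W \<Longrightarrow> F x > 0) \<Longrightarrow> Cinf W (\<lambda>x. sqrt (F x))"
  by (simp add: Cinf_def Ck_on_sqrt)

lemma Cinf_exp: "Cinf W F \<Longrightarrow> Cinf W (\<lambda>x. exp (F x :: real))"
  by (simp add: Cinf_def Ck_on_exp)

lemma Cinf_nth: "open W \<Longrightarrow> Cinf W (\<lambda>x. x $ i)"
  by (simp add: Cinf_def Ck_on_linear bounded_linear_vec_nth)

lemma Cinf_nth_comp: "Cinf W F \<Longrightarrow> Cinf W (\<lambda>x. F x $ i)"
  by (rule Cinf_linear_comp[OF bounded_linear_vec_nth])

lemma Cinf_subset: "Cinf W F \<Longrightarrow> open V \<Longrightarrow> V \<subseteq> W \<Longrightarrow> Cinf V F"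
  unfolding Cinf_def by (meson Ck_on_subset)

lemma Cinf_cong: "Cinf W F \<Longrightarrow> (\<And>x. x \<in> W \<Longrightarrow> F x = G x) \<Longrightarrow> Cinf W G"
  using Ck_on_cong[of W F G] by (auto simp: Cinf_def)

lemma Cinf_local:
  assumes "\<And>x. x \<in> W \<Longrightarrow> \<exists>V. x \<in> V \<and> Cinf V F" "open W"
  shows "Cinf W F"
  unfolding Cinf_def using assms by (auto intro!: Ck_on_local simp: Cinf_def)

lemma Cinf_compose:
  fixes F :: "'a::real_normed_vector \<Rightarrow> 'b::euclidean_space"
  assumes "Cinf W F" "Cinf V G" "F ` W \<subseteq> V"
  shows "Cinf W (\<lambda>x. G (F x))"
  using assms Ck_on_compose[of W V F] unfolding Cinf_def by blast

lemma Cinf_differentiable: "Cinf W F \<Longrightarrow> x \<in> W \<Longrightarrow> F differentiable (at x)"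
  unfolding Cinf_def by (metis Ck_on.simps(2) differentiable_on_eq_differentiable_at)

lemma Cinf_continuous_on: "Cinf W F \<Longrightarrow> continuous_on W F"
  unfolding Cinf_def by (metis Ck_on.simps(1))

lemma Cinf_frechet: "Cinf W F \<Longrightarrow> Cinf W (\<lambda>x. frechet_derivative F (at x) v)"
  unfolding Cinf_def by (metis Ck_on.simps(2))

section \<open>Two-sided partial derivatives, for use at interior points and on smooth
  extensions\<close>

definition pd :: "'n::finite \<Rightarrow> (real^'n \<Rightarrow> real) \<Rightarrow> real^'n \<Rightarrow> real" where
  "pd i f x = frechet_derivative f (at x) (axis i 1)"

lemma Cinf_pd: "Cinf W f \<Longrightarrow> Cinf W (pd i f)"
  unfolding pd_def[abs_def] by (rule Cinf_frechet)

lemma pd_eqI: "(f has_derivative D) (at x) \<Longrightarrow> pd i f x = D (axis i 1)"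
  unfolding pd_def by (metis frechet_derivative_at)

lemma pd_cong: "open W \<Longrightarrow> x \<in> W \<Longrightarrow> (\<And>y. y \<in> W \<Longrightarrow> f y = g y) \<Longrightarrow> pd i f x = pd i g x"
  unfolding pd_def by (metis frechet_derivative_cong_open)

lemma has_derivative_pd:
  assumes "f differentiable (at x)"
  shows "(f has_derivative (\<lambda>v. \<Sum>i\<in>UNIV. v $ i * pd i f x)) (at x)"
proof -
  have d: "(f has_derivative frechet_derivative f (at x)) (at x)"
    using assms frechet_derivative_works by blast
  then have lin: "linear (frechet_derivative f (at x))" using has_derivative_linear by blast
  have "frechet_derivative f (at x) v = (\<Sum>i\<in>UNIV. v $ i * pd i f x)" for v
  proof -
    have "frechet_derivative f (at x) v = frechet_derivative f (at x) (\<Sum>i\<in>UNIV. v $ i *\<^sub>R axis i 1)"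
      using basis_expansion[of v] by (simp add: scalar_mult_eq_scaleR)
    also have "\<dots> = (\<Sum>i\<in>UNIV. v $ i * pd i f x)"
      by (simp add: linear_sum[OF lin] linear_cmul[OF lin] pd_def)
    finally show ?thesis .
  qed
  then have "frechet_derivative f (at x) = (\<lambda>v. \<Sum>i\<in>UNIV. v $ i * pd i f x)" by (rule ext)
  with d show ?thesis by simp
qed

lemma pd_const [simp]: "pd i (\<lambda>x. c) x = 0"
  by (rule trans[OF pd_eqI[where D="\<lambda>v. 0"]]) auto

lemma pd_const' [simp]: "pd i (\<lambda>x. c) = (\<lambda>x. 0)"
  by (rule ext) simp

lemma pd_nth [simp]: "pd i (\<lambda>x. x $ j) x = (if i = j then 1 else 0)"
  by (rule trans[OF pd_eqI[where D="\<lambda>v. v $ j"]])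
    (auto intro: bounded_linear_imp_has_derivative bounded_linear_vec_nth simp: axis_def)

lemma pd_add: "f differentiable (at x) \<Longrightarrow> g differentiable (at x) \<Longrightarrow> pd i (\<lambda>x. f x + g x) x = pd i f x + pd i g x"
  unfolding pd_def by (subst frechet_derivative_at[symmetric, OF has_derivative_add]) (auto simp: frechet_derivative_works)

lemma pd_mult: "f differentiable (at x) \<Longrightarrow> g differentiable (at x) \<Longrightarrow> pd i (\<lambda>x. f x * g x) x = f x * pd i g x + pd i f x * g x"
  unfolding pd_def by (subst frechet_derivative_at[symmetric, OF has_derivative_mult]) (auto simp: frechet_derivative_works)

lemma pd_sum:
  assumes "\<And>k. k \<in> I \<Longrightarrow> f k differentiable (at x)"
  shows "pd i (\<lambda>x. \<Sum>k\<in>I. f k x) x = (\<Sum>k\<in>I. pd i (f k) x)"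
proof -
  have "((\<lambda>x. \<Sum>k\<in>I. f k x) has_derivative (\<lambda>v. \<Sum>k\<in>I. frechet_derivative (f k) (at x) v)) (at x)"
    using assms by (intro has_derivative_sum) (simp add: frechet_derivative_works)
  from pd_eqI[OF this] show ?thesis by (simp add: pd_def)
qed

lemma pd_chain:
  assumes "f differentiable (at x)" "(\<eta> has_real_derivative d) (at (f x))"
  shows "pd i (\<lambda>x. \<eta> (f x)) x = d * pd i f x"
proof -
  have "(f has_derivative frechet_derivative f (at x)) (at x)" using assms(1) frechet_derivative_works by blast
  moreover have "(\<eta> has_derivative (\<lambda>v. d * v)) (at (f x))" using assms(2) by (simp add: has_field_derivative_def)
  ultimately have "((\<lambda>x. \<eta> (f x)) has_derivative (\<lambda>v. d * frechet_derivative f (at x) v)) (at x)"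
    using diff_chain_at by (fastforce simp: o_def)
  then show ?thesis using pd_eqI by (fastforce simp: pd_def)
qed

lemma DERIV_line:
  assumes "f differentiable (at (x + t *\<^sub>R v))"
  shows "((\<lambda>t. f (x + t *\<^sub>R v)) has_real_derivative (\<Sum>i\<in>UNIV. v $ i * pd i f (x + t *\<^sub>R v))) (at t)"
proof -
  have "((\<lambda>t. x + t *\<^sub>R v) has_derivative (\<lambda>s. s *\<^sub>R v)) (at t)"
    by (auto intro!: derivative_eq_intros)
  from diff_chain_at[OF this has_derivative_pd[OF assms]]
  have "((\<lambda>t. f (x + t *\<^sub>R v)) has_derivative (\<lambda>s. \<Sum>i\<in>UNIV. (s *\<^sub>R v) $ i * pd i f (x + t *\<^sub>R v))) (at t)"
    by (simp add: o_def)
  moreover have "(\<lambda>s. \<Sum>i\<in>UNIV. (s *\<^sub>R v) $ i * pd i f (x + t *\<^sub>R v)) = (*) (\<Sum>i\<in>UNIV. v $ i * pd i f (x + t *\<^sub>R v))"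
    by (rule ext) (simp add: sum_distrib_left mult_ac)
  ultimately show ?thesis by (simp add: has_field_derivative_def)
qed

lemma sum_axis: "(\<Sum>k\<in>UNIV. axis i 1 $ k * f k) = (f i :: real)"
proof -
  have "axis i 1 $ k * f k = (if k = i then f k else 0)" for k by (simp add: axis_def)
  then show ?thesis by simp
qed

lemma DERIV_line_axis:
  assumes "f differentiable (at (x + t *\<^sub>R axis i 1))"
  shows "((\<lambda>t. f (x + t *\<^sub>R axis i 1)) has_real_derivative pd i f (x + t *\<^sub>R axis i 1)) (at t)"
  using DERIV_line[OF assms] by (simp add: sum_axis)

text \<open>Two applications of the mean value theorem, first along \<open>axis i\<close>, then
  along \<open>axis j\<close>, turn the second difference into a mixed derivative at a nearby point.
  The second difference is symmetric in \<open>i\<close> and \<open>j\<close>; letting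
  \<open>s\<close> tend to 0 makes the mixed derivatives commute.\<close>

lemma pd_commute_aux:
  fixes f :: "real^'n::finite \<Rightarrow> real"
  assumes f: "Cinf (ball x r) f" and s: "0 < s" "2 * s < r"
  shows "\<exists>y\<in>cball x (2 * s). f (x + s *\<^sub>R axis i 1 + s *\<^sub>R axis j 1) - f (x + s *\<^sub>R axis i 1) - f (x + s *\<^sub>R axis j 1) + f x
     = s\<^sup>2 * pd j (pd i f) y"
proof -
  let ?e = "axis i 1 :: real^'n" and ?d = "axis j 1 :: real^'n"
  have nrm: "norm (a *\<^sub>R ?e + b *\<^sub>R ?d) \<le> 2 * s" if "0 \<le> a" "a \<le> s" "0 \<le> b" "b \<le> s" for a b
    using norm_triangle_ineq[of "a *\<^sub>R ?e" "b *\<^sub>R ?d"] that by (simp add: norm_axis_1)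
  have inb: "x + a *\<^sub>R ?e + b *\<^sub>R ?d \<in> cball x (2 * s)" if "0 \<le> a" "a \<le> s" "0 \<le> b" "b \<le> s" for a b
  proof -
    have "dist x (x + w) = norm w" for w by (simp add: dist_norm)
    then show ?thesis using nrm[OF that] by (simp only: mem_cball add.assoc)
  qed
  have inb': "x + a *\<^sub>R ?e + b *\<^sub>R ?d \<in> ball x r" if "0 \<le> a" "a \<le> s" "0 \<le> b" "b \<le> s" for a b
    using inb[OF that] s by auto
  define \<phi> where "\<phi> a = f (x + s *\<^sub>R ?d + a *\<^sub>R ?e) - f (x + a *\<^sub>R ?e)" for a
  have "(\<phi> has_real_derivative (pd i f (x + s *\<^sub>R ?d + a *\<^sub>R ?e) - pd i f (x + a *\<^sub>R ?e))) (at a)"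
    if "0 \<le> a" "a \<le> s" for a
    unfolding \<phi>_def[abs_def]
    using inb'[of a s] inb'[of a 0] that s
    by (intro DERIV_diff DERIV_line_axis Cinf_differentiable[OF f]) (auto simp: add_ac)
  from MVT2[OF s(1) this] obtain a where a: "0 < a" "a < s"
    "\<phi> s - \<phi> 0 = (s - 0) * (pd i f (x + s *\<^sub>R ?d + a *\<^sub>R ?e) - pd i f (x + a *\<^sub>R ?e))" by blast
  have "((\<lambda>b. pd i f (x + a *\<^sub>R ?e + b *\<^sub>R ?d)) has_real_derivative pd j (pd i f) (x + a *\<^sub>R ?e + b *\<^sub>R ?d)) (at b)"
    if "0 \<le> b" "b \<le> s" for b
    using inb'[of a b] that a s
    by (intro DERIV_line_axis Cinf_differentiable[OF Cinf_pd[OF f]]) auto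
  from MVT2[OF s(1) this] obtain b where b: "0 < b" "b < s"
    "pd i f (x + a *\<^sub>R ?e + s *\<^sub>R ?d) - pd i f (x + a *\<^sub>R ?e + 0 *\<^sub>R ?d)
      = (s - 0) * pd j (pd i f) (x + a *\<^sub>R ?e + b *\<^sub>R ?d)" by blast
  have "\<phi> s - \<phi> 0 = s\<^sup>2 * pd j (pd i f) (x + a *\<^sub>R ?e + b *\<^sub>R ?d)"
    using a(3) b(3) by (simp add: power2_eq_square add_ac)
  moreover have "\<phi> s - \<phi> 0 = f (x + s *\<^sub>R ?e + s *\<^sub>R ?d) - f (x + s *\<^sub>R ?e) - f (x + s *\<^sub>R ?d) + f x"
    by (simp add: \<phi>_def add_ac)
  ultimately show ?thesis using inb[of a b] a b by force
qed

lemma pd_commute: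
  fixes f :: "real^'n::finite \<Rightarrow> real"
  assumes f: "Cinf W f" and x: "x \<in> W"
  shows "pd i (pd j f) x = pd j (pd i f) x"
proof (rule ccontr)
  assume ne: "pd i (pd j f) x \<noteq> pd j (pd i f) x"
  obtain r where r: "0 < r" "ball x r \<subseteq> W" using Cinf_open[OF f] x open_contains_ball by blast
  have fb: "Cinf (ball x r) f" using Cinf_subset[OF f _ r(2)] by simp
  define e where "e = \<bar>pd i (pd j f) x - pd j (pd i f) x\<bar> / 2"
  have e: "0 < e" using ne by (simp add: e_def)
  have cont: "isCont (pd k (pd l f)) x" for k l
    using Cinf_continuous_on[OF Cinf_pd[OF Cinf_pd[OF fb]]] r(1) by (simp add: continuous_on_eq_continuous_at)
  obtain d1 where d1: "0 < d1" "\<And>y. dist y x < d1 \<Longrightarrow> dist (pd i (pd j f) y) (pd i (pd j f) x) < e"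
    using cont[of i j] e unfolding continuous_at_eps_delta by blast
  obtain d2 where d2: "0 < d2" "\<And>y. dist y x < d2 \<Longrightarrow> dist (pd j (pd i f) y) (pd j (pd i f) x) < e"
    using cont[of j i] e unfolding continuous_at_eps_delta by blast
  define s where "s = min (min d1 d2) r / 3"
  have s: "0 < s" "2 * s < r" "2 * s < d1" "2 * s < d2" using d1 d2 r by (auto simp: s_def min_def)
  obtain y where y: "y \<in> cball x (2 * s)" "f (x + s *\<^sub>R axis i 1 + s *\<^sub>R axis j 1) - f (x + s *\<^sub>R axis i 1) - f (x + s *\<^sub>R axis j 1) + f x
     = s\<^sup>2 * pd j (pd i f) y" using pd_commute_aux[OF fb s(1,2), of i j] by blast
  obtain z where z: "z \<in> cball x (2 * s)" "f (x + s *\<^sub>R axis j 1 + s *\<^sub>R axis i 1) - f (x + s *\<^sub>R axis j 1) - f (x + s *\<^sub>R axis i 1) + f x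
     = s\<^sup>2 * pd i (pd j f) z" using pd_commute_aux[OF fb s(1,2), of j i] by blast
  have sw: "x + s *\<^sub>R axis j 1 + s *\<^sub>R axis i 1 = x + s *\<^sub>R axis i 1 + s *\<^sub>R axis j 1" by (simp add: add_ac)
  have "s\<^sup>2 * pd j (pd i f) y = s\<^sup>2 * pd i (pd j f) z"
    unfolding y(2)[symmetric] z(2)[symmetric] sw by simp
  then have eq: "pd j (pd i f) y = pd i (pd j f) z" using s by simp
  have "dist (pd j (pd i f) y) (pd j (pd i f) x) < e" by (rule d2(2)) (use y(1) s in \<open>simp add: dist_commute\<close>)
  moreover have "dist (pd i (pd j f) z) (pd i (pd j f) x) < e" by (rule d1(2)) (use z(1) s in \<open>simp add: dist_commute\<close>)
  ultimately show False using eq by (simp add: dist_real_def e_def field_simps abs_if split: if_splits)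
qed

section \<open>Second order operators and the maximum principle\<close>

text \<open>The coefficients are numbers, frozen at one point; an operator with variable
  coefficients appears as \<open>Lop (a x) (b x) f x\<close>. Product and chain rules then need no
  regularity of the coefficients.\<close>

definition Lop :: "('n::finite \<Rightarrow> 'n \<Rightarrow> real) \<Rightarrow> ('n \<Rightarrow> real) \<Rightarrow> (real^'n \<Rightarrow> real) \<Rightarrow> real^'n \<Rightarrow> real" where
  "Lop a b f x = (\<Sum>i\<in>UNIV. \<Sum>j\<in>UNIV. a i j * pd i (pd j f) x) + (\<Sum>i\<in>UNIV. b i * pd i f x)"

text \<open>The carre du champ of the second-order part: the correction term in the product and
  chain rules for \<open>Lop\<close>.\<close>

definition Gam :: "('n::finite \<Rightarrow> 'n \<Rightarrow> real) \<Rightarrow> (real^'n \<Rightarrow> real) \<Rightarrow> (real^'n \<Rightarrow> real) \<Rightarrow> real^'n \<Rightarrow> real" where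
  "Gam a f g x = (\<Sum>i\<in>UNIV. \<Sum>j\<in>UNIV. a i j * (pd i f x * pd j g x))"

definition elliptic :: "real \<Rightarrow> ('n::finite \<Rightarrow> 'n \<Rightarrow> real) \<Rightarrow> bool" where
  "elliptic l a \<longleftrightarrow> (\<forall>i j. a i j = a j i) \<and> (\<forall>\<xi>. l * (\<Sum>i\<in>UNIV. (\<xi> i)\<^sup>2) \<le> (\<Sum>i\<in>UNIV. \<Sum>j\<in>UNIV. a i j * (\<xi> i * \<xi> j)))"

lemma Lop_add:
  assumes "Cinf W f" "Cinf W g" "x \<in> W"
  shows "Lop a b (\<lambda>x. f x + g x) x = Lop a b f x + Lop a b g x"
proof -
  have "pd j (\<lambda>x. f x + g x) y = pd j f y + pd j g y" if "y \<in> W" for j y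
    using pd_add assms Cinf_differentiable that by blast
  then have "pd i (pd j (\<lambda>x. f x + g x)) x = pd i (pd j f) x + pd i (pd j g) x" for i j
    using pd_cong[OF Cinf_open[OF assms(1)] assms(3), of "pd j (\<lambda>x. f x + g x)" "\<lambda>y. pd j f y + pd j g y" i]
      pd_add[OF Cinf_differentiable[OF Cinf_pd[OF assms(1)] assms(3)] Cinf_differentiable[OF Cinf_pd[OF assms(2)] assms(3)]] by simp
  moreover have "pd i (\<lambda>x. f x + g x) x = pd i f x + pd i g x" for i
    using pd_add assms Cinf_differentiable by blast
  ultimately show ?thesis by (simp add: Lop_def algebra_simps sum.distrib)
qed

lemma Lop_mult:
  assumes "Cinf W f" "Cinf W g" "x \<in> W" "\<And>i j. a i j = a j i"
  shows "Lop a b (\<lambda>x. f x * g x) x = f x * Lop a b g x + g x * Lop a b f x + 2 * Gam a f g x"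
proof -
  have dif: "f differentiable (at y)" "g differentiable (at y)" "pd j f differentiable (at y)" "pd j g differentiable (at y)"
    if "y \<in> W" for y j using that assms Cinf_differentiable Cinf_pd by blast+
  have "pd j (\<lambda>x. f x * g x) y = f y * pd j g y + pd j f y * g y" if "y \<in> W" for j y
    using pd_mult dif that by blast
  then have "pd i (pd j (\<lambda>x. f x * g x)) x = pd i (\<lambda>y. f y * pd j g y + pd j f y * g y) x" for i j
    by (rule pd_cong[OF Cinf_open[OF assms(1)] assms(3)])
  also have "\<dots> i j = f x * pd i (pd j g) x + pd i f x * pd j g x + (pd j f x * pd i g x + pd i (pd j f) x * g x)" for i j
    using dif[OF assms(3)] by (simp add: pd_add pd_mult)
  finally have 1: "pd i (pd j (\<lambda>x. f x * g x)) x = f x * pd i (pd j g) x + pd i f x * pd j g x + (pd j f x * pd i g x + pd i (pd j f) x * g x)" for i j .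
  have 2: "pd i (\<lambda>x. f x * g x) x = f x * pd i g x + pd i f x * g x" for i
    using pd_mult dif assms(3) by blast
  have sw: "(\<Sum>i\<in>UNIV. \<Sum>j\<in>UNIV. a i j * (pd j f x * pd i g x)) = Gam a f g x"
    unfolding Gam_def by (subst sum.swap) (simp add: assms(4))
  have "a i j * (f x * pd i (pd j g) x + pd i f x * pd j g x + (pd j f x * pd i g x + pd i (pd j f) x * g x))
    = f x * (a i j * pd i (pd j g) x) + g x * (a i j * pd i (pd j f) x) + a i j * (pd i f x * pd j g x) + a i j * (pd j f x * pd i g x)" for i j
    by (simp add: algebra_simps)
  moreover have "b i * (f x * pd i g x + pd i f x * g x) = f x * (b i * pd i g x) + g x * (b i * pd i f x)" for i
    by (simp add: algebra_simps)
  ultimately have "Lop a b (\<lambda>x. f x * g x) x = (\<Sum>i\<in>UNIV. \<Sum>j\<in>UNIV. f x * (a i j * pd i (pd j g) x))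
     + (\<Sum>i\<in>UNIV. \<Sum>j\<in>UNIV. g x * (a i j * pd i (pd j f) x)) + Gam a f g x
     + (\<Sum>i\<in>UNIV. \<Sum>j\<in>UNIV. a i j * (pd j f x * pd i g x)) + ((\<Sum>i\<in>UNIV. f x * (b i * pd i g x)) + (\<Sum>i\<in>UNIV. g x * (b i * pd i f x)))"
    unfolding Lop_def 1 2 Gam_def by (simp only: sum.distrib)
  then show ?thesis unfolding sw Lop_def by (simp add: sum_distrib_left algebra_simps)
qed

lemma Lop_const [simp]: "Lop a b (\<lambda>x. c) x = 0"
  by (simp add: Lop_def)

lemma Lop_cmult:
  assumes "Cinf W f" "x \<in> W" "\<And>i j. a i j = a j i"
  shows "Lop a b (\<lambda>x. c * f x) x = c * Lop a b f x"
  using Lop_mult[of W "\<lambda>x. c" f x a b] assms Cinf_open[OF assms(1)] by (simp add: Gam_def)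

lemma Lop_sum:
  assumes "open W" "finite I" "\<And>k. k \<in> I \<Longrightarrow> Cinf W (f k)" "x \<in> W"
  shows "Lop a b (\<lambda>x. \<Sum>k\<in>I. f k x) x = (\<Sum>k\<in>I. Lop a b (f k) x)"
  using assms(2,3)
proof (induction I rule: finite_induct)
  case (insert k I)
  then show ?case using Lop_add[of W "f k" "\<lambda>x. \<Sum>k\<in>I. f k x" x a b] assms Cinf_sum[of W I f] by simp
qed simp

lemma Lop_chain:
  assumes f: "Cinf W f" "x \<in> W"
    and d1: "\<And>y. y \<in> W \<Longrightarrow> (\<eta> has_real_derivative \<eta>' (f y)) (at (f y))"
    and d2: "(\<eta>' has_real_derivative \<eta>'') (at (f x))"
  shows "Lop a b (\<lambda>x. \<eta> (f x)) x = \<eta>' (f x) * Lop a b f x + \<eta>'' * Gam a f f x"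
proof -
  have dif: "f differentiable (at y)" "pd j f differentiable (at y)" if "y \<in> W" for y j
    using that f Cinf_differentiable Cinf_pd by blast+
  have 2: "pd j (\<lambda>x. \<eta> (f x)) y = \<eta>' (f y) * pd j f y" if "y \<in> W" for j y
    using pd_chain dif d1 that by blast
  have dc: "(\<lambda>y. \<eta>' (f y)) differentiable (at x)"
  proof -
    have "(\<eta>' has_derivative (\<lambda>v. \<eta>'' * v)) (at (f x))" using d2 by (simp add: has_field_derivative_def)
    then show ?thesis using differentiable_chain_at[OF dif(1)[OF f(2)], of \<eta>'] by (auto simp: o_def differentiable_def)
  qed
  have "pd i (pd j (\<lambda>x. \<eta> (f x))) x = pd i (\<lambda>y. \<eta>' (f y) * pd j f y) x" for i j
    by (rule pd_cong[OF Cinf_open[OF f(1)] f(2)]) (rule 2)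
  also have "\<dots> i j = \<eta>' (f x) * pd i (pd j f) x + \<eta>'' * pd i f x * pd j f x" for i j
    using pd_mult[OF dc dif(2)[OF f(2)]] pd_chain[OF dif(1)[OF f(2)] d2] by simp
  finally have 1: "pd i (pd j (\<lambda>x. \<eta> (f x))) x = \<eta>' (f x) * pd i (pd j f) x + \<eta>'' * pd i f x * pd j f x" for i j .
  show ?thesis unfolding Lop_def 1 2[OF f(2)] Gam_def
    by (simp add: sum_distrib_left sum.distrib algebra_simps)
qed

text \<open>Everything is restricted to a line through x. A positive second derivative along it
  would make the first derivative positive just after 0, and the mean value theorem would produce a
  value above the maximum.\<close>

lemma local_max_pd:
  assumes f: "Cinf W f" "x \<in> W" and max: "\<And>y. y \<in> W \<Longrightarrow> f y \<le> f x"
  shows "pd i f x = 0" and "(\<Sum>i\<in>UNIV. \<Sum>j\<in>UNIV. pd i (pd j f) x * (\<xi> i * \<xi> j)) \<le> 0"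
proof -
  obtain r where r: "0 < r" "ball x r \<subseteq> W" using Cinf_open[OF f(1)] f(2) open_contains_ball by blast
  have inW: "\<exists>d>0. \<forall>t. \<bar>t\<bar> < d \<longrightarrow> x + t *\<^sub>R v \<in> W" for v :: "real^'a"
  proof (intro exI[of _ "r / (norm v + 1)"] conjI allI impI)
    fix t :: real assume t: "\<bar>t\<bar> < r / (norm v + 1)"
    have "\<bar>t\<bar> * norm v \<le> \<bar>t\<bar> * (norm v + 1)" by (simp add: mult_left_mono)
    also have "\<dots> < r" using t by (simp add: pos_less_divide_eq add_nonneg_pos)
    finally show "x + t *\<^sub>R v \<in> W" using r(2) by (auto simp: dist_norm subset_iff)
  qed (use r in \<open>auto simp: add_nonneg_pos\<close>)
  have dif: "f differentiable (at y)" "pd j f differentiable (at y)" if "y \<in> W" for y j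
    using that f Cinf_differentiable Cinf_pd by blast+
  have zero: "(\<Sum>i\<in>UNIV. v $ i * pd i f x) = 0" for v :: "real^'a"
  proof -
    obtain d where d: "d > 0" "\<And>t. \<bar>t\<bar> < d \<Longrightarrow> x + t *\<^sub>R v \<in> W" using inW by blast
    have "((\<lambda>t. f (x + t *\<^sub>R v)) has_real_derivative (\<Sum>i\<in>UNIV. v $ i * pd i f (x + 0 *\<^sub>R v))) (at 0)"
      by (rule DERIV_line) (use dif f in simp)
    from DERIV_local_max[OF this d(1)] show ?thesis using d(2) max by simp
  qed
  show "pd i f x = 0" using zero[of "axis i 1"] by (simp add: sum_axis)
  define v :: "real^'a" where "v = (\<chi> i. \<xi> i)"
  obtain d where d: "d > 0" "\<And>t. \<bar>t\<bar> < d \<Longrightarrow> x + t *\<^sub>R v \<in> W" using inW by blast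
  define g where "g t = (\<Sum>j\<in>UNIV. v $ j * pd j f (x + t *\<^sub>R v))" for t
  have g: "((\<lambda>t. f (x + t *\<^sub>R v)) has_real_derivative g t) (at t)" if "\<bar>t\<bar> < d" for t
    unfolding g_def by (rule DERIV_line) (use dif d(2)[OF that] in blast)
  have "(g has_real_derivative (\<Sum>j\<in>UNIV. v $ j * (\<Sum>i\<in>UNIV. v $ i * pd i (pd j f) (x + 0 *\<^sub>R v)))) (at 0)"
    unfolding g_def[abs_def] using dif(2) f(2)
    by (intro DERIV_sum DERIV_cmult DERIV_line) simp
  moreover have "(\<Sum>j\<in>UNIV. v $ j * (\<Sum>i\<in>UNIV. v $ i * pd i (pd j f) (x + 0 *\<^sub>R v)))
     = (\<Sum>i\<in>UNIV. \<Sum>j\<in>UNIV. pd i (pd j f) x * (\<xi> i * \<xi> j))"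
    unfolding sum_distrib_left by (subst sum.swap) (simp add: v_def mult_ac)
  ultimately have g': "(g has_real_derivative (\<Sum>i\<in>UNIV. \<Sum>j\<in>UNIV. pd i (pd j f) x * (\<xi> i * \<xi> j))) (at 0)" by simp
  show "(\<Sum>i\<in>UNIV. \<Sum>j\<in>UNIV. pd i (pd j f) x * (\<xi> i * \<xi> j)) \<le> 0"
  proof (rule ccontr)
    assume "\<not> ?thesis"
    then obtain d' where d': "d' > 0" "\<And>t. 0 < t \<Longrightarrow> t < d' \<Longrightarrow> g 0 < g t"
      using DERIV_pos_inc_right[OF g'] by auto
    define t where "t = min d d' / 2"
    have t: "0 < t" "t < d" "t < d'" using d d' by (auto simp: t_def min_def)
    obtain z where z: "0 < z" "z < t" "f (x + t *\<^sub>R v) - f (x + 0 *\<^sub>R v) = (t - 0) * g z"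
      using MVT2[OF t(1), of "\<lambda>t. f (x + t *\<^sub>R v)" g] g t by force
    have "g 0 = 0" unfolding g_def using zero[of v] by simp
    then have "0 < g z" using d'(2)[of z] z t by simp
    then have "0 < t * g z" using t by simp
    then show False using z(3) max[OF d(2)[of t]] t by simp
  qed
qed

text \<open>Lagrange's reduction of a quadratic form takes the place of diagonalisation. One index
  at a time, \<open>a\<close> splits into a rank-one square and a remainder on the smaller index
  set. The pairing of the square with \<open>H\<close> is a value of the form \<open>H\<close>, up
  to a positive factor; the remainder is handled by induction.\<close>

lemma trace_prod_nonpos:
  assumes "finite I" "0 < l" "\<And>i j. a i j = a j i"
    and "\<And>\<xi>. l * (\<Sum>i\<in>I. (\<xi> i)\<^sup>2) \<le> (\<Sum>i\<in>I. \<Sum>j\<in>I. a i j * (\<xi> i * \<xi> j))"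
    and "\<And>\<xi>. (\<Sum>i\<in>I. \<Sum>j\<in>I. H i j * (\<xi> i * \<xi> j)) \<le> 0"
  shows "(\<Sum>i\<in>I. \<Sum>j\<in>I. a i j * H i j) \<le> (0::real)"
  using assms
proof (induction I arbitrary: a rule: finite_induct)
  case (insert k I)
  note sym = insert.prems(2) and ell = insert.prems(3) and H = insert.prems(4)
  have split: "(\<Sum>i\<in>insert k I. \<Sum>j\<in>insert k I. f i j) = f k k + (\<Sum>j\<in>I. f k j) + (\<Sum>i\<in>I. f i k) + (\<Sum>i\<in>I. \<Sum>j\<in>I. f i j)"
    for f :: "_ \<Rightarrow> _ \<Rightarrow> real"
    using insert.hyps by (simp add: sum.distrib)
  have akk: "a k k \<ge> l"
  proof -
    have z: "(\<Sum>i\<in>I. if i = k then (1::real) else 0) = 0" using insert.hyps by simp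
    have "l * (\<Sum>i\<in>insert k I. (if i = k then 1 else 0)\<^sup>2) \<le>
        (\<Sum>i\<in>insert k I. \<Sum>j\<in>insert k I. a i j * ((if i = k then 1 else 0) * (if j = k then 1 else 0)))"
      using ell[of "\<lambda>i. if i = k then 1 else 0"] .
    moreover have "(if i = k then 1 else 0)\<^sup>2 = (if i = k then 1 else (0::real))" for i by simp
    then have "(\<Sum>i\<in>insert k I. (if i = k then 1 else 0)\<^sup>2) = (1::real)"
      using insert.hyps by simp
    moreover have "(\<Sum>i\<in>insert k I. \<Sum>j\<in>insert k I. a i j * ((if i = k then 1 else 0) * (if j = k then 1 else 0))) = a k k"
    proof -
      have "(\<Sum>j\<in>I. a k j * ((if k = k then 1 else 0) * (if j = k then 1 else 0))) = 0"
        "(\<Sum>i\<in>I. a i k * ((if i = k then 1 else 0) * (if k = k then 1 else 0))) = 0"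
        "(\<Sum>i\<in>I. \<Sum>j\<in>I. a i j * ((if i = k then 1 else 0) * (if j = k then 1 else 0))) = 0"
        using insert.hyps by (auto intro!: sum.neutral)
      then show ?thesis unfolding split by simp
    qed
    ultimately show ?thesis by simp
  qed
  then have pos: "0 < a k k" using insert.prems(1) by linarith
  \<comment> \<open>The Schur complement of the pivot \<open>a k k\<close>: what is left after the
    rank-one square. Its row and column \<open>k\<close> vanish by symmetry.\<close>
  define a' where "a' i j = a i j - a i k * a j k / a k k" for i j
  have IH: "(\<Sum>i\<in>I. \<Sum>j\<in>I. a' i j * H i j) \<le> 0"
  proof (rule insert.IH[OF insert.prems(1)])
    show "a' i j = a' j i" for i j using sym by (simp add: a'_def mult.commute)
  next
    fix \<xi> :: "'a \<Rightarrow> real"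
    define s where "s = (\<Sum>j\<in>I. a k j * \<xi> j)"
    \<comment> \<open>The entry at \<open>k\<close> minimises the form of \<open>a\<close> in that
      coordinate, and the minimum is the form of \<open>a'\<close>. Ellipticity therefore passes to
      \<open>a'\<close> with the same constant \<open>l\<close>.\<close>
    define \<zeta> where "\<zeta> i = (if i = k then - s / a k k else \<xi> i)" for i
    have zI: "\<zeta> i = \<xi> i" if "i \<in> I" for i using that insert.hyps by (auto simp: \<zeta>_def)
    define Q where "Q = (\<Sum>i\<in>I. \<Sum>j\<in>I. a i j * (\<xi> i * \<xi> j))"
    have 1: "(\<Sum>j\<in>I. a k j * (\<zeta> k * \<zeta> j)) = \<zeta> k * s"
      unfolding s_def sum_distrib_left by (rule sum.cong) (auto simp: zI)
    have 2: "(\<Sum>i\<in>I. a i k * (\<zeta> i * \<zeta> k)) = \<zeta> k * s"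
      unfolding s_def sum_distrib_left by (rule sum.cong) (auto simp: zI sym[of _ k])
    have 3: "(\<Sum>i\<in>I. \<Sum>j\<in>I. a i j * (\<zeta> i * \<zeta> j)) = Q"
      unfolding Q_def by (intro sum.cong) (auto simp: zI)
    have zk: "\<zeta> k = - s / a k k" by (simp add: \<zeta>_def)
    have "(\<Sum>i\<in>insert k I. \<Sum>j\<in>insert k I. a i j * (\<zeta> i * \<zeta> j)) = Q - s\<^sup>2 / a k k"
      unfolding split 1 2 3 unfolding zk using pos by (simp add: power2_eq_square)
    moreover have "(\<Sum>i\<in>I. \<Sum>j\<in>I. a' i j * (\<xi> i * \<xi> j)) = Q - s\<^sup>2 / a k k"
    proof -
      have "s\<^sup>2 = (\<Sum>i\<in>I. \<Sum>j\<in>I. (a i k * \<xi> i) * (a j k * \<xi> j))"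
        unfolding s_def power2_eq_square sum_product using sym[of k] by simp
      then have "s\<^sup>2 / a k k = (\<Sum>i\<in>I. \<Sum>j\<in>I. a i k * a j k / a k k * (\<xi> i * \<xi> j))"
        by (simp add: sum_divide_distrib mult_ac)
      then show ?thesis unfolding Q_def a'_def by (simp add: left_diff_distrib sum_subtractf)
    qed
    moreover have "(\<Sum>i\<in>I. (\<xi> i)\<^sup>2) \<le> (\<Sum>i\<in>insert k I. (\<zeta> i)\<^sup>2)"
      using insert.hyps by (simp add: zI)
    then have "l * (\<Sum>i\<in>I. (\<xi> i)\<^sup>2) \<le> l * (\<Sum>i\<in>insert k I. (\<zeta> i)\<^sup>2)"
      using insert.prems(1) by (intro mult_left_mono) auto
    ultimately show "l * (\<Sum>i\<in>I. (\<xi> i)\<^sup>2) \<le> (\<Sum>i\<in>I. \<Sum>j\<in>I. a' i j * (\<xi> i * \<xi> j))"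
      using ell[of \<zeta>] by linarith
  next
    fix \<xi> :: "'a \<Rightarrow> real"
    define \<zeta> where "\<zeta> i = (if i = k then 0 else \<xi> i)" for i
    have zI: "\<zeta> i = \<xi> i" if "i \<in> I" for i using that insert.hyps by (auto simp: \<zeta>_def)
    have "(\<Sum>i\<in>I. \<Sum>j\<in>I. H i j * (\<zeta> i * \<zeta> j)) = (\<Sum>i\<in>I. \<Sum>j\<in>I. H i j * (\<xi> i * \<xi> j))"
      by (intro sum.cong) (auto simp: zI)
    then show "(\<Sum>i\<in>I. \<Sum>j\<in>I. H i j * (\<xi> i * \<xi> j)) \<le> 0"
      using H[of \<zeta>] unfolding split by (simp add: \<zeta>_def)
  qed
  have "(\<Sum>i\<in>insert k I. \<Sum>j\<in>insert k I. a i j * H i j)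
     = (\<Sum>i\<in>insert k I. \<Sum>j\<in>insert k I. H i j * (a i k * a j k)) / a k k + (\<Sum>i\<in>insert k I. \<Sum>j\<in>insert k I. a' i j * H i j)"
    unfolding sum_divide_distrib sum.distrib[symmetric]
    by (intro sum.cong refl) (simp add: a'_def algebra_simps)
  also have "(\<Sum>i\<in>insert k I. \<Sum>j\<in>insert k I. a' i j * H i j) = (\<Sum>i\<in>I. \<Sum>j\<in>I. a' i j * H i j)"
    unfolding split using pos sym by (simp add: a'_def)
  also have "(\<Sum>i\<in>insert k I. \<Sum>j\<in>insert k I. H i j * (a i k * a j k)) / a k k \<le> 0"
    using H[of "\<lambda>i. a i k"] pos by (simp add: divide_nonpos_pos)
  finally show ?case using IH by linarith
qed simp

lemma Lop_local_max:
  assumes f: "Cinf W f" "x \<in> W" and max: "\<And>y. y \<in> W \<Longrightarrow> f y \<le> f x" and a: "elliptic l a" "0 < l"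
  shows "Lop a b f x \<le> 0"
proof -
  have "(\<Sum>i\<in>UNIV. \<Sum>j\<in>UNIV. a i j * pd i (pd j f) x) \<le> 0"
    by (rule trace_prod_nonpos[where l=l]) (use a local_max_pd(2)[OF f max] in \<open>auto simp: elliptic_def\<close>)
  then show ?thesis using local_max_pd(1)[OF f max] by (simp add: Lop_def)
qed

lemma Lop_diff:
  assumes "Cinf W f" "Cinf W g" "x \<in> W" "\<And>i j. a i j = a j i"
  shows "Lop a b (\<lambda>x. f x - g x) x = Lop a b f x - Lop a b g x"
  using Lop_add[of W f "\<lambda>x. - 1 * g x" x a b] Lop_cmult[of W g x a b "-1"] assms Cinf_minus[of W g]
  by simp

section \<open>The squared distance as building block of comparison functions\<close>

definition sqd :: "real^'n::finite \<Rightarrow> real^'n \<Rightarrow> real" where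
  "sqd y x = (\<Sum>i\<in>UNIV. (x $ i - y $ i) * (x $ i - y $ i))"

lemma sqd_eq: "sqd y x = (dist x y)\<^sup>2"
  unfolding sqd_def dist_norm norm_vec_def L2_set_def
  by (simp add: sum_nonneg power2_eq_square)

lemma Cinf_coord: "open W \<Longrightarrow> Cinf W (\<lambda>x. x $ i - c)"
  by (intro Cinf_diff Cinf_nth Cinf_const)

lemma Cinf_sqd: "open W \<Longrightarrow> Cinf W (sqd y)"
  unfolding sqd_def[abs_def] by (intro Cinf_sum Cinf_mult Cinf_coord)

lemma pd_coord: "pd i (\<lambda>x. x $ j - c) x = (if i = j then 1 else 0)"
proof -
  have "(\<lambda>x. x $ j) differentiable (at x)" by (rule Cinf_differentiable[OF Cinf_nth[OF open_UNIV]]) simp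
  from pd_add[OF this, of "\<lambda>x. - c" i] show ?thesis by simp
qed

lemma pd_sqd: "pd i (sqd y) x = 2 * (x $ i - y $ i)"
proof -
  have d: "(\<lambda>x. x $ j - y $ j) differentiable (at x)" for j
    using Cinf_differentiable[OF Cinf_coord[OF open_UNIV]] by simp
  have dd: "(\<lambda>x. (x $ j - y $ j) * (x $ j - y $ j)) differentiable (at x)" for j
    by (rule Cinf_differentiable[OF Cinf_mult[OF Cinf_coord Cinf_coord], of UNIV]) auto
  have "pd i (sqd y) x = (\<Sum>j\<in>UNIV. pd i (\<lambda>x. (x $ j - y $ j) * (x $ j - y $ j)) x)"
    unfolding sqd_def[abs_def] by (rule pd_sum) (rule dd)
  also have "\<dots> = (\<Sum>j\<in>UNIV. if i = j then 2 * (x $ j - y $ j) else 0)"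
    by (rule sum.cong) (auto simp: pd_mult[OF d d] pd_coord)
  finally show ?thesis by simp
qed

lemma pd_pd_sqd: "pd i (pd j (sqd y)) x = (if i = j then 2 else 0)"
proof -
  have "pd j (sqd y) = (\<lambda>x. 2 * (x $ j - y $ j))" by (rule ext) (rule pd_sqd)
  then show ?thesis
    using pd_mult[of "\<lambda>x. 2" x "\<lambda>x. x $ j - y $ j" i] Cinf_differentiable[OF Cinf_coord[OF open_UNIV], of x j "y $ j"]
    by (simp add: pd_coord)
qed

lemma abs_sum_le:
  fixes f :: "'n::finite \<Rightarrow> real" and K :: real
  assumes "\<And>i. \<bar>f i\<bar> \<le> K"
  shows "\<bar>\<Sum>i\<in>UNIV. f i\<bar> \<le> CARD('n) * K"
  using sum_norm_bound[of UNIV f K] assms by simp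

lemma abs_Lop_sqd_le:
  fixes x :: "real^'n::finite" and \<Lambda> R :: real
  assumes "\<And>i j. \<bar>a i j\<bar> \<le> \<Lambda>" "\<And>i. \<bar>b i\<bar> \<le> \<Lambda>" "dist x y \<le> R"
  shows "\<bar>Lop a b (sqd y) x\<bar> \<le> 2 * real CARD('n) * \<Lambda> * (1 + R)"
proof -
  have L: "0 \<le> \<Lambda>" using assms(1) abs_ge_zero order_trans by blast
  have R: "0 \<le> R" using assms(3) zero_le_dist order_trans by blast
  have c: "\<bar>x $ i - y $ i\<bar> \<le> R" for i
    using component_le_norm_cart[of "x - y" i] assms(3) by (simp add: dist_norm)
  have e: "Lop a b (sqd y) x = (\<Sum>i\<in>UNIV. 2 * a i i) + (\<Sum>i\<in>UNIV. b i * (2 * (x $ i - y $ i)))"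
  proof -
    have "(\<Sum>j\<in>UNIV. a i j * (if i = j then 2 else 0)) = 2 * a i i" for i
    proof -
      have "a i j * (if i = j then 2 else 0) = (if j = i then 2 * a i i else 0)" for j by auto
      then show ?thesis by simp
    qed
    then show ?thesis unfolding Lop_def pd_pd_sqd pd_sqd by simp
  qed
  have "\<bar>\<Sum>i\<in>UNIV. 2 * a i i\<bar> \<le> CARD('n) * (2 * \<Lambda>)"
    by (rule abs_sum_le) (use assms(1) in \<open>simp add: abs_mult\<close>)
  moreover have "\<bar>\<Sum>i\<in>UNIV. b i * (2 * (x $ i - y $ i))\<bar> \<le> CARD('n) * (\<Lambda> * (2 * R))"
  proof (rule abs_sum_le)
    fix i
    have "\<bar>b i\<bar> * (2 * \<bar>x $ i - y $ i\<bar>) \<le> \<Lambda> * (2 * R)"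
      by (intro mult_mono) (use c[of i] assms(2)[of i] L in auto)
    then show "\<bar>b i * (2 * (x $ i - y $ i))\<bar> \<le> \<Lambda> * (2 * R)" by (simp only: abs_mult abs_numeral)
  qed
  ultimately show ?thesis unfolding e by (simp add: algebra_simps)
qed

lemma Gam_sqd_ge:
  assumes "elliptic l a"
  shows "4 * l * sqd y x \<le> Gam a (sqd y) (sqd y) x"
proof -
  have "l * (\<Sum>i\<in>UNIV. (2 * (x $ i - y $ i))\<^sup>2) \<le> Gam a (sqd y) (sqd y) x"
    using assms[unfolded elliptic_def, THEN conjunct2, rule_format, of "\<lambda>i. 2 * (x $ i - y $ i)"]
    unfolding Gam_def pd_sqd .
  then show ?thesis
    by (simp only: power_mult_distrib) (simp add: sqd_def sum_distrib_left power2_eq_square mult_ac)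
qed

section \<open>Interior estimates\<close>

text \<open>The constant must not depend on the operator within the class of operators with the given bounds.\<close>

lemma growth:
  fixes l \<Lambda> r \<rho> :: real
  assumes l: "0 < l" and r: "0 < r" and \<rho>: "0 < \<rho>"
  shows "\<exists>\<kappa>>0. \<forall>a b v y m (W :: (real^'n::finite) set).
    Cinf W v \<and> cball y (3 * \<rho>) \<subseteq> W \<and> 0 \<le> m \<and>
    (\<forall>x\<in>W. elliptic l (a x) \<and> (\<forall>i j. \<bar>a x i j\<bar> \<le> \<Lambda>) \<and> (\<forall>i. \<bar>b x i\<bar> \<le> \<Lambda>) \<and> Lop (a x) (b x) v x = 0 \<and> 0 \<le> v x) \<and>
    (\<forall>x\<in>cball y r. x \<in> W \<longrightarrow> m \<le> v x) \<longrightarrow> (\<forall>x\<in>cball y (2 * \<rho>). \<kappa> * m \<le> v x)"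
proof -
  \<comment> \<open>\<open>N\<close> bounds the operator applied to the squared distance on the ball
    of radius 3 \<rho>.\<close>
  define N where "N = 2 * real CARD('n) * \<bar>\<Lambda>\<bar> * (1 + 3 * \<rho>)"
  have N: "0 \<le> N" using \<rho> by (simp add: N_def)
  \<comment> \<open>Chosen so that \<open>\<alpha> * Gam\<close> is at least \<open>N + 1\<close> at
    distance at least \<open>r\<close> from the centre. The Gaussian with exponent \<alpha> is then
    a strict subsolution there.\<close>
  define \<alpha> where "\<alpha> = (N + 1) / (4 * l * r\<^sup>2)"
  have \<alpha>: "0 < \<alpha>" using N l r by (simp add: \<alpha>_def)
  \<comment> \<open>The least value, on the ball of radius 2 \<rho>, of the Gaussian lowered so as
    to vanish at radius 3 \<rho>.\<close>
  define \<kappa> where "\<kappa> = exp (- \<alpha> * (4 * \<rho>\<^sup>2)) - exp (- \<alpha> * (9 * \<rho>\<^sup>2))"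
  have \<kappa>: "0 < \<kappa>" using \<alpha> \<rho> by (simp add: \<kappa>_def)
  show ?thesis
  proof (intro exI[of _ \<kappa>] conjI \<kappa> allI impI ballI, elim conjE)
    fix a b v y m x and W :: "(real^'n) set"
    assume v: "Cinf W v" and sub: "cball y (3 * \<rho>) \<subseteq> W" and m: "0 \<le> m"
      and op: "\<forall>x\<in>W. elliptic l (a x) \<and> (\<forall>i j. \<bar>a x i j\<bar> \<le> \<Lambda>) \<and> (\<forall>i. \<bar>b x i\<bar> \<le> \<Lambda>) \<and> Lop (a x) (b x) v x = 0 \<and> 0 \<le> v x"
      and ge: "\<forall>x\<in>cball y r. x \<in> W \<longrightarrow> m \<le> v x" and x: "x \<in> cball y (2 * \<rho>)"
    define E where "E z = exp (- \<alpha> * sqd y z)" for z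
    define e9 where "e9 = exp (- \<alpha> * (9 * \<rho>\<^sup>2))"
    define F where "F z = m * (E z - e9) - v z" for z
    have oW: "open W" using v by (rule Cinf_open)
    have CE: "Cinf W E" unfolding E_def[abs_def] by (intro Cinf_exp Cinf_mult Cinf_sqd Cinf_const oW)
    have CF: "Cinf W F" unfolding F_def[abs_def] by (intro Cinf_diff Cinf_mult Cinf_const CE v oW)
    have "continuous_on (cball y (3 * \<rho>)) F" using Cinf_continuous_on[OF CF] sub continuous_on_subset by blast
    moreover have "cball y (3 * \<rho>) \<noteq> {}" using \<rho> by simp
    ultimately obtain z where z: "z \<in> cball y (3 * \<rho>)" "\<And>w. w \<in> cball y (3 * \<rho>) \<Longrightarrow> F w \<le> F z"
      using continuous_attains_sup[OF compact_cball] by metis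
    have zW: "z \<in> W" using z sub by blast
    have vz: "0 \<le> v z" using op zW by blast
    \<comment> \<open>A positive maximum of \<open>F\<close> could only lie strictly between the
      radii \<open>r\<close> and 3 \<rho>: near the centre \<open>v\<close> is at least
      \<open>m\<close>, and at radius 3 \<rho> the lowered Gaussian is 0. In between the strict
      subsolution property forbids a maximum.\<close>
    have Fz: "F z \<le> 0"
    proof (rule ccontr)
      assume "\<not> F z \<le> 0"
      then have pos: "0 < m * (E z - e9) - v z" by (simp add: F_def)
      have mpos: "0 < m" using pos vz m by (cases "m = 0") auto
      have E1: "E z \<le> 1" using \<alpha> by (simp add: E_def sqd_eq)
      have "E z - e9 < 1" using E1 by (simp add: e9_def add_pos_nonneg less_add_same_cancel1 add_strict_increasing2 algebra_simps le_less_trans[OF E1])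
      then have "m * (E z - e9) < m * 1" using mpos by (intro mult_strict_left_mono)
      then have "v z < m" using pos by linarith
      then have zr: "r < dist z y" using ge zW by (force simp: dist_commute)
      have "e9 < E z"
      proof (rule ccontr)
        assume "\<not> e9 < E z"
        then have "m * (E z - e9) \<le> 0" using mpos by (simp add: mult_nonneg_nonpos)
        then show False using pos vz by linarith
      qed
      then have "sqd y z < 9 * \<rho>\<^sup>2" using \<alpha> by (simp add: E_def e9_def)
      then have "(dist z y)\<^sup>2 < (3 * \<rho>)\<^sup>2" by (simp add: sqd_eq power_mult_distrib)
      then have zin: "z \<in> ball y (3 * \<rho>)" using \<rho> power_less_imp_less_base by (fastforce simp: dist_commute)
      have "Lop (a z) (b z) F z \<le> 0"
      proof (rule Lop_local_max)
        show "Cinf (ball y (3 * \<rho>)) F" using Cinf_subset[OF CF] sub ball_subset_cball by blast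
        show "elliptic l (a z)" using op zW by blast
      qed (use zin z(2) l in auto)
      moreover have "Lop (a z) (b z) F z = m * Lop (a z) (b z) E z - Lop (a z) (b z) v z"
      proof -
        have sym: "a z i j = a z j i" for i j using op zW by (auto simp: elliptic_def)
        have c: "Cinf W (\<lambda>x. E x - e9)" "Cinf W (\<lambda>x. m * (E x - e9))" "Cinf W (\<lambda>x. e9)"
          by (intro Cinf_diff Cinf_mult Cinf_const CE oW)+
        show ?thesis unfolding F_def[abs_def]
          using Lop_diff[OF c(2) v zW sym] Lop_cmult[OF c(1) zW sym] Lop_diff[OF CE c(3) zW sym] by simp
      qed
      moreover have "Lop (a z) (b z) v z = 0" using op zW by blast
      moreover have "0 < Lop (a z) (b z) E z"
      proof -
        have "Lop (a z) (b z) E z = (- \<alpha> * exp (- \<alpha> * sqd y z)) * Lop (a z) (b z) (sqd y) z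
            + (\<alpha>\<^sup>2 * exp (- \<alpha> * sqd y z)) * Gam (a z) (sqd y) (sqd y) z"
          unfolding E_def[abs_def]
          by (rule Lop_chain[where \<eta>="\<lambda>t. exp (- \<alpha> * t)" and \<eta>'="\<lambda>t. - \<alpha> * exp (- \<alpha> * t)", OF Cinf_sqd[OF oW] zW])
            (auto intro!: derivative_eq_intros simp: power2_eq_square)
        also have "\<dots> = \<alpha> * exp (- \<alpha> * sqd y z) * (\<alpha> * Gam (a z) (sqd y) (sqd y) z - Lop (a z) (b z) (sqd y) z)"
          by (simp add: algebra_simps power2_eq_square)
        also have "\<dots> > 0"
        proof -
          have "\<bar>Lop (a z) (b z) (sqd y) z\<bar> \<le> 2 * real CARD('n) * \<bar>\<Lambda>\<bar> * (1 + 3 * \<rho>)"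
            by (rule abs_Lop_sqd_le) (use op zW z(1) in \<open>force simp: dist_commute intro: order_trans[OF _ abs_ge_self]\<close>)+
          then have 1: "Lop (a z) (b z) (sqd y) z \<le> N" by (simp add: N_def)
          have "r\<^sup>2 \<le> sqd y z" unfolding sqd_eq using zr r by (intro power_mono) auto
          then have "4 * l * r\<^sup>2 \<le> 4 * l * sqd y z" using l by simp
          also have "\<dots> \<le> Gam (a z) (sqd y) (sqd y) z" by (rule Gam_sqd_ge) (use op zW in blast)
          finally have "\<alpha> * (4 * l * r\<^sup>2) \<le> \<alpha> * Gam (a z) (sqd y) (sqd y) z" using \<alpha> by (intro mult_left_mono) auto
          moreover have "\<alpha> * (4 * l * r\<^sup>2) = N + 1" using l r by (simp add: \<alpha>_def)
          ultimately show ?thesis using 1 \<alpha> by (intro mult_pos_pos) auto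
        qed
        finally show ?thesis .
      qed
      ultimately show False using mpos by (simp add: zero_less_mult_iff mult_le_0_iff)
    qed
    have xin: "x \<in> cball y (3 * \<rho>)" using x \<rho> by auto
    then have "m * (E x - e9) \<le> v x" using z(2)[of x] Fz by (simp add: F_def)
    moreover have "\<kappa> \<le> E x - e9"
    proof -
      have "sqd y x \<le> (2 * \<rho>)\<^sup>2" unfolding sqd_eq using x \<rho> by (intro power_mono) (auto simp: dist_commute)
      then show ?thesis using \<alpha> by (simp add: \<kappa>_def E_def e9_def power_mult_distrib)
    qed
    then have "\<kappa> * m \<le> m * (E x - e9)" using m by (metis mult.commute mult_left_mono)
    ultimately show "\<kappa> * m \<le> v x" by linarith
  qed
qed

text \<open>Differentiating the equation and commuting derivatives leaves an error that contains
  second and first derivatives of \<open>u\<close> only, so the Bernstein argument can absorb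
  it.\<close>

lemma Lop_pd:
  fixes u :: "real^'n::finite \<Rightarrow> real"
  assumes u: "Cinf W u" and a: "\<And>i j. Cinf W (\<lambda>x. a x i j)" and b: "\<And>i. Cinf W (\<lambda>x. b x i)"
    and L: "\<And>x. x \<in> W \<Longrightarrow> Lop (a x) (b x) u x = 0" and x: "x \<in> W"
  shows "Lop (a x) (b x) (pd k u) x =
    - ((\<Sum>i\<in>UNIV. \<Sum>j\<in>UNIV. pd k (\<lambda>x. a x i j) x * pd i (pd j u) x) + (\<Sum>i\<in>UNIV. pd k (\<lambda>x. b x i) x * pd i u x))"
proof -
  note oW = Cinf_open[OF u]
  have d: "(\<lambda>x. a x i j) differentiable (at x)" "(\<lambda>x. b x i) differentiable (at x)"
    "pd i u differentiable (at x)" "pd i (pd j u) differentiable (at x)" for i j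
    by (rule Cinf_differentiable[OF a x] Cinf_differentiable[OF b x] Cinf_differentiable[OF Cinf_pd[OF u] x]
      Cinf_differentiable[OF Cinf_pd[OF Cinf_pd[OF u]] x])+
  have c1: "Cinf W (\<lambda>x. a x i j * pd i (pd j u) x)" for i j
    by (rule Cinf_mult[OF a Cinf_pd[OF Cinf_pd[OF u]]])
  have c2: "Cinf W (\<lambda>x. \<Sum>j\<in>UNIV. a x i j * pd i (pd j u) x)" for i
    by (rule Cinf_sum[OF oW c1])
  have c3: "Cinf W (\<lambda>x. \<Sum>i\<in>UNIV. \<Sum>j\<in>UNIV. a x i j * pd i (pd j u) x)"
    by (rule Cinf_sum[OF oW c2])
  have c4: "Cinf W (\<lambda>x. b x i * pd i u x)" for i
    by (rule Cinf_mult[OF b Cinf_pd[OF u]])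
  have c5: "Cinf W (\<lambda>x. \<Sum>i\<in>UNIV. b x i * pd i u x)"
    by (rule Cinf_sum[OF oW c4])
  note d2 = c1[THEN Cinf_differentiable, OF x] c2[THEN Cinf_differentiable, OF x] c3[THEN Cinf_differentiable, OF x]
    c4[THEN Cinf_differentiable, OF x] c5[THEN Cinf_differentiable, OF x]
  have comm: "pd k (pd i (pd j u)) x = pd i (pd j (pd k u)) x" for i j
  proof -
    have "pd k (pd i (pd j u)) x = pd i (pd k (pd j u)) x" by (rule pd_commute[OF Cinf_pd[OF u] x])
    also have "\<dots> = pd i (pd j (pd k u)) x" by (rule pd_cong[OF oW x]) (rule pd_commute[OF u])
    finally show ?thesis .
  qed
  have comm': "pd k (pd i u) x = pd i (pd k u) x" for i by (rule pd_commute[OF u x])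
  have "0 = pd k (\<lambda>x. Lop (a x) (b x) u x) x"
    using pd_cong[OF oW x, of "\<lambda>x. Lop (a x) (b x) u x" "\<lambda>x. 0" k] L by simp
  also have "\<dots> = (\<Sum>i\<in>UNIV. \<Sum>j\<in>UNIV. a x i j * pd k (pd i (pd j u)) x + pd k (\<lambda>x. a x i j) x * pd i (pd j u) x)
     + (\<Sum>i\<in>UNIV. b x i * pd k (pd i u) x + pd k (\<lambda>x. b x i) x * pd i u x)"
    unfolding Lop_def using d d2 by (simp add: pd_add pd_sum pd_mult)
  finally show ?thesis unfolding comm comm' Lop_def by (simp add: sum.distrib)
qed

lemma elliptic_Gam_ge: "elliptic l a \<Longrightarrow> l * (\<Sum>i\<in>UNIV. (pd i f x)\<^sup>2) \<le> Gam a f f x"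
  unfolding elliptic_def Gam_def by (drule conjunct2, drule spec[of _ "\<lambda>i. pd i f x"])

text \<open>Bernstein's auxiliary function: the squared gradient, cut off by the square of \<zeta> =
  R^2 - |x - y|^2, plus \<open>A\<close> times u^2. The good terms are 2 l \<zeta>^2 |D^2 u|^2 and 2
  l A |grad u|^2. The constant \<open>c\<close> collects the cross terms between gradient and
  Hessian, 2 n^3 \<Lambda> from differentiating the equation and 16 n^3 \<Lambda> from the cutoff.
  \<open>A\<close> is just large enough to complete the square, to pay for the remaining gradient
  terms and to keep one |grad u|^2 in reserve.\<close>

lemma bernstein_pointwise:
  fixes u :: "real^'n::finite \<Rightarrow> real" and y :: "real^'n" and l \<Lambda> R A n c :: real
  defines "n \<equiv> real CARD('n)"
  defines "c \<equiv> 18 * n ^ 3 * \<Lambda>"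
  defines "A \<equiv> (c\<^sup>2 / (8 * l) + 1 + 2 * n\<^sup>2 * \<Lambda> + 8 * n * \<Lambda>) / (2 * l)"
  defines "Q \<equiv> \<lambda>x. \<Sum>k\<in>UNIV. pd k u x * pd k u x"
  defines "P \<equiv> \<lambda>x. ((R\<^sup>2 - sqd y x) * (R\<^sup>2 - sqd y x)) * Q x + A * (u x * u x)"
  assumes l: "0 < l" and R: "0 < R" "R \<le> 1"
    and u: "Cinf W u" and a: "\<And>i j. Cinf W (\<lambda>x. a x i j)" and b: "\<And>i. Cinf W (\<lambda>x. b x i)"
    and L: "\<And>x. x \<in> W \<Longrightarrow> Lop (a x) (b x) u x = 0" and x: "x \<in> W" "x \<in> cball y R"
    and ell: "elliptic l (a x)"
    and bnd: "\<And>i j. \<bar>a x i j\<bar> \<le> \<Lambda>" "\<And>i. \<bar>b x i\<bar> \<le> \<Lambda>"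
      "\<And>i j k. \<bar>pd k (\<lambda>x. a x i j) x\<bar> \<le> \<Lambda>" "\<And>i k. \<bar>pd k (\<lambda>x. b x i) x\<bar> \<le> \<Lambda>"
    and Q: "0 < Q x"
  shows "0 < Lop (a x) (b x) P x" and "Cinf W P"
proof -
  note oW = Cinf_open[OF u]
  have sym: "a x i j = a x j i" for i j using ell by (simp add: elliptic_def)
  let ?L = "Lop (a x) (b x)" and ?G = "Gam (a x)"
  define \<zeta> where "\<zeta> x = R\<^sup>2 - sqd y x" for x
  define Z where "Z x = \<zeta> x * \<zeta> x" for x
  define z where "z = \<zeta> x"
  have \<Lambda>: "0 \<le> \<Lambda>" using bnd(1) abs_ge_zero order_trans by blast
  have n1: "1 \<le> n" unfolding n_def by (simp add: Suc_leI)
  have dxy: "dist x y \<le> R" using x(2) by (simp add: dist_commute)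
  have C\<zeta>: "Cinf W \<zeta>" unfolding \<zeta>_def[abs_def] by (intro Cinf_diff Cinf_const Cinf_sqd oW)
  have CZ: "Cinf W Z" unfolding Z_def[abs_def] by (intro Cinf_mult C\<zeta>)
  have Ck: "Cinf W (pd k u)" for k by (rule Cinf_pd[OF u])
  have Ckk: "Cinf W (\<lambda>x. pd k u x * pd k u x)" for k by (intro Cinf_mult Ck)
  have CQ: "Cinf W Q" unfolding Q_def by (intro Cinf_sum oW Ckk)
  have CZQ: "Cinf W (\<lambda>x. Z x * Q x)" by (intro Cinf_mult CZ CQ)
  have Cuu: "Cinf W (\<lambda>x. u x * u x)" by (intro Cinf_mult u)
  have P_eq: "P = (\<lambda>x. Z x * Q x + A * (u x * u x))" by (simp add: P_def Z_def \<zeta>_def)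
  show "Cinf W P" unfolding P_eq by (intro Cinf_add CZQ Cinf_mult Cinf_const oW u)
  have z01: "0 \<le> z" "z \<le> 1"
  proof -
    have "sqd y x \<le> R\<^sup>2" unfolding sqd_eq using dxy by (intro power_mono) auto
    then show "0 \<le> z" by (simp add: z_def \<zeta>_def)
    have "R\<^sup>2 \<le> 1" using R by (simp add: power_le_one)
    moreover have "0 \<le> sqd y x" by (simp add: sqd_eq)
    ultimately show "z \<le> 1" by (simp add: z_def \<zeta>_def)
  qed
  define q where "q = sqrt (Q x)"
  define H where "H = (\<Sum>k\<in>UNIV. \<Sum>i\<in>UNIV. (pd i (pd k u) x)\<^sup>2)"
  define h where "h = sqrt H"
  have q: "0 < q" "q * q = Q x" using Q by (auto simp: q_def)
  have H0: "0 \<le> H" unfolding H_def by (intro sum_nonneg) auto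
  have h: "0 \<le> h" "h * h = H" using H0 by (auto simp: h_def)
  have uk: "\<bar>pd k u x\<bar> \<le> q" for k
  proof -
    have "pd k u x * pd k u x \<le> Q x" unfolding Q_def by (rule member_le_sum) auto
    then show ?thesis unfolding q_def by (intro real_le_rsqrt) (simp add: power2_eq_square)
  qed
  have uik: "\<bar>pd i (pd k u) x\<bar> \<le> h" for i k
  proof -
    have "(pd i (pd k u) x)\<^sup>2 \<le> (\<Sum>i\<in>UNIV. (pd i (pd k u) x)\<^sup>2)" by (rule member_le_sum) auto
    also have "\<dots> \<le> H" unfolding H_def by (rule member_le_sum[of k UNIV "\<lambda>k. \<Sum>i\<in>UNIV. (pd i (pd k u) x)\<^sup>2"]) (auto intro: sum_nonneg)
    finally show ?thesis unfolding h_def by (intro real_le_rsqrt) simp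
  qed
  have LQ: "2 * l * (h * h) - (2 * n ^ 3 * \<Lambda> * (q * h) + 2 * n\<^sup>2 * \<Lambda> * (q * q)) \<le> ?L Q x"
  proof -
    have "?L Q x = (\<Sum>k\<in>UNIV. ?L (\<lambda>x. pd k u x * pd k u x) x)"
      unfolding Q_def by (rule Lop_sum[OF oW _ _ x(1)]) (auto intro: Ckk)
    also have "\<dots> = (\<Sum>k\<in>UNIV. 2 * (pd k u x * ?L (pd k u) x)) + 2 * (\<Sum>k\<in>UNIV. ?G (pd k u) (pd k u) x)"
      by (simp add: Lop_mult[OF Ck Ck x(1) sym] sum.distrib sum_distrib_left)
    finally have e: "?L Q x = (\<Sum>k\<in>UNIV. 2 * (pd k u x * ?L (pd k u) x)) + 2 * (\<Sum>k\<in>UNIV. ?G (pd k u) (pd k u) x)" .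
    have "l * H \<le> (\<Sum>k\<in>UNIV. ?G (pd k u) (pd k u) x)"
      unfolding H_def sum_distrib_left[of l _ UNIV] by (intro sum_mono) (use elliptic_Gam_ge[OF ell] in \<open>simp add: sum_distrib_left\<close>)
    moreover have "\<bar>\<Sum>k\<in>UNIV. 2 * (pd k u x * ?L (pd k u) x)\<bar> \<le> CARD('n) * (2 * (q * (n * (n * (\<Lambda> * h)) + n * (\<Lambda> * q))))"
    proof (rule abs_sum_le)
      fix k
      have "\<bar>\<Sum>i\<in>UNIV. \<Sum>j\<in>UNIV. pd k (\<lambda>x. a x i j) x * pd i (pd j u) x\<bar> \<le> CARD('n) * (CARD('n) * (\<Lambda> * h))"
        by (intro abs_sum_le) (simp add: abs_mult, intro mult_mono bnd uik, use \<Lambda> in auto)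
      moreover have "\<bar>\<Sum>i\<in>UNIV. pd k (\<lambda>x. b x i) x * pd i u x\<bar> \<le> CARD('n) * (\<Lambda> * q)"
        by (intro abs_sum_le) (simp add: abs_mult, intro mult_mono bnd uk, use \<Lambda> in auto)
      ultimately have "\<bar>?L (pd k u) x\<bar> \<le> n * (n * (\<Lambda> * h)) + n * (\<Lambda> * q)"
        using Lop_pd[where k=k, OF u a b L x(1)] unfolding n_def by linarith
      then have "\<bar>pd k u x\<bar> * \<bar>?L (pd k u) x\<bar> \<le> q * (n * (n * (\<Lambda> * h)) + n * (\<Lambda> * q))"
        using q uk by (intro mult_mono) auto
      then show "\<bar>2 * (pd k u x * ?L (pd k u) x)\<bar> \<le> 2 * (q * (n * (n * (\<Lambda> * h)) + n * (\<Lambda> * q)))"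
        by (simp add: abs_mult)
    qed
    then have "\<bar>\<Sum>k\<in>UNIV. 2 * (pd k u x * ?L (pd k u) x)\<bar> \<le> 2 * n ^ 3 * \<Lambda> * (q * h) + 2 * n\<^sup>2 * \<Lambda> * (q * q)"
      by (simp add: n_def power3_eq_cube power2_eq_square algebra_simps)
    ultimately show ?thesis unfolding e h(2) by linarith
  qed
  have LZ: "- (8 * n * \<Lambda>) \<le> ?L Z x"
  proof -
    have "?L \<zeta> x = - ?L (sqd y) x"
      unfolding \<zeta>_def[abs_def] using Lop_diff[OF Cinf_const[where c="R\<^sup>2", OF oW] Cinf_sqd[OF oW] x(1) sym] by simp
    moreover have "\<bar>?L (sqd y) x\<bar> \<le> 2 * n * \<Lambda> * (1 + 1)"
      unfolding n_def by (rule abs_Lop_sqd_le) (use bnd dxy R in auto)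
    ultimately have 1: "\<bar>?L \<zeta> x\<bar> \<le> 4 * n * \<Lambda>" by simp
    have "\<bar>z * ?L \<zeta> x\<bar> \<le> 1 * (4 * n * \<Lambda>)" unfolding abs_mult using 1 z01 by (intro mult_mono) auto
    moreover have "0 \<le> ?G \<zeta> \<zeta> x"
      using elliptic_Gam_ge[OF ell, of \<zeta> x] l by (meson mult_nonneg_nonneg order.trans less_imp_le sum_nonneg zero_le_power2)
    moreover have "?L Z x = 2 * (z * ?L \<zeta> x) + 2 * ?G \<zeta> \<zeta> x"
      unfolding Z_def[abs_def] Lop_mult[OF C\<zeta> C\<zeta> x(1) sym] z_def by simp
    ultimately show ?thesis by linarith
  qed
  have GZ: "\<bar>?G Z Q x\<bar> \<le> 8 * n ^ 3 * \<Lambda> * (z * (q * h))"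
  proof -
    \<comment> \<open>The gradient of the squared cutoff vanishes together with the cutoff. This is
      the reason for squaring: the cross term carries a factor \<open>z\<close> next to the Hessian
      norm \<open>h\<close>, so a term in \<open>z * z * h * h\<close> can absorb it.\<close>
    have pz: "\<bar>pd i Z x\<bar> \<le> 4 * z" for i
    proof -
      have dz: "\<zeta> differentiable (at x)" by (rule Cinf_differentiable[OF C\<zeta> x(1)])
      have "pd i \<zeta> x = - (2 * (x $ i - y $ i))"
        using pd_add[of "\<lambda>x. R\<^sup>2" x "\<lambda>x. - 1 * sqd y x" i] pd_mult[of "\<lambda>x. - 1" x "sqd y" i]
          Cinf_differentiable[OF Cinf_sqd[OF oW] x(1)] pd_sqd[of i y x] unfolding \<zeta>_def[abs_def] by simp
      moreover have "\<bar>x $ i - y $ i\<bar> \<le> 1" using component_le_norm_cart[of "x - y" i] dxy R by (simp add: dist_norm)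
      ultimately have "\<bar>pd i \<zeta> x\<bar> \<le> 2" by simp
      moreover have "pd i Z x = 2 * (z * pd i \<zeta> x)" unfolding Z_def[abs_def] pd_mult[OF dz dz] z_def by simp
      ultimately show ?thesis using z01 mult_left_mono[of "\<bar>pd i \<zeta> x\<bar>" 2 z] by (simp add: abs_mult)
    qed
    have pQ: "\<bar>pd j Q x\<bar> \<le> n * (2 * (q * h))" for j
    proof -
      have "pd j Q x = (\<Sum>k\<in>UNIV. 2 * (pd k u x * pd j (pd k u) x))"
        unfolding Q_def using Cinf_differentiable[OF Ckk x(1)] Cinf_differentiable[OF Ck x(1)] by (simp add: pd_sum pd_mult)
      moreover have "\<bar>\<Sum>k\<in>UNIV. 2 * (pd k u x * pd j (pd k u) x)\<bar> \<le> CARD('n) * (2 * (q * h))"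
        by (rule abs_sum_le) (simp add: abs_mult mult_mono uk uik q(1) less_imp_le)
      ultimately show ?thesis by (simp add: n_def)
    qed
    have "\<bar>?G Z Q x\<bar> \<le> CARD('n) * (CARD('n) * (\<Lambda> * ((4 * z) * (n * (2 * (q * h))))))"
      unfolding Gam_def
      by (intro abs_sum_le, unfold abs_mult, intro mult_mono bnd pz pQ) (use \<Lambda> z01 q h n1 in auto)
    then show ?thesis by (simp add: n_def power3_eq_cube mult_ac)
  qed
  have Luu: "2 * l * (q * q) \<le> ?L (\<lambda>x. u x * u x) x"
    using elliptic_Gam_ge[OF ell, of u x] Lop_mult[OF u u x(1) sym, where b="b x"] L[OF x(1)]
    unfolding q(2) Q_def by (simp add: power2_eq_square)
  have LP: "?L P x = Z x * ?L Q x + Q x * ?L Z x + 2 * ?G Z Q x + A * ?L (\<lambda>x. u x * u x) x"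
    unfolding P_eq using Lop_add[OF CZQ Cinf_mult[OF Cinf_const[where c=A, OF oW] Cuu] x(1)] Lop_mult[OF CZ CQ x(1) sym]
      Lop_cmult[OF Cuu x(1) sym] by simp
  \<comment> \<open>The Hessian norm weighted by the cutoff, in which the square is
    completed.\<close>
  define X where "X = z * h"
  have X0: "0 \<le> X" using z01 h by (simp add: X_def)
  have c0: "0 \<le> c" unfolding c_def using \<Lambda> n1 by simp
  have A0: "0 \<le> A" unfolding A_def using c0 l \<Lambda> n1 by simp
  have t1: "2 * l * (X * X) - (2 * n ^ 3 * \<Lambda> * (q * X) + 2 * n\<^sup>2 * \<Lambda> * (q * q)) \<le> Z x * ?L Q x"
  proof -
    have zz: "z * z \<le> z" "z * z \<le> 1" using z01 by (auto simp: mult_le_one mult_left_le)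
    have n0: "0 \<le> n ^ 3 * \<Lambda>" "0 \<le> n\<^sup>2 * \<Lambda>" using \<Lambda> n1 by auto
    have "(z * z) * (2 * l * (h * h) - (2 * n ^ 3 * \<Lambda> * (q * h) + 2 * n\<^sup>2 * \<Lambda> * (q * q))) \<le> Z x * ?L Q x"
      using LQ z01 unfolding Z_def z_def[symmetric] by (intro mult_left_mono) auto
    moreover have "(z * z) * (2 * n ^ 3 * \<Lambda> * (q * h)) \<le> z * (2 * n ^ 3 * \<Lambda> * (q * h))"
    proof (rule mult_right_mono[OF zz(1)])
      have "0 \<le> 2 * ((n ^ 3 * \<Lambda>) * (q * h))" using n0(1) q h by simp
      then show "0 \<le> 2 * n ^ 3 * \<Lambda> * (q * h)" by (simp only: mult.assoc)
    qed
    moreover have "(z * z) * (2 * n\<^sup>2 * \<Lambda> * (q * q)) \<le> 1 * (2 * n\<^sup>2 * \<Lambda> * (q * q))"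
    proof (rule mult_right_mono[OF zz(2)])
      have "0 \<le> (n\<^sup>2 * \<Lambda>) * (q * q)" by (rule mult_nonneg_nonneg[OF n0(2) zero_le_square])
      then have "0 \<le> 2 * ((n\<^sup>2 * \<Lambda>) * (q * q))" by linarith
      then show "0 \<le> 2 * n\<^sup>2 * \<Lambda> * (q * q)" by (simp only: mult.assoc)
    qed
    moreover have "(z * z) * (2 * l * (h * h) - (2 * n ^ 3 * \<Lambda> * (q * h) + 2 * n\<^sup>2 * \<Lambda> * (q * q)))
      = 2 * l * (X * X) - (z * z) * (2 * n ^ 3 * \<Lambda> * (q * h)) - (z * z) * (2 * n\<^sup>2 * \<Lambda> * (q * q))"
      by (simp add: X_def algebra_simps)
    moreover have "z * (2 * n ^ 3 * \<Lambda> * (q * h)) = 2 * n ^ 3 * \<Lambda> * (q * X)" by (simp add: X_def)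
    ultimately show ?thesis by linarith
  qed
  have t2: "- (8 * n * \<Lambda> * (q * q)) \<le> Q x * ?L Z x"
    using mult_left_mono[OF LZ, of "Q x"] Q q(2) by (simp add: mult_ac)
  have t3: "- (16 * n ^ 3 * \<Lambda> * (q * X)) \<le> 2 * ?G Z Q x"
  proof -
    have "8 * n ^ 3 * \<Lambda> * (z * (q * h)) = 8 * n ^ 3 * \<Lambda> * (q * X)" by (simp add: X_def)
    then show ?thesis using GZ by linarith
  qed
  have t4: "(c\<^sup>2 / (8 * l) + 1 + 2 * n\<^sup>2 * \<Lambda> + 8 * n * \<Lambda>) * (q * q) \<le> A * ?L (\<lambda>x. u x * u x) x"
  proof -
    have "A * (2 * l * (q * q)) \<le> A * ?L (\<lambda>x. u x * u x) x" using Luu A0 by (rule mult_left_mono)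
    moreover have "A * (2 * l * (q * q)) = (c\<^sup>2 / (8 * l) + 1 + 2 * n\<^sup>2 * \<Lambda> + 8 * n * \<Lambda>) * (q * q)"
      using l by (simp add: A_def)
    ultimately show ?thesis by simp
  qed
  \<comment> \<open>The summand \<open>q * q\<close> is the reserve built into \<open>A\<close>; it
    makes the inequality strict because the gradient is nonzero at \<open>x\<close>.\<close>
  have "2 * l * (X * X) - c * (q * X) + (c\<^sup>2 / (8 * l) + 1) * (q * q) = 2 * l * (X - c * q / (4 * l))\<^sup>2 + q * q"
    using l by (simp add: power2_eq_square field_simps)
  moreover have "0 < 2 * l * (X - c * q / (4 * l))\<^sup>2 + q * q" unfolding q(2) using l Q by (simp add: add_nonneg_pos)
  moreover have "c * (q * X) = 18 * n ^ 3 * \<Lambda> * (q * X)" by (simp add: c_def)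
  moreover have "(c\<^sup>2 / (8 * l) + 1 + 2 * n\<^sup>2 * \<Lambda> + 8 * n * \<Lambda>) * (q * q) =
     (c\<^sup>2 / (8 * l) + 1) * (q * q) + 2 * n\<^sup>2 * \<Lambda> * (q * q) + 8 * n * \<Lambda> * (q * q)" by (simp add: distrib_right)
  ultimately show "0 < ?L P x" unfolding LP using t1 t2 t3 t4 by linarith
qed

lemma bernstein:
  fixes l \<Lambda> R :: real
  assumes l: "0 < l" and R: "0 < R" "R \<le> 1"
  shows "\<exists>C\<ge>0. \<forall>a b u y (W :: (real^'n::finite) set).
    Cinf W u \<and> cball y R \<subseteq> W \<and> (\<forall>i j. Cinf W (\<lambda>x. a x i j)) \<and> (\<forall>i. Cinf W (\<lambda>x. b x i)) \<and>
    (\<forall>x\<in>W. elliptic l (a x) \<and> (\<forall>i j. \<bar>a x i j\<bar> \<le> \<Lambda>) \<and> (\<forall>i. \<bar>b x i\<bar> \<le> \<Lambda>) \<and>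
      (\<forall>i j k. \<bar>pd k (\<lambda>x. a x i j) x\<bar> \<le> \<Lambda>) \<and> (\<forall>i k. \<bar>pd k (\<lambda>x. b x i) x\<bar> \<le> \<Lambda>) \<and>
      Lop (a x) (b x) u x = 0 \<and> \<bar>u x\<bar> \<le> 2) \<longrightarrow>
    (\<forall>x\<in>cball y (R/2). \<forall>k. \<bar>pd k u x\<bar> \<le> C)"
proof -
  define n where "n = real CARD('n)"
  define c where "c = 18 * n ^ 3 * \<Lambda>"
  define A where "A = (c\<^sup>2 / (8 * l) + 1 + 2 * n\<^sup>2 * \<Lambda> + 8 * n * \<Lambda>) / (2 * l)"
  \<comment> \<open>On the ball of radius R/2 the cutoff is at least 3 R^2 / 4, and the maximum of
    \<open>P\<close> is at most 4 |A| because |u| is at most 2.\<close>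
  define C where "C = sqrt (4 * \<bar>A\<bar> / ((3 * R\<^sup>2 / 4) * (3 * R\<^sup>2 / 4)))"
  have C: "0 \<le> C" using R by (simp add: C_def)
  show ?thesis
  proof (intro exI[of _ C] conjI C allI impI ballI, elim conjE)
    fix a b u y x k and W :: "(real^'n) set"
    assume u: "Cinf W u" and sub: "cball y R \<subseteq> W" and a: "\<forall>i j. Cinf W (\<lambda>x. a x i j)" and b: "\<forall>i. Cinf W (\<lambda>x. b x i)"
      and op: "\<forall>x\<in>W. elliptic l (a x) \<and> (\<forall>i j. \<bar>a x i j\<bar> \<le> \<Lambda>) \<and> (\<forall>i. \<bar>b x i\<bar> \<le> \<Lambda>) \<and>
      (\<forall>i j k. \<bar>pd k (\<lambda>x. a x i j) x\<bar> \<le> \<Lambda>) \<and> (\<forall>i k. \<bar>pd k (\<lambda>x. b x i) x\<bar> \<le> \<Lambda>) \<and>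
      Lop (a x) (b x) u x = 0 \<and> \<bar>u x\<bar> \<le> 2" and x: "x \<in> cball y (R/2)"
    define Q where "Q x = (\<Sum>k\<in>UNIV. pd k u x * pd k u x)" for x
    define P where "P x = ((R\<^sup>2 - sqd y x) * (R\<^sup>2 - sqd y x)) * Q x + A * (u x * u x)" for x
    have Q0: "0 \<le> Q x" for x unfolding Q_def by (intro sum_nonneg) auto
    have L: "\<And>x. x \<in> W \<Longrightarrow> Lop (a x) (b x) u x = 0" using op by blast
    have CP: "Cinf W P" unfolding P_def[abs_def] Q_def[abs_def]
      by (intro Cinf_add Cinf_mult Cinf_diff Cinf_const Cinf_sqd Cinf_sum Cinf_pd u Cinf_open[OF u])
    have pos: "0 < Lop (a x) (b x) P x" if "x \<in> W" "x \<in> cball y R" "0 < Q x" for x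
      unfolding P_def[abs_def] Q_def[abs_def] A_def c_def n_def
      by (rule bernstein_pointwise[OF l R u _ _ L that(1,2)])
         (use a b op that in \<open>auto simp: Q_def\<close>)
    have "continuous_on (cball y R) P" using Cinf_continuous_on[OF CP] sub continuous_on_subset by blast
    moreover have "cball y R \<noteq> {}" using R by simp
    ultimately obtain z where z: "z \<in> cball y R" "\<And>w. w \<in> cball y R \<Longrightarrow> P w \<le> P z"
      using continuous_attains_sup[OF compact_cball] by metis
    have zW: "z \<in> W" using z sub by blast
    have uu: "A * (u x * u x) \<le> 4 * \<bar>A\<bar>" "- (4 * \<bar>A\<bar>) \<le> A * (u x * u x)" if "x \<in> W" for x
    proof -
      have "\<bar>u x\<bar> * \<bar>u x\<bar> \<le> 2 * 2" using op that by (intro mult_mono) auto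
      then have "\<bar>A\<bar> * (\<bar>u x\<bar> * \<bar>u x\<bar>) \<le> \<bar>A\<bar> * 4" by (intro mult_left_mono) auto
      then have "\<bar>A * (u x * u x)\<bar> \<le> 4 * \<bar>A\<bar>" by (simp add: abs_mult)
      then show "A * (u x * u x) \<le> 4 * \<bar>A\<bar>" "- (4 * \<bar>A\<bar>) \<le> A * (u x * u x)" by linarith+
    qed
    \<comment> \<open>At an interior maximum the gradient must vanish, and on the sphere the cutoff
      does. Either way only the summand with u^2 is left.\<close>
    have Pz: "P z \<le> 4 * \<bar>A\<bar>"
    proof (cases "Q z = 0")
      case True
      then show ?thesis using uu(1)[OF zW] by (simp add: P_def)
    next
      case False
      then have Qz: "0 < Q z" using Q0[of z] by simp
      have "z \<notin> ball y R"
      proof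
        assume zb: "z \<in> ball y R"
        have "Lop (a z) (b z) P z \<le> 0"
        proof (rule Lop_local_max)
          show "Cinf (ball y R) P" using Cinf_subset[OF CP] sub ball_subset_cball by blast
          show "elliptic l (a z)" using op zW by blast
        qed (use zb z(2) l in auto)
        then show False using pos[OF zW z(1) Qz] by simp
      qed
      then have "sqd y z = R\<^sup>2" using z(1) by (simp add: sqd_eq dist_commute)
      then show ?thesis using uu(1)[OF zW] by (simp add: P_def)
    qed
    have xR: "x \<in> cball y R" using x R by auto
    have xW: "x \<in> W" using xR sub by blast
    have A0: "0 \<le> A"
    proof -
      have "0 \<le> \<Lambda>" using op xW abs_ge_zero order_trans by blast
      then show ?thesis using l by (simp add: A_def c_def n_def)
    qed
    have "sqd y x \<le> (R/2)\<^sup>2" unfolding sqd_eq using x by (intro power_mono) (auto simp: dist_commute)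
    then have ge: "3 * R\<^sup>2 / 4 \<le> R\<^sup>2 - sqd y x" by (simp add: power_divide)
    have R2: "0 < 3 * R\<^sup>2 / 4" using R by simp
    have "((3 * R\<^sup>2 / 4) * (3 * R\<^sup>2 / 4)) * Q x \<le> ((R\<^sup>2 - sqd y x) * (R\<^sup>2 - sqd y x)) * Q x"
    proof (intro mult_right_mono mult_mono ge Q0)
      show "0 \<le> R\<^sup>2 - sqd y x" "0 \<le> 3 * R\<^sup>2 / 4" using ge R2 by linarith+
    qed
    also have "\<dots> \<le> P x" using A0 by (simp add: P_def)
    also have "\<dots> \<le> 4 * \<bar>A\<bar>" using z(2)[OF xR] Pz by simp
    finally have Qx: "Q x \<le> 4 * \<bar>A\<bar> / ((3 * R\<^sup>2 / 4) * (3 * R\<^sup>2 / 4))"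
      using R2 by (subst pos_le_divide_eq) (auto simp: mult.commute)
    have "pd k u x * pd k u x \<le> Q x" unfolding Q_def by (rule member_le_sum) auto
    then have "(\<bar>pd k u x\<bar>)\<^sup>2 \<le> 4 * \<bar>A\<bar> / ((3 * R\<^sup>2 / 4) * (3 * R\<^sup>2 / 4))" using Qx by (simp add: power2_eq_square)
    then show "\<bar>pd k u x\<bar> \<le> C" unfolding C_def by (rule real_le_rsqrt)
  qed
qed

lemma pd_bound_osc:
  fixes u :: "real^'n::finite \<Rightarrow> real" and C R :: real
  assumes u: "Cinf W u" "cball y R \<subseteq> W" and C: "\<And>x k. x \<in> cball y R \<Longrightarrow> \<bar>pd k u x\<bar> \<le> C" and x: "x \<in> cball y R"
  shows "\<bar>u x - u y\<bar> \<le> real CARD('n) * C * dist x y"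
proof -
  have in1: "y + t *\<^sub>R (x - y) \<in> cball y R" if "0 \<le> t" "t \<le> 1" for t
  proof -
    have "dist y (y + t *\<^sub>R (x - y)) = t * dist x y" using that by (simp add: dist_norm)
    also have "\<dots> \<le> 1 * dist x y" using that by (intro mult_right_mono) auto
    finally show ?thesis using x by (simp add: dist_commute)
  qed
  have "((\<lambda>t. u (y + t *\<^sub>R (x - y))) has_real_derivative (\<Sum>i\<in>UNIV. (x - y) $ i * pd i u (y + t *\<^sub>R (x - y)))) (at t)"
    if "0 \<le> t" "t \<le> 1" for t
    using in1[OF that] u by (intro DERIV_line Cinf_differentiable[OF u(1)]) auto
  from MVT2[OF zero_less_one this] obtain t where t: "0 < t" "t < 1"
    "u (y + 1 *\<^sub>R (x - y)) - u (y + 0 *\<^sub>R (x - y)) = (1 - 0) * (\<Sum>i\<in>UNIV. (x - y) $ i * pd i u (y + t *\<^sub>R (x - y)))" by blast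
  have "\<bar>\<Sum>i\<in>UNIV. (x - y) $ i * pd i u (y + t *\<^sub>R (x - y))\<bar> \<le> CARD('n) * (dist x y * C)"
  proof (rule abs_sum_le)
    fix i
    have "\<bar>(x - y) $ i\<bar> * \<bar>pd i u (y + t *\<^sub>R (x - y))\<bar> \<le> dist x y * C"
      using component_le_norm_cart[of "x - y" i] C[OF in1] t by (intro mult_mono) (auto simp: dist_norm)
    then show "\<bar>(x - y) $ i * pd i u (y + t *\<^sub>R (x - y))\<bar> \<le> dist x y * C" by (simp only: abs_mult)
  qed
  then show ?thesis using t(3) by (simp add: mult_ac)
qed

section \<open>Charts of a manifold with boundary\<close>

lemma half_space_step: "x \<in> half_space \<Longrightarrow> 0 \<le> d \<Longrightarrow> x + d *\<^sub>R axis i 1 \<in> half_space"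
  by (auto simp: half_space_def axis_def)

text \<open>From every point of the half-space, boundary points included, small positive steps along
  the coordinate axes stay in it. This already determines the derivative.\<close>

lemma frechet_derivative_half_space:
  assumes "(F has_derivative D) (at x within half_space)" "x \<in> half_space"
  shows "frechet_derivative F (at x within half_space) = D"
proof -
  have "F differentiable (at x within half_space)" using assms(1) differentiable_def by blast
  then have 1: "(F has_derivative frechet_derivative F (at x within half_space)) (at x within half_space)"
    using frechet_derivative_works by blast
  show ?thesis
  proof (rule frechet_derivative_unique_within[OF 1 assms(1)])
    fix i :: "real^'a option" and e :: real assume i: "i \<in> Basis" and e: "0 < e"
    obtain k where "i = axis k 1" using i by (auto simp: Basis_vec_def)
    then show "\<exists>d. 0 < \<bar>d\<bar> \<and> \<bar>d\<bar> < e \<and> x + d *\<^sub>R i \<in> half_space"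
      using half_space_step[OF assms(2), of "e/2" k] e by (intro exI[of _ "e/2"]) auto
  qed
qed

lemma has_derivative_half_space:
  assumes "Cinf (ball x0 r) F'" "x \<in> ball x0 r" "x \<in> half_space"
    and "\<And>y. y \<in> ball x0 r \<Longrightarrow> y \<in> half_space \<Longrightarrow> F y = F' y"
  shows "(F has_derivative frechet_derivative F' (at x)) (at x within half_space)"
proof -
  have 1: "(F' has_derivative frechet_derivative F' (at x)) (at x within half_space)"
    using Cinf_differentiable[OF assms(1,2)] frechet_derivative_works has_derivative_at_withinI by blast
  have "\<forall>\<^sub>F y in at x within half_space. y \<in> ball x0 r"
    using eventually_at_in_open'[OF open_ball assms(2)] by (simp add: eventually_at_topological) blast
  then have "\<forall>\<^sub>F y in at x within half_space. F' y = F y"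
    unfolding eventually_at_filter by eventually_elim (use assms(4) in auto)
  then show ?thesis
    using has_derivative_transform_eventually[OF 1, of F] assms by auto
qed

locale manifold =
  fixes M :: "'a::t2_space set" and A :: "('a, 'm::finite) chart set"
  assumes manifold: "smooth_manifold M A"
begin

abbreviation bd where "bd \<equiv> boundary A"

lemma chart: "c \<in> A \<Longrightarrow> is_chart M c"
  and M_eq: "M = (\<Union>c\<in>A. fst c)"
  and transition_smooth: "c \<in> A \<Longrightarrow> d \<in> A \<Longrightarrow> smooth_on (snd c ` (fst c \<inter> fst d)) (transition c d)"
  using manifold by (auto simp: smooth_manifold_def)

lemma chart_hom: "c \<in> A \<Longrightarrow> homeomorphism (fst c) (chart_image c) (snd c) (chart_inv c)"
  and chart_openin: "c \<in> A \<Longrightarrow> openin (top_of_set M) (fst c)"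
  and chart_image_openin: "c \<in> A \<Longrightarrow> openin (top_of_set half_space) (chart_image c)"
  using chart by (auto simp: is_chart_def)

lemma chart_sub: "c \<in> A \<Longrightarrow> fst c \<subseteq> M" using M_eq by blast

lemma obtain_chart:
  assumes "p \<in> M" obtains c where "c \<in> A" "p \<in> fst c" using assms M_eq by auto

lemma chart_inv_snd [simp]: "c \<in> A \<Longrightarrow> p \<in> fst c \<Longrightarrow> chart_inv c (snd c p) = p"
  using chart_hom by (auto simp: homeomorphism_def)

lemma snd_chart_inv [simp]: "c \<in> A \<Longrightarrow> x \<in> chart_image c \<Longrightarrow> snd c (chart_inv c x) = x"
  by (simp add: f_inv_into_f)

lemma chart_inv_in: "x \<in> chart_image c \<Longrightarrow> chart_inv c x \<in> fst c"
  by (simp add: inv_into_into)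

lemma chart_image_half: "c \<in> A \<Longrightarrow> x \<in> chart_image c \<Longrightarrow> x \<in> half_space"
  using chart_image_openin openin_imp_subset by blast

lemma None_nonneg: "c \<in> A \<Longrightarrow> p \<in> fst c \<Longrightarrow> 0 \<le> snd c p $ None"
  using chart_image_half[of c "snd c p"] by (auto simp: half_space_def)

lemma openin_half_ball:
  assumes "openin (top_of_set half_space) S" "x \<in> S"
  obtains r where "0 < r" "ball x r \<inter> half_space \<subseteq> S"
  using assms by (metis openin_contains_ball)

lemma chart_ball:
  assumes "c \<in> A" "x \<in> chart_image c"
  obtains r where "0 < r" "ball x r \<inter> half_space \<subseteq> chart_image c"
  using openin_half_ball[OF chart_image_openin[OF assms(1)] assms(2)] by blast

lemma openin_chart_inv:
  assumes "c \<in> A" "openin (top_of_set half_space) B" "B \<subseteq> chart_image c"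
  shows "openin (top_of_set M) (chart_inv c ` B)"
proof -
  have "openin (top_of_set (chart_image c)) B" using assms openin_subset_trans chart_image_openin openin_imp_subset by metis
  then have "openin (top_of_set (fst c)) (chart_inv c ` B)"
    using homeomorphism_imp_open_map[OF homeomorphism_symD[OF chart_hom[OF assms(1)]]] by blast
  then show ?thesis using openin_trans chart_openin[OF assms(1)] by blast
qed

lemma openin_snd_image:
  assumes "c \<in> A" "openin (top_of_set M) U"
  shows "openin (top_of_set half_space) (snd c ` (U \<inter> fst c))"
proof -
  have "openin (top_of_set (fst c)) (U \<inter> fst c)"
  proof -
    obtain T where "open T" "U = M \<inter> T" using assms(2) by (metis openin_open)
    then show ?thesis unfolding openin_open using chart_sub[OF assms(1)] by (intro exI[of _ T]) auto
  qed
  then have "openin (top_of_set (chart_image c)) (snd c ` (U \<inter> fst c))"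
    using homeomorphism_imp_open_map[OF chart_hom[OF assms(1)]] by blast
  then show ?thesis using openin_trans chart_image_openin[OF assms(1)] by blast
qed

text \<open>A transition map cannot push a boundary point into the interior: its inverse has there a normal
  coordinate with a minimum, hence a singular derivative.\<close>

lemma boundary_chart_independent:
  assumes c: "c \<in> A" "d \<in> A" and p: "p \<in> fst c" "p \<in> fst d" and z: "snd c p $ None = 0"
  shows "snd d p $ None = 0"
proof (rule ccontr)
  assume "snd d p $ None \<noteq> 0"
  then have pos: "0 < snd d p $ None" using None_nonneg[OF c(2) p(2)] by simp
  let ?x = "snd c p" and ?y = "snd d p" and ?N = "fst c \<inter> fst d"
  have xh: "?x \<in> half_space" using z by (simp add: half_space_def)
  have xN: "?x \<in> snd c ` ?N" "?y \<in> snd d ` ?N" using p by auto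
  obtain W1 T where T: "open W1" "?x \<in> W1" "\<And>k. Ck_on k T W1" "\<And>w. w \<in> snd c ` ?N \<inter> W1 \<Longrightarrow> T w = transition c d w"
    using transition_smooth[OF c] xN(1) unfolding smooth_on_def by metis
  obtain W2 S where S: "open W2" "?y \<in> W2" "\<And>k. Ck_on k S W2" "\<And>w. w \<in> snd d ` ?N \<inter> W2 \<Longrightarrow> S w = transition d c w"
    using transition_smooth[OF c(2,1)] xN(2) unfolding smooth_on_def by (metis Int_commute)
  have Nop: "openin (top_of_set M) ?N" using chart_openin c by blast
  have "openin (top_of_set half_space) (snd c ` (?N \<inter> fst c))" "openin (top_of_set half_space) (snd d ` (?N \<inter> fst d))"
    using openin_snd_image Nop c by blast+
  moreover have "?N \<inter> fst c = ?N" "?N \<inter> fst d = ?N" by auto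
  ultimately have op: "openin (top_of_set half_space) (snd c ` ?N)" "openin (top_of_set half_space) (snd d ` ?N)" by simp_all
  obtain r1 where r1: "0 < r1" "ball ?x r1 \<inter> half_space \<subseteq> snd c ` ?N" using openin_half_ball[OF op(1) xN(1)] by blast
  obtain r2 where r2: "0 < r2" "ball ?y r2 \<inter> half_space \<subseteq> snd d ` ?N" using openin_half_ball[OF op(2) xN(2)] by blast
  have Tx: "T ?x = ?y" using T(2,4) xN(1) c p by (simp add: transition_def)
  have Sy: "S ?y = ?x" using S(2,4) xN(2) c p by (simp add: transition_def)
  \<comment> \<open>A full neighbourhood of \<open>?y\<close> inside the open half-space. On it
    \<open>S\<close> is the inverse transition, and its normal coordinate has an interior minimum at
    \<open>?y\<close>, which allows two-sided calculus.\<close>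
  define V where "V = ball ?y r2 \<inter> W2 \<inter> {w. 0 < w $ None}"
  have V: "open V" "?y \<in> V"
    unfolding V_def using S r2 pos by (auto intro!: open_Int open_Collect_less continuous_intros)
  have CS: "Cinf V (\<lambda>w. - (S w $ None))"
    unfolding Cinf_def
    by (intro conjI allI V Ck_on_minus Ck_on_linear_comp[OF bounded_linear_vec_nth] Ck_on_subset[OF S(3)]) (auto simp: V_def)
  have le: "- (S w $ None) \<le> - (S ?y $ None)" if "w \<in> V" for w
  proof -
    have "w \<in> snd d ` ?N" using that r2 by (auto simp: V_def half_space_def)
    then obtain s where s: "s \<in> ?N" "w = snd d s" by blast
    then have "S w = snd c s" using S(4)[of w] that c by (auto simp: V_def transition_def)
    then show ?thesis using None_nonneg[OF c(1)] s(1) Sy z by auto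
  qed
  have "pd i (\<lambda>w. - (S w $ None)) ?y = 0" for i using local_max_pd(1)[OF CS V(2) le] .
  then have dS: "((\<lambda>w. - (S w $ None)) has_derivative (\<lambda>v. 0)) (at ?y)"
    using has_derivative_pd[OF Cinf_differentiable[OF CS V(2)]] by simp
  have dT: "(T has_derivative frechet_derivative T (at ?x)) (at ?x within half_space)"
    using Ck_on_has_derivative[OF T(3) T(1,2)] has_derivative_at_withinI by blast
  have "((\<lambda>w. - (S (T w) $ None)) has_derivative (\<lambda>v. 0)) (at ?x within half_space)"
    using diff_chain_within[OF dT has_derivative_at_withinI[OF dS[folded Tx]]] by (simp add: o_def)
  \<comment> \<open>Near the point, \<open>S\<close> undoes \<open>T\<close> on the half-space. The
    derivative found to be zero is thus that of the normal coordinate itself.\<close>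
  moreover have "\<forall>\<^sub>F w in at ?x within half_space. - (S (T w) $ None) = - (w $ None)"
  proof -
    have Tc: "isCont T ?x" using T(3)[of 0] T(1,2) by (simp add: continuous_on_eq_continuous_at)
    have "\<forall>\<^sub>F w in at ?x. T w \<in> W2" using Tc S(1,2) Tx by (metis isCont_def topological_tendstoD)
    moreover have "\<forall>\<^sub>F w in at ?x. w \<in> W1 \<inter> ball ?x r1"
      using T(1,2) r1(1) eventually_at_in_open'[of "W1 \<inter> ball ?x r1" ?x] by auto
    ultimately have "\<forall>\<^sub>F w in at ?x. w \<in> half_space \<longrightarrow> - (S (T w) $ None) = - (w $ None)"
    proof eventually_elim
      case (elim w)
      show ?case
      proof
        assume "w \<in> half_space"
        then have "w \<in> snd c ` ?N" using r1 elim by auto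
        then obtain s where s: "s \<in> ?N" "w = snd c s" by blast
        then have "T w = snd d s" using T(4)[of w] elim c by (auto simp: transition_def)
        moreover then have "S (T w) = snd c s" using S(4)[of "T w"] elim c s by (auto simp: transition_def)
        ultimately show "- (S (T w) $ None) = - (w $ None)" using s by simp
      qed
    qed
    then show ?thesis by (simp add: eventually_at_filter eventually_mono)
  qed
  ultimately have "((\<lambda>w. - (w $ None)) has_derivative (\<lambda>v. 0)) (at ?x within half_space)"
    using has_derivative_transform_eventually[of "\<lambda>w. - (S (T w) $ None)" _ ?x half_space "\<lambda>w. - (w $ None)"] xh Tx Sy by auto
  then have "frechet_derivative (\<lambda>w. - (w $ None)) (at ?x within half_space) = (\<lambda>v. 0)"
    using frechet_derivative_half_space xh by blast
  moreover have "((\<lambda>w. - (w $ None)) has_derivative (\<lambda>v. - (v $ None))) (at ?x within half_space)"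
    by (intro has_derivative_minus bounded_linear_imp_has_derivative bounded_linear_vec_nth)
  then have "frechet_derivative (\<lambda>w. - (w $ None)) (at ?x within half_space) = (\<lambda>v. - (v $ None))"
    using frechet_derivative_half_space xh by blast
  ultimately have "(\<lambda>v::'m model. 0::real) = (\<lambda>v. - (v $ None))" by simp
  from fun_cong[OF this, of "axis None 1"] show False by simp
qed

lemma boundary_iff: "c \<in> A \<Longrightarrow> p \<in> fst c \<Longrightarrow> p \<in> bd \<longleftrightarrow> snd c p $ None = 0"
  unfolding boundary_def using boundary_chart_independent by blast

lemma interior_iff: "c \<in> A \<Longrightarrow> p \<in> fst c \<Longrightarrow> p \<notin> bd \<longleftrightarrow> 0 < snd c p $ None"
  using boundary_iff[of c p] None_nonneg[of c p] by auto

lemma bd_sub: "bd \<subseteq> M" unfolding boundary_def using chart_sub by blast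

text \<open>The coordinate ball is open, so the set is relatively open in \<open>M\<close> once the
  half-ball fits into the chart. It serves boundary and interior points alike, and without the
  boundary it stays convex in coordinates, hence connected.\<close>

definition cball_nbhd :: "('a, 'm) chart \<Rightarrow> 'm model \<Rightarrow> real \<Rightarrow> 'a set" where
  "cball_nbhd c x r = chart_inv c ` (ball x r \<inter> half_space)"

lemma cball_nbhd_openin:
  assumes "c \<in> A" "ball x r \<inter> half_space \<subseteq> chart_image c"
  shows "openin (top_of_set M) (cball_nbhd c x r)"
  unfolding cball_nbhd_def by (rule openin_chart_inv) (use assms in \<open>auto simp: Int_commute openin_open_Int\<close>)

lemma cball_nbhd_interior:
  assumes "c \<in> A" "ball x r \<inter> half_space \<subseteq> chart_image c"
  shows "cball_nbhd c x r - bd = chart_inv c ` (ball x r \<inter> {y. 0 < y $ None})"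
proof -
  have "chart_inv c y \<notin> bd \<longleftrightarrow> 0 < y $ None" if "y \<in> ball x r" "y \<in> half_space" for y
    using that assms interior_iff[OF assms(1), of "chart_inv c y"] chart_inv_in[of y c] snd_chart_inv[of c y] by auto
  note key = this
  show ?thesis
  proof (intro set_eqI iffI)
    fix p assume "p \<in> cball_nbhd c x r - bd"
    then obtain y where y: "y \<in> ball x r" "y \<in> half_space" "p = chart_inv c y" "p \<notin> bd"
      by (auto simp: cball_nbhd_def)
    then show "p \<in> chart_inv c ` (ball x r \<inter> {y. 0 < y $ None})" using key[OF y(1,2)] by simp
  next
    fix p assume "p \<in> chart_inv c ` (ball x r \<inter> {y. 0 < y $ None})"
    then obtain y where y: "y \<in> ball x r" "0 < y $ None" "p = chart_inv c y" by auto
    then have "y \<in> half_space" by (simp add: half_space_def)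
    then show "p \<in> cball_nbhd c x r - bd" using key[OF y(1)] y by (simp add: cball_nbhd_def)
  qed
qed

lemma continuous_chart_inv: "c \<in> A \<Longrightarrow> continuous_on (chart_image c) (chart_inv c)"
  using chart_hom homeomorphism_def by blast

lemma cball_nbhd_connected:
  assumes "c \<in> A" "ball x r \<inter> half_space \<subseteq> chart_image c"
  shows "connected (cball_nbhd c x r - bd)"
  unfolding cball_nbhd_interior[OF assms]
proof (rule connected_continuous_image)
  show "continuous_on (ball x r \<inter> {y. 0 < y $ None}) (chart_inv c)"
    by (rule continuous_on_subset[OF continuous_chart_inv[OF assms(1)]]) (use assms(2) in \<open>auto simp: half_space_def\<close>)
  have "convex {y::'m model. 0 < y $ None}"
    using convex_halfspace_gt[of 0 "axis None 1 :: 'm model"] by (simp add: inner_axis' )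
  then show "connected (ball x r \<inter> {y. 0 < y $ None})"
    by (intro convex_connected convex_Int convex_ball)
qed

lemma obtain_nbhd:
  assumes "openin (top_of_set M) U" "p \<in> U" "c \<in> A" "p \<in> fst c"
  obtains r where "0 < r" "ball (snd c p) r \<inter> half_space \<subseteq> chart_image c" "cball_nbhd c (snd c p) r \<subseteq> U"
    "p \<in> cball_nbhd c (snd c p) r"
proof -
  have "snd c p \<in> snd c ` (U \<inter> fst c)" using assms by blast
  then obtain r where r: "0 < r" "ball (snd c p) r \<inter> half_space \<subseteq> snd c ` (U \<inter> fst c)"
    using openin_half_ball[OF openin_snd_image[OF assms(3,1)]] by blast
  show thesis
  proof (rule that[OF r(1)])
    show "ball (snd c p) r \<inter> half_space \<subseteq> chart_image c" using r(2) by blast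
    show "cball_nbhd c (snd c p) r \<subseteq> U"
    proof
      fix s assume "s \<in> cball_nbhd c (snd c p) r"
      then obtain t where "t \<in> U \<inter> fst c" "s = chart_inv c (snd c t)" using r(2) unfolding cball_nbhd_def by blast
      then show "s \<in> U" using assms(3) by simp
    qed
    have "snd c p \<in> half_space" using chart_image_half[OF assms(3)] assms(4) by blast
    then show "p \<in> cball_nbhd c (snd c p) r"
      unfolding cball_nbhd_def using r(1) assms(3,4) by (intro image_eqI[of _ _ "snd c p"]) auto
  qed
qed

lemma interior_dense:
  assumes "openin (top_of_set M) U" "p \<in> U"
  shows "U - bd \<noteq> {}"
proof -
  have "p \<in> M" using assms openin_imp_subset by blast
  then obtain c where c: "c \<in> A" "p \<in> fst c" by (rule obtain_chart)
  obtain r where r: "0 < r" "ball (snd c p) r \<inter> half_space \<subseteq> chart_image c" "cball_nbhd c (snd c p) r \<subseteq> U"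
    "p \<in> cball_nbhd c (snd c p) r"
    by (rule obtain_nbhd[OF assms c])
  let ?y = "snd c p + (r/2) *\<^sub>R axis None 1"
  have "?y \<in> ball (snd c p) r" using r(1) by (simp add: dist_norm norm_axis_1)
  moreover have "0 < ?y $ None" using None_nonneg[OF c] r(1) by (simp add: add_nonneg_pos)
  ultimately have "chart_inv c ?y \<in> cball_nbhd c (snd c p) r - bd" unfolding cball_nbhd_interior[OF c(1) r(2)] by blast
  then show ?thesis using r(3) by blast
qed

lemma interior_openin: "openin (top_of_set M) (M - bd)"
proof (subst openin_subopen, intro ballI)
  fix p assume p: "p \<in> M - bd"
  then obtain c where c: "c \<in> A" "p \<in> fst c" using obtain_chart by blast
  have pos: "0 < snd c p $ None" using interior_iff[OF c] p by blast
  obtain r where r: "0 < r" "ball (snd c p) r \<inter> half_space \<subseteq> chart_image c" "cball_nbhd c (snd c p) r \<subseteq> M" "p \<in> cball_nbhd c (snd c p) r"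
    using obtain_nbhd[of M p c] p c by auto
  define B where "B = ball (snd c p) r \<inter> {y. 0 < y $ None}"
  have B: "B \<subseteq> chart_image c" "B \<subseteq> half_space" using r(2) by (auto simp: B_def half_space_def)
  have "open B" unfolding B_def by (auto intro!: open_Int open_Collect_less continuous_intros)
  then have "openin (top_of_set half_space) B" using B(2) open_subset by blast
  then have "openin (top_of_set M) (chart_inv c ` B)" using openin_chart_inv c B by blast
  moreover have "chart_inv c ` B \<subseteq> M - bd"
    using cball_nbhd_interior[OF c(1) r(2)] r(3) by (auto simp: B_def)
  moreover have "p \<in> chart_inv c ` B" using pos r(1) c by (intro image_eqI[of _ _ "snd c p"]) (auto simp: B_def)
  ultimately show "\<exists>T. openin (top_of_set M) T \<and> p \<in> T \<and> T \<subseteq> M - bd" by blast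
qed

lemma bd_closedin: "closedin (top_of_set M) bd"
  using interior_openin bd_sub by (simp add: closedin_def)

text \<open>In a separation every piece lies on one side. Pieces around neighbouring points of
  \<open>X\<close> overlap in interior points, because the interior is dense, so the side is locally
  constant along \<open>X\<close>. For a boundary component \<open>X\<close> this produces a
  connected set of interior points surrounding it.\<close>

lemma connected_interior_union:
  assumes X: "connected X" "X \<subseteq> M"
    and U: "\<And>q. q \<in> X \<Longrightarrow> openin (top_of_set M) (U q) \<and> q \<in> U q \<and> connected (U q - bd)"
  shows "connected (\<Union>q\<in>X. U q - bd)"
proof (rule connectedI)
  fix S T assume S: "open S" "open T" "S \<inter> (\<Union>q\<in>X. U q - bd) \<noteq> {}" "T \<inter> (\<Union>q\<in>X. U q - bd) \<noteq> {}"
    "S \<inter> T \<inter> (\<Union>q\<in>X. U q - bd) = {}" "(\<Union>q\<in>X. U q - bd) \<subseteq> S \<union> T"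
  have dich: "U q - bd \<subseteq> S \<or> U q - bd \<subseteq> T" if "q \<in> X" for q
  proof (rule ccontr)
    assume "\<not> ?thesis"
    then have "S \<inter> (U q - bd) \<noteq> {}" "T \<inter> (U q - bd) \<noteq> {}" using S(6) that by blast+
    moreover have "S \<inter> T \<inter> (U q - bd) = {}" using S(5) that by blast
    moreover have "U q - bd \<subseteq> S \<union> T" using S(6) that by blast
    ultimately show False using connectedD[of "U q - bd" S T] U[OF that] S(1,2) by blast
  qed
  define XS XT where "XS = {q \<in> X. U q - bd \<subseteq> S}" and "XT = {q \<in> X. U q - bd \<subseteq> T}"
  have ne: "U q \<inter> U q' - bd \<noteq> {}" if "q \<in> X" "q' \<in> U q" "q' \<in> X" for q q'
    using interior_dense[of "U q \<inter> U q'" q'] U that by blast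
  have opS: "openin (top_of_set X) {q \<in> X. U q - bd \<subseteq> S'}" if "S' = S \<or> S' = T" for S'
  proof (subst openin_subopen, intro ballI)
    fix q assume q: "q \<in> {q \<in> X. U q - bd \<subseteq> S'}"
    have "openin (top_of_set X) (X \<inter> U q)"
    proof -
      obtain T' where "open T'" "U q = M \<inter> T'" using U q by (metis (no_types, lifting) mem_Collect_eq openin_open)
      then show ?thesis unfolding openin_open using X(2) by (intro exI[of _ T']) auto
    qed
    moreover have "X \<inter> U q \<subseteq> {q \<in> X. U q - bd \<subseteq> S'}"
    proof
      fix q' assume q': "q' \<in> X \<inter> U q"
      then have "U q \<inter> U q' - bd \<noteq> {}" using ne q by blast
      moreover have "S \<inter> T \<inter> (U q' - bd) = {}" using S(5) q' by blast
      ultimately have "U q' - bd \<subseteq> S'" using dich[of q'] q q' that by blast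
      then show "q' \<in> {q \<in> X. U q - bd \<subseteq> S'}" using q' by blast
    qed
    ultimately show "\<exists>T. openin (top_of_set X) T \<and> q \<in> T \<and> T \<subseteq> {q \<in> X. U q - bd \<subseteq> S'}"
      using q U by (intro exI[of _ "X \<inter> U q"]) blast
  qed
  have "XS \<inter> XT = {}"
  proof (rule ccontr)
    assume "XS \<inter> XT \<noteq> {}"
    then obtain q where q: "q \<in> X" "U q - bd \<subseteq> S" "U q - bd \<subseteq> T" by (auto simp: XS_def XT_def)
    then have "U q - bd \<noteq> {}" using interior_dense U by blast
    then show False using q S(5) by blast
  qed
  moreover have "X \<subseteq> XS \<union> XT" using dich by (auto simp: XS_def XT_def)
  moreover have "XS \<noteq> {}" "XT \<noteq> {}"
    using S(3,4,5) dich unfolding XS_def XT_def by blast+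
  ultimately show False
    using X(1) opS[of S] opS[of T] unfolding connected_openin XS_def[symmetric] XT_def[symmetric] by blast
qed

text \<open>Smoothness up to the boundary means extension to a full ball; derivatives at boundary
  points are computed on this extension.\<close>

lemma smooth_fun_local:
  assumes f: "smooth_fun A f" and c: "c \<in> A" and x: "x \<in> chart_image c"
  obtains r F where "0 < r" "ball x r \<inter> half_space \<subseteq> chart_image c" "Cinf (ball x r) F"
    "\<forall>y. y \<in> ball x r \<longrightarrow> y \<in> half_space \<longrightarrow> F y = (f \<circ> chart_inv c) y"
proof -
  obtain W F where W: "open W" "x \<in> W" "\<And>k. Ck_on k F W" "\<And>y. y \<in> chart_image c \<inter> W \<Longrightarrow> F y = (f \<circ> chart_inv c) y"
    using f c x unfolding smooth_fun_def smooth_on_def by metis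
  obtain r1 where r1: "0 < r1" "ball x r1 \<subseteq> W" using W(1,2) open_contains_ball by blast
  obtain r2 where r2: "0 < r2" "ball x r2 \<inter> half_space \<subseteq> chart_image c" using chart_ball[OF c x] by blast
  show thesis
  proof (rule that[of "min r1 r2" F])
    have "ball x (min r1 r2) \<subseteq> W" using r1(2) by auto
    then show "Cinf (ball x (min r1 r2)) F" unfolding Cinf_def using Ck_on_subset[OF W(3)] by simp
    show "ball x (min r1 r2) \<inter> half_space \<subseteq> chart_image c" using r2 by auto
    show "\<forall>y. y \<in> ball x (min r1 r2) \<longrightarrow> y \<in> half_space \<longrightarrow> F y = (f \<circ> chart_inv c) y"
    proof (intro allI impI)
      fix y assume y: "y \<in> ball x (min r1 r2)" "y \<in> half_space"
      then have "y \<in> ball x r1" "y \<in> ball x r2 \<inter> half_space" by auto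
      then have "y \<in> W" "y \<in> chart_image c" using r1(2) r2(2) by blast+
      then show "F y = (f \<circ> chart_inv c) y" using W(4) by blast
    qed
  qed (use r1 r2 in auto)
qed

lemma smooth_fun_interior:
  assumes f: "smooth_fun A f" and c: "c \<in> A" and B: "open B" "B \<subseteq> chart_image c" "\<And>y. y \<in> B \<Longrightarrow> 0 < y $ None"
  shows "Cinf B (f \<circ> chart_inv c)"
proof (rule Cinf_local)
  fix x assume x: "x \<in> B"
  obtain r F where r: "0 < r" "ball x r \<inter> half_space \<subseteq> chart_image c" "Cinf (ball x r) F"
    "\<forall>y. y \<in> ball x r \<longrightarrow> y \<in> half_space \<longrightarrow> F y = (f \<circ> chart_inv c) y"
    using smooth_fun_local[OF f c subsetD[OF B(2) x]] by blast
  have "Cinf (ball x r \<inter> B) (f \<circ> chart_inv c)"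
  proof (rule Cinf_cong)
    show "Cinf (ball x r \<inter> B) F" by (rule Cinf_subset[OF r(3)]) (use B(1) in auto)
    show "F y = (f \<circ> chart_inv c) y" if "y \<in> ball x r \<inter> B" for y
      using r(4) that B(3)[of y] by (auto simp: half_space_def)
  qed
  then show "\<exists>V. x \<in> V \<and> Cinf V (f \<circ> chart_inv c)" using r(1) x by (intro exI[of _ "ball x r \<inter> B"]) auto
qed (rule B)

lemma smooth_fun_continuous:
  assumes f: "smooth_fun A f"
  shows "continuous_on M f"
proof -
  have "continuous (at p within M) f" if p: "p \<in> M" for p
  proof -
    obtain c where c: "c \<in> A" "p \<in> fst c" using obtain_chart p by blast
    have "continuous_on (chart_image c) (f \<circ> chart_inv c)"
    proof -
      have "continuous (at x within chart_image c) (f \<circ> chart_inv c)" if x: "x \<in> chart_image c" for x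
      proof -
        obtain r F where r: "0 < r" "ball x r \<inter> half_space \<subseteq> chart_image c" "Cinf (ball x r) F"
          "\<forall>y. y \<in> ball x r \<longrightarrow> y \<in> half_space \<longrightarrow> F y = (f \<circ> chart_inv c) y"
          using smooth_fun_local[OF f c(1) x] by blast
        have "isCont F x" using Cinf_continuous_on[OF r(3)] r(1) by (simp add: continuous_on_eq_continuous_at)
        then have "continuous (at x within chart_image c) F" using continuous_at_imp_continuous_at_within by blast
        then show ?thesis
          by (rule continuous_transform_within[OF _ r(1) x]) (use r(4) chart_image_half[OF c(1)] in \<open>auto simp: dist_commute\<close>)
      qed
      then show ?thesis unfolding continuous_on_eq_continuous_within by blast
    qed
    moreover have "continuous_on (fst c) (snd c)" using chart_hom[OF c(1)] homeomorphism_def by blast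
    ultimately have "continuous_on (fst c) (\<lambda>p. (f \<circ> chart_inv c) (snd c p))"
      by (rule continuous_on_compose2) simp
    then have "continuous_on (fst c) f" by (rule continuous_on_eq) (use c in auto)
    then have "continuous (at p within fst c) f" using c(2) continuous_on_eq_continuous_within by blast
    moreover obtain O' where "open O'" "fst c = M \<inter> O'" using chart_openin[OF c(1)] by (metis openin_open)
    then have "at p within fst c = at p within M"
      using c(2) by (intro at_within_nhd[of p O']) auto
    ultimately show ?thesis by simp
  qed
  then show ?thesis by (simp add: continuous_on_eq_continuous_within)
qed

end

section \<open>The Laplacian of a conformal metric\<close>

lemma matrix_inv_props:
  assumes "invertible (B :: 'b::semiring_1^'n^'m)"
  shows "B ** matrix_inv B = mat 1" "matrix_inv B ** B = mat 1"
  using someI_ex[OF assms[unfolded invertible_def]] by (simp_all add: matrix_inv_def)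

lemma matrix_inv_eqI:
  fixes B C :: "real^'n^'n"
  assumes "B ** C = mat 1" "C ** B = mat 1"
  shows "matrix_inv B = C"
proof -
  have "invertible B" using assms unfolding invertible_def by blast
  note p = matrix_inv_props[OF this]
  have "matrix_inv B = matrix_inv B ** (B ** C)" using assms by simp
  also have "\<dots> = C" using p by (simp add: matrix_mul_assoc)
  finally show ?thesis .
qed

lemma matrix_inv_scaleR:
  fixes B :: "real^'n^'n"
  assumes "invertible B" "k \<noteq> 0"
  shows "matrix_inv (k *\<^sub>R B) = inverse k *\<^sub>R matrix_inv B"
  using matrix_inv_props[OF assms(1)] assms(2)
  by (intro matrix_inv_eqI) (simp_all add: matrix_scalar_ac scalar_matrix_assoc[symmetric])

lemma det_scaleR_matrix:
  fixes B :: "real^'n^'n"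
  shows "det (k *\<^sub>R B) = k ^ CARD('n) * det B"
proof -
  have "k *\<^sub>R B = (\<chi> i. k *s (B $ i))" by (simp add: vec_eq_iff vector_scalar_mult_def)
  then show ?thesis using det_rows_mul[of "\<lambda>i. k" "\<lambda>i. B $ i"] by simp
qed

text \<open>Cramer's rule. It exhibits the inverse entries as rational functions of the entries,
  hence as smooth where the determinant is nonzero.\<close>

lemma matrix_inv_entry:
  fixes B :: "real^'n^'n"
  assumes "det B \<noteq> 0"
  shows "matrix_inv B $ i $ j = det (\<chi> r s. if s = i then axis j 1 $ r else B $ r $ s) / det B"
proof -
  have inv: "invertible B" using assms invertible_det_nz by blast
  have "B *v (matrix_inv B *v axis j 1) = axis j 1"
    by (simp add: matrix_vector_mul_assoc matrix_inv_props[OF inv])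
  then have "matrix_inv B *v axis j 1 = (\<chi> k. det (\<chi> r s. if s = k then axis j 1 $ r else B $ r $ s) / det B)"
    using cramer[OF assms] by blast
  then have "(matrix_inv B *v axis j 1) $ i = det (\<chi> r s. if s = i then axis j 1 $ r else B $ r $ s) / det B" by simp
  then show ?thesis by (simp add: matrix_vector_mult_basis column_def)
qed

lemma Cinf_det:
  fixes F :: "'b::real_normed_vector \<Rightarrow> real^'n^'n"
  assumes "open W" "\<And>i j. Cinf W (\<lambda>x. F x $ i $ j)"
  shows "Cinf W (\<lambda>x. det (F x))"
  unfolding det_def by (intro Cinf_sum Cinf_mult Cinf_const Cinf_prod assms)

lemma Cinf_matrix_inv_entry:
  fixes F :: "'b::real_normed_vector \<Rightarrow> real^'n^'n"
  assumes F: "Cinf W F" and nz: "\<And>x. x \<in> W \<Longrightarrow> det (F x) \<noteq> 0"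
  shows "Cinf W (\<lambda>x. matrix_inv (F x) $ i $ j)"
proof -
  have oW: "open W" using F by (rule Cinf_open)
  have e: "Cinf W (\<lambda>x. F x $ i $ j)" for i j by (intro Cinf_nth_comp F)
  have "Cinf W (\<lambda>x. det (\<chi> r s. if s = i then axis j 1 $ r else F x $ r $ s) / det (F x))"
  proof (intro Cinf_divide Cinf_det oW e nz)
    show "Cinf W (\<lambda>x. (\<chi> r s. if s = i then axis j 1 $ r else F x $ r $ s) $ k $ l)" for k l
      by (cases "l = i") (simp_all add: oW e)
  qed
  then show ?thesis by (rule Cinf_cong) (simp add: matrix_inv_entry nz)
qed

lemma posdef_invertible:
  fixes B :: "real^'n^'n"
  assumes "\<And>v. v \<noteq> 0 \<Longrightarrow> 0 < v \<bullet> (B *v v)"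
  shows "invertible B"
proof -
  have "v = 0" if "B *v v = 0" for v using assms[of v] that by auto
  then show ?thesis unfolding invertible_left_inverse matrix_left_invertible_ker by blast
qed

text \<open>The form of the inverse at v equals the form of \<open>B\<close> at the vector
  \<open>matrix_inv B *v v\<close>.\<close>

lemma posdef_matrix_inv:
  fixes B :: "real^'n^'n"
  assumes pos: "\<And>v. v \<noteq> 0 \<Longrightarrow> 0 < v \<bullet> (B *v v)" and sym: "transpose B = B"
  shows "matrix_inv B $ i $ j = matrix_inv B $ j $ i"
    and "(\<exists>i. \<xi> i \<noteq> 0) \<Longrightarrow> 0 < (\<Sum>i\<in>UNIV. \<Sum>j\<in>UNIV. matrix_inv B $ i $ j * (\<xi> i * \<xi> j))"
proof -
  note p = matrix_inv_props[OF posdef_invertible[OF pos]]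
  have "transpose (matrix_inv B) = matrix_inv B"
  proof (rule matrix_inv_eqI[symmetric])
    show "B ** transpose (matrix_inv B) = mat 1"
      by (metis matrix_transpose_mul p(2) sym transpose_mat)
    show "transpose (matrix_inv B) ** B = mat 1"
      by (metis matrix_transpose_mul p(1) sym transpose_mat)
  qed
  then have "transpose (matrix_inv B) $ i $ j = matrix_inv B $ i $ j" by simp
  then show "matrix_inv B $ i $ j = matrix_inv B $ j $ i" by (simp add: transpose_def)
  assume "\<exists>i. \<xi> i \<noteq> 0"
  then have v: "(\<chi> i. \<xi> i) \<noteq> 0" by (auto simp: vec_eq_iff)
  define v :: "real^'n" where "v = (\<chi> i. \<xi> i)"
  define w where "w = matrix_inv B *v v"
  have Bw: "B *v w = v" by (simp add: w_def matrix_vector_mul_assoc p)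
  have "w \<noteq> 0" using Bw v by (auto simp: v_def)
  then have "0 < w \<bullet> v" using pos[of w] Bw by simp
  also have "w \<bullet> v = (\<Sum>i\<in>UNIV. \<Sum>j\<in>UNIV. matrix_inv B $ i $ j * (\<xi> i * \<xi> j))"
    unfolding w_def v_def inner_vec_def matrix_vector_mult_def
    by (simp add: sum_distrib_left sum_distrib_right mult_ac)
  finally show "0 < (\<Sum>i\<in>UNIV. \<Sum>j\<in>UNIV. matrix_inv B $ i $ j * (\<xi> i * \<xi> j))" .
qed

text \<open>The constant is the minimum of the form over the compact product of \<open>K\<close>
  with the unit sphere; homogeneity extends the bound to all vectors.\<close>

lemma elliptic_uniform:
  fixes a :: "real^'k::finite \<Rightarrow> 'n::finite \<Rightarrow> 'n \<Rightarrow> real"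
  assumes K: "compact K" and cont: "\<And>i j. continuous_on K (\<lambda>y. a y i j)"
    and sym: "\<And>y i j. y \<in> K \<Longrightarrow> a y i j = a y j i"
    and pos: "\<And>y \<xi>. y \<in> K \<Longrightarrow> \<exists>i. \<xi> i \<noteq> 0 \<Longrightarrow> 0 < (\<Sum>i\<in>UNIV. \<Sum>j\<in>UNIV. a y i j * (\<xi> i * \<xi> j))"
  shows "\<exists>l>0. \<forall>y\<in>K. elliptic l (a y)"
proof (cases "K = {}")
  case False
  define q where "q z = (\<Sum>i\<in>UNIV. \<Sum>j\<in>UNIV. a (fst z) i j * (snd z $ i * snd z $ j))" for z :: "(real^'k) \<times> (real^'n)"
  have "continuous_on (K \<times> sphere 0 1) q"
    unfolding q_def
    by (intro continuous_intros continuous_on_compose2[OF cont]) auto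
  moreover have "compact (K \<times> sphere 0 1 :: ((real^'k) \<times> (real^'n)) set)" using K by (intro compact_Times) auto
  moreover have "K \<times> sphere 0 1 \<noteq> ({} :: ((real^'k) \<times> (real^'n)) set)"
    using False by auto
  ultimately obtain z where z: "z \<in> K \<times> sphere 0 1" "\<And>w. w \<in> K \<times> sphere 0 1 \<Longrightarrow> q z \<le> q w"
    using continuous_attains_inf by metis
  have "snd z \<noteq> 0" using z(1) by auto
  then have qz: "0 < q z" unfolding q_def by (intro pos) (use z(1) in \<open>auto simp: vec_eq_iff\<close>)
  have "elliptic (q z) (a y)" if y: "y \<in> K" for y
    unfolding elliptic_def
  proof (intro conjI allI)
    show "a y i j = a y j i" for i j using sym y by blast
    fix \<xi> :: "'n \<Rightarrow> real"
    define v :: "real^'n" where "v = (\<chi> i. \<xi> i)"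
    have n2: "(\<Sum>i\<in>UNIV. (\<xi> i)\<^sup>2) = (norm v)\<^sup>2" by (simp add: norm_vec_def L2_set_def v_def sum_nonneg)
    show "q z * (\<Sum>i\<in>UNIV. (\<xi> i)\<^sup>2) \<le> (\<Sum>i\<in>UNIV. \<Sum>j\<in>UNIV. a y i j * (\<xi> i * \<xi> j))"
    proof (cases "v = 0")
      case True
      then have "\<xi> i = 0" for i by (simp add: v_def vec_eq_iff)
      then show ?thesis by simp
    next
      case False
      then have nv: "0 < norm v" by simp
      have "q z \<le> q (y, inverse (norm v) *\<^sub>R v)" using z(2) y nv by simp
      then have "q z * (norm v)\<^sup>2 \<le> q (y, inverse (norm v) *\<^sub>R v) * (norm v)\<^sup>2" by (rule mult_right_mono) simp
      also have "\<dots> = (\<Sum>i\<in>UNIV. \<Sum>j\<in>UNIV. a y i j * (\<xi> i * \<xi> j) * (inverse (norm v) * inverse (norm v) * (norm v)\<^sup>2))"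
        by (simp add: q_def v_def sum_distrib_left sum_distrib_right mult_ac)
      also have "inverse (norm v) * inverse (norm v) * (norm v)\<^sup>2 = 1" using nv by (simp add: power2_eq_square field_simps)
      finally show ?thesis using n2 by simp
    qed
  qed
  then show ?thesis using qz by blast
qed (auto intro: exI[of _ 1])

lemma bounded_family:
  fixes f :: "'i::finite \<Rightarrow> 'b::topological_space \<Rightarrow> real"
  assumes "compact K" "\<And>i. continuous_on K (f i)"
  shows "\<exists>\<Lambda>\<ge>0. \<forall>i. \<forall>y\<in>K. \<bar>f i y\<bar> \<le> \<Lambda>"
proof -
  have "\<exists>B. \<forall>y\<in>K. \<bar>f i y\<bar> \<le> B" for i
    using compact_imp_bounded[OF compact_continuous_image[OF assms(2) assms(1)], of i]
    by (auto simp: bounded_iff)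
  then obtain B where B: "\<And>i y. y \<in> K \<Longrightarrow> \<bar>f i y\<bar> \<le> B i" by metis
  have "\<bar>f i y\<bar> \<le> (\<Sum>i\<in>UNIV. \<bar>B i\<bar>)" if "y \<in> K" for i y
  proof -
    have "\<bar>f i y\<bar> \<le> \<bar>B i\<bar>" using B[OF that, of i] by simp
    also have "\<dots> \<le> (\<Sum>i\<in>UNIV. \<bar>B i\<bar>)" by (rule member_le_sum) auto
    finally show ?thesis .
  qed
  then show ?thesis by (intro exI[of _ "\<Sum>i\<in>UNIV. \<bar>B i\<bar>"]) (auto intro: sum_nonneg)
qed

lemma partial_deriv_open:
  assumes "open B" "B \<subseteq> half_space" "x \<in> B" "\<And>y. y \<in> B \<Longrightarrow> F y = F' y"
  shows "partial_deriv i F x = pd i F' x"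
proof -
  have "at x within half_space = at x"
    using assms(1-3) at_within_interior interior_maximal by blast
  then show ?thesis unfolding partial_deriv_def pd_def
    using frechet_derivative_cong_open[OF assms(1,3,4)] by simp
qed

text \<open>\<open>sqrt\<close> is an odd function here, and this one formula covers both signs. It
  fits the coordinate extension of a metric, whose determinant is recorded only as nonzero.\<close>

lemma DERIV_sqrt_nonzero:
  assumes "x \<noteq> 0"
  shows "(sqrt has_real_derivative sqrt x / (2 * x)) (at x)"
proof (rule DERIV_real_sqrt_generic[OF assms])
  have *: "sqrt x * sqrt x = \<bar>x\<bar>" by simp
  show "sqrt x / (2 * x) = inverse (sqrt x) / 2" if "0 < x"
    using * that by (simp add: field_simps)
  show "sqrt x / (2 * x) = - inverse (sqrt x) / 2" if "x < 0"
    using * that by (simp add: field_simps)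
qed

section \<open>Coefficients of the conformal Laplacian in a chart\<close>

definition inv_coeff :: "('b \<Rightarrow> real^'n^'n) \<Rightarrow> 'b \<Rightarrow> 'n::finite \<Rightarrow> 'n \<Rightarrow> real" where
  "inv_coeff G y i j = matrix_inv (G y) $ i $ j"

text \<open>The first-order coefficients of the Laplacian of \<open>G\<close>, read off from its
  divergence form. The quotient is the derivative of log sqrt(det G), written without a
  logarithm.\<close>

definition drift0 :: "(real^'n \<Rightarrow> real^'n^'n) \<Rightarrow> real^'n \<Rightarrow> 'n::finite \<Rightarrow> real" where
  "drift0 G y j = (\<Sum>i\<in>UNIV. pd i (\<lambda>y. inv_coeff G y i j) y + inv_coeff G y i j * (pd i (\<lambda>y. det (G y)) y / (2 * det (G y))))"

text \<open>The \<open>G\<close>-gradient of \<Phi> times n - 2, where n is the dimension. The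
  subtraction is one of natural numbers; the conformal family below has n at least 3.\<close>

definition drift1 :: "(real^'n \<Rightarrow> real^'n^'n) \<Rightarrow> (real^'n \<Rightarrow> real) \<Rightarrow> real^'n \<Rightarrow> 'n::finite \<Rightarrow> real" where
  "drift1 G \<Phi> y j = (\<Sum>i\<in>UNIV. real (CARD('n) - 2) * (inv_coeff G y i j * pd i \<Phi> y))"

text \<open>The Laplacian of \<open>(1 + \<Phi>/\<epsilon>)\<^sup>2 G\<close> is, up to a positive factor, the operator with second order
  coefficients \<open>G\<^sup>-\<^sup>1\<close> and this drift.\<close>

definition drift :: "(real^'n \<Rightarrow> real^'n^'n) \<Rightarrow> (real^'n \<Rightarrow> real) \<Rightarrow> real \<Rightarrow> real^'n \<Rightarrow> 'n::finite \<Rightarrow> real" where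
  "drift G \<Phi> \<epsilon> y j = drift0 G y j + drift1 G \<Phi> y j * inverse (\<epsilon> + \<Phi> y)"

locale conformal_family = manifold M A for M :: "'a::t2_space set" and A :: "('a, 'm::finite) chart set" +
  fixes g :: "('a, 'm) metric" and \<phi> :: "'a \<Rightarrow> real"
  assumes metric: "riemannian_metric A g" and dim3: "3 \<le> CARD('m option)"
    and phi_smooth: "smooth_fun A \<phi>" and phi_nonneg: "\<And>p. p \<in> M \<Longrightarrow> 0 \<le> \<phi> p"
begin

definition gc :: "real \<Rightarrow> ('a, 'm) metric" where
  "gc \<epsilon> c p = (1 + \<phi> p / \<epsilon>)\<^sup>2 *\<^sub>R g c p"

text \<open>\<open>G\<close> and \<open>\<Phi>\<close> extend the coordinate expressions of \<open>g\<close> and \<open>\<phi>\<close> smoothly across the boundary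
  hyperplane to a full ball; outside the half space they carry no geometric meaning.\<close>

definition datum :: "('a, 'm) chart \<Rightarrow> 'm model \<Rightarrow> real \<Rightarrow> ('m model \<Rightarrow> real^('m option)^('m option)) \<Rightarrow> ('m model \<Rightarrow> real) \<Rightarrow> bool" where
  "datum c x R G \<Phi> \<longleftrightarrow> c \<in> A \<and> x \<in> chart_image c \<and> 0 < R \<and> ball x R \<inter> half_space \<subseteq> chart_image c \<and>
     Cinf (ball x R) G \<and> (\<forall>y\<in>ball x R. det (G y) \<noteq> 0) \<and> (\<forall>y\<in>ball x R. y \<in> half_space \<longrightarrow> G y = g c (chart_inv c y)) \<and>
     Cinf (ball x R) \<Phi> \<and> (\<forall>y\<in>ball x R. y \<in> half_space \<longrightarrow> \<Phi> y = \<phi> (chart_inv c y))"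

lemma g_sym: "c \<in> A \<Longrightarrow> p \<in> fst c \<Longrightarrow> transpose (g c p) = g c p"
  and g_pos: "c \<in> A \<Longrightarrow> p \<in> fst c \<Longrightarrow> v \<noteq> 0 \<Longrightarrow> 0 < v \<bullet> (g c p *v v)"
  and g_smooth: "c \<in> A \<Longrightarrow> smooth_on (chart_image c) (g c \<circ> chart_inv c)"
  using metric unfolding riemannian_metric_def by blast+

lemma datum_exists:
  assumes c: "c \<in> A" and x: "x \<in> chart_image c"
  shows "\<exists>R G \<Phi>. datum c x R G \<Phi>"
proof -
  obtain r1 \<Phi> where 1: "0 < r1" "ball x r1 \<inter> half_space \<subseteq> chart_image c" "Cinf (ball x r1) \<Phi>"
    "\<forall>y. y \<in> ball x r1 \<longrightarrow> y \<in> half_space \<longrightarrow> \<Phi> y = (\<phi> \<circ> chart_inv c) y"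
    using smooth_fun_local[OF phi_smooth c x] by blast
  obtain W G where W: "open W" "x \<in> W" "\<And>k. Ck_on k G W" "\<And>y. y \<in> chart_image c \<inter> W \<Longrightarrow> G y = (g c \<circ> chart_inv c) y"
    using g_smooth[OF c] x unfolding smooth_on_def by metis
  have CG: "Cinf W G" using W by (simp add: Cinf_def)
  have "Cinf W (\<lambda>y. det (G y))" by (intro Cinf_det Cinf_nth_comp CG W(1))
  then have "open {y \<in> W. det (G y) \<noteq> 0}"
    using continuous_open_preimage[OF Cinf_continuous_on, of W "\<lambda>y. det (G y)" "- {0}"] W(1)
    by (simp add: vimage_def Int_def open_Compl Collect_neg_eq)
  moreover have "det (G x) \<noteq> 0"
    using posdef_invertible[OF g_pos[OF c chart_inv_in[OF x]]] W(2,4) x invertible_det_nz by fastforce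
  ultimately obtain r2 where r2: "0 < r2" "ball x r2 \<subseteq> {y \<in> W. det (G y) \<noteq> 0}"
    using W(2) open_contains_ball by (metis (mono_tags, lifting) mem_Collect_eq)
  let ?r = "min r1 r2"
  have sub: "ball x ?r \<subseteq> ball x r1" "ball x ?r \<subseteq> W" "\<And>y. y \<in> ball x ?r \<Longrightarrow> det (G y) \<noteq> 0" using r2 by auto
  have in1: "y \<in> chart_image c" if "y \<in> ball x ?r" "y \<in> half_space" for y using 1(2) that by auto
  have "datum c x ?r G \<Phi>"
    unfolding datum_def
  proof (intro conjI ballI impI)
    show "Cinf (ball x ?r) G" by (rule Cinf_subset[OF CG open_ball sub(2)])
    show "Cinf (ball x ?r) \<Phi>" by (rule Cinf_subset[OF 1(3) open_ball sub(1)])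
    show "G y = g c (chart_inv c y)" if "y \<in> ball x ?r" "y \<in> half_space" for y
      using W(4)[of y] in1[OF that] sub(2) that by auto
    show "\<Phi> y = \<phi> (chart_inv c y)" if "y \<in> ball x ?r" "y \<in> half_space" for y
      using 1(4) sub(1) that by auto
  qed (use c x 1(1) r2(1) in1 sub in auto)
  then show ?thesis by blast
qed

lemma datum_smooth:
  assumes "datum c x R G \<Phi>"
  shows "Cinf (ball x R) (\<lambda>y. det (G y))" "Cinf (ball x R) (\<lambda>y. inv_coeff G y i j)"
    "Cinf (ball x R) (\<lambda>y. drift0 G y j)" "Cinf (ball x R) (\<lambda>y. drift1 G \<Phi> y j)"
proof -
  have G: "Cinf (ball x R) G" and nz: "\<And>y. y \<in> ball x R \<Longrightarrow> det (G y) \<noteq> 0" and P: "Cinf (ball x R) \<Phi>"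
    using assms unfolding datum_def by blast+
  show d: "Cinf (ball x R) (\<lambda>y. det (G y))" by (intro Cinf_det Cinf_nth_comp G open_ball)
  show a: "Cinf (ball x R) (\<lambda>y. inv_coeff G y i j)" for i j
    unfolding inv_coeff_def by (rule Cinf_matrix_inv_entry[OF G nz])
  show "Cinf (ball x R) (\<lambda>y. drift0 G y j)"
    unfolding drift0_def
    by (intro Cinf_sum Cinf_add Cinf_mult Cinf_divide a d Cinf_const open_ball Cinf_pd[OF a] Cinf_pd[OF d]) (use nz in auto)
  show "Cinf (ball x R) (\<lambda>y. drift1 G \<Phi> y j)"
    unfolding drift1_def by (intro Cinf_sum Cinf_mult a Cinf_const open_ball Cinf_pd[OF P])
qed

lemma datum_chart:
  assumes "datum c x R G \<Phi>" "y \<in> ball x R" "y \<in> half_space"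
  shows "y \<in> chart_image c" "chart_inv c y \<in> fst c" "chart_inv c y \<in> M" "snd c (chart_inv c y) = y"
proof -
  have c: "c \<in> A" using assms by (simp add: datum_def)
  show y: "y \<in> chart_image c" using assms unfolding datum_def by blast
  show p: "chart_inv c y \<in> fst c" by (rule chart_inv_in[OF y])
  show "chart_inv c y \<in> M" using chart_sub[OF c] p by blast
  show "snd c (chart_inv c y) = y" by (rule snd_chart_inv[OF c y])
qed

lemma datum_pos:
  assumes "datum c x R G \<Phi>" "y \<in> ball x R" "y \<in> half_space"
  shows "inv_coeff G y i j = inv_coeff G y j i"
    "\<exists>i. \<xi> i \<noteq> 0 \<Longrightarrow> 0 < (\<Sum>i\<in>UNIV. \<Sum>j\<in>UNIV. inv_coeff G y i j * (\<xi> i * \<xi> j))"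
proof -
  have c: "c \<in> A" and G: "G y = g c (chart_inv c y)" using assms unfolding datum_def by auto
  show "inv_coeff G y i j = inv_coeff G y j i" unfolding inv_coeff_def G
    using posdef_matrix_inv(1)[OF g_pos[OF c datum_chart(2)[OF assms]] g_sym[OF c datum_chart(2)[OF assms]]] .
  show "0 < (\<Sum>i\<in>UNIV. \<Sum>j\<in>UNIV. inv_coeff G y i j * (\<xi> i * \<xi> j))" if "\<exists>i. \<xi> i \<noteq> 0"
    unfolding inv_coeff_def G
    using posdef_matrix_inv(2)[OF g_pos[OF c datum_chart(2)[OF assms]] g_sym[OF c datum_chart(2)[OF assms]] that] .
qed

text \<open>Ellipticity is confined to the half-space: beyond it the extension of the metric is only
  known to be nondegenerate.\<close>

lemma datum_elliptic:
  assumes "datum c x R G \<Phi>" "r < R"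
  shows "\<exists>l>0. \<forall>y\<in>cball x r \<inter> half_space. elliptic l (inv_coeff G y)"
proof (rule elliptic_uniform)
  have sub: "cball x r \<inter> half_space \<subseteq> ball x R" using assms(2) by auto
  have "closed (half_space :: 'm model set)"
    unfolding half_space_def by (intro closed_Collect_le continuous_intros)
  then show "compact (cball x r \<inter> half_space)" by (intro compact_Int_closed compact_cball)
  show "continuous_on (cball x r \<inter> half_space) (\<lambda>y. inv_coeff G y i j)" for i j
    using Cinf_continuous_on[OF datum_smooth(2)[OF assms(1)]] sub continuous_on_subset by blast
  fix y assume "y \<in> cball x r \<inter> half_space"
  then have y: "y \<in> ball x R" "y \<in> half_space" using sub by auto
  show "inv_coeff G y i j = inv_coeff G y j i" for i j by (rule datum_pos(1)[OF assms(1) y])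
  show "0 < (\<Sum>i\<in>UNIV. \<Sum>j\<in>UNIV. inv_coeff G y i j * (\<xi> i * \<xi> j))" if "\<exists>i. \<xi> i \<noteq> 0" for \<xi>
    by (rule datum_pos(2)[OF assms(1) y that])
qed

lemma eps_phi_pos:
  assumes "datum c x R G \<Phi>" "y \<in> ball x R" "y \<in> half_space" "0 < \<epsilon>"
  shows "0 \<le> \<Phi> y" "0 < \<epsilon> + \<Phi> y" "0 < 1 + \<Phi> y / \<epsilon>"
proof -
  have "\<Phi> y = \<phi> (chart_inv c y)" using assms unfolding datum_def by auto
  then show 1: "0 \<le> \<Phi> y" using phi_nonneg datum_chart(3)[OF assms(1-3)] by simp
  then show "0 < \<epsilon> + \<Phi> y" "0 < 1 + \<Phi> y / \<epsilon>" using assms(4) by (auto intro: add_pos_nonneg)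
qed

text \<open>With H = 1 + \<Phi>/\<epsilon>, the conformal factor multiplies the volume density by
  H^n and the gradient by H^(-2), so the flux carries the weight \<open>\<omega>\<close>, that is
  H^(n-2) sqrt(det G). Its logarithmic derivative supplies the drift. Since grad H / H equals grad
  \<Phi> / (\<epsilon> + \<Phi>), the parameter survives only in this denominator.\<close>

lemma laplacian_iff:
  assumes D: "datum c x R G \<Phi>" and e: "0 < \<epsilon>" and f: "smooth_fun A f" and y: "y \<in> ball x R" "0 < y $ None"
  shows "laplacian (gc \<epsilon>) c f (chart_inv c y) = 0 \<longleftrightarrow>
    Lop (inv_coeff G y) (drift G \<Phi> \<epsilon> y) (f \<circ> chart_inv c) y = 0"
proof -
  define B where "B = ball x R \<inter> {y. 0 < y $ None}"
  define m where "m = CARD('m option) - 2"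
  have m: "CARD('m option) = m + 2" using dim3 by (simp add: m_def)
  have oB: "open B" unfolding B_def by (auto intro!: open_Int open_Collect_less continuous_intros)
  have Bh: "B \<subseteq> half_space" by (auto simp: B_def half_space_def)
  have Bb: "B \<subseteq> ball x R" by (auto simp: B_def)
  have yB: "y \<in> B" using y by (simp add: B_def)
  have c: "c \<in> A" using D by (simp add: datum_def)
  have Bc: "B \<subseteq> chart_image c" using datum_chart(1)[OF D] Bb Bh by blast
  define U where "U = f \<circ> chart_inv c"
  have U: "Cinf B U" unfolding U_def by (rule smooth_fun_interior[OF f c oB Bc]) (auto simp: B_def)
  let ?a = "\<lambda>i j x. inv_coeff G x i j"
  have a: "Cinf B (?a i j)" for i j using Cinf_subset[OF datum_smooth(2)[OF D] oB Bb] .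
  have d: "Cinf B (\<lambda>y. det (G y))" using Cinf_subset[OF datum_smooth(1)[OF D] oB Bb] .
  have P: "Cinf B \<Phi>" using D Cinf_subset[OF _ oB Bb] by (auto simp: datum_def)
  have dnz: "det (G z) \<noteq> 0" if "z \<in> B" for z using D Bb that by (auto simp: datum_def)
  define H where "H z = 1 + \<Phi> z / \<epsilon>" for z
  have H: "Cinf B H" unfolding H_def[abs_def] by (intro Cinf_add Cinf_divide Cinf_const oB P) (use e in auto)
  have Hpos: "0 < H z" if "z \<in> B" for z using eps_phi_pos(3)[OF D subsetD[OF Bb that] subsetD[OF Bh that] e] by (simp add: H_def)
  define \<omega> where "\<omega> z = H z ^ m * sqrt (det (G z))" for z
  define S where "S i z = (\<Sum>j\<in>UNIV. ?a i j z * pd j U z)" for i z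
  have gcz: "gc \<epsilon> c (chart_inv c z) = (H z)\<^sup>2 *\<^sub>R G z" if "z \<in> B" for z
  proof -
    have z: "z \<in> ball x R" "z \<in> half_space" using that Bb Bh by blast+
    have "G z = g c (chart_inv c z)" "\<Phi> z = \<phi> (chart_inv c z)" using D z unfolding datum_def by blast+
    then show ?thesis by (simp add: gc_def H_def)
  qed
  have flux: "sqrt (det (gc \<epsilon> c (chart_inv c z))) * gradient (gc \<epsilon>) c f z $ i = \<omega> z * S i z" if z: "z \<in> B" for i z
  proof -
    have inv: "invertible (G z)" using dnz[OF z] invertible_det_nz by blast
    have H2: "(H z)\<^sup>2 \<noteq> 0" using Hpos[OF z] by simp
    have "partial_deriv j (f \<circ> chart_inv c) z = pd j U z" for j
      by (rule partial_deriv_open[OF oB Bh z]) (simp add: U_def)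
    then have gr: "gradient (gc \<epsilon>) c f z $ i = inverse ((H z)\<^sup>2) * S i z"
      unfolding gradient_def gcz[OF z] matrix_inv_scaleR[OF inv H2]
      by (simp add: matrix_vector_mult_def S_def inv_coeff_def sum_distrib_left mult_ac)
    have "((H z)\<^sup>2) ^ CARD('m option) = (H z ^ CARD('m option))\<^sup>2"
      by (simp only: power_mult[symmetric] mult.commute[of 2])
    then have "sqrt (det (gc \<epsilon> c (chart_inv c z))) = H z ^ CARD('m option) * sqrt (det (G z))"
      unfolding gcz[OF z] det_scaleR_matrix using Hpos[OF z] by (simp add: real_sqrt_mult)
    moreover have "H z ^ CARD('m option) * inverse ((H z)\<^sup>2) = H z ^ m"
      using Hpos[OF z] unfolding m power_add by simp
    then have "H z ^ CARD('m option) * sqrt (det (G z)) * (inverse ((H z)\<^sup>2) * S i z) = H z ^ m * sqrt (det (G z)) * S i z"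
      by (metis mult.assoc mult.commute)
    ultimately show ?thesis unfolding gr \<omega>_def by simp
  qed
  have \<omega>nz: "\<omega> y \<noteq> 0" using Hpos[OF yB] dnz[OF yB] by (simp add: \<omega>_def)
  have dif: "(?a i j) differentiable (at y)" "(\<lambda>y. det (G y)) differentiable (at y)" "H differentiable (at y)"
    "\<Phi> differentiable (at y)" "pd j U differentiable (at y)" for i j
    using Cinf_differentiable[OF a yB] Cinf_differentiable[OF d yB] Cinf_differentiable[OF H yB]
      Cinf_differentiable[OF P yB] Cinf_differentiable[OF Cinf_pd[OF U] yB] by blast+
  have CS: "Cinf B (S i)" for i unfolding S_def[abs_def] by (intro Cinf_sum oB Cinf_mult a Cinf_pd[OF U])
  \<comment> \<open>The logarithmic derivative of \<open>\<omega>\<close> at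
    \<open>y\<close>.\<close>
  define \<theta> where "\<theta> i = pd i (\<lambda>y. det (G y)) y / (2 * det (G y)) + real m * (pd i \<Phi> y * inverse (\<epsilon> + \<Phi> y))" for i
  have ds: "(\<lambda>z. sqrt (det (G z))) differentiable (at y)" "pd i (\<lambda>z. sqrt (det (G z))) y = sqrt (det (G y)) / (2 * det (G y)) * pd i (\<lambda>y. det (G y)) y" for i
  proof -
    note s = DERIV_sqrt_nonzero[OF dnz[OF yB]]
    show "pd i (\<lambda>z. sqrt (det (G z))) y = sqrt (det (G y)) / (2 * det (G y)) * pd i (\<lambda>y. det (G y)) y"
      by (rule pd_chain[OF dif(2) s])
    have "sqrt differentiable (at (det (G y)))" using s real_differentiable_def by blast
    from differentiable_chain_at[OF dif(2) this] show "(\<lambda>z. sqrt (det (G z))) differentiable (at y)" by (simp add: o_def)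
  qed
  have pH: "pd i (\<lambda>z. H z ^ m) y = real m * (H y ^ m * (pd i \<Phi> y * inverse (\<epsilon> + \<Phi> y)))" for i
  proof -
    have "pd i H y = pd i \<Phi> y / \<epsilon>"
      using pd_add[of "\<lambda>z. 1" y "\<lambda>z. inverse \<epsilon> * \<Phi> z" i] pd_mult[of "\<lambda>z. inverse \<epsilon>" y \<Phi> i] dif(4)
      by (simp add: H_def[abs_def] divide_inverse mult.commute)
    moreover have "((\<lambda>t. t ^ m) has_real_derivative real m * H y ^ (m - 1)) (at (H y))"
      by (auto intro!: derivative_eq_intros)
    from pd_chain[OF dif(3) this] have "pd i (\<lambda>z. H z ^ m) y = real m * H y ^ (m - 1) * pd i H y" .
    moreover have "real m * H y ^ (m - 1) * (pd i \<Phi> y / \<epsilon>) = real m * (H y ^ m * (pd i \<Phi> y * inverse (\<epsilon> + \<Phi> y)))"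
    proof (cases m)
      case (Suc k)
      have "\<epsilon> + \<Phi> y = \<epsilon> * H y" using e by (simp add: H_def field_simps)
      then show ?thesis unfolding Suc using Hpos[OF yB] e by (simp add: divide_inverse) 
    qed simp
    ultimately show ?thesis by simp
  qed
  have p\<omega>: "pd i \<omega> y = \<omega> y * \<theta> i" for i
  proof -
    have "(\<lambda>z. H z ^ m) differentiable (at y)" using Cinf_differentiable[OF Cinf_power[OF H] yB] .
    then have "pd i \<omega> y = H y ^ m * (sqrt (det (G y)) / (2 * det (G y)) * pd i (\<lambda>y. det (G y)) y) + real m * (H y ^ m * (pd i \<Phi> y * inverse (\<epsilon> + \<Phi> y))) * sqrt (det (G y))"
      unfolding \<omega>_def[abs_def] by (subst pd_mult) (simp_all only: ds pH)
    then show ?thesis by (simp add: \<omega>_def \<theta>_def algebra_simps)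
  qed
  have d\<omega>: "\<omega> differentiable (at y)" unfolding \<omega>_def[abs_def]
    by (intro differentiable_mult ds Cinf_differentiable[OF Cinf_power[OF H] yB])
  have trm: "partial_deriv i (\<lambda>z. sqrt (det (gc \<epsilon> c (chart_inv c z))) * gradient (gc \<epsilon>) c f z $ i) y
     = \<omega> y * (\<Sum>j\<in>UNIV. ?a i j y * pd i (pd j U) y + (pd i (?a i j) y + ?a i j y * \<theta> i) * pd j U y)" for i
  proof -
    have "partial_deriv i (\<lambda>z. sqrt (det (gc \<epsilon> c (chart_inv c z))) * gradient (gc \<epsilon>) c f z $ i) y = pd i (\<lambda>z. \<omega> z * S i z) y"
      by (rule partial_deriv_open[OF oB Bh yB flux])
    also have "\<dots> = \<omega> y * (pd i (S i) y + \<theta> i * S i y)"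
      unfolding pd_mult[OF d\<omega> Cinf_differentiable[OF CS yB]] p\<omega> by (simp add: algebra_simps)
    also have "pd i (S i) y = (\<Sum>j\<in>UNIV. ?a i j y * pd i (pd j U) y + pd i (?a i j) y * pd j U y)"
      unfolding S_def[abs_def]
      by (subst pd_sum) (auto intro!: differentiable_mult dif sum.cong simp: pd_mult[OF dif(1) dif(5)])
    also have "\<dots> + \<theta> i * S i y = (\<Sum>j\<in>UNIV. ?a i j y * pd i (pd j U) y + (pd i (?a i j) y + ?a i j y * \<theta> i) * pd j U y)"
      unfolding S_def sum_distrib_left sum.distrib[symmetric] by (simp add: algebra_simps)
    finally show ?thesis .
  qed
  have dr: "(\<Sum>i\<in>UNIV. pd i (?a i j) y + ?a i j y * \<theta> i) = drift G \<Phi> \<epsilon> y j" for j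
    unfolding drift_def drift0_def drift1_def \<theta>_def m_def[symmetric]
    by (simp add: sum.distrib sum_distrib_left algebra_simps)
  have "(\<Sum>i\<in>UNIV. partial_deriv i (\<lambda>z. sqrt (det (gc \<epsilon> c (chart_inv c z))) * gradient (gc \<epsilon>) c f z $ i) y)
     = \<omega> y * ((\<Sum>i\<in>UNIV. \<Sum>j\<in>UNIV. ?a i j y * pd i (pd j U) y) + (\<Sum>i\<in>UNIV. \<Sum>j\<in>UNIV. (pd i (?a i j) y + ?a i j y * \<theta> i) * pd j U y))"
    unfolding trm by (simp add: sum_distrib_left[symmetric] sum.distrib)
  also have "(\<Sum>i\<in>UNIV. \<Sum>j\<in>UNIV. (pd i (?a i j) y + ?a i j y * \<theta> i) * pd j U y) = (\<Sum>j\<in>UNIV. drift G \<Phi> \<epsilon> y j * pd j U y)"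
    unfolding dr[symmetric] sum_distrib_right by (rule sum.swap)
  also have "(\<Sum>i\<in>UNIV. \<Sum>j\<in>UNIV. ?a i j y * pd i (pd j U) y) + (\<Sum>j\<in>UNIV. drift G \<Phi> \<epsilon> y j * pd j U y)
    = Lop (inv_coeff G y) (drift G \<Phi> \<epsilon> y) U y" by (simp add: Lop_def)
  finally have sum: "(\<Sum>i\<in>UNIV. partial_deriv i (\<lambda>z. sqrt (det (gc \<epsilon> c (chart_inv c z))) * gradient (gc \<epsilon>) c f z $ i) y)
    = \<omega> y * Lop (inv_coeff G y) (drift G \<Phi> \<epsilon> y) U y" .
  have "sqrt (det (gc \<epsilon> c (chart_inv c y))) \<noteq> 0"
    unfolding gcz[OF yB] det_scaleR_matrix using Hpos[OF yB] dnz[OF yB] by simp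
  then show ?thesis
    unfolding laplacian_def using sum \<omega>nz snd_chart_inv[OF c subsetD[OF Bc yB]] by (simp add: U_def)
qed

end

section \<open>Smooth functions on the manifold and finite covers\<close>

lemma smooth_on_iff_Cinf:
  "smooth_on S F \<longleftrightarrow> (\<forall>x\<in>S. \<exists>W F'. x \<in> W \<and> Cinf W F' \<and> (\<forall>y\<in>S \<inter> W. F' y = F y))"
  unfolding smooth_on_def Cinf_def by metis

lemma smooth_on_combine:
  fixes S :: "'b::real_normed_vector set"
  assumes "smooth_on S F" "smooth_on S G" and op: "\<And>(W::'b set) F G. Cinf W F \<Longrightarrow> Cinf W G \<Longrightarrow> Cinf W (\<lambda>x. p (F x) (G x))"
  shows "smooth_on S (\<lambda>x. p (F x) (G x))"
  unfolding smooth_on_iff_Cinf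
proof
  fix x assume x: "x \<in> S"
  obtain W1 F' where 1: "x \<in> W1" "Cinf W1 F'" "\<forall>y\<in>S \<inter> W1. F' y = F y" using assms(1) x unfolding smooth_on_iff_Cinf by blast
  obtain W2 G' where 2: "x \<in> W2" "Cinf W2 G'" "\<forall>y\<in>S \<inter> W2. G' y = G y" using assms(2) x unfolding smooth_on_iff_Cinf by blast
  have o: "open (W1 \<inter> W2)" by (rule open_Int[OF Cinf_open[OF 1(2)] Cinf_open[OF 2(2)]])
  have "Cinf (W1 \<inter> W2) F'" by (rule Cinf_subset[OF 1(2) o]) auto
  moreover have "Cinf (W1 \<inter> W2) G'" by (rule Cinf_subset[OF 2(2) o]) auto
  ultimately have "Cinf (W1 \<inter> W2) (\<lambda>x. p (F' x) (G' x))" by (rule op)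
  then show "\<exists>W F'. x \<in> W \<and> Cinf W F' \<and> (\<forall>y\<in>S \<inter> W. F' y = p (F y) (G y))"
    using 1 2 by (intro exI[of _ "W1 \<inter> W2"] exI[of _ "\<lambda>x. p (F' x) (G' x)"]) auto
qed

lemma smooth_on_const: "smooth_on S (\<lambda>x. c)"
  unfolding smooth_on_iff_Cinf using Cinf_const[OF open_UNIV] by blast

lemma smooth_fun_combine:
  assumes "smooth_fun A f" "smooth_fun A h"
    and op: "\<And>W (F::'m model \<Rightarrow> real) G. Cinf W F \<Longrightarrow> Cinf W G \<Longrightarrow> Cinf W (\<lambda>x. p (F x) (G x))"
  shows "smooth_fun (A :: ('a, 'm::finite) chart set) (\<lambda>x. p (f x) (h x))"
  unfolding smooth_fun_def
proof
  fix c assume c: "c \<in> A"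
  have "smooth_on (chart_image c) (f \<circ> chart_inv c)" "smooth_on (chart_image c) (h \<circ> chart_inv c)"
    using assms c unfolding smooth_fun_def by blast+
  from smooth_on_combine[OF this op] show "smooth_on (chart_image c) ((\<lambda>x. p (f x) (h x)) \<circ> chart_inv c)" by (simp add: o_def)
qed

lemma smooth_fun_const: "smooth_fun A (\<lambda>x. c)"
  unfolding smooth_fun_def by (simp add: o_def smooth_on_const)

lemma smooth_fun_add: "smooth_fun A f \<Longrightarrow> smooth_fun A h \<Longrightarrow> smooth_fun A (\<lambda>x. f x + h x)"
  by (rule smooth_fun_combine[where p="(+)"]) (auto intro: Cinf_add)

lemma smooth_fun_mult: "smooth_fun A f \<Longrightarrow> smooth_fun A h \<Longrightarrow> smooth_fun A (\<lambda>x. f x * h x)"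
  by (rule smooth_fun_combine[where p="(*)"]) (auto intro: Cinf_mult)

lemma smooth_fun_sum: "(\<And>i. i \<in> I \<Longrightarrow> smooth_fun A (f i)) \<Longrightarrow> smooth_fun A (\<lambda>x. \<Sum>i\<in>I. f i x)"
  by (induction I rule: infinite_finite_induct) (simp_all add: smooth_fun_const smooth_fun_add)

lemma finite_openin_cover:
  assumes "compact K" "K \<subseteq> M" "\<And>p. p \<in> K \<Longrightarrow> openin (top_of_set M) (O' p) \<and> p \<in> O' p"
  shows "\<exists>F. finite F \<and> F \<subseteq> K \<and> K \<subseteq> (\<Union>p\<in>F. O' p)"
proof -
  have "\<forall>p\<in>K. \<exists>T. open T \<and> O' p = M \<inter> T" using assms(3) by (meson openin_open)
  then obtain T where T: "\<And>p. p \<in> K \<Longrightarrow> open (T p) \<and> O' p = M \<inter> T p" by metis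
  have "K \<subseteq> (\<Union>p\<in>K. T p)" using assms(3) T by blast
  then obtain F where F: "F \<subseteq> K" "finite F" "K \<subseteq> (\<Union>p\<in>F. T p)"
    using compactE_image[OF assms(1), of K T] T by blast
  moreover have "K \<subseteq> (\<Union>p\<in>F. O' p)" using F T assms(2) by blast
  ultimately show ?thesis by blast
qed

lemma finite_pos_lower_bound:
  assumes "finite F" "\<And>p. p \<in> F \<Longrightarrow> 0 < (\<kappa> p :: real)"
  shows "\<exists>\<delta>>0. \<forall>p\<in>F. \<delta> \<le> \<kappa> p"
  using assms
proof (induction F rule: finite_induct)
  case (insert p F)
  then obtain \<delta> where "0 < \<delta>" "\<forall>p\<in>F. \<delta> \<le> \<kappa> p" by auto
  then show ?case using insert.prems by (intro exI[of _ "min \<delta> (\<kappa> p)"]) (auto simp: min_le_iff_disj)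
qed (auto intro: exI[of _ 1])

context conformal_family begin

text \<open>The equation is imposed off the boundary, so that the operator is only ever examined at
  points with two-sided derivatives; behaviour at the boundary enters through normal
  derivatives.\<close>

definition Lsol :: "real \<Rightarrow> ('a \<Rightarrow> real) \<Rightarrow> bool" where
  "Lsol \<epsilon> f \<longleftrightarrow> smooth_fun A f \<and> (\<forall>c\<in>A. \<forall>p\<in>fst c - bd. laplacian (gc \<epsilon>) c f p = 0)"

lemma Lsol_smooth: "Lsol \<epsilon> f \<Longrightarrow> smooth_fun A f" by (simp add: Lsol_def)

lemma datum_at:
  assumes "c \<in> A" "p \<in> fst c"
  obtains R G \<Phi> where "datum c (snd c p) R G \<Phi>" "snd c p \<in> ball (snd c p) R"
  using datum_exists[of c "snd c p"] assms by (metis (no_types, lifting) centre_in_ball datum_def imageI)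

lemma Lsol_Lop:
  assumes D: "datum c x R G \<Phi>" and e: "0 < \<epsilon>" and f: "Lsol \<epsilon> f" and y: "y \<in> ball x R" "0 < y $ None"
  shows "Lop (inv_coeff G y) (drift G \<Phi> \<epsilon> y) (f \<circ> chart_inv c) y = 0"
proof -
  have yh: "y \<in> half_space" using y(2) by (simp add: half_space_def)
  have c: "c \<in> A" using D by (simp add: datum_def)
  have "chart_inv c y \<notin> bd"
    using interior_iff[OF c datum_chart(2)[OF D y(1) yh]] datum_chart(4)[OF D y(1) yh] y(2) by simp
  then have "laplacian (gc \<epsilon>) c f (chart_inv c y) = 0"
    using f c datum_chart(2)[OF D y(1) yh] unfolding Lsol_def by blast
  then show ?thesis using laplacian_iff[OF D e Lsol_smooth[OF f] y] by blast
qed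

lemma LsolI:
  assumes e: "0 < \<epsilon>" and f: "smooth_fun A f"
    and L: "\<And>c x R G \<Phi>. datum c x R G \<Phi> \<Longrightarrow> 0 < x $ None \<Longrightarrow>
      Lop (inv_coeff G x) (drift G \<Phi> \<epsilon> x) (f \<circ> chart_inv c) x = 0"
  shows "Lsol \<epsilon> f"
  unfolding Lsol_def
proof (intro conjI f ballI)
  fix c p assume c: "c \<in> A" and p: "p \<in> fst c - bd"
  then obtain R G \<Phi> where D: "datum c (snd c p) R G \<Phi>" "snd c p \<in> ball (snd c p) R" using datum_at by blast
  have pos: "0 < snd c p $ None" using interior_iff[OF c] p by blast
  show "laplacian (gc \<epsilon>) c f p = 0"
    using laplacian_iff[OF D(1) e f D(2) pos] L[OF D(1) pos] c p by simp
qed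

lemma interior_Cinf:
  assumes D: "datum c x R G \<Phi>" and f: "smooth_fun A f"
  shows "Cinf (ball x R \<inter> {y. 0 < y $ None}) (f \<circ> chart_inv c)"
proof (rule smooth_fun_interior[OF f])
  show "c \<in> A" using D by (simp add: datum_def)
  show "open (ball x R \<inter> {y::'m model. 0 < y $ None})" by (auto intro!: open_Int open_Collect_less continuous_intros)
  show "ball x R \<inter> {y. 0 < y $ None} \<subseteq> chart_image c"
    using datum_chart(1)[OF D] by (auto simp: half_space_def less_imp_le)
qed auto

lemma Lsol_const: "0 < \<epsilon> \<Longrightarrow> Lsol \<epsilon> (\<lambda>p. k)"
  by (rule LsolI) (auto simp: smooth_fun_const o_def)

lemma Lsol_lincomb:
  assumes e: "0 < \<epsilon>" and f: "Lsol \<epsilon> f" and h: "Lsol \<epsilon> h"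
  shows "Lsol \<epsilon> (\<lambda>p. a * f p + b * h p)"
proof (rule LsolI[OF e])
  show "smooth_fun A (\<lambda>p. a * f p + b * h p)"
    using f h by (intro smooth_fun_add smooth_fun_mult smooth_fun_const Lsol_smooth)
  fix c x R G \<Phi> assume D: "datum c x R G \<Phi>" and pos: "0 < x $ None"
  have x: "x \<in> ball x R" using D by (simp add: datum_def)
  have xh: "x \<in> half_space" using pos by (simp add: half_space_def)
  let ?B = "ball x R \<inter> {y. 0 < y $ None}"
  note C = interior_Cinf[OF D]
  have xB: "x \<in> ?B" using x pos by simp
  have o: "open ?B" using C[OF Lsol_smooth[OF f]] Cinf_open by blast
  have 1: "Cinf ?B (\<lambda>y. a * (f \<circ> chart_inv c) y)" "Cinf ?B (\<lambda>y. b * (h \<circ> chart_inv c) y)"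
    by (rule Cinf_mult[OF Cinf_const[OF o] C[OF Lsol_smooth[OF f]]] Cinf_mult[OF Cinf_const[OF o] C[OF Lsol_smooth[OF h]]])+
  have "Lop (inv_coeff G x) (drift G \<Phi> \<epsilon> x) (\<lambda>y. a * (f \<circ> chart_inv c) y + b * (h \<circ> chart_inv c) y) x = 0"
    unfolding Lop_add[OF 1 xB] Lop_cmult[OF C[OF Lsol_smooth[OF f]] xB datum_pos(1)[OF D x xh]]
      Lop_cmult[OF C[OF Lsol_smooth[OF h]] xB datum_pos(1)[OF D x xh]]
    using Lsol_Lop[OF D e f x pos] Lsol_Lop[OF D e h x pos] by simp
  then show "Lop (inv_coeff G x) (drift G \<Phi> \<epsilon> x) ((\<lambda>p. a * f p + b * h p) \<circ> chart_inv c) x = 0"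
    by (simp add: o_def)
qed

lemma Lsol_affine: "0 < \<epsilon> \<Longrightarrow> Lsol \<epsilon> f \<Longrightarrow> Lsol \<epsilon> (\<lambda>p. a * f p + b)"
  using Lsol_lincomb[OF _ _ Lsol_const, of \<epsilon> f a b 1] by simp

lemma Lsol_sum:
  assumes e: "0 < \<epsilon>" and f: "\<And>i. i \<in> I \<Longrightarrow> Lsol \<epsilon> (f i)"
  shows "Lsol \<epsilon> (\<lambda>p. \<Sum>i\<in>I. a i * f i p)"
  using f
proof (induction I rule: infinite_finite_induct)
  case (insert i I)
  then show ?case using Lsol_lincomb[OF e, of "f i" "\<lambda>p. \<Sum>i\<in>I. a i * f i p" "a i" 1] by simp
qed (use Lsol_const[OF e] in auto)

text \<open>The parameter enters only through the reciprocal of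
  \<open>\<epsilon> + \<Phi> y\<close>. Where this sum is at least \<delta>, the drift and its first
  derivatives are bounded independently of \<epsilon>; the Bernstein estimate uses both.\<close>

lemma datum_bounds:
  assumes D: "datum c x R G \<Phi>" and r: "r < R" and \<delta>: "0 < \<delta>"
  shows "\<exists>\<Lambda>. \<forall>\<epsilon>>0. \<forall>y\<in>cball x r. \<forall>i j k. \<bar>inv_coeff G y i j\<bar> \<le> \<Lambda> \<and> \<bar>pd k (\<lambda>y. inv_coeff G y i j) y\<bar> \<le> \<Lambda> \<and>
    (\<delta> \<le> \<epsilon> + \<Phi> y \<longrightarrow> \<bar>drift G \<Phi> \<epsilon> y j\<bar> \<le> \<Lambda> \<and> \<bar>pd k (\<lambda>y. drift G \<Phi> \<epsilon> y j) y\<bar> \<le> \<Lambda>)"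
proof -
  have sub: "cball x r \<subseteq> ball x R" using r by auto
  have P: "Cinf (ball x R) \<Phi>" using D by (simp add: datum_def)
  note S = datum_smooth[OF D]
  have cont: "continuous_on (cball x r) f" if "Cinf (ball x R) f" for f :: "'m model \<Rightarrow> real"
    using Cinf_continuous_on[OF that] sub continuous_on_subset by blast
  obtain B1 where B1: "\<And>i j y. y \<in> cball x r \<Longrightarrow> \<bar>inv_coeff G y i j\<bar> \<le> B1"
    using bounded_family[OF compact_cball, of x r "\<lambda>(i, j) y. inv_coeff G y i j"] cont[OF S(2)] by fastforce
  obtain B2 where B2: "\<And>i j k y. y \<in> cball x r \<Longrightarrow> \<bar>pd k (\<lambda>y. inv_coeff G y i j) y\<bar> \<le> B2"
    using bounded_family[OF compact_cball, of x r "\<lambda>(i, j, k). pd k (\<lambda>y. inv_coeff G y i j)"] cont[OF Cinf_pd[OF S(2)]] by fastforce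
  obtain B3 where B3: "0 \<le> B3" "\<And>j y. y \<in> cball x r \<Longrightarrow> \<bar>drift0 G y j\<bar> \<le> B3"
    using bounded_family[OF compact_cball, of x r "\<lambda>j y. drift0 G y j"] cont[OF S(3)] by fastforce
  obtain B4 where B4: "0 \<le> B4" "\<And>j k y. y \<in> cball x r \<Longrightarrow> \<bar>pd k (\<lambda>y. drift0 G y j) y\<bar> \<le> B4"
    using bounded_family[OF compact_cball, of x r "\<lambda>(j, k). pd k (\<lambda>y. drift0 G y j)"] cont[OF Cinf_pd[OF S(3)]] by fastforce
  obtain B5 where B5: "0 \<le> B5" "\<And>j y. y \<in> cball x r \<Longrightarrow> \<bar>drift1 G \<Phi> y j\<bar> \<le> B5"
    using bounded_family[OF compact_cball, of x r "\<lambda>j y. drift1 G \<Phi> y j"] cont[OF S(4)] by fastforce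
  obtain B6 where B6: "0 \<le> B6" "\<And>j k y. y \<in> cball x r \<Longrightarrow> \<bar>pd k (\<lambda>y. drift1 G \<Phi> y j) y\<bar> \<le> B6"
    using bounded_family[OF compact_cball, of x r "\<lambda>(j, k). pd k (\<lambda>y. drift1 G \<Phi> y j)"] cont[OF Cinf_pd[OF S(4)]] by fastforce
  obtain B7 where B7: "0 \<le> B7" "\<And>k y. y \<in> cball x r \<Longrightarrow> \<bar>pd k \<Phi> y\<bar> \<le> B7"
    using bounded_family[OF compact_cball, of x r "\<lambda>k. pd k \<Phi>"] cont[OF Cinf_pd[OF P]] by fastforce
  define I where "I = inverse \<delta>"
  have I: "0 < I" using \<delta> by (simp add: I_def)
  define \<Lambda> where "\<Lambda> = Max {B1, B2, B3 + B5 * I, B4 + (B5 * (I * I * B7) + B6 * I)}"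
  have \<Lambda>: "B1 \<le> \<Lambda>" "B2 \<le> \<Lambda>" "B3 + B5 * I \<le> \<Lambda>" "B4 + (B5 * (I * I * B7) + B6 * I) \<le> \<Lambda>"
    unfolding \<Lambda>_def by (auto intro!: Max_ge)
  show ?thesis
  proof (intro exI[of _ \<Lambda>] allI impI ballI conjI)
    fix \<epsilon> :: real and y i j k assume e: "0 < \<epsilon>" and y: "y \<in> cball x r"
    show "\<bar>inv_coeff G y i j\<bar> \<le> \<Lambda>" using B1[OF y] \<Lambda> order_trans by blast
    show "\<bar>pd k (\<lambda>y. inv_coeff G y i j) y\<bar> \<le> \<Lambda>" using B2[OF y] \<Lambda> order_trans by blast
    assume d: "\<delta> \<le> \<epsilon> + \<Phi> y"
    define s where "s = inverse (\<epsilon> + \<Phi> y)"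
    have s: "0 < s" "s \<le> I" using d \<delta> by (auto simp: s_def I_def le_imp_inverse_le)
    have "\<bar>drift1 G \<Phi> y j * s\<bar> \<le> B5 * I" unfolding abs_mult using s B5 y by (intro mult_mono) auto
    then show "\<bar>drift G \<Phi> \<epsilon> y j\<bar> \<le> \<Lambda>"
      using B3(2)[OF y, of j] \<Lambda>(3) unfolding drift_def s_def[symmetric] by linarith
    have yb: "y \<in> ball x R" using y sub by blast
    have dP: "\<Phi> differentiable (at y)" by (rule Cinf_differentiable[OF P yb])
    have nz: "\<epsilon> + \<Phi> y \<noteq> 0" using d \<delta> by linarith
    have der: "((\<lambda>t. inverse (\<epsilon> + t)) has_real_derivative - (s * s)) (at (\<Phi> y))"
      using nz by (auto intro!: derivative_eq_intros simp: s_def)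
    have p1: "pd k (\<lambda>y. inverse (\<epsilon> + \<Phi> y)) y = - (s * s) * pd k \<Phi> y" by (rule pd_chain[OF dP der])
    have d1: "(\<lambda>y. inverse (\<epsilon> + \<Phi> y)) differentiable (at y)"
    proof -
      have "(\<lambda>t. inverse (\<epsilon> + t)) differentiable (at (\<Phi> y))" using der real_differentiable_def by blast
      from differentiable_chain_at[OF dP this] show ?thesis by (simp add: o_def)
    qed
    have d2: "(\<lambda>y. drift0 G y j) differentiable (at y)" "(\<lambda>y. drift1 G \<Phi> y j) differentiable (at y)"
      using Cinf_differentiable[OF S(3) yb] Cinf_differentiable[OF S(4) yb] by blast+
    have "pd k (\<lambda>y. drift G \<Phi> \<epsilon> y j) y = pd k (\<lambda>y. drift0 G y j) y
        + (drift1 G \<Phi> y j * (- (s * s) * pd k \<Phi> y) + pd k (\<lambda>y. drift1 G \<Phi> y j) y * s)"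
      unfolding drift_def pd_add[OF d2(1) differentiable_mult[OF d2(2) d1]] pd_mult[OF d2(2) d1] p1 s_def[symmetric] by simp
    moreover have "\<bar>drift1 G \<Phi> y j * (- (s * s) * pd k \<Phi> y)\<bar> \<le> B5 * (I * I * B7)"
      unfolding abs_mult abs_minus_cancel using s I B5 B7 y by (intro mult_mono) auto
    moreover have "\<bar>pd k (\<lambda>y. drift1 G \<Phi> y j) y * s\<bar> \<le> B6 * I"
      unfolding abs_mult using s B6 y by (intro mult_mono) auto
    ultimately show "\<bar>pd k (\<lambda>y. drift G \<Phi> \<epsilon> y j) y\<bar> \<le> \<Lambda>"
      using B4(2)[OF y, of k j] \<Lambda>(4) by linarith
  qed
qed

text \<open>The set \<open>J\<close> serves two purposes: all positive \<epsilon> near a point with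
  \<phi> > 0, for uniform estimates, and a single \<epsilon> near any interior point, for the strong
  maximum principle. By continuity the bound 2 \<delta> at \<open>p\<close> leaves \<delta> on the
  whole patch.\<close>

lemma interior_patch:
  assumes p: "p \<in> M - bd" and \<delta>: "0 < \<delta>" and J: "\<forall>\<epsilon>\<in>J. 0 < \<epsilon> \<and> 2 * \<delta> \<le> \<epsilon> + \<phi> p"
  shows "\<exists>c R l \<Lambda> a b. c \<in> A \<and> p \<in> fst c \<and> 0 < R \<and> 0 < l \<and>
    (\<forall>y\<in>ball (snd c p) R. y \<in> chart_image c \<and> 0 < y $ None) \<and>
    (\<forall>\<epsilon>\<in>J. (\<forall>i j. Cinf (ball (snd c p) R) (\<lambda>y. a y i j)) \<and> (\<forall>j. Cinf (ball (snd c p) R) (\<lambda>y. b \<epsilon> y j)) \<and>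
      (\<forall>y\<in>ball (snd c p) R. elliptic l (a y) \<and> (\<forall>i j. \<bar>a y i j\<bar> \<le> \<Lambda>) \<and> (\<forall>j. \<bar>b \<epsilon> y j\<bar> \<le> \<Lambda>) \<and>
        (\<forall>i j k. \<bar>pd k (\<lambda>y. a y i j) y\<bar> \<le> \<Lambda>) \<and> (\<forall>j k. \<bar>pd k (\<lambda>y. b \<epsilon> y j) y\<bar> \<le> \<Lambda>)) \<and>
      (\<forall>f. Lsol \<epsilon> f \<longrightarrow> Cinf (ball (snd c p) R) (f \<circ> chart_inv c) \<and>
        (\<forall>y\<in>ball (snd c p) R. Lop (a y) (b \<epsilon> y) (f \<circ> chart_inv c) y = 0)))"
proof -
  obtain c where c: "c \<in> A" "p \<in> fst c" using p obtain_chart by blast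
  let ?x = "snd c p"
  obtain R0 G \<Phi> where D: "datum c ?x R0 G \<Phi>" "?x \<in> ball ?x R0" using datum_at[OF c] by blast
  have pos: "0 < ?x $ None" using interior_iff[OF c] p by blast
  have P: "Cinf (ball ?x R0) \<Phi>" using D by (simp add: datum_def)
  have Px: "\<Phi> ?x = \<phi> p" using D pos c by (auto simp: datum_def half_space_def)
  have R0: "0 < R0" using D by (simp add: datum_def)
  have "isCont \<Phi> ?x" using Cinf_continuous_on[OF P] R0 by (simp add: continuous_on_eq_continuous_at)
  then obtain r where r: "0 < r" "\<And>y. dist y ?x < r \<Longrightarrow> dist (\<Phi> y) (\<Phi> ?x) < \<delta>"
    using \<delta> unfolding continuous_at_eps_delta by blast
  define R where "R = min (R0 / 2) (min r (?x $ None))"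
  have R: "0 < R" "R \<le> R0 / 2" "R \<le> r" "R \<le> ?x $ None" using R0 r pos by (auto simp: R_def)
  let ?W = "ball ?x R"
  have None_pos: "0 < y $ None" if "y \<in> ?W" for y
    using component_le_norm_cart[of "?x - y" None] that R(4) by (simp add: dist_norm)
  have sub: "?W \<subseteq> ball ?x R0" "?W \<subseteq> cball ?x (R0/2)" "?W \<subseteq> ball ?x R0 \<inter> {y. 0 < y $ None}" using R R0 None_pos by auto
  have half: "?W \<subseteq> half_space" using None_pos by (auto simp: half_space_def less_imp_le)
  obtain l where l: "0 < l" "\<forall>y\<in>cball ?x (R0/2) \<inter> half_space. elliptic l (inv_coeff G y)"
    using datum_elliptic[OF D(1), of "R0/2"] R0 by auto
  obtain \<Lambda> where \<Lambda>: "\<forall>\<epsilon>>0. \<forall>y\<in>cball ?x (R0/2). \<forall>i j k. \<bar>inv_coeff G y i j\<bar> \<le> \<Lambda> \<and> \<bar>pd k (\<lambda>y. inv_coeff G y i j) y\<bar> \<le> \<Lambda> \<and>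
    (\<delta> \<le> \<epsilon> + \<Phi> y \<longrightarrow> \<bar>drift G \<Phi> \<epsilon> y j\<bar> \<le> \<Lambda> \<and> \<bar>pd k (\<lambda>y. drift G \<Phi> \<epsilon> y j) y\<bar> \<le> \<Lambda>)"
    using datum_bounds[OF D(1) _ \<delta>, of "R0/2"] R0 by auto
  have ge: "\<delta> \<le> \<epsilon> + \<Phi> y" if "\<epsilon> \<in> J" "y \<in> ?W" for \<epsilon> y
  proof -
    have "dist (\<Phi> y) (\<Phi> ?x) < \<delta>" by (rule r(2)) (use that(2) R(3) in \<open>simp add: dist_commute\<close>)
    then have "\<phi> p - \<delta> < \<Phi> y" unfolding Px dist_real_def by linarith
    moreover have "2 * \<delta> \<le> \<epsilon> + \<phi> p" using J that(1) by blast
    ultimately show ?thesis by linarith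
  qed
  show ?thesis
  proof (rule exI[of _ c], rule exI[of _ R], rule exI[of _ l], rule exI[of _ \<Lambda>], rule exI[of _ "inv_coeff G"], rule exI[of _ "drift G \<Phi>"],
      intro conjI ballI allI impI)
    show "y \<in> chart_image c" if "y \<in> ?W" for y using datum_chart(1)[OF D(1)] that sub(1) half by blast
    show "0 < y $ None" if "y \<in> ?W" for y by (rule None_pos[OF that])
    fix \<epsilon> assume e: "\<epsilon> \<in> J"
    then have e0: "0 < \<epsilon>" using J by blast
    show "Cinf ?W (\<lambda>y. inv_coeff G y i j)" for i j by (rule Cinf_subset[OF datum_smooth(2)[OF D(1)] open_ball sub(1)])
    show "Cinf ?W (\<lambda>y. drift G \<Phi> \<epsilon> y j)" for j
      unfolding drift_def
    proof (intro Cinf_add Cinf_mult Cinf_inverse Cinf_const open_ball)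
      show "Cinf ?W (\<lambda>y. drift0 G y j)" "Cinf ?W (\<lambda>y. drift1 G \<Phi> y j)" "Cinf ?W \<Phi>"
        using Cinf_subset[OF _ open_ball sub(1)] datum_smooth[OF D(1)] P by blast+
      show "\<epsilon> + \<Phi> y \<noteq> 0" if "y \<in> ?W" for y using ge[OF e that] \<delta> by linarith
    qed
    fix y assume y: "y \<in> ?W"
    have yc: "y \<in> cball ?x (R0/2)" using y sub(2) by blast
    show "elliptic l (inv_coeff G y)" using l(2) yc half y by blast
    show "\<bar>inv_coeff G y i j\<bar> \<le> \<Lambda>" "\<bar>pd k (\<lambda>y. inv_coeff G y i j) y\<bar> \<le> \<Lambda>" for i j k using \<Lambda> e0 yc by blast+
    show "\<bar>drift G \<Phi> \<epsilon> y j\<bar> \<le> \<Lambda>" "\<bar>pd k (\<lambda>y. drift G \<Phi> \<epsilon> y j) y\<bar> \<le> \<Lambda>" for j k using \<Lambda> e0 yc ge[OF e y] by blast+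
  next
    fix \<epsilon> f assume e: "\<epsilon> \<in> J" and f: "Lsol \<epsilon> f"
    show "Cinf ?W (f \<circ> chart_inv c)" by (rule Cinf_subset[OF interior_Cinf[OF D(1) Lsol_smooth[OF f]] open_ball sub(3)])
    show "Lop (inv_coeff G y) (drift G \<Phi> \<epsilon> y) (f \<circ> chart_inv c) y = 0" if "y \<in> ?W" for y
      using Lsol_Lop[OF D(1) _ f, of y] J e that sub(1) None_pos by blast
  qed (use c R l in auto)
qed

lemma half_ball_openin:
  assumes c: "c \<in> A" and W: "\<And>y. y \<in> ball x r \<Longrightarrow> y \<in> chart_image c \<and> 0 < y $ None"
  shows "openin (top_of_set M) (chart_inv c ` ball x r)" "chart_inv c ` ball x r \<subseteq> M - bd"
proof -
  have sub: "ball x r \<inter> half_space \<subseteq> chart_image c" using W by blast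
  have eq: "ball x r \<inter> half_space = ball x r" "ball x r \<inter> {y. 0 < y $ None} = ball x r"
    using W by (auto simp: half_space_def less_imp_le)
  show "openin (top_of_set M) (chart_inv c ` ball x r)"
    using cball_nbhd_openin[OF c sub] unfolding cball_nbhd_def eq .
  then show "chart_inv c ` ball x r \<subseteq> M - bd"
    using cball_nbhd_interior[OF c sub] openin_imp_subset unfolding cball_nbhd_def eq by blast
qed

text \<open>The Bernstein bound makes bounded solutions equicontinuous, uniformly over
  \<open>J\<close>. The tolerance 1/4 is half of the level 1/2 at which the Harnack inequality
  starts.\<close>

lemma Lsol_osc:
  assumes p: "p \<in> M - bd" and \<delta>: "0 < \<delta>" and J: "\<forall>\<epsilon>\<in>J. 0 < \<epsilon> \<and> 2 * \<delta> \<le> \<epsilon> + \<phi> p"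
  shows "\<exists>U. openin (top_of_set M) U \<and> p \<in> U \<and>
    (\<forall>\<epsilon>\<in>J. \<forall>f. Lsol \<epsilon> f \<and> (\<forall>q\<in>M. \<bar>f q\<bar> \<le> 2) \<longrightarrow> (\<forall>q\<in>U. \<forall>q'\<in>U. f q - 1/4 \<le> f q'))"
proof -
  obtain c R l \<Lambda> a b where c: "c \<in> A" "p \<in> fst c" and R: "0 < R" and l: "0 < l"
    and W: "\<forall>y\<in>ball (snd c p) R. y \<in> chart_image c \<and> 0 < y $ None"
    and op: "\<forall>\<epsilon>\<in>J. (\<forall>i j. Cinf (ball (snd c p) R) (\<lambda>y. a y i j)) \<and> (\<forall>j. Cinf (ball (snd c p) R) (\<lambda>y. b \<epsilon> y j)) \<and>
      (\<forall>y\<in>ball (snd c p) R. elliptic l (a y) \<and> (\<forall>i j. \<bar>a y i j\<bar> \<le> \<Lambda>) \<and> (\<forall>j. \<bar>b \<epsilon> y j\<bar> \<le> \<Lambda>) \<and>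
        (\<forall>i j k. \<bar>pd k (\<lambda>y. a y i j) y\<bar> \<le> \<Lambda>) \<and> (\<forall>j k. \<bar>pd k (\<lambda>y. b \<epsilon> y j) y\<bar> \<le> \<Lambda>)) \<and>
      (\<forall>f. Lsol \<epsilon> f \<longrightarrow> Cinf (ball (snd c p) R) (f \<circ> chart_inv c) \<and>
        (\<forall>y\<in>ball (snd c p) R. Lop (a y) (b \<epsilon> y) (f \<circ> chart_inv c) y = 0))"
    using interior_patch[OF assms] by (elim exE conjE) (rule that; assumption)
  let ?x = "snd c p"
  define R' where "R' = min (R / 2) 1"
  have R': "0 < R'" "R' \<le> 1" "R' < R" using R by (auto simp: R'_def)
  obtain C where C: "0 \<le> C" "\<forall>a b u y (W :: 'm model set).
    Cinf W u \<and> cball y R' \<subseteq> W \<and> (\<forall>i j. Cinf W (\<lambda>x. a x i j)) \<and> (\<forall>i. Cinf W (\<lambda>x. b x i)) \<and>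
    (\<forall>x\<in>W. elliptic l (a x) \<and> (\<forall>i j. \<bar>a x i j\<bar> \<le> \<Lambda>) \<and> (\<forall>i. \<bar>b x i\<bar> \<le> \<Lambda>) \<and>
      (\<forall>i j k. \<bar>pd k (\<lambda>x. a x i j) x\<bar> \<le> \<Lambda>) \<and> (\<forall>i k. \<bar>pd k (\<lambda>x. b x i) x\<bar> \<le> \<Lambda>) \<and>
      Lop (a x) (b x) u x = 0 \<and> \<bar>u x\<bar> \<le> 2) \<longrightarrow>
    (\<forall>x\<in>cball y (R'/2). \<forall>k. \<bar>pd k u x\<bar> \<le> C)"
    using bernstein[OF l R'(1,2), where \<Lambda>=\<Lambda>] by (elim exE conjE) (rule that; assumption)
  \<comment> \<open>Values on the small ball then differ from the one at the centre by at most 1/8,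
    hence from each other by at most 1/4. The summand 1 next to \<open>C\<close> guards against
    division by zero.\<close>
  define r where "r = min (R' / 2) (1 / (8 * real CARD('m option) * (C + 1)))"
  have r: "0 < r" "r \<le> R' / 2" "real CARD('m option) * (C + 1) * r \<le> 1/8"
  proof -
    have pos: "0 < 8 * real CARD('m option) * (C + 1)" using C(1) by (intro mult_pos_pos) auto
    then show "0 < r" using R' by (simp add: r_def)
    show "r \<le> R' / 2" by (simp add: r_def)
    have "r \<le> 1 / (8 * real CARD('m option) * (C + 1))" by (simp add: r_def)
    then have "r * (8 * real CARD('m option) * (C + 1)) \<le> 1" using pos by (simp only: pos_le_divide_eq)
    then show "real CARD('m option) * (C + 1) * r \<le> 1/8" by (simp add: algebra_simps)
  qed
  have Wr: "y \<in> chart_image c \<and> 0 < y $ None" if "y \<in> ball ?x r" for y using W that r(2) R' by auto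
  show ?thesis
  proof (intro exI[of _ "chart_inv c ` ball ?x r"] conjI ballI allI impI)
    show "openin (top_of_set M) (chart_inv c ` ball ?x r)" by (rule half_ball_openin(1)[OF c(1) Wr])
    show "p \<in> chart_inv c ` ball ?x r" using r(1) c by (intro image_eqI[of _ _ ?x]) auto
    fix \<epsilon> f q q' assume e: "\<epsilon> \<in> J" and f: "Lsol \<epsilon> f \<and> (\<forall>q\<in>M. \<bar>f q\<bar> \<le> 2)"
      and q: "q \<in> chart_inv c ` ball ?x r" "q' \<in> chart_inv c ` ball ?x r"
    let ?u = "f \<circ> chart_inv c"
    have u: "Cinf (ball ?x R) ?u" using op e f by blast
    have sub: "cball ?x R' \<subseteq> ball ?x R" using R' by auto
    have le2: "\<bar>?u y\<bar> \<le> 2" if "y \<in> ball ?x R" for y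
      using f W that chart_inv_in[of y c] chart_sub[OF c(1)] by auto
    note K = C(2)[THEN spec[of _ a], THEN spec[of _ "b \<epsilon>"], THEN spec[of _ ?u], THEN spec[of _ ?x],
        THEN spec[of _ "ball ?x R"], THEN mp]
    have "\<forall>x\<in>cball ?x (R'/2). \<forall>k. \<bar>pd k ?u x\<bar> \<le> C"
    proof (rule K, intro conjI u sub)
      show "\<forall>i j. Cinf (ball ?x R) (\<lambda>x. a x i j)" "\<forall>i. Cinf (ball ?x R) (\<lambda>x. b \<epsilon> x i)" using op e by blast+
      show "\<forall>z\<in>ball ?x R. elliptic l (a z) \<and> (\<forall>i j. \<bar>a z i j\<bar> \<le> \<Lambda>) \<and> (\<forall>i. \<bar>b \<epsilon> z i\<bar> \<le> \<Lambda>) \<and>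
        (\<forall>i j k. \<bar>pd k (\<lambda>x. a x i j) z\<bar> \<le> \<Lambda>) \<and> (\<forall>i k. \<bar>pd k (\<lambda>x. b \<epsilon> x i) z\<bar> \<le> \<Lambda>) \<and>
        Lop (a z) (b \<epsilon> z) ?u z = 0 \<and> \<bar>?u z\<bar> \<le> 2"
        using op e f le2 by blast
    qed
    then have pd: "\<bar>pd k ?u x\<bar> \<le> C" if "x \<in> cball ?x (R'/2)" for x k using that by blast
    have near: "\<bar>f s - f p\<bar> \<le> 1/8" if s: "s \<in> chart_inv c ` ball ?x r" for s
    proof -
      obtain y where y: "y \<in> ball ?x r" "s = chart_inv c y" using s by blast
      have yy: "y \<in> cball ?x (R'/2)" using y(1) r(2) by auto
      have "cball ?x (R'/2) \<subseteq> ball ?x R" using R' by auto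
      from pd_bound_osc[OF u this pd yy]
      have "\<bar>?u y - ?u ?x\<bar> \<le> CARD('m option) * C * dist y ?x" by blast
      also have "\<dots> \<le> CARD('m option) * (C + 1) * r"
        using y(1) C(1) by (intro mult_mono) (auto simp: dist_commute)
      also have "\<dots> \<le> 1/8" by (rule r(3))
      finally show ?thesis using y(2) c by simp
    qed
    show "f q - 1/4 \<le> f q'" using near[OF q(1)] near[OF q(2)] by linarith
  qed
qed

section \<open>Harnack inequality\<close>

text \<open>The factor is fixed before the parameter and the solution, and factors multiply along
  chains. This is how uniformity in \<epsilon> passes from balls to compact sets.\<close>

definition dominates :: "real set \<Rightarrow> 'a set \<Rightarrow> real \<Rightarrow> 'a set \<Rightarrow> bool" where
  "dominates J U' \<kappa> U \<longleftrightarrow> (\<forall>\<epsilon>\<in>J. \<forall>v m. Lsol \<epsilon> v \<and> (\<forall>q\<in>M. 0 \<le> v q) \<and> 0 \<le> m \<and> (\<forall>q\<in>U'. m \<le> v q)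
    \<longrightarrow> (\<forall>q\<in>U. \<kappa> * m \<le> v q))"

lemma dominatesD:
  "dominates J U' \<kappa> U \<Longrightarrow> \<epsilon> \<in> J \<Longrightarrow> Lsol \<epsilon> v \<Longrightarrow> (\<And>q. q \<in> M \<Longrightarrow> 0 \<le> v q) \<Longrightarrow> 0 \<le> m \<Longrightarrow>
    (\<And>q. q \<in> U' \<Longrightarrow> m \<le> v q) \<Longrightarrow> q \<in> U \<Longrightarrow> \<kappa> * m \<le> v q"
  unfolding dominates_def by blast

text \<open>The order of choice matters: \<open>U\<close> depends on \<open>p\<close> alone, while
  the source \<open>U'\<close> may be arbitrarily small as long as it meets \<open>U\<close>. A ball
  inside \<open>U'\<close> feeds the growth estimate, whose factor may depend on the size of that
  ball, and the estimate covers all of \<open>U\<close>.\<close>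

lemma chain_step:
  assumes p: "p \<in> M - bd" and \<delta>: "0 < \<delta>" and J: "\<forall>\<epsilon>\<in>J. 0 < \<epsilon> \<and> 2 * \<delta> \<le> \<epsilon> + \<phi> p"
  shows "\<exists>U. openin (top_of_set M) U \<and> p \<in> U \<and>
    (\<forall>p'\<in>U. \<forall>U'. openin (top_of_set M) U' \<and> p' \<in> U' \<longrightarrow>
      (\<exists>\<kappa>>0. dominates J U' \<kappa> U))"
proof -
  obtain c R l \<Lambda> a b where c: "c \<in> A" "p \<in> fst c" and R: "0 < R" and l: "0 < l"
    and W: "\<forall>y\<in>ball (snd c p) R. y \<in> chart_image c \<and> 0 < y $ None"
    and op: "\<forall>\<epsilon>\<in>J. (\<forall>i j. Cinf (ball (snd c p) R) (\<lambda>y. a y i j)) \<and> (\<forall>j. Cinf (ball (snd c p) R) (\<lambda>y. b \<epsilon> y j)) \<and>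
      (\<forall>y\<in>ball (snd c p) R. elliptic l (a y) \<and> (\<forall>i j. \<bar>a y i j\<bar> \<le> \<Lambda>) \<and> (\<forall>j. \<bar>b \<epsilon> y j\<bar> \<le> \<Lambda>) \<and>
        (\<forall>i j k. \<bar>pd k (\<lambda>y. a y i j) y\<bar> \<le> \<Lambda>) \<and> (\<forall>j k. \<bar>pd k (\<lambda>y. b \<epsilon> y j) y\<bar> \<le> \<Lambda>)) \<and>
      (\<forall>f. Lsol \<epsilon> f \<longrightarrow> Cinf (ball (snd c p) R) (f \<circ> chart_inv c) \<and>
        (\<forall>y\<in>ball (snd c p) R. Lop (a y) (b \<epsilon> y) (f \<circ> chart_inv c) y = 0))"
    using interior_patch[OF assms] by (elim exE conjE) (rule that; assumption)
  let ?x = "snd c p"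
  \<comment> \<open>About any centre in \<open>ball ?x \<rho>\<close>, the ball of radius 3 \<rho>
    stays in the patch and the ball of radius 2 \<rho> covers \<open>ball ?x \<rho>\<close>.\<close>
  define \<rho> where "\<rho> = R / 8"
  have \<rho>: "0 < \<rho>" "4 * \<rho> < R" using R by (auto simp: \<rho>_def)
  have W\<rho>: "y \<in> chart_image c \<and> 0 < y $ None" if "y \<in> ball ?x \<rho>" for y using W that \<rho> by auto
  let ?U = "chart_inv c ` ball ?x \<rho>"
  show ?thesis
  proof (intro exI[of _ ?U] conjI ballI allI impI, goal_cases)
    case 1 show ?case by (rule half_ball_openin(1)[OF c(1) W\<rho>])
  next
    case 2 show ?case using \<rho>(1) c by (intro image_eqI[of _ _ ?x]) auto
  next
    case (3 p' U')
    then have U': "openin (top_of_set M) U'" "p' \<in> U'" by auto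
    obtain y where y: "y \<in> ball ?x \<rho>" "p' = chart_inv c y" using 3(1) by blast
    have yc: "y \<in> chart_image c" using W\<rho> y by blast
    have p'c: "p' \<in> fst c" "snd c p' = y" using chart_inv_in[OF yc] snd_chart_inv[OF c(1) yc] y by auto
    obtain r where "0 < r" "ball (snd c p') r \<inter> half_space \<subseteq> chart_image c" "cball_nbhd c (snd c p') r \<subseteq> U'"
      "p' \<in> cball_nbhd c (snd c p') r"
      by (rule obtain_nbhd[OF U' c(1) p'c(1)])
    note r = this[unfolded p'c(2)]
    have r2: "0 < r/2" using r by simp
    obtain \<kappa> where \<kappa>: "0 < \<kappa>" "\<forall>a b v y m (W :: 'm model set).
      Cinf W v \<and> cball y (3 * \<rho>) \<subseteq> W \<and> 0 \<le> m \<and>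
      (\<forall>x\<in>W. elliptic l (a x) \<and> (\<forall>i j. \<bar>a x i j\<bar> \<le> \<Lambda>) \<and> (\<forall>i. \<bar>b x i\<bar> \<le> \<Lambda>) \<and> Lop (a x) (b x) v x = 0 \<and> 0 \<le> v x) \<and>
      (\<forall>x\<in>cball y (r/2). x \<in> W \<longrightarrow> m \<le> v x) \<longrightarrow> (\<forall>x\<in>cball y (2 * \<rho>). \<kappa> * m \<le> v x)"
      using growth[OF l r2 \<rho>(1), of \<Lambda>] by (elim exE conjE) (rule that; assumption)
    have "dominates J U' \<kappa> ?U"
      unfolding dominates_def
    proof (intro ballI allI impI)
      fix \<epsilon> v m q assume e: "\<epsilon> \<in> J"
        and v: "Lsol \<epsilon> v \<and> (\<forall>q\<in>M. 0 \<le> v q) \<and> 0 \<le> m \<and> (\<forall>q\<in>U'. m \<le> v q)" and q: "q \<in> ?U"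
      let ?v = "v \<circ> chart_inv c" and ?W = "ball ?x R"
      note K = \<kappa>(2)[THEN spec[of _ a], THEN spec[of _ "b \<epsilon>"], THEN spec[of _ ?v], THEN spec[of _ y], THEN spec[of _ m],
        THEN spec[of _ ?W], THEN mp]
      have concl: "\<forall>x\<in>cball y (2 * \<rho>). \<kappa> * m \<le> ?v x"
      proof (rule K, intro conjI)
        show "Cinf ?W ?v" using op e v by blast
        show "cball y (3 * \<rho>) \<subseteq> ?W"
        proof
          fix z assume "z \<in> cball y (3 * \<rho>)"
          then have "dist ?x z < \<rho> + 3 * \<rho>" using y(1) dist_triangle[of ?x z y] by simp
          then show "z \<in> ?W" using \<rho>(2) by simp
        qed
        show "0 \<le> m" using v by blast
        have nn: "0 \<le> ?v z" if "z \<in> ?W" for z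
          using v W that chart_inv_in[of z c] chart_sub[OF c(1)] by auto
        show "\<forall>z\<in>?W. elliptic l (a z) \<and> (\<forall>i j. \<bar>a z i j\<bar> \<le> \<Lambda>) \<and> (\<forall>i. \<bar>b \<epsilon> z i\<bar> \<le> \<Lambda>) \<and> Lop (a z) (b \<epsilon> z) ?v z = 0 \<and> 0 \<le> ?v z"
          using op e v nn by blast
        show "\<forall>z\<in>cball y (r/2). z \<in> ?W \<longrightarrow> m \<le> ?v z"
        proof (intro ballI impI)
          fix z assume z: "z \<in> cball y (r/2)" "z \<in> ?W"
          have "z \<in> ball y r" using z(1) r(1) by simp
          moreover have "z \<in> half_space" using W z(2) by (auto simp: half_space_def less_imp_le)
          ultimately have "chart_inv c z \<in> U'" using r(3) unfolding cball_nbhd_def by blast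
          then show "m \<le> ?v z" using v by simp
        qed
      qed
      obtain z where z: "z \<in> ball ?x \<rho>" "q = chart_inv c z" using q by blast
      have "dist y z \<le> 2 * \<rho>" using y(1) z(1) dist_triangle[of y z ?x] by (simp add: dist_commute)
      then show "\<kappa> * m \<le> v q" using concl z(2) by simp
    qed
    then show ?case using \<kappa>(1) by blast
  qed
qed

definition reach :: "real set \<Rightarrow> 'a set \<Rightarrow> 'a \<Rightarrow> bool" where
  "reach J U0 p \<longleftrightarrow> (\<exists>U \<kappa>. openin (top_of_set M) U \<and> p \<in> U \<and> 0 < \<kappa> \<and>
    dominates J U0 \<kappa> U)"

text \<open>The points reached from \<open>U0\<close> form a relatively open subset of
  \<open>D\<close>. So do the others: if some point near \<open>q\<close> were reached, one chain
  step from its neighbourhood would reach \<open>q\<close>. Connectedness rules out the second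
  kind.\<close>

lemma reach_connected:
  assumes D: "connected D" "D \<subseteq> M - bd"
    and J: "\<And>p. p \<in> D \<Longrightarrow> \<exists>\<delta>>0. \<forall>\<epsilon>\<in>J. 0 < \<epsilon> \<and> 2 * \<delta> \<le> \<epsilon> + \<phi> p"
    and U0: "openin (top_of_set M) U0" "p0 \<in> U0" "p0 \<in> D" and p: "p \<in> D"
  shows "reach J U0 p"
proof (rule ccontr)
  assume np: "\<not> reach J U0 p"
  define S where "S = {q \<in> D. reach J U0 q}"
  define T where "T = {q \<in> D. \<not> reach J U0 q}"
  have rel: "openin (top_of_set D) (D \<inter> U)" if U: "openin (top_of_set M) U" for U
  proof -
    obtain T' where "open T'" "U = M \<inter> T'" using U by (meson openin_open)
    then show ?thesis unfolding openin_open using D(2) by (intro exI[of _ T']) auto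
  qed
  have "openin (top_of_set D) S"
  proof (subst openin_subopen, intro ballI)
    fix q assume "q \<in> S"
    then obtain U \<kappa> where U: "openin (top_of_set M) U" "q \<in> U" "0 < \<kappa>" "q \<in> D"
      "dominates J U0 \<kappa> U"
      unfolding S_def reach_def by blast
    then have "D \<inter> U \<subseteq> S" unfolding S_def reach_def by blast
    then show "\<exists>T. openin (top_of_set D) T \<and> q \<in> T \<and> T \<subseteq> S" using rel[OF U(1)] U by blast
  qed
  moreover have "openin (top_of_set D) T"
  proof (subst openin_subopen, intro ballI)
    fix q assume q: "q \<in> T"
    then obtain \<delta> where \<delta>: "0 < \<delta>" "\<forall>\<epsilon>\<in>J. 0 < \<epsilon> \<and> 2 * \<delta> \<le> \<epsilon> + \<phi> q" using J unfolding T_def by blast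
    have "q \<in> M - bd" using q D(2) by (auto simp: T_def)
    from chain_step[OF this \<delta>] obtain U where U: "openin (top_of_set M) U" "q \<in> U"
      "\<forall>p'\<in>U. \<forall>U'. openin (top_of_set M) U' \<and> p' \<in> U' \<longrightarrow>
      (\<exists>\<kappa>>0. dominates J U' \<kappa> U)"
      by (elim exE conjE) (rule that; assumption)
    have "D \<inter> U \<subseteq> T"
    proof
      fix p' assume p': "p' \<in> D \<inter> U"
      have "\<not> reach J U0 p'"
      proof
        assume "reach J U0 p'"
        then obtain U' \<kappa>' where U': "openin (top_of_set M) U'" "p' \<in> U'" "0 < \<kappa>'"
          "dominates J U0 \<kappa>' U'"
          unfolding reach_def by blast
        obtain \<kappa> where \<kappa>: "0 < \<kappa>" "dominates J U' \<kappa> U"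
          using U(3) p' U'(1,2) by blast
        have "dominates J U0 (\<kappa> * \<kappa>') U"
          unfolding dominates_def
        proof (intro ballI allI impI)
          fix \<epsilon> v m q assume e: "\<epsilon> \<in> J" and v: "Lsol \<epsilon> v \<and> (\<forall>q\<in>M. 0 \<le> v q) \<and> 0 \<le> m \<and> (\<forall>q\<in>U0. m \<le> v q)" and q: "q \<in> U"
          have "\<kappa>' * m \<le> v x" if "x \<in> U'" for x using dominatesD[OF U'(4) e] v that by blast
          moreover have "0 \<le> \<kappa>' * m" using U'(3) v by simp
          ultimately have "\<kappa> * (\<kappa>' * m) \<le> v q" using dominatesD[OF \<kappa>(2) e] v q by blast
          then show "(\<kappa> * \<kappa>') * m \<le> v q" by (simp add: mult.assoc)
        qed
        then have "reach J U0 q" unfolding reach_def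
          using U(1,2) \<kappa>(1) U'(3) by (intro exI[of _ U] exI[of _ "\<kappa> * \<kappa>'"]) simp
        then show False using q by (simp add: T_def)
      qed
      then show "p' \<in> T" using p' by (simp add: T_def)
    qed
    then show "\<exists>T'. openin (top_of_set D) T' \<and> q \<in> T' \<and> T' \<subseteq> T" using rel[OF U(1)] U(2) q by (auto simp: T_def)
  qed
  moreover have "dominates J U0 1 U0" by (simp add: dominates_def)
  then have "p0 \<in> S" unfolding S_def reach_def using U0 zero_less_one by blast
  moreover have "p \<in> T" using np p by (simp add: T_def)
  moreover have "S \<inter> T = {}" "D \<subseteq> S \<union> T" by (auto simp: S_def T_def)
  ultimately show False using D(1) unfolding connected_openin by blast
qed

text \<open>The constant is uniform in \<open>\<epsilon>\<close>, because on the positivity set of \<open>\<phi>\<close> the drift stays bounded as \<open>\<epsilon>\<close> tends to 0.\<close>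

lemma harnack:
  assumes D: "connected D" "D \<subseteq> M - bd"
    and J: "\<And>p. p \<in> D \<Longrightarrow> \<exists>\<delta>>0. \<forall>\<epsilon>\<in>J. 0 < \<epsilon> \<and> 2 * \<delta> \<le> \<epsilon> + \<phi> p"
    and K: "compact K" "K \<subseteq> D"
  shows "\<exists>\<kappa>>0. \<forall>\<epsilon>\<in>J. \<forall>v. Lsol \<epsilon> v \<and> (\<forall>q\<in>M. 0 \<le> v q \<and> v q \<le> 2) \<and> (\<exists>x\<in>K. 1/2 \<le> v x) \<longrightarrow> (\<forall>x\<in>K. \<kappa> \<le> v x)"
proof -
  have KM: "K \<subseteq> M" using K D by blast
  \<comment> \<open>Neighbourhoods of small oscillation come first: they turn the value 1/2 at one
    point into the bound 1/4 on an open set, from which lower bounds can spread.\<close>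
  have "\<exists>U. openin (top_of_set M) U \<and> p \<in> U \<and>
    (\<forall>\<epsilon>\<in>J. \<forall>f. Lsol \<epsilon> f \<and> (\<forall>q\<in>M. \<bar>f q\<bar> \<le> 2) \<longrightarrow> (\<forall>q\<in>U. \<forall>q'\<in>U. f q - 1/4 \<le> f q'))" if "p \<in> K" for p
  proof -
    have "p \<in> D" using that K by blast
    then obtain \<delta> where "0 < \<delta>" "\<forall>\<epsilon>\<in>J. 0 < \<epsilon> \<and> 2 * \<delta> \<le> \<epsilon> + \<phi> p" using J by blast
    then show ?thesis using Lsol_osc[of p \<delta> J] D(2) \<open>p \<in> D\<close> by blast
  qed
  then obtain U where U: "\<And>p. p \<in> K \<Longrightarrow> openin (top_of_set M) (U p) \<and> p \<in> U p \<and>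
    (\<forall>\<epsilon>\<in>J. \<forall>f. Lsol \<epsilon> f \<and> (\<forall>q\<in>M. \<bar>f q\<bar> \<le> 2) \<longrightarrow> (\<forall>q\<in>U p. \<forall>q'\<in>U p. f q - 1/4 \<le> f q'))" by metis
  have "\<exists>\<kappa>>0. dominates J (U p) \<kappa> K"
    if p: "p \<in> K" for p
  proof -
    have "reach J (U p) x" if "x \<in> K" for x
      using reach_connected[OF D J, of "U p" p x] U[OF p] K p that by blast
    then have "\<forall>x\<in>K. \<exists>V \<kappa>. openin (top_of_set M) V \<and> x \<in> V \<and> 0 < \<kappa> \<and> dominates J (U p) \<kappa> V"
      unfolding reach_def by blast
    then obtain V \<kappa> where V: "\<And>x. x \<in> K \<Longrightarrow> openin (top_of_set M) (V x) \<and> x \<in> V x \<and> 0 < \<kappa> x \<and>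
      dominates J (U p) (\<kappa> x) (V x)"
      by metis
    have "openin (top_of_set M) (V x) \<and> x \<in> V x" if "x \<in> K" for x using V[OF that] by blast
    from finite_openin_cover[OF K(1) KM this]
    obtain F where F: "finite F" "F \<subseteq> K" "K \<subseteq> (\<Union>x\<in>F. V x)" by blast
    obtain \<kappa>0 where \<kappa>0: "0 < \<kappa>0" "\<forall>x\<in>F. \<kappa>0 \<le> \<kappa> x" using finite_pos_lower_bound[OF F(1), of \<kappa>] V F(2) by blast
    have "dominates J (U p) \<kappa>0 K"
      unfolding dominates_def
    proof (intro ballI allI impI)
      fix \<epsilon> v m x assume e: "\<epsilon> \<in> J" and v: "Lsol \<epsilon> v \<and> (\<forall>q\<in>M. 0 \<le> v q) \<and> 0 \<le> m \<and> (\<forall>q\<in>U p. m \<le> v q)" and x: "x \<in> K"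
      obtain z where z: "z \<in> F" "x \<in> V z" using F(3) x by blast
      have zK: "z \<in> K" using z F(2) by blast
      have "\<kappa>0 * m \<le> \<kappa> z * m" using \<kappa>0(2) z v by (intro mult_right_mono) auto
      also have "\<dots> \<le> v x" using dominatesD[OF _ e, of "U p" "\<kappa> z" "V z"] V[OF zK] z(2) v by blast
      finally show "\<kappa>0 * m \<le> v x" .
    qed
    then show ?thesis using \<kappa>0(1) by blast
  qed
  then obtain \<kappa> where \<kappa>: "\<And>p. p \<in> K \<Longrightarrow> 0 < \<kappa> p \<and>
    dominates J (U p) (\<kappa> p) K"
    by metis
  have "openin (top_of_set M) (U x) \<and> x \<in> U x" if "x \<in> K" for x using U[OF that] by blast
  from finite_openin_cover[OF K(1) KM this]
  obtain F where F: "finite F" "F \<subseteq> K" "K \<subseteq> (\<Union>x\<in>F. U x)" by blast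
  obtain \<kappa>0 where \<kappa>0: "0 < \<kappa>0" "\<forall>x\<in>F. \<kappa>0 \<le> \<kappa> x" using finite_pos_lower_bound[OF F(1), of \<kappa>] \<kappa> F(2) by blast
  show ?thesis
  proof (intro exI[of _ "\<kappa>0 / 4"] conjI ballI allI impI)
    show "0 < \<kappa>0 / 4" using \<kappa>0 by simp
    fix \<epsilon> v y assume e: "\<epsilon> \<in> J"
      and v: "Lsol \<epsilon> v \<and> (\<forall>q\<in>M. 0 \<le> v q \<and> v q \<le> 2) \<and> (\<exists>x\<in>K. 1/2 \<le> v x)" and y: "y \<in> K"
    then obtain x where x: "x \<in> K" "1/2 \<le> v x" by blast
    obtain p where p: "p \<in> F" "x \<in> U p" using F(3) x(1) by blast
    have pK: "p \<in> K" using p F(2) by blast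
    have "\<forall>q\<in>M. \<bar>v q\<bar> \<le> 2" using v by auto
    then have "\<forall>q'\<in>U p. v x - 1/4 \<le> v q'" using U[OF pK] e v p(2) by blast
    then have "\<forall>q\<in>U p. 1/4 \<le> v q" using x(2) by fastforce
    then have "\<kappa> p * (1/4) \<le> v y" using dominatesD[OF \<kappa>[OF pK, THEN conjunct2] e, of v "1/4" y] v y by auto
    moreover have "\<kappa>0 \<le> \<kappa> p" using \<kappa>0 p by blast
    ultimately show "\<kappa>0 / 4 \<le> v y" by linarith
  qed
qed

section \<open>The strong maximum principle\<close>

lemma interior_connected:
  assumes "connected M" shows "connected (M - bd)"
proof -
  have "\<exists>U. openin (top_of_set M) U \<and> q \<in> U \<and> connected (U - bd)" if q: "q \<in> M" for q
  proof -
    obtain c where c: "c \<in> A" "q \<in> fst c" using obtain_chart q by blast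
    have "openin (top_of_set M) M" by simp
    from obtain_nbhd[OF this q c] obtain r where r: "0 < r" "ball (snd c q) r \<inter> half_space \<subseteq> chart_image c"
      "cball_nbhd c (snd c q) r \<subseteq> M" "q \<in> cball_nbhd c (snd c q) r" .
    show ?thesis
      using cball_nbhd_openin[OF c(1) r(2)] cball_nbhd_connected[OF c(1) r(2)] r(4)
      by (intro exI[of _ "cball_nbhd c (snd c q) r"] conjI)
  qed
  then obtain U where U: "\<And>q. q \<in> M \<Longrightarrow> openin (top_of_set M) (U q) \<and> q \<in> U q \<and> connected (U q - bd)" by metis
  have "connected (\<Union>q\<in>M. U q - bd)" using connected_interior_union[OF assms subset_refl, of U] U by blast
  moreover have "(\<Union>q\<in>M. U q - bd) = M - bd" using U openin_imp_subset by blast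
  ultimately show ?thesis by simp
qed

text \<open>If |f| is maximal at an interior point, the deficit \<open>v\<close> is a nonnegative
  solution with a zero there. The chain argument for the single parameter \<epsilon> forces
  \<open>v\<close> to vanish throughout the interior, and by density also at the boundary.\<close>

lemma max_on_boundary:
  assumes M: "compact M" "connected M" and ne: "bd \<noteq> {}" and e: "0 < \<epsilon>" and f: "Lsol \<epsilon> f"
  shows "\<exists>q\<in>bd. \<forall>p\<in>M. \<bar>f p\<bar> \<le> \<bar>f q\<bar>"
proof -
  have cf: "continuous_on M f" by (rule smooth_fun_continuous[OF Lsol_smooth[OF f]])
  have "continuous_on M (\<lambda>p. \<bar>f p\<bar>)" using cf by (intro continuous_intros)
  moreover have "M \<noteq> {}" using ne bd_sub by blast
  ultimately obtain p where p: "p \<in> M" "\<And>q. q \<in> M \<Longrightarrow> \<bar>f q\<bar> \<le> \<bar>f p\<bar>"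
    using continuous_attains_sup[OF M(1)] by metis
  show ?thesis
  proof (cases "p \<in> bd")
    case False
    define s where "s = (if 0 \<le> f p then 1 else - 1 :: real)"
    define v where "v q = - s * f q + \<bar>f p\<bar>" for q
    have v: "Lsol \<epsilon> v" unfolding v_def[abs_def] by (rule Lsol_affine[OF e f])
    have v0: "0 \<le> v q" if "q \<in> M" for q using p(2)[OF that] by (auto simp: v_def s_def)
    have vp: "v p = 0" by (simp add: v_def s_def)
    have zero: "v q = 0" if q: "q \<in> M - bd" for q
    proof (rule ccontr)
      assume "v q \<noteq> 0"
      then have vq: "0 < v q" using v0[of q] q by simp
      define U0 where "U0 = M \<inter> v -` {v q / 2<..}"
      have U0: "openin (top_of_set M) U0" unfolding U0_def
        by (rule continuous_openin_preimage_gen[OF smooth_fun_continuous[OF Lsol_smooth[OF v]]]) simp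
      have qU: "q \<in> U0" using q vq by (simp add: U0_def)
      \<comment> \<open>For a fixed parameter \<delta> = \<epsilon>/2 works even where \<phi>
        vanishes.\<close>
      have "\<exists>\<delta>>0. \<forall>\<epsilon>'\<in>{\<epsilon>}. 0 < \<epsilon>' \<and> 2 * \<delta> \<le> \<epsilon>' + \<phi> x" if "x \<in> M - bd" for x
        using e phi_nonneg[of x] that by (intro exI[of _ "\<epsilon> / 2"]) auto
      then have "reach {\<epsilon>} U0 p"
        using reach_connected[OF interior_connected[OF M(2)] subset_refl, of "{\<epsilon>}" U0 q p] U0 qU q False p(1) by blast
      then obtain U \<kappa> where U: "p \<in> U" "0 < \<kappa>" "dominates {\<epsilon>} U0 \<kappa> U"
        unfolding reach_def by blast
      have "\<kappa> * (v q / 2) \<le> v p"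
        by (rule dominatesD[OF U(3) _ v v0 _ _ U(1)]) (use vq in \<open>auto simp: U0_def\<close>)
      moreover have "0 < \<kappa> * (v q / 2)" using U(2) vq by simp
      ultimately show False using vp by linarith
    qed
    obtain q where q: "q \<in> bd" using ne by blast
    have qM: "q \<in> M" using q bd_sub by blast
    have "v q = 0"
    proof (rule ccontr)
      assume "v q \<noteq> 0"
      then have vq: "0 < v q" using v0[OF qM] by simp
      have "openin (top_of_set M) (M \<inter> v -` {0<..})"
        by (rule continuous_openin_preimage_gen[OF smooth_fun_continuous[OF Lsol_smooth[OF v]]]) simp
      moreover have "q \<in> M \<inter> v -` {0<..}" using qM vq by simp
      ultimately obtain x where "x \<in> M \<inter> v -` {0<..}" "x \<notin> bd" using interior_dense by blast
      then show False using zero[of x] by auto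
    qed
    then have "\<bar>f q\<bar> = \<bar>f p\<bar>" by (auto simp: v_def s_def split: if_splits)
    then show ?thesis using p(2) by (intro bexI[of _ q] q) simp
  qed (use p in blast)
qed

section \<open>Normal derivatives and the collar barrier\<close>

text \<open>Orthogonality to the boundary directions makes \<open>G *v \<nu>\<close> a multiple of
  \<open>axis None 1\<close>; length and sign fix the multiple. The explicit formula replaces the
  definite description and shows that normal derivatives depend continuously on the point.\<close>

lemma outward_normal_eq:
  assumes c: "c \<in> A" and p: "p \<in> fst c"
  shows "outward_normal g c p =
    - (1 / sqrt (matrix_inv (g c p) $ None $ None)) *\<^sub>R (\<chi> i. matrix_inv (g c p) $ i $ None)"
    and "0 < matrix_inv (g c p) $ None $ None"
proof -
  define G where "G = g c p"
  define B where "B = matrix_inv G"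
  define a where "a = B $ None $ None"
  let ?e = "axis None 1 :: 'm model"
  have pos: "v \<noteq> 0 \<Longrightarrow> 0 < v \<bullet> (G *v v)" for v using g_pos[OF c p] by (simp add: G_def)
  have inv: "invertible G" by (rule posdef_invertible[OF pos])
  note GB = matrix_inv_props[OF inv, folded B_def]
  have "0 < (\<Sum>i\<in>UNIV. \<Sum>j\<in>UNIV. B $ i $ j * (?e $ i * ?e $ j))"
    unfolding B_def by (rule posdef_matrix_inv(2)[OF pos]) (use g_sym[OF c p] in \<open>auto simp: G_def axis_def\<close>)
  also have "\<dots> = (\<Sum>i\<in>UNIV. ?e $ i * (\<Sum>j\<in>UNIV. ?e $ j * B $ i $ j))"
    by (simp add: sum_distrib_left mult_ac)
  also have "\<dots> = a" unfolding sum_axis a_def ..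
  finally have a: "0 < a" .
  then show "0 < matrix_inv (g c p) $ None $ None" by (simp add: a_def B_def G_def)
  define w where "w = (\<chi> i. B $ i $ None)"
  have w: "w = B *v ?e" by (simp add: w_def matrix_vector_mult_basis column_def)
  have Gw: "G *v w = ?e" by (simp add: w matrix_vector_mul_assoc GB)
  define s where "s = 1 / sqrt a"
  have s: "0 < s" "s * s * a = 1" using a by (auto simp: s_def)
  define \<nu> where "\<nu> = - s *\<^sub>R w"
  have G\<nu>: "G *v \<nu> = - s *\<^sub>R ?e" unfolding \<nu>_def by (simp only: matrix_vector_mult_scaleR Gw)
  have wN: "w $ None = a" by (simp add: w_def a_def)
  have "outward_normal g c p = \<nu>"
    unfolding outward_normal_def G_def[symmetric]
  proof (rule the_equality)
    show "(\<forall>v. v $ None = 0 \<longrightarrow> v \<bullet> (G *v \<nu>) = 0) \<and> \<nu> \<bullet> (G *v \<nu>) = 1 \<and> \<nu> $ None < 0"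
      unfolding G\<nu> using s a by (simp add: inner_axis \<nu>_def wN mult.assoc)
  next
    fix \<mu> assume \<mu>: "(\<forall>v. v $ None = 0 \<longrightarrow> v \<bullet> (G *v \<mu>) = 0) \<and> \<mu> \<bullet> (G *v \<mu>) = 1 \<and> \<mu> $ None < 0"
    define t where "t = (G *v \<mu>) $ None"
    have "(G *v \<mu>) $ i = (t *\<^sub>R ?e) $ i" for i
    proof (cases "i = None")
      case False
      have "(axis i 1 :: 'm model) $ None = 0" using False by (auto simp: axis_def)
      then have "axis i 1 \<bullet> (G *v \<mu>) = 0" using \<mu> by blast
      then have "(G *v \<mu>) $ i = 0" by (simp add: cart_eq_inner_axis inner_commute)
      then show ?thesis using False by (auto simp: axis_def)
    qed (simp add: t_def)
    then have Gm: "G *v \<mu> = t *\<^sub>R ?e" unfolding vec_eq_iff by blast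
    have "\<mu> = B *v (G *v \<mu>)" by (simp add: matrix_vector_mul_assoc GB)
    then have m: "\<mu> = t *\<^sub>R w" unfolding Gm w by (simp only: matrix_vector_mult_scaleR)
    have mN: "\<mu> $ None = t * a" by (simp add: m wN)
    have tn: "t < 0" using \<mu> mN a by (simp add: mult_less_0_iff)
    have "\<mu> \<bullet> (G *v \<mu>) = t * (t * a)" unfolding Gm by (simp add: inner_axis mN)
    then have "t * t * a = s * s * a" using \<mu> s by (simp add: mult.assoc)
    then have "t * t = s * s" using a by simp
    then have "t = s \<or> t = - s" by (simp add: square_eq_iff)
    then have "t = - s" using tn s by linarith
    then show "\<mu> = \<nu>" by (simp add: m \<nu>_def)
  qed
  then show "outward_normal g c p =
    - (1 / sqrt (matrix_inv (g c p) $ None $ None)) *\<^sub>R (\<chi> i. matrix_inv (g c p) $ i $ None)"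
    by (simp only: \<nu>_def s_def w_def a_def B_def G_def)
qed

lemma outward_normal_neg:
  assumes "c \<in> A" "p \<in> fst c" shows "outward_normal g c p $ None < 0"
  unfolding outward_normal_eq(1)[OF assms] using outward_normal_eq(2)[OF assms] by simp

lemma normal_deriv_local:
  assumes c: "c \<in> A" "p \<in> fst c" and F: "Cinf (ball x r) F" "snd c p \<in> ball x r"
    "\<And>y. y \<in> ball x r \<Longrightarrow> y \<in> half_space \<Longrightarrow> (f \<circ> chart_inv c) y = F y"
  shows "normal_deriv g c f p = (\<Sum>i\<in>UNIV. outward_normal g c p $ i * pd i F (snd c p))"
proof -
  have h: "snd c p \<in> half_space" using chart_image_half[OF c(1)] c(2) by blast
  have "frechet_derivative (f \<circ> chart_inv c) (at (snd c p) within half_space) = frechet_derivative F (at (snd c p))"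
    by (rule frechet_derivative_half_space[OF has_derivative_half_space[OF F(1,2) h F(3)] h])
  also have "\<dots> = (\<lambda>v. \<Sum>i\<in>UNIV. v $ i * pd i F (snd c p))"
    by (rule frechet_derivative_at[OF has_derivative_pd[OF Cinf_differentiable[OF F(1,2)]], symmetric])
  finally show ?thesis by (simp add: normal_deriv_def)
qed

lemma smooth_extension:
  assumes f: "smooth_fun A f" and c: "c \<in> A" "p \<in> fst c"
  obtains r F where "0 < r" "ball (snd c p) r \<inter> half_space \<subseteq> chart_image c" "Cinf (ball (snd c p) r) F"
    "\<forall>y. y \<in> ball (snd c p) r \<longrightarrow> y \<in> half_space \<longrightarrow> F y = (f \<circ> chart_inv c) y"
  by (rule smooth_fun_local[OF f c(1) imageI[OF c(2)]]) (rule that; assumption)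

lemma normal_deriv_lincomb:
  assumes c: "c \<in> A" "p \<in> fst c" and f: "smooth_fun A f" and h: "smooth_fun A h"
  shows "normal_deriv g c (\<lambda>q. a * f q + b * h q) p = a * normal_deriv g c f p + b * normal_deriv g c h p"
proof -
  obtain r1 F where F: "0 < r1" "ball (snd c p) r1 \<inter> half_space \<subseteq> chart_image c" "Cinf (ball (snd c p) r1) F"
    "\<forall>y. y \<in> ball (snd c p) r1 \<longrightarrow> y \<in> half_space \<longrightarrow> F y = (f \<circ> chart_inv c) y" by (rule smooth_extension[OF f c])
  obtain r2 H where H: "0 < r2" "ball (snd c p) r2 \<inter> half_space \<subseteq> chart_image c" "Cinf (ball (snd c p) r2) H"
    "\<forall>y. y \<in> ball (snd c p) r2 \<longrightarrow> y \<in> half_space \<longrightarrow> H y = (h \<circ> chart_inv c) y" by (rule smooth_extension[OF h c])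
  let ?x = "snd c p" and ?r = "min r1 r2"
  have xr: "?x \<in> ball ?x ?r" using F(1) H(1) by simp
  have CF: "Cinf (ball ?x ?r) F" by (rule Cinf_subset[OF F(3)]) auto
  have CH: "Cinf (ball ?x ?r) H" by (rule Cinf_subset[OF H(3)]) auto
  have C: "Cinf (ball ?x ?r) (\<lambda>y. a * F y)" "Cinf (ball ?x ?r) (\<lambda>y. b * H y)"
    by (rule Cinf_mult[OF Cinf_const[OF open_ball] CF] Cinf_mult[OF Cinf_const[OF open_ball] CH])+
  note d = Cinf_differentiable[OF CF xr] Cinf_differentiable[OF CH xr] Cinf_differentiable[OF C(1) xr] Cinf_differentiable[OF C(2) xr]
  have "normal_deriv g c (\<lambda>q. a * f q + b * h q) p = (\<Sum>i\<in>UNIV. outward_normal g c p $ i * pd i (\<lambda>y. a * F y + b * H y) ?x)"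
    by (rule normal_deriv_local[OF c Cinf_add[OF C] xr]) (use F(4) H(4) in auto)
  also have "\<dots> = (\<Sum>i\<in>UNIV. a * (outward_normal g c p $ i * pd i F ?x) + b * (outward_normal g c p $ i * pd i H ?x))"
    using pd_mult[OF differentiable_const d(1), of _ a] pd_mult[OF differentiable_const d(2), of _ b]
    by (intro sum.cong refl) (simp add: pd_add[OF d(3,4)] algebra_simps)
  also have "\<dots> = a * normal_deriv g c f p + b * normal_deriv g c h p"
    using normal_deriv_local[OF c CF xr, of f] normal_deriv_local[OF c CH xr, of h] F(4) H(4)
    by (simp add: sum.distrib sum_distrib_left)
  finally show ?thesis .
qed

lemma normal_deriv_const:
  assumes c: "c \<in> A" "p \<in> fst c"
  shows "normal_deriv g c (\<lambda>q. k) p = 0"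
  using normal_deriv_local[OF c, of "snd c p" 1 "\<lambda>y. k" "\<lambda>q. k"] by simp

lemma normal_deriv_sum:
  assumes c: "c \<in> A" "p \<in> fst c" and f: "\<And>i. i \<in> I \<Longrightarrow> smooth_fun A (f i)"
  shows "normal_deriv g c (\<lambda>q. \<Sum>i\<in>I. a i * f i q) p = (\<Sum>i\<in>I. a i * normal_deriv g c (f i) p)"
  using f
proof (induction I rule: infinite_finite_induct)
  case (insert i I)
  have "smooth_fun A (\<lambda>q. \<Sum>i\<in>I. a i * f i q)"
    using insert.prems by (intro smooth_fun_sum smooth_fun_mult smooth_fun_const) auto
  then show ?case using normal_deriv_lincomb[OF c, of "f i" "\<lambda>q. \<Sum>i\<in>I. a i * f i q" "a i" 1] insert by simp
qed (simp_all add: normal_deriv_const[OF c])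

text \<open>Small steps from \<open>p\<close> along minus the outward normal stay in the half-space,
  and the function cannot grow along them. This sign takes over the role of integration by parts in
  the study of the Dirichlet-to-Neumann operator.\<close>

lemma normal_deriv_local_max:
  assumes c: "c \<in> A" "p \<in> fst c" and f: "smooth_fun A f" and U: "openin (top_of_set M) U" "p \<in> U"
    and max: "\<And>q. q \<in> U \<Longrightarrow> f q \<le> f p"
  shows "0 \<le> normal_deriv g c f p"
proof (rule ccontr)
  assume neg: "\<not> 0 \<le> normal_deriv g c f p"
  let ?x = "snd c p" and ?\<nu> = "outward_normal g c p"
  obtain r1 F where F: "0 < r1" "ball ?x r1 \<inter> half_space \<subseteq> chart_image c" "Cinf (ball ?x r1) F"
    "\<forall>y. y \<in> ball ?x r1 \<longrightarrow> y \<in> half_space \<longrightarrow> F y = (f \<circ> chart_inv c) y" by (rule smooth_extension[OF f c])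
  obtain r2 where r2: "0 < r2" "ball ?x r2 \<inter> half_space \<subseteq> chart_image c" "cball_nbhd c ?x r2 \<subseteq> U" "p \<in> cball_nbhd c ?x r2"
    by (rule obtain_nbhd[OF U c])
  have xh: "?x \<in> half_space" using chart_image_half[OF c(1)] c(2) by blast
  have x1: "?x \<in> ball ?x r1" using F(1) by simp
  have nd: "normal_deriv g c f p = (\<Sum>i\<in>UNIV. ?\<nu> $ i * pd i F ?x)"
    by (rule normal_deriv_local[OF c F(3) x1]) (use F(4) in auto)
  have "((\<lambda>t. F (?x + t *\<^sub>R (- ?\<nu>))) has_real_derivative (\<Sum>i\<in>UNIV. (- ?\<nu>) $ i * pd i F (?x + 0 *\<^sub>R (- ?\<nu>)))) (at 0)"
    by (rule DERIV_line) (use Cinf_differentiable[OF F(3) x1] in simp)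
  moreover have "(\<Sum>i\<in>UNIV. (- ?\<nu>) $ i * pd i F (?x + 0 *\<^sub>R (- ?\<nu>))) = - normal_deriv g c f p"
    by (simp add: nd sum_negf)
  ultimately have "((\<lambda>t. F (?x + t *\<^sub>R (- ?\<nu>))) has_real_derivative - normal_deriv g c f p) (at 0)" by simp
  from DERIV_pos_inc_right[OF this] neg obtain d where d: "0 < d" "\<And>t. 0 < t \<Longrightarrow> t < d \<Longrightarrow> F (?x + 0 *\<^sub>R (- ?\<nu>)) < F (?x + t *\<^sub>R (- ?\<nu>))"
    by auto
  define e where "e = min d (min r1 r2 / (norm ?\<nu> + 1))"
  have n1: "0 < norm ?\<nu> + 1" by (simp add: add_nonneg_pos)
  have e: "0 < e" using d(1) F(1) r2(1) n1 by (simp add: e_def)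
  define t where "t = e / 2"
  have t: "0 < t" "t < d" "t * (norm ?\<nu> + 1) < min r1 r2"
  proof -
    have "t < e" using e by (simp add: t_def)
    moreover have "e \<le> d" "e \<le> min r1 r2 / (norm ?\<nu> + 1)" by (simp_all add: e_def)
    ultimately have "t < min r1 r2 / (norm ?\<nu> + 1)" "t < d" by linarith+
    then show "0 < t" "t < d" using e by (simp_all add: t_def)
    have "t < min r1 r2 / (norm ?\<nu> + 1)" by fact
    then show "t * (norm ?\<nu> + 1) < min r1 r2" using n1 by (simp only: pos_less_divide_eq)
  qed
  let ?y = "?x + t *\<^sub>R (- ?\<nu>)"
  have "dist ?x ?y = t * norm ?\<nu>" using t(1) by (simp add: dist_norm)
  also have "\<dots> \<le> t * (norm ?\<nu> + 1)" using t(1) by simp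
  finally have y: "?y \<in> ball ?x r1" "?y \<in> ball ?x r2" using t(3) by auto
  have "0 \<le> ?y $ None" using None_nonneg[OF c] outward_normal_neg[OF c] t(1) by (simp add: mult_nonneg_nonpos less_imp_le diff_le_eq le_diff_eq order_trans[of _ 0])
  then have yh: "?y \<in> half_space" by (simp add: half_space_def)
  have "chart_inv c ?y \<in> U" using r2(3) y(2) yh unfolding cball_nbhd_def by blast
  then have "f (chart_inv c ?y) \<le> f p" by (rule max)
  moreover have "F ?y = f (chart_inv c ?y)" using F(4) y(1) yh by simp
  moreover have "F ?x = f p" using F(4) x1 xh c by simp
  ultimately show False using d(2)[OF t(1,2)] by simp
qed

text \<open>A power (\<epsilon> + \<phi>)^\<beta> with 0 < \<beta> < 1, scaled by
  \<epsilon>^(1-\<beta>) / \<beta>. The scaling makes the derivative with respect to \<phi> equal to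
  1 at \<phi> = 0, so on the boundary the normal derivative is that of \<phi>, while the size tends
  to 0 with \<epsilon>. The exponent 1/2 is one convenient choice.\<close>

definition barrier :: "real \<Rightarrow> 'a \<Rightarrow> real" where
  "barrier \<epsilon> q = 2 * sqrt \<epsilon> * sqrt (\<epsilon> + \<phi> q)"

lemma barrier_deriv:
  assumes "0 < \<epsilon> + t"
  shows "((\<lambda>t. 2 * sqrt \<epsilon> * sqrt (\<epsilon> + t)) has_real_derivative sqrt \<epsilon> * inverse (sqrt (\<epsilon> + t))) (at t)"
    and "((\<lambda>t. sqrt \<epsilon> * inverse (sqrt (\<epsilon> + t))) has_real_derivative - (1/2) * (sqrt \<epsilon> * inverse (sqrt (\<epsilon> + t))) * inverse (\<epsilon> + t)) (at t)"
proof -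
  have s: "0 < sqrt (\<epsilon> + t)" "sqrt (\<epsilon> + t) * sqrt (\<epsilon> + t) = \<epsilon> + t" using assms by auto
  have d: "((\<lambda>t. sqrt (\<epsilon> + t)) has_real_derivative inverse (sqrt (\<epsilon> + t)) / 2) (at t)"
    using assms by (auto intro!: derivative_eq_intros)
  show "((\<lambda>t. 2 * sqrt \<epsilon> * sqrt (\<epsilon> + t)) has_real_derivative sqrt \<epsilon> * inverse (sqrt (\<epsilon> + t))) (at t)"
    by (rule DERIV_cong[OF DERIV_cmult[OF d]]) simp
  have "((\<lambda>t. inverse (sqrt (\<epsilon> + t))) has_real_derivative - (inverse (sqrt (\<epsilon> + t)) * (inverse (sqrt (\<epsilon> + t)) / 2) * inverse (sqrt (\<epsilon> + t)))) (at t)"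
    using DERIV_inverse'[OF d] s by simp
  from DERIV_cmult[OF this, of "sqrt \<epsilon>"]
  show "((\<lambda>t. sqrt \<epsilon> * inverse (sqrt (\<epsilon> + t))) has_real_derivative - (1/2) * (sqrt \<epsilon> * inverse (sqrt (\<epsilon> + t))) * inverse (\<epsilon> + t)) (at t)"
  proof (rule DERIV_cong)
    define j where "j = inverse (sqrt (\<epsilon> + t))"
    have "inverse (\<epsilon> + t) = j * j" unfolding j_def inverse_mult_distrib[symmetric] s(2) ..
    then show "sqrt \<epsilon> * - (inverse (sqrt (\<epsilon> + t)) * (inverse (sqrt (\<epsilon> + t)) / 2) * inverse (sqrt (\<epsilon> + t)))
      = - (1/2) * (sqrt \<epsilon> * inverse (sqrt (\<epsilon> + t))) * inverse (\<epsilon> + t)"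
      unfolding j_def[symmetric] by simp
  qed
qed

text \<open>For \<open>n \<ge> 3\<close> the singular drift \<open>(n - 2) \<nabla>\<phi> / (\<epsilon> + \<phi>)\<close> outweighs the concavity of the square root; for
  \<open>n = 2\<close> it is absent and the barrier fails.\<close>

lemma barrier_subharmonic:
  assumes D: "datum c x R G \<Phi>" and e: "0 < \<epsilon>" and y: "y \<in> ball x R" "0 < y $ None"
    and \<gamma>: "0 < \<gamma>" "\<gamma> \<le> Gam (inv_coeff G y) \<Phi> \<Phi> y"
    and C: "\<bar>Lop (inv_coeff G y) (drift0 G y) \<Phi> y\<bar> \<le> C" and small: "(\<epsilon> + \<Phi> y) * (2 * C) < \<gamma>"
  shows "0 < Lop (inv_coeff G y) (drift G \<Phi> \<epsilon> y) (\<lambda>z. 2 * sqrt \<epsilon> * sqrt (\<epsilon> + \<Phi> z)) y"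
proof -
  let ?B = "ball x R \<inter> {y. 0 < y $ None}"
  have oB: "open ?B" by (auto intro!: open_Int open_Collect_less continuous_intros)
  have yB: "y \<in> ?B" using y by simp
  have P: "Cinf ?B \<Phi>" using D Cinf_subset[OF _ oB] by (auto simp: datum_def)
  have Bpos: "0 < \<epsilon> + \<Phi> z" if "z \<in> ?B" for z
    using eps_phi_pos(2)[OF D _ _ e, of z] that by (auto simp: half_space_def)
  have yh: "y \<in> half_space" using y(2) by (simp add: half_space_def)
  define s where "s = sqrt \<epsilon> * inverse (sqrt (\<epsilon> + \<Phi> y))"
  define i where "i = inverse (\<epsilon> + \<Phi> y)"
  have s: "0 < s" and i: "0 < i" using e Bpos[OF yB] by (auto simp: s_def i_def)
  let ?G = "Gam (inv_coeff G y) \<Phi> \<Phi> y" and ?L0 = "Lop (inv_coeff G y) (drift0 G y) \<Phi> y"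
  have "Lop (inv_coeff G y) (drift G \<Phi> \<epsilon> y) (\<lambda>z. 2 * sqrt \<epsilon> * sqrt (\<epsilon> + \<Phi> z)) y
      = s * Lop (inv_coeff G y) (drift G \<Phi> \<epsilon> y) \<Phi> y + (- (1/2) * s * i) * ?G"
    unfolding s_def i_def
    by (rule Lop_chain[OF P yB, where \<eta>="\<lambda>t. 2 * sqrt \<epsilon> * sqrt (\<epsilon> + t)" and \<eta>'="\<lambda>t. sqrt \<epsilon> * inverse (sqrt (\<epsilon> + t))"])
      (intro barrier_deriv Bpos yB; assumption)+
  moreover have "Lop (inv_coeff G y) (drift G \<Phi> \<epsilon> y) \<Phi> y = ?L0 + i * (real (CARD('m option) - 2) * ?G)"
  proof -
    have "(\<Sum>j\<in>UNIV. drift1 G \<Phi> y j * pd j \<Phi> y) = real (CARD('m option) - 2) * ?G"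
      unfolding drift1_def Gam_def sum_distrib_left sum_distrib_right
      by (subst sum.swap) (simp add: mult_ac)
    moreover have "drift G \<Phi> \<epsilon> y j * pd j \<Phi> y = drift0 G y j * pd j \<Phi> y + i * (drift1 G \<Phi> y j * pd j \<Phi> y)" for j
      unfolding drift_def i_def[symmetric] by (simp add: algebra_simps)
    then have "(\<Sum>j\<in>UNIV. drift G \<Phi> \<epsilon> y j * pd j \<Phi> y) = (\<Sum>j\<in>UNIV. drift0 G y j * pd j \<Phi> y) + i * (\<Sum>j\<in>UNIV. drift1 G \<Phi> y j * pd j \<Phi> y)"
      by (simp only: sum.distrib sum_distrib_left)
    ultimately show ?thesis unfolding Lop_def by (simp only: add.assoc)
  qed
  \<comment> \<open>The singular drift contributes at least \<open>i * ?G\<close>, and the concavity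
    of the root costs half of it. The other half beats the bounded part \<open>?L0\<close> once
    \<open>\<epsilon> + \<Phi> y\<close> is small compared with \<open>\<gamma> / C\<close>.\<close>
  moreover have "0 < ?L0 + i * (real (CARD('m option) - 2) * ?G) - (1/2) * i * ?G"
  proof -
    have "1 \<le> CARD('m option) - 2" using dim3 by linarith
    then have "1 \<le> real (CARD('m option) - 2)" by (simp only: real_of_nat_ge_one_iff)
    then have "1 * ?G \<le> real (CARD('m option) - 2) * ?G" using \<gamma> by (intro mult_right_mono) auto
    then have 1: "i * ?G \<le> i * (real (CARD('m option) - 2) * ?G)" using i by (intro mult_left_mono) auto
    have "2 * C < \<gamma> * i"
      using small Bpos[OF yB] unfolding i_def by (simp add: divide_inverse[symmetric] pos_less_divide_eq mult.commute)
    also have "\<dots> \<le> i * ?G" using \<gamma> i by (simp add: mult.commute)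
    finally have "- (i * ?G) / 2 < ?L0" using C by linarith
    then show ?thesis using 1 by (simp add: algebra_simps)
  qed
  ultimately have "Lop (inv_coeff G y) (drift G \<Phi> \<epsilon> y) (\<lambda>z. 2 * sqrt \<epsilon> * sqrt (\<epsilon> + \<Phi> z)) y
     = s * (?L0 + i * (real (CARD('m option) - 2) * ?G) - (1/2) * i * ?G)" by (simp add: algebra_simps)
  then show ?thesis using s \<open>0 < ?L0 + _ - _\<close> by simp
qed

text \<open>Beyond the half-space an extension of \<phi> may become negative. The ball is shrunk
  until \<open>\<epsilon> + F\<close> stays positive, so that the root in the barrier remains
  smooth.\<close>

lemma phi_plus_extension:
  assumes c: "c \<in> A" "p \<in> fst c" and e: "0 < \<epsilon>"
  shows "\<exists>r F. 0 < r \<and> Cinf (ball (snd c p) r) F \<and> (\<forall>y\<in>ball (snd c p) r. 0 < \<epsilon> + F y) \<and>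
    (\<forall>y\<in>ball (snd c p) r. y \<in> half_space \<longrightarrow> F y = \<phi> (chart_inv c y))"
proof -
  let ?x = "snd c p"
  obtain r1 F where F: "0 < r1" "ball ?x r1 \<inter> half_space \<subseteq> chart_image c" "Cinf (ball ?x r1) F"
    "\<forall>y. y \<in> ball ?x r1 \<longrightarrow> y \<in> half_space \<longrightarrow> F y = (\<phi> \<circ> chart_inv c) y" by (rule smooth_extension[OF phi_smooth c])
  have "?x \<in> half_space" using chart_image_half[OF c(1)] c(2) by blast
  then have "F ?x = \<phi> p" using F(1,4) c by simp
  then have pos: "0 < \<epsilon> + F ?x" using e phi_nonneg[of p] chart_sub[OF c(1)] c(2) by (simp add: add_pos_nonneg subset_iff)
  have "isCont F ?x" using Cinf_continuous_on[OF F(3)] F(1) by (simp add: continuous_on_eq_continuous_at)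
  then obtain d where d: "0 < d" "\<And>y. dist y ?x < d \<Longrightarrow> dist (F y) (F ?x) < \<epsilon> + F ?x"
    using pos unfolding continuous_at_eps_delta by blast
  have "0 < \<epsilon> + F y" if "y \<in> ball ?x (min r1 d)" for y
  proof -
    have "dist (F y) (F ?x) < \<epsilon> + F ?x" by (rule d(2)) (use that in \<open>simp add: dist_commute\<close>)
    then show ?thesis unfolding dist_real_def by linarith
  qed
  moreover have "Cinf (ball ?x (min r1 d)) F" by (rule Cinf_subset[OF F(3)]) auto
  ultimately show ?thesis using F(1,4) d(1) by (intro exI[of _ "min r1 d"] exI[of _ F]) auto
qed

lemma barrier_smooth:
  assumes e: "0 < \<epsilon>" shows "smooth_fun A (barrier \<epsilon>)"
  unfolding smooth_fun_def smooth_on_iff_Cinf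
proof (intro ballI)
  fix c x assume c: "c \<in> A" and "x \<in> chart_image c"
  then obtain p where p: "p \<in> fst c" "x = snd c p" by blast
  obtain r F where F: "0 < r" "Cinf (ball x r) F" "\<forall>y\<in>ball x r. 0 < \<epsilon> + F y"
    "\<forall>y\<in>ball x r. y \<in> half_space \<longrightarrow> F y = \<phi> (chart_inv c y)"
    using phi_plus_extension[OF c p(1) e] p(2) by blast
  have "Cinf (ball x r) (\<lambda>y. sqrt (\<epsilon> + F y))"
    by (rule Cinf_sqrt[OF Cinf_add[OF Cinf_const[OF open_ball] F(2)]]) (use F(3) in blast)
  then have "Cinf (ball x r) (\<lambda>y. 2 * sqrt \<epsilon> * sqrt (\<epsilon> + F y))"
    by (rule Cinf_mult[OF Cinf_const[OF open_ball]])
  then show "\<exists>W F'. x \<in> W \<and> Cinf W F' \<and> (\<forall>y\<in>chart_image c \<inter> W. F' y = (barrier \<epsilon> \<circ> chart_inv c) y)"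
    using F(1,4) chart_image_half[OF c]
    by (intro exI[of _ "ball x r"] exI[of _ "\<lambda>y. 2 * sqrt \<epsilon> * sqrt (\<epsilon> + F y)"]) (auto simp: barrier_def)
qed

lemma normal_deriv_barrier:
  assumes c: "c \<in> A" "p \<in> fst c" and e: "0 < \<epsilon>" and p: "\<phi> p = 0"
  shows "normal_deriv g c (barrier \<epsilon>) p = normal_deriv g c \<phi> p"
proof -
  let ?x = "snd c p"
  obtain r F where F: "0 < r" "Cinf (ball ?x r) F" "\<forall>y\<in>ball ?x r. 0 < \<epsilon> + F y"
    "\<forall>y\<in>ball ?x r. y \<in> half_space \<longrightarrow> F y = \<phi> (chart_inv c y)"
    using phi_plus_extension[OF c e] by blast
  have x: "?x \<in> ball ?x r" using F(1) by simp
  have "?x \<in> half_space" using chart_image_half[OF c(1)] c(2) by blast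
  then have Fx: "F ?x = 0" using F(4) x p c by simp
  have "Cinf (ball ?x r) (\<lambda>y. sqrt (\<epsilon> + F y))"
    by (rule Cinf_sqrt[OF Cinf_add[OF Cinf_const[OF open_ball] F(2)]]) (use F(3) in blast)
  then have C: "Cinf (ball ?x r) (\<lambda>y. 2 * sqrt \<epsilon> * sqrt (\<epsilon> + F y))"
    by (rule Cinf_mult[OF Cinf_const[OF open_ball]])
  have "((\<lambda>t. 2 * sqrt \<epsilon> * sqrt (\<epsilon> + t)) has_real_derivative 1) (at (F ?x))"
    using barrier_deriv(1)[of \<epsilon> "F ?x"] e unfolding Fx by simp
  then have pd: "pd i (\<lambda>y. 2 * sqrt \<epsilon> * sqrt (\<epsilon> + F y)) ?x = pd i F ?x" for i
    using pd_chain[OF Cinf_differentiable[OF F(2) x], of "\<lambda>t. 2 * sqrt \<epsilon> * sqrt (\<epsilon> + t)" 1 i] by simp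
  have "normal_deriv g c (barrier \<epsilon>) p = (\<Sum>i\<in>UNIV. outward_normal g c p $ i * pd i (\<lambda>y. 2 * sqrt \<epsilon> * sqrt (\<epsilon> + F y)) ?x)"
    by (rule normal_deriv_local[OF c C x]) (use F(4) in \<open>auto simp: barrier_def\<close>)
  also have "\<dots> = normal_deriv g c \<phi> p"
    unfolding pd by (rule normal_deriv_local[OF c F(2) x, symmetric]) (use F(4) in auto)
  finally show ?thesis .
qed

text \<open>At interior points near \<open>p\<close> the function \<open>v + T * barrier\<close> is
  a strict subsolution, because the gradient of \<phi> does not vanish there. At boundary points its
  normal derivative is negative: that of \<open>T * barrier\<close> lies below
  \<open>- T * c0\<close>, that of \<open>v\<close> below \<open>T * c0\<close>. Either way a local
  maximum is impossible.\<close>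

lemma collar_local:
  assumes phi0: "\<And>q. q \<in> bd \<Longrightarrow> \<phi> q = 0"
    and c: "c \<in> A" "p \<in> fst c" and p: "p \<in> bd" and nd: "normal_deriv g c \<phi> p < 0"
  shows "\<exists>U a0 c0. openin (top_of_set M) U \<and> p \<in> U \<and> 0 < a0 \<and> 0 < c0 \<and>
    (\<forall>\<epsilon> v T q. 0 < \<epsilon> \<and> 0 < T \<and> Lsol \<epsilon> v \<and> q \<in> U \<and> (q \<notin> bd \<longrightarrow> \<epsilon> + \<phi> q < a0) \<and>
      (q \<in> bd \<longrightarrow> (\<forall>c\<in>A. q \<in> fst c \<longrightarrow> normal_deriv g c v q < T * c0)) \<longrightarrow>
      \<not> (\<exists>N. openin (top_of_set M) N \<and> q \<in> N \<and> (\<forall>q'\<in>N. v q' + T * barrier \<epsilon> q' \<le> v q + T * barrier \<epsilon> q)))"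
proof -
  let ?x = "snd c p"
  obtain R G \<Phi> where D: "datum c ?x R G \<Phi>" "?x \<in> ball ?x R" using datum_at[OF c] by blast
  have P: "Cinf (ball ?x R) \<Phi>" and R: "0 < R" and sub: "ball ?x R \<inter> half_space \<subseteq> chart_image c"
    and P\<phi>: "\<And>y. y \<in> ball ?x R \<Longrightarrow> y \<in> half_space \<Longrightarrow> \<Phi> y = \<phi> (chart_inv c y)"
    and Gg: "\<And>y. y \<in> ball ?x R \<Longrightarrow> y \<in> half_space \<Longrightarrow> G y = g c (chart_inv c y)"
    using D(1) unfolding datum_def by blast+
  have xh: "?x \<in> half_space" using chart_image_half[OF c(1)] c(2) by blast
  note S = datum_smooth[OF D(1)]
  \<comment> \<open>The normal derivative of \<phi> as a function of the coordinates; its continuity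
    keeps the sign near \<open>p\<close>.\<close>
  define n where "n y = (\<Sum>i\<in>UNIV. (- (1 / sqrt (inv_coeff G y None None)) * inv_coeff G y i None) * pd i \<Phi> y)" for y
  have n: "normal_deriv g c \<phi> q = n (snd c q)" if "q \<in> fst c" "snd c q \<in> ball ?x R" for q
  proof -
    have h: "snd c q \<in> half_space" using chart_image_half[OF c(1)] that(1) by blast
    have "G (snd c q) = g c q" using Gg[OF that(2) h] c(1) that(1) by simp
    then have "outward_normal g c q $ i = - (1 / sqrt (inv_coeff G (snd c q) None None)) * inv_coeff G (snd c q) i None" for i
      unfolding outward_normal_eq(1)[OF c(1) that(1)] inv_coeff_def by simp
    moreover have "normal_deriv g c \<phi> q = (\<Sum>i\<in>UNIV. outward_normal g c q $ i * pd i \<Phi> (snd c q))"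
      by (rule normal_deriv_local[OF c(1) that(1) P that(2)]) (use P\<phi> in auto)
    ultimately show ?thesis by (simp add: n_def)
  qed
  have nx: "n ?x < 0" using n[OF c(2) D(2)] nd by simp
  define \<gamma> where "\<gamma> y = Gam (inv_coeff G y) \<Phi> \<Phi> y" for y
  have "\<exists>i. pd i \<Phi> ?x \<noteq> 0"
  proof (rule ccontr)
    assume "\<not> ?thesis"
    then have "n ?x = 0" by (simp add: n_def)
    then show False using nx by simp
  qed
  then have \<gamma>x: "0 < \<gamma> ?x" unfolding \<gamma>_def Gam_def by (rule datum_pos(2)[OF D(1,2) xh])
  define L0 where "L0 y = Lop (inv_coeff G y) (drift0 G y) \<Phi> y" for y
  define C where "C = \<bar>L0 ?x\<bar> + 1"
  have isC: "isCont f ?x" if "Cinf (ball ?x R) f" for f :: "'m model \<Rightarrow> real"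
    using Cinf_continuous_on[OF that] D(2) by (simp add: continuous_on_eq_continuous_at)
  have "Cinf (ball ?x R) \<gamma>" unfolding \<gamma>_def[abs_def] Gam_def by (intro Cinf_sum Cinf_mult open_ball S Cinf_pd[OF P])
  note c\<gamma> = isC[OF this]
  have "Cinf (ball ?x R) L0" unfolding L0_def[abs_def] Lop_def
    by (intro Cinf_add Cinf_sum Cinf_mult open_ball S Cinf_pd[OF Cinf_pd[OF P]] Cinf_pd[OF P])
  note cL = isC[OF this]
  have aNN: "0 < inv_coeff G ?x None None"
    using outward_normal_eq(2)[OF c] Gg[OF D(2) xh] c by (simp add: inv_coeff_def)
  have cn: "isCont n ?x"
    unfolding isCont_def n_def
  proof (rule tendsto_sum, rule tendsto_mult, rule tendsto_mult, rule tendsto_minus, rule tendsto_divide)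
    show "((\<lambda>y. sqrt (inv_coeff G y None None)) \<longlongrightarrow> sqrt (inv_coeff G ?x None None)) (at ?x)"
      by (rule tendsto_real_sqrt[OF isC[OF S(2), unfolded isCont_def]])
    show "((\<lambda>y. inv_coeff G y i None) \<longlongrightarrow> inv_coeff G ?x i None) (at ?x)" for i
      by (rule isC[OF S(2), unfolded isCont_def])
    show "(pd i \<Phi> \<longlongrightarrow> pd i \<Phi> ?x) (at ?x)" for i
      by (rule isC[OF Cinf_pd[OF P], unfolded isCont_def])
    show "sqrt (inv_coeff G ?x None None) \<noteq> 0" using aNN by simp
  qed (rule tendsto_const)
  have "\<forall>\<^sub>F y in nhds ?x. \<gamma> ?x / 2 < \<gamma> y"
    using order_tendstoD(1)[OF c\<gamma>[unfolded isCont_def tendsto_at_iff_tendsto_nhds], of "\<gamma> ?x / 2"] \<gamma>x by simp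
  moreover have "\<forall>\<^sub>F y in nhds ?x. \<bar>L0 y\<bar> < C"
    using order_tendstoD(2)[OF tendsto_rabs[OF cL[unfolded isCont_def tendsto_at_iff_tendsto_nhds]], of C] by (simp add: C_def)
  moreover have "\<forall>\<^sub>F y in nhds ?x. n y < n ?x / 2"
    using order_tendstoD(2)[OF cn[unfolded isCont_def tendsto_at_iff_tendsto_nhds], of "n ?x / 2"] nx by simp
  ultimately have "\<forall>\<^sub>F y in nhds ?x. \<gamma> ?x / 2 < \<gamma> y \<and> \<bar>L0 y\<bar> < C \<and> n y < n ?x / 2" by (intro eventually_conj)
  then obtain r0 where r0: "0 < r0" "\<And>y. dist y ?x < r0 \<Longrightarrow> \<gamma> ?x / 2 < \<gamma> y \<and> \<bar>L0 y\<bar> < C \<and> n y < n ?x / 2"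
    unfolding eventually_nhds_metric by blast
  define r where "r = min r0 (R / 2)"
  have r: "0 < r" "r \<le> r0" "r \<le> R / 2" using r0 R by (auto simp: r_def)
  have rR: "ball ?x r \<subseteq> ball ?x R" using r R by auto
  have subr: "ball ?x r \<inter> half_space \<subseteq> chart_image c" using sub rR by blast
  have C1: "1 \<le> C" by (simp add: C_def)
  \<comment> \<open>The smallness condition of \<open>barrier_subharmonic\<close> solved for
    \<epsilon> + \<phi>, with half the value of \<open>\<gamma>\<close> at the centre as lower bound
    for the gradient form.\<close>
  define a0 where "a0 = \<gamma> ?x / 2 / (2 * C)"
  have a0: "0 < a0" using \<gamma>x C1 by (simp add: a0_def)
  define c0 where "c0 = - n ?x / 2"
  have c0: "0 < c0" using nx by (simp add: c0_def)
  obtain l where l: "0 < l" "\<forall>y\<in>cball ?x (R/2) \<inter> half_space. elliptic l (inv_coeff G y)"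
    using datum_elliptic[OF D(1), of "R/2"] R by auto
  have main: False
    if e: "0 < \<epsilon>" and T: "0 < T" and v: "Lsol \<epsilon> v" and q: "q \<in> cball_nbhd c ?x r"
      and qi: "q \<notin> bd \<longrightarrow> \<epsilon> + \<phi> q < a0" and qb: "q \<in> bd \<longrightarrow> (\<forall>c\<in>A. q \<in> fst c \<longrightarrow> normal_deriv g c v q < T * c0)"
      and N: "openin (top_of_set M) N" "q \<in> N" "\<forall>q'\<in>N. v q' + T * barrier \<epsilon> q' \<le> v q + T * barrier \<epsilon> q"
    for \<epsilon> v T q N
  proof -
    obtain y where y: "y \<in> ball ?x r" "y \<in> half_space" "q = chart_inv c y" using q unfolding cball_nbhd_def by blast
    have yR: "y \<in> ball ?x R" using y(1) rR by blast
    have yc: "y \<in> chart_image c" using y subr by blast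
    have qc: "q \<in> fst c" "snd c q = y" using chart_inv_in[OF yc] snd_chart_inv[OF c(1) yc] y(3) by auto
    have near: "\<gamma> ?x / 2 < \<gamma> y" "\<bar>L0 y\<bar> < C" "n y < n ?x / 2"
      using r0(2)[of y] y(1) r(2) by (auto simp: dist_commute)
    show False
    proof (cases "q \<in> bd")
      case True
      have "0 \<le> normal_deriv g c (\<lambda>q. 1 * v q + T * barrier \<epsilon> q) q"
        by (rule normal_deriv_local_max[OF c(1) qc(1) _ N(1,2)])
          (use N(3) in \<open>auto intro!: smooth_fun_add smooth_fun_mult smooth_fun_const Lsol_smooth[OF v] barrier_smooth[OF e]\<close>)
      also have "\<dots> = normal_deriv g c v q + T * n y"
        using normal_deriv_lincomb[OF c(1) qc(1) Lsol_smooth[OF v] barrier_smooth[OF e], of 1 T]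
          normal_deriv_barrier[OF c(1) qc(1) e phi0[OF True]] n[OF qc(1)] qc(2) yR by simp
      also have "\<dots> < T * c0 + T * n y" using qb True c(1) qc(1) by simp
      also have "\<dots> \<le> T * c0 + T * (- c0)" using near(3) T by (intro add_left_mono mult_left_mono) (auto simp: c0_def)
      finally show False by simp
    next
      case False
      have ypos: "0 < y $ None" using interior_iff[OF c(1) qc(1)] False qc(2) by simp
      obtain s where s: "0 < s" "ball (snd c q) s \<inter> half_space \<subseteq> chart_image c" "cball_nbhd c (snd c q) s \<subseteq> N" "q \<in> cball_nbhd c (snd c q) s"
        by (rule obtain_nbhd[OF N(1,2) c(1) qc(1)])
      define B where "B = ball y s \<inter> (ball ?x R \<inter> {y. 0 < y $ None})"
      have oB: "open B" unfolding B_def by (auto intro!: open_Int open_Collect_less continuous_intros)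
      have yB: "y \<in> B" using s(1) yR ypos by (simp add: B_def)
      have Bh: "z \<in> half_space" if "z \<in> B" for z using that by (auto simp: B_def half_space_def)
      let ?b = "\<lambda>z. 2 * sqrt \<epsilon> * sqrt (\<epsilon> + \<Phi> z)"
      have C1': "Cinf B (v \<circ> chart_inv c)" by (rule Cinf_subset[OF interior_Cinf[OF D(1) Lsol_smooth[OF v]] oB]) (auto simp: B_def)
      have PB: "Cinf B \<Phi>" by (rule Cinf_subset[OF P oB]) (auto simp: B_def)
      have "Cinf B (\<lambda>z. sqrt (\<epsilon> + \<Phi> z))"
        by (rule Cinf_sqrt[OF Cinf_add[OF Cinf_const[OF oB] PB]])
          (use eps_phi_pos(2)[OF D(1) _ _ e] Bh in \<open>auto simp: B_def\<close>)
      then have C2: "Cinf B ?b" by (rule Cinf_mult[OF Cinf_const[OF oB]])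
      have C3: "Cinf B (\<lambda>z. T * ?b z)" by (rule Cinf_mult[OF Cinf_const[OF oB] C2])
      have bz: "?b z = barrier \<epsilon> (chart_inv c z)" if "z \<in> B" for z
        using P\<phi>[of z] that Bh[OF that] by (simp add: B_def barrier_def)
      have le: "(v \<circ> chart_inv c) z + T * ?b z \<le> (v \<circ> chart_inv c) y + T * ?b y" if z: "z \<in> B" for z
      proof -
        have "chart_inv c z \<in> N" using s(3) z Bh[OF z] unfolding cball_nbhd_def qc(2) by (auto simp: B_def)
        then show ?thesis using N(3) unfolding bz[OF z] bz[OF yB] y(3) by simp
      qed
      have ell: "elliptic l (inv_coeff G y)"
      proof -
        have "y \<in> cball ?x (R/2)" using y(1) r(3) by auto
        then show ?thesis using l(2) y(2) by blast
      qed
      have "Lop (inv_coeff G y) (drift G \<Phi> \<epsilon> y) (\<lambda>z. (v \<circ> chart_inv c) z + T * ?b z) y \<le> 0"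
        by (rule Lop_local_max[OF Cinf_add[OF C1' C3] yB le ell l(1)])
      moreover have "Lop (inv_coeff G y) (drift G \<Phi> \<epsilon> y) (\<lambda>z. (v \<circ> chart_inv c) z + T * ?b z) y
        = T * Lop (inv_coeff G y) (drift G \<Phi> \<epsilon> y) ?b y"
        unfolding Lop_add[OF C1' C3 yB] Lop_cmult[OF C2 yB datum_pos(1)[OF D(1) yR y(2)]]
        using Lsol_Lop[OF D(1) e v yR ypos] by simp
      moreover have "0 < Lop (inv_coeff G y) (drift G \<Phi> \<epsilon> y) ?b y"
      proof (rule barrier_subharmonic[OF D(1) e yR ypos])
        show "0 < \<gamma> ?x / 2" using \<gamma>x by simp
        show "\<gamma> ?x / 2 \<le> Gam (inv_coeff G y) \<Phi> \<Phi> y" using near(1) by (simp add: \<gamma>_def)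
        show "\<bar>Lop (inv_coeff G y) (drift0 G y) \<Phi> y\<bar> \<le> C" using near(2) by (simp add: L0_def)
        have "\<epsilon> + \<Phi> y < a0" using qi False P\<phi>[OF yR y(2)] y(3) by simp
        then show "(\<epsilon> + \<Phi> y) * (2 * C) < \<gamma> ?x / 2" using C1 unfolding a0_def by (simp add: pos_less_divide_eq)
      qed
      then have "0 < T * Lop (inv_coeff G y) (drift G \<Phi> \<epsilon> y) ?b y" using T by simp
      ultimately show False by simp
    qed
  qed
  have "openin (top_of_set M) (cball_nbhd c ?x r)" by (rule cball_nbhd_openin[OF c(1) subr])
  moreover have "p \<in> cball_nbhd c ?x r" unfolding cball_nbhd_def using r(1) xh c by (intro image_eqI[of _ _ ?x]) auto
  moreover have "\<forall>\<epsilon> v T q. 0 < \<epsilon> \<and> 0 < T \<and> Lsol \<epsilon> v \<and> q \<in> cball_nbhd c ?x r \<and> (q \<notin> bd \<longrightarrow> \<epsilon> + \<phi> q < a0) \<and>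
      (q \<in> bd \<longrightarrow> (\<forall>c\<in>A. q \<in> fst c \<longrightarrow> normal_deriv g c v q < T * c0)) \<longrightarrow>
      \<not> (\<exists>N. openin (top_of_set M) N \<and> q \<in> N \<and> (\<forall>q'\<in>N. v q' + T * barrier \<epsilon> q' \<le> v q + T * barrier \<epsilon> q))"
  proof (intro allI impI, elim conjE, rule notI, elim exE conjE)
    fix \<epsilon> v T q N
    assume "0 < \<epsilon>" "0 < T" "Lsol \<epsilon> v" "q \<in> cball_nbhd c ?x r" "q \<notin> bd \<longrightarrow> \<epsilon> + \<phi> q < a0"
      "q \<in> bd \<longrightarrow> (\<forall>c\<in>A. q \<in> fst c \<longrightarrow> normal_deriv g c v q < T * c0)"
      "openin (top_of_set M) N" "q \<in> N" "\<forall>q'\<in>N. v q' + T * barrier \<epsilon> q' \<le> v q + T * barrier \<epsilon> q"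
    then show False by (rule main)
  qed
  ultimately show ?thesis using a0 c0 by (intro exI[of _ "cball_nbhd c ?x r"] exI[of _ a0] exI[of _ c0] conjI)
qed

end

section \<open>Counting Steklov eigenvalues\<close>

text \<open>Gaussian elimination: an equation with a nonzero coefficient expresses one unknown by
  the others and leaves a smaller system of the same kind.\<close>

lemma exists_kernel_vector:
  fixes m :: "'l \<Rightarrow> 'i \<Rightarrow> real"
  assumes "finite L" "finite I" "card L < card I"
  shows "\<exists>a. (\<exists>i\<in>I. a i \<noteq> 0) \<and> (\<forall>l\<in>L. (\<Sum>i\<in>I. a i * m l i) = 0)"
  using assms
proof (induction L arbitrary: I m rule: finite_induct)
  case empty
  then have "I \<noteq> {}" by auto
  then show ?case by (intro exI[of _ "\<lambda>i. 1"]) auto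
next
  case (insert l L)
  show ?case
  proof (cases "\<forall>i\<in>I. m l i = 0")
    case True
    have "card L < card I" using insert by simp
    then obtain a where a: "\<exists>i\<in>I. a i \<noteq> 0" "\<forall>l\<in>L. (\<Sum>i\<in>I. a i * m l i) = 0"
      using insert.IH[OF insert.prems(1), of m] by blast
    then show ?thesis using True by (intro exI[of _ a]) auto
  next
    case False
    then obtain j where j: "j \<in> I" "m l j \<noteq> 0" by blast
    define I' where "I' = I - {j}"
    have I': "finite I'" "card L < card I'" "I = insert j I'" "j \<notin> I'"
      using insert.prems insert.hyps j by (auto simp: I'_def)
    obtain a where a: "\<exists>i\<in>I'. a i \<noteq> 0" "\<forall>k\<in>L. (\<Sum>i\<in>I'. a i * (m k i - m k j * m l i / m l j)) = 0"
      using insert.IH[OF I'(1,2), of "\<lambda>k i. m k i - m k j * m l i / m l j"] by blast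
    define s where "s = (\<Sum>i\<in>I'. a i * m l i)"
    define a' where "a' i = (if i = j then - s / m l j else a i)" for i
    have sum: "(\<Sum>i\<in>I. a' i * m k i) = - s / m l j * m k j + (\<Sum>i\<in>I'. a i * m k i)" for k
    proof -
      have "(\<Sum>i\<in>I'. a' i * m k i) = (\<Sum>i\<in>I'. a i * m k i)"
        using I'(4) by (intro sum.cong) (auto simp: a'_def)
      then show ?thesis unfolding I'(3) using I'(1,4) by (simp add: a'_def)
    qed
    have "(\<Sum>i\<in>I. a' i * m k i) = 0" if "k \<in> insert l L" for k
    proof (cases "k = l")
      case True
      then show ?thesis unfolding sum using j(2) by (simp add: s_def)
    next
      case False
      then have "(\<Sum>i\<in>I'. a i * (m k i - m k j * m l i / m l j)) = 0" using a(2) that by blast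
      moreover have "(\<Sum>i\<in>I'. a i * (m k i - m k j * m l i / m l j)) = (\<Sum>i\<in>I'. a i * m k i) - s * (m k j / m l j)"
        unfolding s_def sum_distrib_right sum_subtractf[symmetric] by (intro sum.cong) (auto simp: algebra_simps)
      ultimately show ?thesis unfolding sum by simp
    qed
    moreover have "\<exists>i\<in>I. a' i \<noteq> 0" using a(1) I'(3,4) by (auto simp: a'_def)
    ultimately show ?thesis by blast
  qed
qed

text \<open>For an operator with eigenvalues \<open>\<tau>\<^sub>i \<in> [1, 2]\<close> whose inverse is a contraction, the
  Cayley--Hamilton relation \<open>\<Prod>\<^sub>r (1 - \<tau>\<^sub>r T\<^sup>-\<^sup>1) = 0\<close> writes \<open>T\<close> as a polynomial in \<open>T\<^sup>-\<^sup>1\<close>; this bounds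
  \<open>T\<close> independently of the angles between the eigenvectors.\<close>

locale contraction_inverse =
  fixes I :: "'i set" and P :: "'p set" and f :: "'i \<Rightarrow> 'p \<Rightarrow> real" and \<tau> :: "'i \<Rightarrow> real"
  assumes I: "finite I" and \<tau>: "\<And>i. i \<in> I \<Longrightarrow> 1 \<le> \<tau> i \<and> \<tau> i \<le> 2"
    and contr: "\<And>a K p. (\<And>p. p \<in> P \<Longrightarrow> \<bar>\<Sum>i\<in>I. \<tau> i * a i * f i p\<bar> \<le> K) \<Longrightarrow> p \<in> P \<Longrightarrow> \<bar>\<Sum>i\<in>I. a i * f i p\<bar> \<le> K"
begin

text \<open>Coefficient vectors are used rather than functions, because independence of the
  \<open>f i\<close> is not known beforehand. It is extracted later from vectors with bound
  0.\<close>

definition bdd :: "('i \<Rightarrow> real) \<Rightarrow> real \<Rightarrow> bool" where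
  "bdd a K \<longleftrightarrow> (\<forall>p\<in>P. \<bar>\<Sum>i\<in>I. a i * f i p\<bar> \<le> K)"

lemma bdd_cong: "bdd a K \<Longrightarrow> (\<And>i. i \<in> I \<Longrightarrow> a i = b i) \<Longrightarrow> bdd b K"
  unfolding bdd_def by (auto cong: sum.cong)

lemma bdd_lincomb:
  assumes "bdd a K" "bdd b L"
  shows "bdd (\<lambda>i. x * a i + y * b i) (\<bar>x\<bar> * K + \<bar>y\<bar> * L)"
  unfolding bdd_def
proof
  fix p assume p: "p \<in> P"
  have "(\<Sum>i\<in>I. (x * a i + y * b i) * f i p) = x * (\<Sum>i\<in>I. a i * f i p) + y * (\<Sum>i\<in>I. b i * f i p)"
    by (simp add: sum_distrib_left distrib_right sum.distrib mult.assoc)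
  moreover have "\<bar>x * (\<Sum>i\<in>I. a i * f i p)\<bar> \<le> \<bar>x\<bar> * K" "\<bar>y * (\<Sum>i\<in>I. b i * f i p)\<bar> \<le> \<bar>y\<bar> * L"
    unfolding abs_mult using assms p by (auto intro!: mult_left_mono simp: bdd_def)
  ultimately show "\<bar>\<Sum>i\<in>I. (x * a i + y * b i) * f i p\<bar> \<le> \<bar>x\<bar> * K + \<bar>y\<bar> * L" by linarith
qed

lemma bdd_mono: "bdd a K \<Longrightarrow> K \<le> L \<Longrightarrow> bdd a L"
  unfolding bdd_def by force

lemma bdd_divide: "bdd a K \<Longrightarrow> bdd (\<lambda>i. a i / \<tau> i) K"
proof -
  assume a: "bdd a K"
  have "\<tau> i * (a i / \<tau> i) = a i" if "i \<in> I" for i using \<tau>[OF that] by simp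
  then have "(\<Sum>i\<in>I. \<tau> i * (a i / \<tau> i) * f i p) = (\<Sum>i\<in>I. a i * f i p)" for p by (intro sum.cong) auto
  then show ?thesis using contr[of "\<lambda>i. a i / \<tau> i" K] a unfolding bdd_def by simp
qed

text \<open>Multiplying out the factors \<open>1 - \<tau> r / \<tau> i\<close> for r in
  \<open>S\<close> gives 1 - Y T^(-1), with Y represented by \<open>y\<close>. A new factor turns a
  bound \<open>C\<close> for Y into at most C + 2 K + 2 C, which, starting from 0, gives (3^n - 1) K
  after n factors. For \<open>S = I\<close> the product vanishes, and Y is T itself.\<close>

lemma bdd_times:
  assumes a: "bdd a K" "0 \<le> K"
  shows "bdd (\<lambda>i. \<tau> i * a i) ((3 ^ card I - 1) * K)"
proof -
  have "\<exists>y. (\<forall>i\<in>I. (\<Prod>r\<in>S. 1 - \<tau> r / \<tau> i) = 1 - y i / \<tau> i) \<and> bdd (\<lambda>i. y i * a i) ((3 ^ card S - 1) * K)"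
    if "finite S" "S \<subseteq> I" for S
    using that
  proof (induction S rule: finite_induct)
    case empty
    then show ?case by (intro exI[of _ "\<lambda>i. 0"]) (simp add: bdd_def)
  next
    case (insert r S)
    then obtain y where y: "\<forall>i\<in>I. (\<Prod>r\<in>S. 1 - \<tau> r / \<tau> i) = 1 - y i / \<tau> i" "bdd (\<lambda>i. y i * a i) ((3 ^ card S - 1) * K)"
      by auto
    define C where "C = (3 ^ card S - 1) * K"
    have C: "0 \<le> C" using a(2) by (simp add: C_def)
    have r: "0 \<le> \<tau> r" "\<tau> r \<le> 2" using \<tau>[of r] insert.prems by auto
    have b1: "bdd (\<lambda>i. 1 * (y i * a i) + \<tau> r * a i) (\<bar>1\<bar> * C + \<bar>\<tau> r\<bar> * K)"
      by (rule bdd_lincomb[OF y(2)[folded C_def] a(1)])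
    have "bdd (\<lambda>i. 1 * (1 * (y i * a i) + \<tau> r * a i) + (- \<tau> r) * (y i * a i / \<tau> i)) (\<bar>1\<bar> * (\<bar>1\<bar> * C + \<bar>\<tau> r\<bar> * K) + \<bar>- \<tau> r\<bar> * C)"
      by (rule bdd_lincomb[OF b1 bdd_divide[OF y(2)[folded C_def]]])
    moreover have "\<bar>1\<bar> * (\<bar>1\<bar> * C + \<bar>\<tau> r\<bar> * K) + \<bar>- \<tau> r\<bar> * C \<le> (3 ^ card (insert r S) - 1) * K"
    proof -
      have "\<tau> r * K \<le> 2 * K" "\<tau> r * C \<le> 2 * C" using r a(2) C by (auto intro: mult_right_mono)
      moreover have "(3 ^ card (insert r S) - 1) * K = 3 * C + 2 * K"
        using insert.hyps by (simp add: C_def algebra_simps)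
      ultimately show ?thesis using r by simp
    qed
    ultimately have b: "bdd (\<lambda>i. 1 * (1 * (y i * a i) + \<tau> r * a i) + (- \<tau> r) * (y i * a i / \<tau> i)) ((3 ^ card (insert r S) - 1) * K)"
      by (rule bdd_mono)
    define y' where "y' i = y i + \<tau> r - \<tau> r * y i / \<tau> i" for i
    have "bdd (\<lambda>i. y' i * a i) ((3 ^ card (insert r S) - 1) * K)"
      by (rule bdd_cong[OF b]) (simp add: y'_def algebra_simps)
    moreover have "(\<Prod>r\<in>insert r S. 1 - \<tau> r / \<tau> i) = 1 - y' i / \<tau> i" if i: "i \<in> I" for i
    proof -
      have "\<tau> i \<noteq> 0" using \<tau>[OF i] by auto
      then have "(1 - \<tau> r / \<tau> i) * (1 - y i / \<tau> i) = 1 - y' i / \<tau> i"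
        by (simp add: y'_def field_simps)
      then show ?thesis using insert.hyps y(1) i by simp
    qed
    ultimately show ?case by (intro exI[of _ y']) blast
  qed
  from this[OF I subset_refl] obtain y where y: "\<forall>i\<in>I. (\<Prod>r\<in>I. 1 - \<tau> r / \<tau> i) = 1 - y i / \<tau> i"
    "bdd (\<lambda>i. y i * a i) ((3 ^ card I - 1) * K)" by blast
  have "y i = \<tau> i" if i: "i \<in> I" for i
  proof -
    have nz: "\<tau> i \<noteq> 0" using \<tau>[OF i] by auto
    then have "(\<Prod>r\<in>I. 1 - \<tau> r / \<tau> i) = 0" using I i by (intro prod_zero) (auto intro!: bexI[of _ i])
    moreover have "(\<Prod>r\<in>I. 1 - \<tau> r / \<tau> i) = 1 - y i / \<tau> i" using y(1) i by blast
    ultimately have "y i / \<tau> i = 1" by linarith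
    then show ?thesis using nz by (simp add: divide_eq_1_iff)
  qed
  then show ?thesis by (intro bdd_cong[OF y(2)]) simp
qed

text \<open>By \<open>bdd_times\<close> with bound 0, multiplying the coefficients by a polynomial
  in \<tau> preserves null combinations. The polynomial that vanishes at all other values of \<tau>
  isolates one eigenvalue.\<close>

lemma null_combination:
  assumes a: "bdd a 0" and j: "j \<in> I" and p: "p \<in> P"
  shows "(\<Sum>i\<in>{i \<in> I. \<tau> i = \<tau> j}. a i * f i p) = 0"
proof -
  have B: "bdd (\<lambda>i. (\<Prod>r\<in>R. \<tau> i - r) * a i) 0" if "finite R" for R
    using that
  proof (induction R rule: finite_induct)
    case empty then show ?case using a by simp
  next
    case (insert r R)
    have "bdd (\<lambda>i. \<tau> i * ((\<Prod>r\<in>R. \<tau> i - r) * a i)) 0" using bdd_times[OF insert.IH] by simp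
    from bdd_lincomb[OF this insert.IH, of 1 "- r"]
    have "bdd (\<lambda>i. 1 * (\<tau> i * ((\<Prod>r\<in>R. \<tau> i - r) * a i)) + (- r) * ((\<Prod>r\<in>R. \<tau> i - r) * a i)) 0" by simp
    then show ?case by (rule bdd_cong) (use insert.hyps in \<open>simp add: algebra_simps\<close>)
  qed
  define R where "R = \<tau> ` I - {\<tau> j}"
  define w where "w i = (\<Prod>r\<in>R. \<tau> i - r)" for i
  have fR: "finite R" using I by (simp add: R_def)
  have "w i = 0" if "i \<in> I" "\<tau> i \<noteq> \<tau> j" for i
    unfolding w_def using that fR by (intro prod_zero) (auto simp: R_def intro!: bexI[of _ "\<tau> i"])
  then have "(\<Sum>i\<in>I. w i * a i * f i p) = (\<Sum>i\<in>{i \<in> I. \<tau> i = \<tau> j}. w i * a i * f i p)"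
    using I by (intro sum.mono_neutral_right) auto
  also have "\<dots> = w j * (\<Sum>i\<in>{i \<in> I. \<tau> i = \<tau> j}. a i * f i p)"
    unfolding sum_distrib_left by (intro sum.cong) (auto simp: w_def mult.assoc)
  finally have "w j * (\<Sum>i\<in>{i \<in> I. \<tau> i = \<tau> j}. a i * f i p) = 0"
    using B[OF fR] p unfolding bdd_def w_def by auto
  moreover have "w j \<noteq> 0" unfolding w_def using fR by (auto simp: R_def)
  ultimately show ?thesis by simp
qed

end

text \<open>Since \<phi> vanishes on the boundary, all metrics of the family share their normals and
  normal derivatives there. The negative outward derivative means that \<phi> grows inward at a
  positive rate, which gives the barrier its slope.\<close>

locale collar_family = conformal_family +
  assumes phi_bd: "\<And>p. p \<in> bd \<Longrightarrow> \<phi> p = 0"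
    and phi_nd: "\<And>p. p \<in> bd \<Longrightarrow> \<exists>c\<in>A. p \<in> fst c \<and> normal_deriv g c \<phi> p < 0"
begin

lemma normal_deriv_gc:
  assumes "p \<in> bd" shows "normal_deriv (gc \<epsilon>) c f p = normal_deriv g c f p"
  unfolding normal_deriv_def outward_normal_def gc_def using phi_bd[OF assms] by simp

text \<open>On a compact collar between \<open>Y\<close> and a level set \<open>K\<close> of \<phi>,
  the function \<open>v + T * barrier\<close> attains its maximum on \<open>K\<close>, because
  \<open>collar_local\<close> excludes every other point. Comparing a point of \<open>Y\<close> with
  this maximum gives the estimate.\<close>

lemma collar:
  assumes Y: "compact Y" "Y \<subseteq> bd" and W: "openin (top_of_set M) W" "Y \<subseteq> W"
    and Z: "closedin (top_of_set M) {q \<in> M. \<phi> q = 0 \<and> q \<notin> Y}"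
  shows "\<exists>a>0. \<exists>c0>0. \<exists>\<epsilon>1>0. \<exists>K. compact K \<and> K \<subseteq> W - bd \<and>
    (\<forall>\<epsilon> v T q. 0 < \<epsilon> \<and> \<epsilon> < \<epsilon>1 \<and> 0 < T \<and> Lsol \<epsilon> v \<and>
      (\<forall>q\<in>Y. \<forall>c\<in>A. q \<in> fst c \<longrightarrow> normal_deriv g c v q < T * c0) \<and> q \<in> Y \<longrightarrow>
      (\<exists>k\<in>K. v q \<le> v k + T * (2 * sqrt \<epsilon> * sqrt (\<epsilon> + a))))"
proof -
  have YM: "Y \<subseteq> M" using Y(2) bd_sub by blast
  have "\<exists>U a0 c0. openin (top_of_set M) U \<and> p \<in> U \<and> 0 < a0 \<and> 0 < c0 \<and>
    (\<forall>\<epsilon> v T q. 0 < \<epsilon> \<and> 0 < T \<and> Lsol \<epsilon> v \<and> q \<in> U \<and> (q \<notin> bd \<longrightarrow> \<epsilon> + \<phi> q < a0) \<and>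
      (q \<in> bd \<longrightarrow> (\<forall>c\<in>A. q \<in> fst c \<longrightarrow> normal_deriv g c v q < T * c0)) \<longrightarrow>
      \<not> (\<exists>N. openin (top_of_set M) N \<and> q \<in> N \<and> (\<forall>q'\<in>N. v q' + T * barrier \<epsilon> q' \<le> v q + T * barrier \<epsilon> q)))"
    if p: "p \<in> Y" for p
  proof -
    have pb: "p \<in> bd" using p Y by blast
    then obtain c where c: "c \<in> A" "p \<in> fst c" "normal_deriv g c \<phi> p < 0" using phi_nd by blast
    from collar_local[OF phi_bd c(1,2) pb c(3)] show ?thesis .
  qed
  then obtain U a0 c0 where U: "\<And>p. p \<in> Y \<Longrightarrow> openin (top_of_set M) (U p) \<and> p \<in> U p \<and> 0 < a0 p \<and> 0 < c0 p \<and>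
    (\<forall>\<epsilon> v T q. 0 < \<epsilon> \<and> 0 < T \<and> Lsol \<epsilon> v \<and> q \<in> U p \<and> (q \<notin> bd \<longrightarrow> \<epsilon> + \<phi> q < a0 p) \<and>
      (q \<in> bd \<longrightarrow> (\<forall>c\<in>A. q \<in> fst c \<longrightarrow> normal_deriv g c v q < T * c0 p)) \<longrightarrow>
      \<not> (\<exists>N. openin (top_of_set M) N \<and> q \<in> N \<and> (\<forall>q'\<in>N. v q' + T * barrier \<epsilon> q' \<le> v q + T * barrier \<epsilon> q)))"
    by metis
  have "openin (top_of_set M) (U p) \<and> p \<in> U p" if "p \<in> Y" for p using U[OF that] by blast
  from finite_openin_cover[OF Y(1) YM this]
  obtain F where F: "finite F" "F \<subseteq> Y" "Y \<subseteq> (\<Union>p\<in>F. U p)" by blast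
  have "0 < a0 p" "0 < c0 p" if "p \<in> F" for p using U F(2) that by blast+
  then obtain a1 c1 where ac: "0 < a1" "\<forall>p\<in>F. a1 \<le> a0 p" "0 < c1" "\<forall>p\<in>F. c1 \<le> c0 p"
    using finite_pos_lower_bound[OF F(1), of a0] finite_pos_lower_bound[OF F(1), of c0] by blast
  \<comment> \<open>Zeros of \<phi> off \<open>Y\<close> are taken out, so that the boundary points
    in \<open>W'\<close> are exactly those of \<open>Y\<close>.\<close>
  define W' where "W' = W \<inter> (\<Union>p\<in>F. U p) - {q \<in> M. \<phi> q = 0 \<and> q \<notin> Y}"
  have "openin (top_of_set M) (\<Union>p\<in>F. U p)" by (intro openin_Union) (use U F(2) in blast)
  then have W'o: "openin (top_of_set M) W'" unfolding W'_def by (intro openin_diff openin_Int W(1) Z)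
  have YW: "Y \<subseteq> W'" using W(2) F(3) unfolding W'_def by blast
  have W'M: "W' \<subseteq> M" using openin_imp_subset[OF W'o] .
  have zero: "q \<in> Y" if "q \<in> W'" "\<phi> q = 0" for q using that W'M unfolding W'_def by blast
  have "\<exists>V N. openin (top_of_set M) V \<and> p \<in> V \<and> V \<subseteq> N \<and> compact N \<and> N \<subseteq> W'" if p: "p \<in> Y" for p
  proof -
    have pM: "p \<in> M" using p YM by blast
    obtain c where c: "c \<in> A" "p \<in> fst c" using obtain_chart[OF pM] by blast
    have pW: "p \<in> W'" using p YW by blast
    obtain r where r: "0 < r" "ball (snd c p) r \<inter> half_space \<subseteq> chart_image c" "cball_nbhd c (snd c p) r \<subseteq> W'" "p \<in> cball_nbhd c (snd c p) r"
      by (rule obtain_nbhd[OF W'o pW c])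
    let ?x = "snd c p"
    have xh: "?x \<in> half_space" using chart_image_half[OF c(1)] c(2) by blast
    have sub: "cball ?x (r/2) \<inter> half_space \<subseteq> ball ?x r \<inter> half_space" using r(1) by auto
    have "closed (half_space :: 'b model set)" unfolding half_space_def by (intro closed_Collect_le continuous_intros)
    then have "compact (cball ?x (r/2) \<inter> half_space)" by (intro compact_Int_closed compact_cball)
    moreover have "continuous_on (cball ?x (r/2) \<inter> half_space) (chart_inv c)"
      by (rule continuous_on_subset[OF continuous_chart_inv[OF c(1)]]) (use sub r(2) in blast)
    ultimately have "compact (chart_inv c ` (cball ?x (r/2) \<inter> half_space))" using compact_continuous_image by blast
    moreover have "chart_inv c ` (cball ?x (r/2) \<inter> half_space) \<subseteq> W'" using r(3) sub unfolding cball_nbhd_def by blast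
    moreover have "cball_nbhd c ?x (r/2) \<subseteq> chart_inv c ` (cball ?x (r/2) \<inter> half_space)" unfolding cball_nbhd_def by auto
    moreover have "openin (top_of_set M) (cball_nbhd c ?x (r/2))"
      by (rule cball_nbhd_openin[OF c(1)]) (use r(1,2) in auto)
    moreover have "p \<in> cball_nbhd c ?x (r/2)" unfolding cball_nbhd_def using r(1) xh c by (intro image_eqI[of _ _ ?x]) auto
    ultimately show ?thesis by blast
  qed
  then obtain V N where VN: "\<And>p. p \<in> Y \<Longrightarrow> openin (top_of_set M) (V p) \<and> p \<in> V p \<and> V p \<subseteq> N p \<and> compact (N p) \<and> N p \<subseteq> W'" by metis
  have "openin (top_of_set M) (V p) \<and> p \<in> V p" if "p \<in> Y" for p using VN[OF that] by blast
  from finite_openin_cover[OF Y(1) YM this]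
  obtain H where H: "finite H" "H \<subseteq> Y" "Y \<subseteq> (\<Union>p\<in>H. V p)" by blast
  define P where "P = (\<Union>p\<in>H. V p)"
  define C0 where "C0 = (\<Union>p\<in>H. N p)"
  have Po: "openin (top_of_set M) P" unfolding P_def by (intro openin_Union) (use VN H(2) in blast)
  have PC: "P \<subseteq> C0" "C0 \<subseteq> W'" using VN H(2) unfolding P_def C0_def by blast+
  have C0: "compact C0" unfolding C0_def by (rule compact_UN[OF H(1)]) (use VN H(2) in blast)
  have c\<phi>: "continuous_on M \<phi>" by (rule smooth_fun_continuous[OF phi_smooth])
  obtain T where T: "open T" "P = M \<inter> T" using Po by (meson openin_open)
  have R: "compact (C0 - T)" using C0 T(1) by (rule compact_diff)
  have Rpos: "0 < \<phi> q" if "q \<in> C0 - T" for q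
  proof -
    have "q \<in> W'" "q \<notin> P" using that PC T W'M by auto
    then have "q \<notin> Y" using H(3) by (auto simp: P_def)
    then have "\<phi> q \<noteq> 0" using zero \<open>q \<in> W'\<close> by blast
    then show ?thesis using phi_nonneg[of q] \<open>q \<in> W'\<close> W'M by fastforce
  qed
  have "\<exists>a2>0. \<forall>q\<in>C0 - T. a2 \<le> \<phi> q"
  proof (cases "C0 - T = {}")
    case False
    have "continuous_on (C0 - T) \<phi>" using c\<phi> PC W'M continuous_on_subset by blast
    from continuous_attains_inf[OF R False this] obtain x where "x \<in> C0 - T" "\<forall>y\<in>C0 - T. \<phi> x \<le> \<phi> y" by blast
    then show ?thesis using Rpos by blast
  qed (auto intro: exI[of _ 1])
  then obtain a2 where a2: "0 < a2" "\<forall>q\<in>C0 - T. a2 \<le> \<phi> q" by blast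
  \<comment> \<open>Below \<open>a2\<close> the sublevel set stays inside the open part
    \<open>P\<close> of \<open>C0\<close>, so a maximum over \<open>C\<close> at a point with \<phi>
    < a is a local maximum in \<open>M\<close>. Staying below half of \<open>a1\<close> leaves room
    for \<epsilon> in the smallness condition.\<close>
  define a where "a = min a1 a2 / 2"
  have a: "0 < a" "a < a1" "a < a2" "a \<le> a1 / 2" using a2 ac by (auto simp: a_def)
  define C where "C = {q \<in> C0. \<phi> q \<le> a}"
  define K where "K = {q \<in> C0. \<phi> q = a}"
  have C0M: "C0 \<subseteq> M" using PC W'M by blast
  have cC0: "continuous_on C0 \<phi>" using c\<phi> C0M continuous_on_subset by blast
  have comp: "compact {q \<in> C0. \<phi> q \<in> D}" if "closed D" for D
  proof -
    have "closedin (top_of_set C0) (C0 \<inter> \<phi> -` D)" by (rule continuous_closedin_preimage[OF cC0 that])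
    then obtain D' where "closed D'" "C0 \<inter> \<phi> -` D = C0 \<inter> D'" by (meson closedin_closed)
    then have "compact (C0 \<inter> \<phi> -` D)" using compact_Int_closed[OF C0, of D'] by simp
    moreover have "C0 \<inter> \<phi> -` D = {q \<in> C0. \<phi> q \<in> D}" by auto
    ultimately show ?thesis by simp
  qed
  have cC: "compact C" "compact K" using comp[of "{..a}"] comp[of "{a}"] by (auto simp: C_def K_def)
  have CP: "C \<subseteq> P" 
  proof
    fix q assume "q \<in> C"
    then have "q \<in> C0" "\<phi> q \<le> a" by (auto simp: C_def)
    then have "q \<in> T" using a2(2) a(3) by force
    then show "q \<in> P" using \<open>q \<in> C0\<close> C0M T(2) by blast
  qed
  have YC: "Y \<subseteq> C"
  proof
    fix q assume "q \<in> Y"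
    then have "q \<in> P" "\<phi> q = 0" using H(3) phi_bd Y(2) unfolding P_def by blast+
    then show "q \<in> C" using PC a(1) by (auto simp: C_def)
  qed
  have Kbd: "K \<subseteq> W - bd"
  proof
    fix q assume "q \<in> K"
    then have "q \<in> W'" "\<phi> q \<noteq> 0" using PC a(1) by (auto simp: K_def)
    then show "q \<in> W - bd" using phi_bd[of q] unfolding W'_def by auto
  qed
  have "openin (top_of_set M) (M \<inter> \<phi> -` {..<a})" by (rule continuous_openin_preimage_gen[OF c\<phi>]) simp
  then have Qo: "openin (top_of_set M) (P \<inter> (M \<inter> \<phi> -` {..<a}))" using Po by (rule openin_Int[rotated])
  have QC: "P \<inter> (M \<inter> \<phi> -` {..<a}) \<subseteq> C" using PC by (auto simp: C_def)
  show ?thesis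
  proof (rule exI[of _ a], intro conjI a(1), rule exI[of _ c1], intro conjI ac(3), rule exI[of _ "a1/2"], intro conjI,
      goal_cases)
    case 1 show ?case using ac(1) by simp
  next
    case 2
    show ?case
    proof (rule exI[of _ K], intro conjI cC(2) Kbd allI impI, elim conjE)
      fix \<epsilon> v T q
      assume e: "0 < \<epsilon>" "\<epsilon> < a1 / 2" and T: "0 < T" and v: "Lsol \<epsilon> v"
        and nd: "\<forall>q\<in>Y. \<forall>c\<in>A. q \<in> fst c \<longrightarrow> normal_deriv g c v q < T * c1" and q: "q \<in> Y"
      define S where "S z = v z + T * barrier \<epsilon> z" for z
      have "smooth_fun A S" unfolding S_def[abs_def]
        by (intro smooth_fun_add smooth_fun_mult smooth_fun_const Lsol_smooth[OF v] barrier_smooth[OF e(1)])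
      then have "continuous_on C S" using smooth_fun_continuous CP Po openin_imp_subset continuous_on_subset by (metis order_trans)
      moreover have "C \<noteq> {}" using q YC by blast
      ultimately obtain z where z: "z \<in> C" "\<forall>w\<in>C. S w \<le> S z" using continuous_attains_sup[OF cC(1)] by metis
      have "z \<in> K"
      proof (rule ccontr)
        assume nK: "z \<notin> K"
        then have lt: "\<phi> z < a" using z(1) by (auto simp: C_def K_def)
        have zW: "z \<in> W'" using z(1) PC by (auto simp: C_def)
        then obtain p where p: "p \<in> F" "z \<in> U p" unfolding W'_def by blast
        have pY: "p \<in> Y" using p F(2) by blast
        have zN: "z \<in> P \<inter> (M \<inter> \<phi> -` {..<a})" using z(1) CP lt zW W'M by auto
        have "\<epsilon> + \<phi> z < a0 p" using e(2) lt a(4) ac(2) p(1) by fastforce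
        moreover have "\<forall>c\<in>A. z \<in> fst c \<longrightarrow> normal_deriv g c v z < T * c0 p" if "z \<in> bd"
        proof -
          have "z \<in> Y" by (rule zero[OF zW phi_bd[OF that]])
          moreover have "T * c1 \<le> T * c0 p" using ac(4) p(1) T by simp
          ultimately show ?thesis using nd by fastforce
        qed
        moreover have "\<exists>N. openin (top_of_set M) N \<and> z \<in> N \<and> (\<forall>q'\<in>N. v q' + T * barrier \<epsilon> q' \<le> v z + T * barrier \<epsilon> z)"
          using Qo zN QC z(2) unfolding S_def by blast
        ultimately show False using U[OF pY] e(1) T v p(2) by blast
      qed
      moreover have "v q \<le> v z + T * (2 * sqrt \<epsilon> * sqrt (\<epsilon> + a))"
      proof -
        have "S q \<le> S z" using z(2) q YC by blast
        moreover have "S z = v z + T * (2 * sqrt \<epsilon> * sqrt (\<epsilon> + a))" using \<open>z \<in> K\<close> by (simp add: S_def barrier_def K_def)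
        moreover have "0 \<le> T * barrier \<epsilon> q" using T e(1) phi_bd[of q] q Y(2) by (auto simp: barrier_def subset_iff)
        ultimately show ?thesis unfolding S_def by linarith
      qed
      ultimately show "\<exists>k\<in>K. v q \<le> v k + T * (2 * sqrt \<epsilon> * sqrt (\<epsilon> + a))" by blast
    qed
  qed
qed

end

lemma fun_vector_space: "vector_space (\<lambda>(r::real) (f::'a \<Rightarrow> real). \<lambda>p. r * f p)"
  by unfold_locales (auto simp: fun_eq_iff algebra_simps)

context collar_family begin

text \<open>The collar is crossed twice, with a Harnack step in between. The value 1 at a point of
  \<open>Y\<close> yields a value of at least 1/2 on the level set \<open>K\<close>; the Harnack
  inequality spreads a bound \<kappa> over \<open>K\<close>; the collar estimate for -v carries it
  back to all of \<open>Y\<close> with a loss smaller than \<kappa>.\<close>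

lemma component_bound:
  fixes T0 :: real
  assumes X: "connected X" "X \<subseteq> M" and Y: "Y = X \<inter> bd" "compact Y"
    and Z: "closedin (top_of_set M) {q \<in> M. \<phi> q = 0 \<and> q \<notin> Y}" and pos: "\<And>q. q \<in> X \<Longrightarrow> \<phi> q = 0 \<Longrightarrow> q \<in> Y"
    and T0: "0 \<le> T0"
  shows "\<exists>\<epsilon>1>0. \<forall>\<epsilon> v. 0 < \<epsilon> \<and> \<epsilon> < \<epsilon>1 \<and> Lsol \<epsilon> v \<and> (\<forall>q\<in>M. 0 \<le> v q \<and> v q \<le> 2) \<and>
    (\<forall>q\<in>Y. \<forall>c\<in>A. q \<in> fst c \<longrightarrow> \<bar>normal_deriv g c v q\<bar> \<le> T0) \<and> (\<exists>p\<in>Y. v p = 1) \<longrightarrow> (\<forall>q\<in>Y. 0 < v q)"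
proof -
  \<comment> \<open>With the zeros of \<phi> off \<open>Y\<close> removed, \<phi> is positive at
    every interior point that is left, and there the Harnack inequality is uniform in
    \<epsilon>.\<close>
  define E where "E = M - {q \<in> M. \<phi> q = 0 \<and> q \<notin> Y}"
  have Eo: "openin (top_of_set M) E" unfolding E_def by (intro openin_diff Z) simp
  have XE: "X \<subseteq> E" using X(2) pos by (auto simp: E_def)
  have "\<exists>U. openin (top_of_set M) U \<and> q \<in> U \<and> connected (U - bd) \<and> U \<subseteq> E" if q: "q \<in> X" for q
  proof -
    have qE: "q \<in> E" and qM: "q \<in> M" using q XE X(2) by blast+
    obtain c where c: "c \<in> A" "q \<in> fst c" using obtain_chart[OF qM] by blast
    obtain r where r: "0 < r" "ball (snd c q) r \<inter> half_space \<subseteq> chart_image c"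
      "cball_nbhd c (snd c q) r \<subseteq> E" "q \<in> cball_nbhd c (snd c q) r" by (rule obtain_nbhd[OF Eo qE c])
    show ?thesis
      using cball_nbhd_openin[OF c(1) r(2)] cball_nbhd_connected[OF c(1) r(2)] r(3,4)
      by (intro exI[of _ "cball_nbhd c (snd c q) r"] conjI)
  qed
  then obtain U where U: "\<And>q. q \<in> X \<Longrightarrow> openin (top_of_set M) (U q) \<and> q \<in> U q \<and> connected (U q - bd) \<and> U q \<subseteq> E" by metis
  define D where "D = (\<Union>q\<in>X. U q - bd)"
  define W where "W = (\<Union>q\<in>X. U q)"
  have Dc: "connected D" unfolding D_def by (rule connected_interior_union[OF X]) (use U in blast)
  have Wo: "openin (top_of_set M) W" unfolding W_def by (intro openin_Union) (use U in blast)
  have DW: "D = W - bd" by (auto simp: D_def W_def)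
  have WE: "W \<subseteq> E" using U by (auto simp: W_def)
  have DM: "D \<subseteq> M - bd" using WE unfolding DW E_def by blast
  have YW: "Y \<subseteq> W" using U Y(1) by (auto simp: W_def)
  have Yb: "Y \<subseteq> bd" using Y(1) by blast
  have J: "\<exists>\<delta>>0. \<forall>\<epsilon>\<in>{0<..}. 0 < \<epsilon> \<and> 2 * \<delta> \<le> \<epsilon> + \<phi> p" if "p \<in> D" for p
  proof -
    have pE: "p \<in> E" "p \<notin> bd" using that WE by (auto simp: DW)
    then have "\<phi> p \<noteq> 0" using Yb by (auto simp: E_def)
    then have "0 < \<phi> p" using phi_nonneg[of p] pE by (auto simp: E_def)
    then show ?thesis by (intro exI[of _ "\<phi> p / 2"]) auto
  qed
  obtain a c0 \<epsilon>2 K where a: "0 < a" and c0: "0 < c0" and \<epsilon>2: "0 < \<epsilon>2" and K: "compact K" "K \<subseteq> W - bd"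
    and col: "\<forall>\<epsilon> v T q. 0 < \<epsilon> \<and> \<epsilon> < \<epsilon>2 \<and> 0 < T \<and> Lsol \<epsilon> v \<and>
      (\<forall>q\<in>Y. \<forall>c\<in>A. q \<in> fst c \<longrightarrow> normal_deriv g c v q < T * c0) \<and> q \<in> Y \<longrightarrow>
      (\<exists>k\<in>K. v q \<le> v k + T * (2 * sqrt \<epsilon> * sqrt (\<epsilon> + a)))"
    using collar[OF Y(2) Yb Wo YW Z] by (elim exE conjE) (rule that; assumption)
  have KD: "K \<subseteq> D" using K(2) DW by simp
  obtain \<kappa> where \<kappa>: "0 < \<kappa>" "\<forall>\<epsilon>\<in>{0<..}. \<forall>v. Lsol \<epsilon> v \<and> (\<forall>q\<in>M. 0 \<le> v q \<and> v q \<le> 2) \<and> (\<exists>x\<in>K. 1/2 \<le> v x) \<longrightarrow> (\<forall>x\<in>K. \<kappa> \<le> v x)"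
  proof -
    have "\<exists>\<kappa>>0. \<forall>\<epsilon>\<in>{0<..}. \<forall>v. Lsol \<epsilon> v \<and> (\<forall>q\<in>M. 0 \<le> v q \<and> v q \<le> 2) \<and> (\<exists>x\<in>K. 1/2 \<le> v x) \<longrightarrow> (\<forall>x\<in>K. \<kappa> \<le> v x)"
      by (rule harnack[OF Dc DM _ K(1) KD]) (rule J)
    then show thesis by (elim exE conjE) (rule that; assumption)
  qed
  \<comment> \<open>The barrier must be steep enough to dominate strictly all normal derivatives up
    to \<open>T0\<close>.\<close>
  define T where "T = (T0 + 1) / c0"
  have T: "0 < T" "T0 < T * c0" using T0 c0 by (auto simp: T_def)
  have "((\<lambda>\<epsilon>. T * (2 * sqrt \<epsilon> * sqrt (\<epsilon> + a))) \<longlongrightarrow> T * (2 * sqrt 0 * sqrt (0 + a))) (at_right 0)"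
    by (intro tendsto_intros)
  then have "((\<lambda>\<epsilon>. T * (2 * sqrt \<epsilon> * sqrt (\<epsilon> + a))) \<longlongrightarrow> 0) (at_right 0)" by simp
  then have "\<forall>\<^sub>F \<epsilon> in at_right 0. T * (2 * sqrt \<epsilon> * sqrt (\<epsilon> + a)) < min (1/2) \<kappa>"
    by (rule order_tendstoD(2)) (use \<kappa>(1) in simp)
  then obtain \<epsilon>3 where \<epsilon>3: "0 < \<epsilon>3" "\<And>\<epsilon>. 0 < \<epsilon> \<Longrightarrow> \<epsilon> < \<epsilon>3 \<Longrightarrow> T * (2 * sqrt \<epsilon> * sqrt (\<epsilon> + a)) < min (1/2) \<kappa>"
    unfolding eventually_at_right_field by blast
  show ?thesis
  proof (intro exI[of _ "min \<epsilon>2 \<epsilon>3"] conjI allI impI ballI, goal_cases)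
    case 1 show ?case using \<epsilon>2 \<epsilon>3(1) by simp
  next
    case (2 \<epsilon> v q)
    then have e: "0 < \<epsilon>" "\<epsilon> < \<epsilon>2" "\<epsilon> < \<epsilon>3" and v: "Lsol \<epsilon> v" and v02: "\<forall>q\<in>M. 0 \<le> v q \<and> v q \<le> 2"
      and nd: "\<forall>q\<in>Y. \<forall>c\<in>A. q \<in> fst c \<longrightarrow> \<bar>normal_deriv g c v q\<bar> \<le> T0" and ex: "\<exists>p\<in>Y. v p = 1" and q: "q \<in> Y"
      by auto
    obtain p where p: "p \<in> Y" "v p = 1" using ex by blast
    have small: "T * (2 * sqrt \<epsilon> * sqrt (\<epsilon> + a)) < 1/2" "T * (2 * sqrt \<epsilon> * sqrt (\<epsilon> + a)) < \<kappa>"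
      using \<epsilon>3(2)[OF e(1,3)] by auto
    have nd1: "\<forall>q\<in>Y. \<forall>c\<in>A. q \<in> fst c \<longrightarrow> normal_deriv g c v q < T * c0"
      using nd T(2) by fastforce
    have "\<exists>k\<in>K. v p \<le> v k + T * (2 * sqrt \<epsilon> * sqrt (\<epsilon> + a))" using col e T(1) v nd1 p(1) by blast
    then have "\<exists>x\<in>K. 1/2 \<le> v x" using p(2) small(1) by force
    then have K\<kappa>: "\<forall>x\<in>K. \<kappa> \<le> v x" using \<kappa>(2) e(1) v v02 by auto
    have mv: "Lsol \<epsilon> (\<lambda>x. - 1 * v x + 0)" by (rule Lsol_affine[OF e(1) v])
    have "normal_deriv g c (\<lambda>x. - 1 * v x + 0 * v x) q = - normal_deriv g c v q" if "c \<in> A" "q \<in> fst c" for q c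
      using normal_deriv_lincomb[OF that Lsol_smooth[OF v] Lsol_smooth[OF v], of "-1" 0] by simp
    then have "\<forall>q\<in>Y. \<forall>c\<in>A. q \<in> fst c \<longrightarrow> normal_deriv g c (\<lambda>x. - 1 * v x + 0) q < T * c0"
      using nd T(2) by fastforce
    then have "\<exists>k\<in>K. - 1 * v q + 0 \<le> - 1 * v k + 0 + T * (2 * sqrt \<epsilon> * sqrt (\<epsilon> + a))"
      using col[THEN spec[of _ \<epsilon>], THEN spec[of _ "\<lambda>x. - 1 * v x + 0"]] e T(1) mv q by blast
    then show ?case using K\<kappa> small(2) by force
  qed
qed

lemma eigenspaceD:
  assumes "f \<in> steklov_eigenspace M A (gc \<epsilon>) s"
  shows "Lsol \<epsilon> f" "\<And>p. p \<notin> M \<Longrightarrow> f p = 0"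
    "\<And>q c. q \<in> bd \<Longrightarrow> c \<in> A \<Longrightarrow> q \<in> fst c \<Longrightarrow> normal_deriv g c f q = s * f q"
proof -
  show "Lsol \<epsilon> f" using assms by (auto simp: steklov_eigenspace_def harmonic_def Lsol_def)
  show "f p = 0" if "p \<notin> M" for p using assms that by (auto simp: steklov_eigenspace_def)
  show "normal_deriv g c f q = s * f q" if "q \<in> bd" "c \<in> A" "q \<in> fst c" for q c
    using assms that normal_deriv_gc[OF that(1), of \<epsilon> c f] by (auto simp: steklov_eigenspace_def)
qed

lemma combination_normal_deriv:
  assumes "\<And>i. i \<in> I \<Longrightarrow> Lsol \<epsilon> (f i)"
    and "\<And>i q c. i \<in> I \<Longrightarrow> q \<in> bd \<Longrightarrow> c \<in> A \<Longrightarrow> q \<in> fst c \<Longrightarrow> normal_deriv g c (f i) q = s i * f i q"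
    and "q \<in> bd" "c \<in> A" "q \<in> fst c"
  shows "normal_deriv g c (\<lambda>x. \<Sum>i\<in>I. a i * f i x) q = (\<Sum>i\<in>I. a i * (s i * f i q))"
proof -
  have "normal_deriv g c (\<lambda>x. \<Sum>i\<in>I. a i * f i x) q = (\<Sum>i\<in>I. a i * normal_deriv g c (f i) q)"
    by (rule normal_deriv_sum[OF assms(4,5)]) (rule Lsol_smooth[OF assms(1)])
  also have "\<dots> = (\<Sum>i\<in>I. a i * (s i * f i q))"
    by (rule sum.cong) (simp_all add: assms(2)[OF _ assms(3-5)])
  finally show ?thesis .
qed

text \<open>Accretivity of the Dirichlet-to-Neumann operator in the supremum norm: the normal derivative has
  the sign of the function at a point of maximal modulus.\<close>

lemma eigenfunctions_contraction:
  assumes M: "compact M" "connected M" and ne: "bd \<noteq> {}" and e: "0 < \<epsilon>" and t: "0 < t" and I: "finite I"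
    and f: "\<And>i. i \<in> I \<Longrightarrow> Lsol \<epsilon> (f i)"
    and nd: "\<And>i q c. i \<in> I \<Longrightarrow> q \<in> bd \<Longrightarrow> c \<in> A \<Longrightarrow> q \<in> fst c \<Longrightarrow> normal_deriv g c (f i) q = s i * f i q"
    and s: "\<And>i. i \<in> I \<Longrightarrow> 0 \<le> s i \<and> s i \<le> t"
  shows "contraction_inverse I M f (\<lambda>i. 1 + s i / t)"
proof
  show "finite I" by (rule I)
  show "1 \<le> 1 + s i / t \<and> 1 + s i / t \<le> 2" if "i \<in> I" for i using s[OF that] t by simp
  fix a K p
  assume b: "\<And>p. p \<in> M \<Longrightarrow> \<bar>\<Sum>i\<in>I. (1 + s i / t) * a i * f i p\<bar> \<le> K" and p: "p \<in> M"
  define F where "F x = (\<Sum>i\<in>I. a i * f i x)" for x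
  have F: "Lsol \<epsilon> F" unfolding F_def[abs_def] by (rule Lsol_sum[OF e f])
  obtain q where q: "q \<in> bd" "\<forall>p\<in>M. \<bar>F p\<bar> \<le> \<bar>F q\<bar>" using max_on_boundary[OF M ne e F] by blast
  have qM: "q \<in> M" using q bd_sub by blast
  then obtain c where c: "c \<in> A" "q \<in> fst c" using obtain_chart by blast
  \<comment> \<open>The operator behind \<tau> is 1 + D/t, with D the Dirichlet-to-Neumann operator.
    Where |F| is maximal, D F / t does not have the sign opposite to F, so adding it cannot reduce
    the modulus.\<close>
  define \<sigma> where "\<sigma> = (if 0 \<le> F q then 1 else - 1 :: real)"
  have sF: "\<sigma> * F q = \<bar>F q\<bar>" "\<bar>\<sigma>\<bar> = 1" by (auto simp: \<sigma>_def)
  have "0 \<le> normal_deriv g c (\<lambda>x. \<sigma> * F x + 0 * F x) q"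
  proof (rule normal_deriv_local_max[OF c])
    show "smooth_fun A (\<lambda>x. \<sigma> * F x + 0 * F x)"
      by (intro smooth_fun_add smooth_fun_mult smooth_fun_const Lsol_smooth[OF F])
    show "openin (top_of_set M) M" "q \<in> M" using qM by auto
    show "\<sigma> * F x + 0 * F x \<le> \<sigma> * F q + 0 * F q" if "x \<in> M" for x
      using q(2) that sF(1) by (auto simp: \<sigma>_def split: if_splits)
  qed
  then have "0 \<le> \<sigma> * normal_deriv g c F q"
    using normal_deriv_lincomb[OF c Lsol_smooth[OF F] Lsol_smooth[OF F], of \<sigma> 0] by simp
  then have nn: "0 \<le> \<sigma> * (\<Sum>i\<in>I. a i * (s i * f i q))"
  proof -
    have "normal_deriv g c F q = (\<Sum>i\<in>I. a i * (s i * f i q))"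
      unfolding F_def[abs_def] by (rule combination_normal_deriv[OF _ _ q(1) c]) (use f nd in auto)
    then show ?thesis using \<open>0 \<le> \<sigma> * normal_deriv g c F q\<close> by simp
  qed
  have "(\<Sum>i\<in>I. (1 + s i / t) * a i * f i q) = F q + (\<Sum>i\<in>I. a i * (s i * f i q)) / t"
    unfolding F_def sum_divide_distrib sum.distrib[symmetric] by (intro sum.cong) (auto simp: algebra_simps)
  then have "\<sigma> * (\<Sum>i\<in>I. (1 + s i / t) * a i * f i q) = \<bar>F q\<bar> + \<sigma> * (\<Sum>i\<in>I. a i * (s i * f i q)) / t"
    using sF(1) by (simp add: distrib_left)
  moreover have "0 \<le> \<sigma> * (\<Sum>i\<in>I. a i * (s i * f i q)) / t" using nn t by simp
  moreover have "\<sigma> * (\<Sum>i\<in>I. (1 + s i / t) * a i * f i q) \<le> K"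
  proof -
    have "\<sigma> * (\<Sum>i\<in>I. (1 + s i / t) * a i * f i q) \<le> \<bar>\<sigma> * (\<Sum>i\<in>I. (1 + s i / t) * a i * f i q)\<bar>" by simp
    also have "\<dots> = \<bar>\<Sum>i\<in>I. (1 + s i / t) * a i * f i q\<bar>" by (simp add: abs_mult sF(2))
    also have "\<dots> \<le> K" by (rule b[OF qM])
    finally show ?thesis .
  qed
  ultimately have "\<bar>F q\<bar> \<le> K" by linarith
  then show "\<bar>\<Sum>i\<in>I. a i * f i p\<bar> \<le> K" using q(2) p unfolding F_def by fastforce
qed

text \<open>At a boundary point \<open>q\<close> of maximal |f| the function \<open>f q * f\<close>
  has its maximum. Its normal derivative there is \<open>s\<close> times a positive square, and it
  is nonnegative.\<close>

lemma eigenvalue_nonneg: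
  assumes M: "compact M" "connected M" and ne: "bd \<noteq> {}" and e: "0 < \<epsilon>"
    and f: "f \<in> steklov_eigenspace M A (gc \<epsilon>) s" "f \<noteq> 0"
  shows "0 \<le> s"
proof -
  note E = eigenspaceD[OF f(1)]
  obtain q where q: "q \<in> bd" "\<forall>p\<in>M. \<bar>f p\<bar> \<le> \<bar>f q\<bar>" using max_on_boundary[OF M ne e E(1)] by blast
  have qM: "q \<in> M" using q bd_sub by blast
  obtain p where "f p \<noteq> 0" using f(2) by (auto simp: fun_eq_iff)
  then have fq: "f q \<noteq> 0" using q(2) E(2)[of p] by force
  obtain c where c: "c \<in> A" "q \<in> fst c" using obtain_chart[OF qM] by blast
  have "0 \<le> normal_deriv g c (\<lambda>x. f q * f x + 0 * f x) q"
  proof (rule normal_deriv_local_max[OF c])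
    show "smooth_fun A (\<lambda>x. f q * f x + 0 * f x)"
      by (intro smooth_fun_add smooth_fun_mult smooth_fun_const Lsol_smooth[OF E(1)])
    show "openin (top_of_set M) M" "q \<in> M" using qM by auto
    show "f q * f x + 0 * f x \<le> f q * f q + 0 * f q" if "x \<in> M" for x
    proof -
      have "f q * f x \<le> \<bar>f q\<bar> * \<bar>f x\<bar>" by (metis abs_ge_self abs_mult)
      also have "\<dots> \<le> \<bar>f q\<bar> * \<bar>f q\<bar>" using q(2) that by (intro mult_left_mono) auto
      finally show ?thesis by simp
    qed
  qed
  then have "0 \<le> f q * (s * f q)"
    using normal_deriv_lincomb[OF c Lsol_smooth[OF E(1)] Lsol_smooth[OF E(1)], of "f q" 0] E(3)[OF q(1) c] by simp
  then have "0 \<le> s * (f q * f q)" by (simp add: mult_ac)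
  moreover have "0 < f q * f q" using fq by (metis not_real_square_gt_zero)
  ultimately show ?thesis by (simp add: zero_le_mult_iff)
qed

text \<open>The pairs \<open>(X, Y)\<close> are \<open>(\<Sigma>\<^sub>j, \<Sigma>\<^sub>j)\<close> in part (i), where \<open>\<phi>\<close> may vanish away from the boundary, and the
  single pair \<open>(M, \<Sigma>)\<close> in part (ii). If there were more than \<open>card L\<close> eigenvalues up to \<open>t\<close>, some nonzero
  combination of eigenfunctions would vanish at a chosen point of every \<open>Y\<close>.\<close>

lemma eigenvalue_count_bound:
  fixes X Y :: "'l \<Rightarrow> 'a set"
  assumes M: "compact M" "connected M" and ne: "bd \<noteq> {}" and L: "finite L" and t: "0 < t"
    and X: "\<And>l. l \<in> L \<Longrightarrow> connected (X l) \<and> X l \<subseteq> M"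
    and Y: "\<And>l. l \<in> L \<Longrightarrow> Y l = X l \<inter> bd \<and> compact (Y l) \<and> Y l \<noteq> {}" and YU: "bd \<subseteq> (\<Union>l\<in>L. Y l)"
    and Z: "\<And>l. l \<in> L \<Longrightarrow> closedin (top_of_set M) {q \<in> M. \<phi> q = 0 \<and> q \<notin> Y l}"
    and pos: "\<And>l q. l \<in> L \<Longrightarrow> q \<in> X l \<Longrightarrow> \<phi> q = 0 \<Longrightarrow> q \<in> Y l"
  shows "\<exists>\<epsilon>1>0. \<forall>\<epsilon>. 0 < \<epsilon> \<and> \<epsilon> < \<epsilon>1 \<longrightarrow>
    \<not> (\<exists>S. finite S \<and> S \<subseteq> {..t} \<and> card L + 1 \<le> (\<Sum>s\<in>S. steklov_multiplicity M A (gc \<epsilon>) s))"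
proof -
  interpret fs: vector_space "\<lambda>(r::real) (f::'a \<Rightarrow> real). \<lambda>p. r * f p" by (rule fun_vector_space)
  define k where "k = card L + 1"
  \<comment> \<open>The normal derivative of a combination of norm 1 is t (T - 1) applied to it,
    where T has the eigenvalues 1 + s/t. \<open>bdd_times\<close> bounds T by 3^k - 1, and the
    identity adds 1.\<close>
  define T0 where "T0 = t * 3 ^ k"
  have T0: "0 \<le> T0" using t by (simp add: T0_def)
  define Q where "Q l \<epsilon>1 \<longleftrightarrow> (\<forall>\<epsilon> v. 0 < \<epsilon> \<and> \<epsilon> < \<epsilon>1 \<and> Lsol \<epsilon> v \<and> (\<forall>q\<in>M. 0 \<le> v q \<and> v q \<le> 2) \<and>
    (\<forall>q\<in>Y l. \<forall>c\<in>A. q \<in> fst c \<longrightarrow> \<bar>normal_deriv g c v q\<bar> \<le> T0) \<and> (\<exists>p\<in>Y l. v p = 1) \<longrightarrow> (\<forall>q\<in>Y l. 0 < v q))" for l \<epsilon>1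
  have "\<exists>\<epsilon>1>0. Q l \<epsilon>1" if l: "l \<in> L" for l
    unfolding Q_def
  proof (rule component_bound[OF _ _ _ _ Z[OF l] pos[OF l] T0])
    show "connected (X l)" "X l \<subseteq> M" "Y l = X l \<inter> bd" "compact (Y l)" using X[OF l] Y[OF l] by blast+
  qed
  then obtain E where E: "\<And>l. l \<in> L \<Longrightarrow> 0 < E l \<and> Q l (E l)" by metis
  obtain \<epsilon>1 where \<epsilon>1: "0 < \<epsilon>1" "\<forall>l\<in>L. \<epsilon>1 \<le> E l" using finite_pos_lower_bound[OF L, of E] E by blast
  have "\<exists>p. \<forall>l\<in>L. p l \<in> Y l" using Y by (intro bchoice) blast
  then obtain pt where pt: "\<And>l. l \<in> L \<Longrightarrow> pt l \<in> Y l" by blast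
  show ?thesis
  proof (intro exI[of _ \<epsilon>1] conjI \<epsilon>1(1) allI impI notI, elim conjE exE)
    fix \<epsilon> S assume e: "0 < \<epsilon>" "\<epsilon> < \<epsilon>1" and S: "finite S" "S \<subseteq> {..t}"
      and mult: "card L + 1 \<le> (\<Sum>s\<in>S. steklov_multiplicity M A (gc \<epsilon>) s)"
    let ?V = "steklov_eigenspace M A (gc \<epsilon>)"
    have "\<exists>B. B \<subseteq> ?V s \<and> finite B \<and> fs.independent B \<and> card B = steklov_multiplicity M A (gc \<epsilon>) s" for s
    proof -
      obtain B where B: "B \<subseteq> ?V s" "fs.independent B" "card B = fs.dim (?V s)" using fs.basis_exists[of "?V s"] by metis
      show ?thesis
      proof (cases "finite B")
        case True
        then show ?thesis using B unfolding steklov_multiplicity_def by blast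
      next
        \<comment> \<open>An infinite basis has \<open>card\<close> equal to 0. The multiplicity is
          then 0, and the empty family serves.\<close>
        case False
        then have "steklov_multiplicity M A (gc \<epsilon>) s = 0" using B unfolding steklov_multiplicity_def by simp
        then show ?thesis by (intro exI[of _ "{}"]) (simp add: fs.independent_empty)
      qed
    qed
    then obtain B where B: "\<And>s. B s \<subseteq> ?V s \<and> finite (B s) \<and> fs.independent (B s) \<and> card (B s) = steklov_multiplicity M A (gc \<epsilon>) s" by metis
    \<comment> \<open>Pairing each eigenfunction with its eigenvalue makes the count additive
      without any independence between different eigenspaces.\<close>
    have "card (Sigma S B) = (\<Sum>s\<in>S. card (B s))" using S(1) B by (intro card_SigmaI) auto
    then have "k \<le> card (Sigma S B)" using mult B by (simp add: k_def)
    then obtain I where I: "I \<subseteq> Sigma S B" "card I = k" "finite I" using obtain_subset_with_card_n by metis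
    let ?f = "snd :: real \<times> ('a \<Rightarrow> real) \<Rightarrow> 'a \<Rightarrow> real" and ?s = "fst :: real \<times> ('a \<Rightarrow> real) \<Rightarrow> real"
    have fV: "?f i \<in> ?V (?s i)" "?f i \<in> B (?s i)" "?s i \<in> S" if "i \<in> I" for i
    proof -
      have "i \<in> Sigma S B" using I(1) that by blast
      then show "?f i \<in> B (?s i)" "?s i \<in> S" by auto
      then show "?f i \<in> ?V (?s i)" using B by blast
    qed
    have f: "Lsol \<epsilon> (?f i)" if "i \<in> I" for i by (rule eigenspaceD(1)[OF fV(1)[OF that]])
    have nd: "normal_deriv g c (?f i) q = ?s i * ?f i q" if "i \<in> I" "q \<in> bd" "c \<in> A" "q \<in> fst c" for i q c
      by (rule eigenspaceD(3)[OF fV(1)[OF that(1)] that(2-)])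
    have s: "0 \<le> ?s i \<and> ?s i \<le> t" if "i \<in> I" for i
    proof -
      have "?f i \<noteq> 0" using fV(2)[OF that] B[of "?s i"] fs.dependent_zero by metis
      then show ?thesis using eigenvalue_nonneg[OF M ne e(1) fV(1)[OF that]] fV(3)[OF that] S(2) by auto
    qed
    define \<tau> where "\<tau> i = 1 + ?s i / t" for i
    interpret ci: contraction_inverse I M ?f \<tau>
      unfolding \<tau>_def[abs_def] by (rule eigenfunctions_contraction[OF M ne e(1) t I(3) f nd s])
    have "card L < card I" using I(2) by (simp add: k_def)
    from exists_kernel_vector[OF L I(3) this, of "\<lambda>l i. ?f i (pt l)"]
    obtain a where a: "\<exists>i\<in>I. a i \<noteq> 0" "\<forall>l\<in>L. (\<Sum>i\<in>I. a i * ?f i (pt l)) = 0" by blast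
    define F where "F x = (\<Sum>i\<in>I. a i * ?f i x)" for x
    have F: "Lsol \<epsilon> F" unfolding F_def[abs_def] by (rule Lsol_sum[OF e(1) f])
    obtain q where q: "q \<in> bd" "\<forall>p\<in>M. \<bar>F p\<bar> \<le> \<bar>F q\<bar>" using max_on_boundary[OF M ne e(1) F] by blast
    have qM: "q \<in> M" using q bd_sub by blast
    \<comment> \<open>Nonzero coefficients do not yet give a nonzero function. If \<open>F\<close>
      vanished, \<open>null_combination\<close> would leave a nontrivial null combination inside one
      eigenspace, against the independence of its basis.\<close>
    have Fq: "F q \<noteq> 0"
    proof
      assume "F q = 0"
      then have b0: "ci.bdd a 0" using q(2) unfolding ci.bdd_def F_def by auto
      obtain j where j: "j \<in> I" "a j \<noteq> 0" using a(1) by blast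
      define I' where "I' = {i \<in> I. \<tau> i = \<tau> j}"
      have I': "I' = {i \<in> I. ?s i = ?s j}" using t by (auto simp: I'_def \<tau>_def)
      define B' where "B' = ?f ` I'"
      have inj: "inj_on ?f I'" unfolding I' by (auto simp: inj_on_def prod_eq_iff)
      have B'B: "B' \<subseteq> B (?s j)" using fV(2) unfolding B'_def I' by auto
      have ind: "fs.independent B'" using B fs.independent_mono B'B by blast
      have finB: "finite B'" using I(3) by (simp add: B'_def I'_def)
      define u where "u \<beta> = a (?s j, \<beta>)" for \<beta>
      have "(\<Sum>\<beta>\<in>B'. (\<lambda>x. u \<beta> * \<beta> x)) = 0"
      proof
        fix x
        have "(\<Sum>\<beta>\<in>B'. (\<lambda>x. u \<beta> * \<beta> x)) x = (\<Sum>\<beta>\<in>B'. u \<beta> * \<beta> x)" by (induction B' rule: infinite_finite_induct) auto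
        also have "\<dots> = (\<Sum>i\<in>I'. a i * ?f i x)"
          unfolding B'_def sum.reindex[OF inj] o_def by (intro sum.cong) (auto simp: u_def I')
        also have "\<dots> = 0"
        proof (cases "x \<in> M")
          case True
          then show ?thesis using ci.null_combination[OF b0 j(1)] unfolding I'_def by blast
        next
          case False
          then show ?thesis using eigenspaceD(2)[OF fV(1)] unfolding I' by (intro sum.neutral) auto
        qed
        finally show "(\<Sum>\<beta>\<in>B'. (\<lambda>x. u \<beta> * \<beta> x)) x = 0 x" by simp
      qed
      moreover have "?f j \<in> B'" using j(1) by (auto simp: B'_def I')
      moreover have "u (?f j) \<noteq> 0" using j(2) by (simp add: u_def)
      ultimately have "fs.dependent B'" using fs.dependent_finite[OF finB] by blast
      then show False using ind by blast
    qed
    define a' where "a' i = - (1 / F q) * a i" for i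
    define v where "v x = - (1 / F q) * F x + 1" for x
    have a'F: "(\<Sum>i\<in>I. a' i * ?f i x) = - (F x / F q)" for x
      unfolding a'_def F_def by (simp add: sum_distrib_left sum_divide_distrib sum_negf)
    have v: "Lsol \<epsilon> v" unfolding v_def[abs_def] by (rule Lsol_affine[OF e(1) F])
    have ratio: "\<bar>F x / F q\<bar> \<le> 1" if "x \<in> M" for x using q(2) that Fq by (simp add: abs_divide)
    have b1: "ci.bdd a' 1" unfolding ci.bdd_def a'F using ratio by simp
    have v02: "\<forall>x\<in>M. 0 \<le> v x \<and> v x \<le> 2"
    proof
      fix x assume "x \<in> M"
      then have "- 1 \<le> F x / F q" "F x / F q \<le> 1" using ratio[of x] by linarith+
      then show "0 \<le> v x \<and> v x \<le> 2" by (simp add: v_def)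
    qed
    have vq: "v q = 0" using Fq by (simp add: v_def)
    obtain l where l: "l \<in> L" "q \<in> Y l" using q(1) YU by blast
    have vpt: "v (pt l) = 1" using a(2) l(1) by (simp add: v_def F_def)
    have ndv: "\<bar>normal_deriv g c v x\<bar> \<le> T0" if x: "x \<in> bd" and c: "c \<in> A" "x \<in> fst c" for x c
    proof -
      have xM: "x \<in> M" using x bd_sub by blast
      have "v = (\<lambda>y. (- (1 / F q)) * F y + 1 * 1)" by (simp add: v_def[abs_def])
      then have "normal_deriv g c v x = - (1 / F q) * normal_deriv g c F x"
        using normal_deriv_lincomb[OF c Lsol_smooth[OF F] smooth_fun_const, of "- (1 / F q)" 1 1] normal_deriv_const[OF c] by simp
      also have "normal_deriv g c F x = (\<Sum>i\<in>I. a i * (?s i * ?f i x))"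
        unfolding F_def[abs_def] by (rule combination_normal_deriv[OF _ _ x c]) (use f nd in auto)
      also have "- (1 / F q) * \<dots> = (\<Sum>i\<in>I. a' i * (?s i * ?f i x))"
        unfolding a'_def sum_distrib_left by (simp only: mult.assoc)
      \<comment> \<open>This is \<open>s i = t * (\<tau> i - 1)\<close>, which makes the sup norm
        bound for multiplication by \<tau> applicable.\<close>
      also have "\<dots> = t * ((\<Sum>i\<in>I. \<tau> i * a' i * ?f i x) - (\<Sum>i\<in>I. a' i * ?f i x))"
        unfolding sum_subtractf[symmetric] sum_distrib_left using t
        by (intro sum.cong) (auto simp: \<tau>_def field_simps)
      finally have eq: "normal_deriv g c v x = t * ((\<Sum>i\<in>I. \<tau> i * a' i * ?f i x) - (\<Sum>i\<in>I. a' i * ?f i x))" .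
      have "\<bar>\<Sum>i\<in>I. \<tau> i * a' i * ?f i x\<bar> \<le> 3 ^ k - 1"
        using ci.bdd_times[OF b1] xM I(2) unfolding ci.bdd_def by simp
      moreover have "\<bar>\<Sum>i\<in>I. a' i * ?f i x\<bar> \<le> 1" using b1 xM unfolding ci.bdd_def by blast
      ultimately have "\<bar>(\<Sum>i\<in>I. \<tau> i * a' i * ?f i x) - (\<Sum>i\<in>I. a' i * ?f i x)\<bar> \<le> 3 ^ k" by linarith
      then show ?thesis unfolding eq T0_def abs_mult using t by (simp add: mult_left_mono)
    qed
    have "\<epsilon> < E l" using e(2) \<epsilon>1(2) l(1) by fastforce
    moreover have "\<forall>x\<in>Y l. \<forall>c\<in>A. x \<in> fst c \<longrightarrow> \<bar>normal_deriv g c v x\<bar> \<le> T0" using ndv Y[OF l(1)] by blast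
    moreover have "\<exists>p\<in>Y l. v p = 1" using vpt pt[OF l(1)] by blast
    ultimately have "0 < v q" using E[OF l(1)] e(1) v v02 l(2) unfolding Q_def by blast
    then show False using vq by simp
  qed
qed

end

section \<open>The conformal potential\<close>

text \<open>The factor \<open>w $ None\<close> is the height above the boundary hyperplane: it makes
  the bump vanish there, but with nonzero slope inside the ball.\<close>

definition chart_bump :: "('a, 'm::finite) chart \<Rightarrow> 'm model \<Rightarrow> real \<Rightarrow> 'm model \<Rightarrow> real" where
  "chart_bump c x r w = flat_exp 0 (r\<^sup>2 - sqd x w) * w $ None"

definition bump :: "('a, 'm::finite) chart \<Rightarrow> 'm model \<Rightarrow> real \<Rightarrow> 'a \<Rightarrow> real" where
  "bump c x r p = (if p \<in> fst c then chart_bump c x r (snd c p) else 0)"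

lemma flat_exp_nonneg: "0 \<le> flat_exp m t"
  by (simp add: flat_exp_def)

lemma flat_exp_pos: "0 < t \<Longrightarrow> 0 < flat_exp m t"
  by (simp add: flat_exp_def)

lemma Cinf_flat_exp_comp: "Cinf W F \<Longrightarrow> Cinf W (\<lambda>x. flat_exp m (F x))"
  by (rule Cinf_compose[where V=UNIV and G="flat_exp m"]) (auto simp: Cinf_def Ck_on_flat_exp)

lemma Cinf_chart_bump: "Cinf UNIV (chart_bump c x r)"
  unfolding chart_bump_def[abs_def]
  by (intro Cinf_mult Cinf_flat_exp_comp Cinf_diff Cinf_const Cinf_sqd Cinf_nth open_UNIV)

lemma chart_bump_outside: "w \<notin> ball x r \<Longrightarrow> 0 < r \<Longrightarrow> chart_bump c x r w = 0"
proof -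
  assume w: "w \<notin> ball x r" and r: "0 < r"
  have "r \<le> dist w x" using w by (simp add: dist_commute)
  then have "r\<^sup>2 \<le> sqd x w" unfolding sqd_eq using r by (intro power_mono) auto
  then show ?thesis by (simp add: chart_bump_def flat_exp_def)
qed

context manifold begin

lemma bump_nonneg: "c \<in> A \<Longrightarrow> 0 \<le> bump c x r p"
  unfolding bump_def chart_bump_def using None_nonneg[of c p] flat_exp_nonneg by simp

lemma bump_pos:
  assumes c: "c \<in> A" and sub: "ball x r \<inter> half_space \<subseteq> chart_image c" and p: "p \<in> cball_nbhd c x r" "p \<notin> bd"
  shows "0 < bump c x r p"
proof -
  obtain y where y: "y \<in> ball x r" "y \<in> half_space" "p = chart_inv c y" using p(1) unfolding cball_nbhd_def by blast
  have yc: "y \<in> chart_image c" using y sub by blast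
  have pc: "p \<in> fst c" "snd c p = y" using chart_inv_in[OF yc] snd_chart_inv[OF c yc] y(3) by auto
  have "dist y x < r" using y(1) by (simp add: dist_commute)
  then have "sqd x y < r\<^sup>2" unfolding sqd_eq by (intro power_strict_mono) auto
  then have "0 < flat_exp 0 (r\<^sup>2 - sqd x y)" by (intro flat_exp_pos) simp
  moreover have "0 < y $ None" using interior_iff[OF c pc(1)] p(2) pc(2) by simp
  ultimately show ?thesis using pc by (simp add: bump_def chart_bump_def)
qed

lemma bump_outside:
  assumes c: "c \<in> A" and p: "p \<notin> cball_nbhd c x r" and r: "0 < r"
  shows "bump c x r p = 0"
proof (cases "p \<in> fst c")
  case True
  have "snd c p \<in> half_space" using chart_image_half[OF c] True by blast
  then have "snd c p \<notin> ball x r"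
    using p True c unfolding cball_nbhd_def by (metis IntI chart_inv_snd image_eqI)
  then show ?thesis using chart_bump_outside[OF _ r] True by (simp add: bump_def)
qed (simp add: bump_def)

lemma bump_boundary: "c \<in> A \<Longrightarrow> p \<in> bd \<Longrightarrow> bump c x r p = 0"
  using boundary_iff[of c p] by (simp add: bump_def chart_bump_def)

text \<open>On overlaps the bump is a smooth function composed with a transition map. A point
  outside the domain of \<open>c\<close> has a neighbourhood on which the bump is 0, because the
  image of the closed half-ball is compact and hence closed in a Hausdorff space.\<close>

lemma bump_smooth:
  assumes c: "c \<in> A" and sub: "cball x r \<inter> half_space \<subseteq> chart_image c" and r: "0 < r"
  shows "smooth_fun A (bump c x r)"
  unfolding smooth_fun_def smooth_on_iff_Cinf
proof (intro ballI)
  fix d y assume d: "d \<in> A" and y: "y \<in> chart_image d"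
  define p where "p = chart_inv d y"
  have p: "p \<in> fst d" "snd d p = y" using chart_inv_in[OF y] snd_chart_inv[OF d y] by (auto simp: p_def)
  show "\<exists>W F'. y \<in> W \<and> Cinf W F' \<and> (\<forall>z\<in>chart_image d \<inter> W. F' z = (bump c x r \<circ> chart_inv d) z)"
  proof (cases "p \<in> fst c")
    case True
    let ?N = "fst d \<inter> fst c"
    have yN: "y \<in> snd d ` ?N" using True p by auto
    obtain W T where T: "open W" "y \<in> W" "\<And>k. Ck_on k T W" "\<And>w. w \<in> snd d ` ?N \<inter> W \<Longrightarrow> T w = transition d c w"
      using transition_smooth[OF d c] yN unfolding smooth_on_def by metis
    have CT: "Cinf W T" using T(1,3) by (simp add: Cinf_def)
    have "openin (top_of_set half_space) (snd d ` (fst c \<inter> fst d))"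
      by (rule openin_snd_image[OF d chart_openin[OF c]])
    moreover have "fst c \<inter> fst d = ?N" by blast
    ultimately have "openin (top_of_set half_space) (snd d ` ?N)" by simp
    then obtain s where s: "0 < s" "ball y s \<inter> half_space \<subseteq> snd d ` ?N" using openin_half_ball[OF _ yN] by blast
    have o: "open (W \<inter> ball y s)" using T(1) by blast
    have "Cinf (W \<inter> ball y s) (\<lambda>z. chart_bump c x r (T z))"
    proof (rule Cinf_compose[OF _ Cinf_chart_bump])
      show "Cinf (W \<inter> ball y s) T" by (rule Cinf_subset[OF CT o]) blast
    qed simp
    moreover have "chart_bump c x r (T z) = (bump c x r \<circ> chart_inv d) z" if z: "z \<in> chart_image d \<inter> (W \<inter> ball y s)" for z
    proof -
      have "z \<in> half_space" using chart_image_half[OF d] z by blast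
      then have zN: "z \<in> snd d ` ?N" using s(2) z by blast
      then obtain u where u: "u \<in> ?N" "z = snd d u" by blast
      have "T z = snd c u" using T(4)[of z] zN z u d by (auto simp: transition_def)
      then show ?thesis using u d by (simp add: bump_def)
    qed
    ultimately show ?thesis using T(2) s(1)
      by (intro exI[of _ "W \<inter> ball y s"] exI[of _ "\<lambda>z. chart_bump c x r (T z)"]) auto
  next
    case False
    define K where "K = chart_inv c ` (cball x r \<inter> half_space)"
    have "closed (half_space :: 'm model set)" unfolding half_space_def by (intro closed_Collect_le continuous_intros)
    then have "compact (cball x r \<inter> half_space)" by (intro compact_Int_closed compact_cball)
    then have "compact K" unfolding K_def
      by (intro compact_continuous_image continuous_on_subset[OF continuous_chart_inv[OF c] sub])
    then have "closed K" by (rule compact_imp_closed)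
    then have op: "openin (top_of_set M) (M \<inter> - K)" by (intro openin_open_Int) (simp add: open_Compl)
    have "K \<subseteq> fst c"
    proof
      fix u assume "u \<in> K"
      then obtain z where "z \<in> cball x r \<inter> half_space" "u = chart_inv c z" unfolding K_def by blast
      then show "u \<in> fst c" using chart_inv_in[of z c] sub by blast
    qed
    then have "p \<in> M \<inter> - K" using False p chart_sub[OF d] by blast
    then have "y \<in> snd d ` (M \<inter> - K \<inter> fst d)" using p by auto
    from openin_half_ball[OF openin_snd_image[OF d op] this]
    obtain s where s: "0 < s" "ball y s \<inter> half_space \<subseteq> snd d ` (M \<inter> - K \<inter> fst d)" by blast
    have "0 = (bump c x r \<circ> chart_inv d) z" if z: "z \<in> chart_image d \<inter> ball y s" for z
    proof -
      have "z \<in> half_space" using chart_image_half[OF d] z by blast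
      then obtain u where u: "u \<in> M \<inter> - K \<inter> fst d" "z = snd d u" using s(2) z by blast
      have "u \<notin> cball_nbhd c x r" using u(1) unfolding K_def cball_nbhd_def by auto
      then show ?thesis using bump_outside[OF c _ r] u d by simp
    qed
    then show ?thesis using s(1) by (intro exI[of _ "ball y s"] exI[of _ "\<lambda>z. 0"]) auto
  qed
qed

text \<open>Only positivity and a boundary slope are asked for, so finitely many bumps are simply
  added. Each is nonnegative and vanishes on the boundary, hence its outward derivative there is at
  most 0; a bump whose ball contains the point makes the sum strictly negative. \<open>X\<close> is
  the boundary in part (i) and all of \<open>M\<close> in part (ii).\<close>

lemma exists_conformal_potential:
  fixes g :: "('a, 'm) metric"
  assumes metric: "riemannian_metric A g" and dim: "3 \<le> CARD('m option)"
    and X: "compact X" "bd \<subseteq> X" and W: "openin (top_of_set M) W" "X \<subseteq> W"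
  shows "\<exists>\<phi> N. collar_family M A g \<phi> \<and> (\<forall>p\<in>M - W. \<phi> p = 0) \<and>
    openin (top_of_set M) N \<and> X \<subseteq> N \<and> (\<forall>p\<in>N - bd. 0 < \<phi> p)"
proof -
  have WM: "W \<subseteq> M" by (rule openin_imp_subset[OF W(1)])
  have XM: "X \<subseteq> M" using W WM by blast
  \<comment> \<open>The trivial potential gives access to the calculus of normal derivatives before
    \<phi> is available.\<close>
  interpret zero: conformal_family M A g "\<lambda>_. 0"
    by unfold_locales (use metric dim in \<open>auto simp: smooth_fun_const\<close>)
  have "\<exists>c x r. c \<in> A \<and> 0 < r \<and> cball x r \<inter> half_space \<subseteq> chart_image c \<and> cball_nbhd c x r \<subseteq> W \<and> q \<in> cball_nbhd c x r"
    if q: "q \<in> X" for q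
  proof -
    have qM: "q \<in> M" "q \<in> W" using q XM W(2) by blast+
    obtain c where c: "c \<in> A" "q \<in> fst c" using obtain_chart[OF qM(1)] by blast
    obtain r where r: "0 < r" "ball (snd c q) r \<inter> half_space \<subseteq> chart_image c" "cball_nbhd c (snd c q) r \<subseteq> W" "q \<in> cball_nbhd c (snd c q) r"
      by (rule obtain_nbhd[OF W(1) qM(2) c])
    have h: "snd c q \<in> half_space" using chart_image_half[OF c(1)] c(2) by blast
    have "cball (snd c q) (r/2) \<subseteq> ball (snd c q) r" "ball (snd c q) (r/2) \<subseteq> ball (snd c q) r" using r(1) by auto
    moreover from this have "cball_nbhd c (snd c q) (r/2) \<subseteq> cball_nbhd c (snd c q) r" unfolding cball_nbhd_def by blast
    moreover have "q \<in> cball_nbhd c (snd c q) (r/2)"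
      unfolding cball_nbhd_def using r(1) h c by (intro image_eqI[of _ _ "snd c q"]) auto
    ultimately show ?thesis using c(1) r
      by (intro exI[of _ c] exI[of _ "snd c q"] exI[of _ "r/2"]) auto
  qed
  then obtain c x r where cxr: "\<And>q. q \<in> X \<Longrightarrow> c q \<in> A \<and> 0 < r q \<and> cball (x q) (r q) \<inter> half_space \<subseteq> chart_image (c q) \<and>
    cball_nbhd (c q) (x q) (r q) \<subseteq> W \<and> q \<in> cball_nbhd (c q) (x q) (r q)" by metis
  define U where "U q = cball_nbhd (c q) (x q) (r q)" for q
  have balls: "ball (x q) (r q) \<inter> half_space \<subseteq> chart_image (c q)" if "q \<in> X" for q
  proof -
    have "ball (x q) (r q) \<subseteq> cball (x q) (r q)" by auto
    then show ?thesis using cxr[OF that] by blast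
  qed
  have Uo: "openin (top_of_set M) (U q) \<and> q \<in> U q" if "q \<in> X" for q
    unfolding U_def using cball_nbhd_openin[OF _ balls[OF that]] cxr[OF that] by blast
  from finite_openin_cover[OF X(1) XM this]
  obtain F where F: "finite F" "F \<subseteq> X" "X \<subseteq> (\<Union>q\<in>F. U q)" by blast
  define h where "h q = bump (c q) (x q) (r q)" for q
  define \<phi> where "\<phi> p = (\<Sum>q\<in>F. h q p)" for p
  have h0: "0 \<le> h q p" if "q \<in> F" for q p unfolding h_def using bump_nonneg cxr F(2) that by blast
  have hs: "smooth_fun A (h q)" if "q \<in> F" for q
    unfolding h_def using bump_smooth[of "c q" "x q" "r q"] cxr[of q] F(2) that by blast
  have hb: "h q p = 0" if "q \<in> F" "p \<in> bd" for q p
    unfolding h_def using bump_boundary cxr F(2) that by blast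
  have smooth: "smooth_fun A \<phi>" unfolding \<phi>_def[abs_def] by (rule smooth_fun_sum[OF hs])
  have phi0: "0 \<le> \<phi> p" for p unfolding \<phi>_def by (rule sum_nonneg[OF h0])
  have pos: "0 < \<phi> p" if p: "p \<in> (\<Union>q\<in>F. U q) - bd" for p
  proof -
    obtain q where q: "q \<in> F" "p \<in> U q" using p by blast
    have qX: "q \<in> X" using q F(2) by blast
    have "0 < h q p" unfolding h_def
      by (rule bump_pos[OF _ balls[OF qX]]) (use cxr[OF qX] q(2) p in \<open>auto simp: U_def\<close>)
    also have "\<dots> \<le> \<phi> p" unfolding \<phi>_def by (rule member_le_sum[OF q(1)]) (use h0 F(1) in auto)
    finally show ?thesis .
  qed
  have nd: "\<exists>d\<in>A. p \<in> fst d \<and> normal_deriv g d \<phi> p < 0" if p: "p \<in> bd" for p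
  proof -
    obtain q where q: "q \<in> F" "p \<in> U q" using F(3) X(2) p by blast
    have qX: "q \<in> X" using q F(2) by blast
    let ?c = "c q"
    have cA: "?c \<in> A" using cxr[OF qX] by blast
    obtain y where y: "y \<in> ball (x q) (r q)" "y \<in> half_space" "p = chart_inv ?c y"
      using q(2) unfolding U_def cball_nbhd_def by blast
    have yc: "y \<in> chart_image ?c" using y balls[OF qX] by blast
    have pc: "p \<in> fst ?c" "snd ?c p = y" using chart_inv_in[OF yc] snd_chart_inv[OF cA yc] y(3) by auto
    have yN: "y $ None = 0" using boundary_iff[OF cA pc(1)] p pc(2) by simp
    have sum: "normal_deriv g ?c \<phi> p = (\<Sum>q'\<in>F. normal_deriv g ?c (h q') p)"
    proof -
      have "normal_deriv g ?c (\<lambda>z. \<Sum>q'\<in>F. 1 * h q' z) p = (\<Sum>q'\<in>F. 1 * normal_deriv g ?c (h q') p)"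
        by (rule zero.normal_deriv_sum[OF cA pc(1)]) (rule hs)
      then show ?thesis by (simp add: \<phi>_def[abs_def])
    qed
    have le: "normal_deriv g ?c (h q') p \<le> 0" if q': "q' \<in> F" for q'
    proof -
      have "0 \<le> normal_deriv g ?c (\<lambda>z. - 1 * h q' z + 0 * h q' z) p"
      proof (rule zero.normal_deriv_local_max[OF cA pc(1)])
        show "smooth_fun A (\<lambda>z. - 1 * h q' z + 0 * h q' z)"
          by (intro smooth_fun_add smooth_fun_mult smooth_fun_const hs[OF q'])
        show "openin (top_of_set M) M" "p \<in> M" using p bd_sub by auto
        show "- 1 * h q' z + 0 * h q' z \<le> - 1 * h q' p + 0 * h q' p" for z
          using h0[OF q', of z] hb[OF q' p] by simp
      qed
      then show ?thesis using zero.normal_deriv_lincomb[OF cA pc(1) hs[OF q'] hs[OF q'], of "-1" 0] by simp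
    qed
    \<comment> \<open>Where \<open>w $ None\<close> is 0, the product rule leaves only the
      derivative of this factor. The result is the negative \<open>None\<close> component of the
      outward normal times a positive value of the profile.\<close>
    have lt: "normal_deriv g ?c (h q) p < 0"
    proof -
      let ?e = "\<lambda>w. flat_exp 0 ((r q)\<^sup>2 - sqd (x q) w)"
      obtain s where s: "0 < s" "ball y s \<inter> half_space \<subseteq> chart_image ?c" by (rule chart_ball[OF cA yc])
      have "pd i (chart_bump ?c (x q) (r q)) y = ?e y * (if i = None then 1 else 0)" for i
      proof -
        have "Cinf UNIV ?e" by (intro Cinf_flat_exp_comp Cinf_diff Cinf_const Cinf_sqd open_UNIV)
        then have "?e differentiable (at y)" by (rule Cinf_differentiable) simp
        moreover have "(\<lambda>w. w $ None) differentiable (at y)" by (rule Cinf_differentiable[OF Cinf_nth[OF open_UNIV]]) simp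
        ultimately show ?thesis unfolding chart_bump_def[abs_def] by (simp add: pd_mult yN)
      qed
      moreover have "normal_deriv g ?c (h q) p = (\<Sum>i\<in>UNIV. outward_normal g ?c p $ i * pd i (chart_bump ?c (x q) (r q)) (snd ?c p))"
      proof (rule zero.normal_deriv_local[OF cA pc(1)])
        show "Cinf (ball y s) (chart_bump ?c (x q) (r q))" by (rule Cinf_subset[OF Cinf_chart_bump]) auto
        show "snd ?c p \<in> ball y s" using s(1) by (simp add: pc(2))
        fix z assume "z \<in> ball y s" "z \<in> half_space"
        then have z: "z \<in> chart_image ?c" using s(2) by blast
        show "(h q \<circ> chart_inv ?c) z = chart_bump ?c (x q) (r q) z"
          unfolding h_def bump_def o_def using chart_inv_in[OF z] snd_chart_inv[OF cA z] by simp
      qed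
      moreover have "outward_normal g ?c p $ i * (?e y * (if i = None then 1 else 0)) = (if i = None then outward_normal g ?c p $ None * ?e y else 0)" for i
        by simp
      ultimately have "normal_deriv g ?c (h q) p = outward_normal g ?c p $ None * ?e y"
        by (simp add: pc(2))
      moreover have "0 < ?e y"
      proof -
        have "dist y (x q) < r q" using y(1) by (simp add: dist_commute)
        then have "sqd (x q) y < (r q)\<^sup>2" unfolding sqd_eq by (intro power_strict_mono) auto
        then show ?thesis by (intro flat_exp_pos) simp
      qed
      ultimately show ?thesis using zero.outward_normal_neg[OF cA pc(1)] by (simp add: mult_neg_pos)
    qed
    have "(\<Sum>q'\<in>F. normal_deriv g ?c (h q') p) = normal_deriv g ?c (h q) p + (\<Sum>q'\<in>F - {q}. normal_deriv g ?c (h q') p)"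
      by (rule sum.remove[OF F(1) q(1)])
    also have "\<dots> < 0" using lt sum_nonpos[of "F - {q}" "\<lambda>q'. normal_deriv g ?c (h q') p"] le by fastforce
    finally show ?thesis using sum cA pc(1) by auto
  qed
  have "collar_family M A g \<phi>"
    by unfold_locales (use metric dim smooth phi0 nd hb in \<open>auto simp: \<phi>_def\<close>)
  moreover have "\<forall>p\<in>M - W. \<phi> p = 0"
  proof
    fix p assume p: "p \<in> M - W"
    have "h q p = 0" if "q \<in> F" for q
    proof -
      have "q \<in> X" using that F(2) by blast
      then show ?thesis unfolding h_def using bump_outside[of "c q" p "x q" "r q"] cxr[of q] p by blast
    qed
    then show "\<phi> p = 0" by (simp add: \<phi>_def)
  qed
  moreover have "openin (top_of_set M) (\<Union>q\<in>F. U q)" by (intro openin_Union) (use Uo F(2) in blast)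
  ultimately show ?thesis using F(3) pos by (intro exI[of _ \<phi>] exI[of _ "\<Union>q\<in>F. U q"]) blast
qed

end

context collar_family begin

section \<open>The family of conformal metrics and the limit of its eigenvalues\<close>

lemma gc_riemannian:
  assumes e: "0 < \<epsilon>" shows "riemannian_metric A (gc \<epsilon>)"
  unfolding riemannian_metric_def
proof (intro conjI ballI allI impI)
  fix c p assume c: "c \<in> A" "p \<in> fst c"
  show "transpose (gc \<epsilon> c p) = gc \<epsilon> c p"
    using g_sym[OF c] by (simp add: gc_def transpose_def vec_eq_iff)
  fix v :: "'b model" assume v: "v \<noteq> 0"
  have "p \<in> M" using chart_sub[OF c(1)] c(2) by blast
  then have "0 < 1 + \<phi> p / \<epsilon>" using phi_nonneg[of p] e by (simp add: add_pos_nonneg)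
  then have "0 < (1 + \<phi> p / \<epsilon>)\<^sup>2" by simp
  then show "0 < v \<bullet> (gc \<epsilon> c p *v v)"
    using g_pos[OF c v] by (simp add: gc_def scaleR_matrix_vector_assoc[symmetric])
next
  fix c d p assume c: "c \<in> A" and d: "d \<in> A" and p: "p \<in> fst c \<inter> fst d"
  have "g c p = transpose (jacobian_transition c d p) ** g d p ** jacobian_transition c d p"
    using metric c d p unfolding riemannian_metric_def by blast
  then show "gc \<epsilon> c p = transpose (jacobian_transition c d p) ** gc \<epsilon> d p ** jacobian_transition c d p"
    by (simp add: gc_def matrix_scalar_ac scalar_matrix_assoc[symmetric])
next
  fix c assume c: "c \<in> A"
  have 1: "smooth_on (chart_image c) (\<lambda>x. (1 + \<phi> (chart_inv c x) / \<epsilon>)\<^sup>2)"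
  proof -
    have "smooth_fun A (\<lambda>p. (1 + inverse \<epsilon> * \<phi> p) * (1 + inverse \<epsilon> * \<phi> p))"
      by (intro smooth_fun_mult smooth_fun_add smooth_fun_const phi_smooth)
    then show ?thesis using c unfolding smooth_fun_def
      by (simp add: o_def power2_eq_square divide_inverse mult.commute)
  qed
  have "smooth_on (chart_image c) (\<lambda>x. (1 + \<phi> (chart_inv c x) / \<epsilon>)\<^sup>2 *\<^sub>R (g c \<circ> chart_inv c) x)"
    by (rule smooth_on_combine[where p="\<lambda>s G. s *\<^sub>R G", OF 1 g_smooth[OF c]]) (rule Cinf_scaleR)
  then show "smooth_on (chart_image c) (gc \<epsilon> c \<circ> chart_inv c)" by (simp add: gc_def o_def)
qed

lemma gc_conformal:
  assumes e: "0 < \<epsilon>" shows "conformal A (gc \<epsilon>) g"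
  unfolding conformal_def
proof (intro exI[of _ "\<lambda>p. 1 + inverse \<epsilon> * \<phi> p"] conjI ballI)
  show "smooth_fun A (\<lambda>p. 1 + inverse \<epsilon> * \<phi> p)" by (intro smooth_fun_mult smooth_fun_add smooth_fun_const phi_smooth)
  fix c p assume c: "c \<in> A" "p \<in> fst c"
  have "p \<in> M" using chart_sub[OF c(1)] c(2) by blast
  then show "0 < 1 + inverse \<epsilon> * \<phi> p" using phi_nonneg[of p] e by (simp add: add_pos_nonneg)
  show "gc \<epsilon> c p = (1 + inverse \<epsilon> * \<phi> p)\<^sup>2 *\<^sub>R g c p" by (simp add: gc_def divide_inverse mult.commute)
qed

lemma gc_coincide: "(\<And>p. p \<in> S \<Longrightarrow> \<phi> p = 0) \<Longrightarrow> metrics_coincide_on A S (gc \<epsilon>) g"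
  by (auto simp: metrics_coincide_on_def gc_def)

text \<open>The eigenvalue is an infimum over an upward closed set of thresholds. A threshold with
  too few eigenvalues below it is therefore a lower bound.\<close>

lemma steklov_tendsto:
  assumes "\<And>t. 0 < t \<Longrightarrow> \<exists>\<epsilon>1>0. \<forall>\<epsilon>. 0 < \<epsilon> \<and> \<epsilon> < \<epsilon>1 \<longrightarrow>
    \<not> (\<exists>S. finite S \<and> S \<subseteq> {..t} \<and> k \<le> (\<Sum>s\<in>S. steklov_multiplicity M A (gc \<epsilon>) s))"
  shows "((\<lambda>\<epsilon>. steklov_eigenvalue M A (gc \<epsilon>) k) \<longlongrightarrow> \<infinity>) (at_right 0)"
  unfolding tendsto_PInfty
proof
  fix x :: real
  define t where "t = \<bar>x\<bar> + 1"
  have t: "0 < t" "x < t" by (auto simp: t_def)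
  obtain \<epsilon>1 where \<epsilon>1: "0 < \<epsilon>1" "\<forall>\<epsilon>. 0 < \<epsilon> \<and> \<epsilon> < \<epsilon>1 \<longrightarrow>
    \<not> (\<exists>S. finite S \<and> S \<subseteq> {..t} \<and> k \<le> (\<Sum>s\<in>S. steklov_multiplicity M A (gc \<epsilon>) s))"
    using assms[OF t(1)] by blast
  have "ereal x < steklov_eigenvalue M A (gc \<epsilon>) k" if e: "0 < \<epsilon>" "\<epsilon> < \<epsilon>1" for \<epsilon>
  proof -
    have "ereal t \<le> steklov_eigenvalue M A (gc \<epsilon>) k"
      unfolding steklov_eigenvalue_def
    proof (rule Inf_greatest)
      fix u assume "u \<in> {ereal t | t. \<exists>S. finite S \<and> S \<subseteq> {..t} \<and> k \<le> (\<Sum>s\<in>S. steklov_multiplicity M A (gc \<epsilon>) s)}"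
      then obtain r S where r: "u = ereal r" "finite S" "S \<subseteq> {..r}" "k \<le> (\<Sum>s\<in>S. steklov_multiplicity M A (gc \<epsilon>) s)" by blast
      have "\<not> S \<subseteq> {..t}" using \<epsilon>1(2) e r(2,4) by blast
      then have "t \<le> r" using r(3) by force
      then show "ereal t \<le> u" using r(1) by simp
    qed
    moreover have "ereal x < ereal t" using t by simp
    ultimately show ?thesis by (rule less_le_trans[rotated])
  qed
  then show "\<forall>\<^sub>F \<epsilon> in at_right 0. ereal x < steklov_eigenvalue M A (gc \<epsilon>) k"
    unfolding eventually_at_right_field using \<epsilon>1(1) by blast
qed

end

theorem theorem1p1:
  fixes M :: "'a::t2_space set"
    and A :: "('a, 'm::finite) chart set"
    and g :: "('a, 'm) metric"
    and b :: nat
  assumes "smooth_manifold M A" and "compact M" and "connected M"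
    and "CARD('m option) \<ge> 3"
    and "riemannian_metric A g"
    and "b = card (components (boundary A))" and "b \<ge> 1"
  shows
    "(\<forall>V. V \<subseteq> M \<and> (\<exists>W. openin (top_of_set M) W \<and> boundary A \<subseteq> W \<and> W \<subseteq> V) \<longrightarrow>
        (\<exists>\<epsilon>\<^sub>0>0. \<exists>g\<^sub>\<epsilon> :: real \<Rightarrow> ('a, 'm) metric.
           (\<forall>\<epsilon>. 0 < \<epsilon> \<and> \<epsilon> < \<epsilon>\<^sub>0 \<longrightarrow>
              riemannian_metric A (g\<^sub>\<epsilon> \<epsilon>) \<and> conformal A (g\<^sub>\<epsilon> \<epsilon>) g \<and>
              metrics_coincide_on A (boundary A \<union> (M - V)) (g\<^sub>\<epsilon> \<epsilon>) g) \<and>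
           ((\<lambda>\<epsilon>. steklov_eigenvalue M A (g\<^sub>\<epsilon> \<epsilon>) (b + 1)) \<longlongrightarrow> \<infinity>) (at_right 0)))
     \<and>
     (\<exists>\<epsilon>\<^sub>0>0. \<exists>g\<^sub>\<epsilon> :: real \<Rightarrow> ('a, 'm) metric.
        (\<forall>\<epsilon>. 0 < \<epsilon> \<and> \<epsilon> < \<epsilon>\<^sub>0 \<longrightarrow>
           riemannian_metric A (g\<^sub>\<epsilon> \<epsilon>) \<and> conformal A (g\<^sub>\<epsilon> \<epsilon>) g \<and>
           metrics_coincide_on A (boundary A) (g\<^sub>\<epsilon> \<epsilon>) g) \<and>
        ((\<lambda>\<epsilon>. steklov_eigenvalue M A (g\<^sub>\<epsilon> \<epsilon>) 2) \<longlongrightarrow> \<infinity>) (at_right 0))"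
proof -
  interpret manifold M A by unfold_locales (rule assms(1))
  have dim: "3 \<le> CARD('m option)" using assms(4) .
  \<comment> \<open>An infinite set of components would have \<open>card\<close> 0, against b >=
    1.\<close>
  have fin: "finite (components bd)" using assms(6,7) card.infinite by fastforce
  have "components bd \<noteq> {}" using assms(6,7) by auto
  then have ne: "bd \<noteq> {}" by auto
  have cb: "compact bd"
    using bd_closedin assms(2) closedin_compact by blast
  have closed_comp: "compact Y" "closedin (top_of_set M) (bd - Y)" if Y: "Y \<in> components bd" for Y
  proof -
    have cl: "closedin (top_of_set M) Y'" if "Y' \<in> components bd" for Y'
      using closedin_component[OF that] closedin_trans[OF _ bd_closedin] by blast
    show "compact Y" using closedin_compact[OF assms(2) cl[OF Y]] .
    \<comment> \<open>Components are closed in the boundary; since there are finitely many, the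
      union of the others is closed as well.\<close>
    have "bd - Y = \<Union>(components bd - {Y})"
    proof
      show "bd - Y \<subseteq> \<Union>(components bd - {Y})" using Union_components[of bd] by blast
      show "\<Union>(components bd - {Y}) \<subseteq> bd - Y"
      proof
        fix x assume "x \<in> \<Union>(components bd - {Y})"
        then obtain Y' where Y': "Y' \<in> components bd" "Y' \<noteq> Y" "x \<in> Y'" by blast
        then have "x \<in> bd" using in_components_subset by blast
        moreover have "x \<notin> Y" using components_nonoverlap[OF Y'(1) Y] Y' by blast
        ultimately show "x \<in> bd - Y" by blast
      qed
    qed
    moreover have "closedin (top_of_set M) (\<Union>(components bd - {Y}))"
      using fin cl by (intro closedin_Union) auto
    ultimately show "closedin (top_of_set M) (bd - Y)" by simp
  qed
  show ?thesis
  proof (intro conjI allI impI; (elim conjE exE)?)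
    fix V W assume V: "V \<subseteq> M" and W: "openin (top_of_set M) W" "bd \<subseteq> W" "W \<subseteq> V"
    obtain \<phi> N where cf: "collar_family M A g \<phi>" and out: "\<forall>p\<in>M - W. \<phi> p = 0"
      and N: "openin (top_of_set M) N" "bd \<subseteq> N" "\<forall>p\<in>N - bd. 0 < \<phi> p"
      using exists_conformal_potential[OF assms(5) dim cb subset_refl W(1,2)] by blast
    interpret collar_family M A g \<phi> by (rule cf)
    have count: "\<exists>\<epsilon>1>0. \<forall>\<epsilon>. 0 < \<epsilon> \<and> \<epsilon> < \<epsilon>1 \<longrightarrow>
      \<not> (\<exists>S. finite S \<and> S \<subseteq> {..t} \<and> b + 1 \<le> (\<Sum>s\<in>S. steklov_multiplicity M A (gc \<epsilon>) s))" if t: "0 < t" for t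
      unfolding assms(6)
    proof (rule eigenvalue_count_bound[OF assms(2,3) ne fin t, where X="\<lambda>Y. Y" and Y="\<lambda>Y. Y"])
      fix Y assume Y: "Y \<in> components bd"
      have Yb: "Y \<subseteq> bd" by (rule in_components_subset[OF Y])
      show "connected Y \<and> Y \<subseteq> M" using in_components_connected[OF Y] Yb bd_sub by blast
      show "Y = Y \<inter> bd \<and> compact Y \<and> Y \<noteq> {}" using Yb closed_comp(1)[OF Y] in_components_nonempty[OF Y] by blast
      have "continuous_on M \<phi>" by (rule smooth_fun_continuous[OF phi_smooth])
      then have "closedin (top_of_set M) (M \<inter> \<phi> -` {0})" by (rule continuous_closedin_preimage) simp
      then have "closedin (top_of_set M) ((bd - Y) \<union> (M \<inter> \<phi> -` {0} - N))"
        by (intro closedin_Un closed_comp(2)[OF Y] closedin_diff N(1))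
      \<comment> \<open>The potential may vanish far from the boundary, but inside \<open>N\<close>
        its zeros are boundary points. This splits the zeros off \<open>Y\<close> into two closed
        sets.\<close>
      moreover have "{q \<in> M. \<phi> q = 0 \<and> q \<notin> Y} = (bd - Y) \<union> (M \<inter> \<phi> -` {0} - N)"
      proof (intro set_eqI iffI)
        fix q assume q: "q \<in> {q \<in> M. \<phi> q = 0 \<and> q \<notin> Y}"
        show "q \<in> (bd - Y) \<union> (M \<inter> \<phi> -` {0} - N)"
        proof (cases "q \<in> bd")
          case False
          then have "q \<notin> N" using N(3) q by (metis (mono_tags, lifting) DiffI less_irrefl mem_Collect_eq)
          then show ?thesis using q by simp
        qed (use q in simp)
      next
        fix q assume "q \<in> (bd - Y) \<union> (M \<inter> \<phi> -` {0} - N)"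
        then show "q \<in> {q \<in> M. \<phi> q = 0 \<and> q \<notin> Y}"
        proof
          assume "q \<in> bd - Y"
          then show ?thesis using phi_bd[of q] bd_sub by auto
        next
          assume q: "q \<in> M \<inter> \<phi> -` {0} - N"
          then have "q \<notin> Y" using N(2) Yb by blast
          then show ?thesis using q by simp
        qed
      qed
      ultimately show "closedin (top_of_set M) {q \<in> M. \<phi> q = 0 \<and> q \<notin> Y}" by simp
    qed (use Union_components[of bd] in auto)
    show "\<exists>\<epsilon>\<^sub>0>0. \<exists>g\<^sub>\<epsilon> :: real \<Rightarrow> ('a, 'm) metric. (\<forall>\<epsilon>. 0 < \<epsilon> \<and> \<epsilon> < \<epsilon>\<^sub>0 \<longrightarrow> riemannian_metric A (g\<^sub>\<epsilon> \<epsilon>) \<and> conformal A (g\<^sub>\<epsilon> \<epsilon>) g \<and>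
              metrics_coincide_on A (bd \<union> (M - V)) (g\<^sub>\<epsilon> \<epsilon>) g) \<and>
           ((\<lambda>\<epsilon>. steklov_eigenvalue M A (g\<^sub>\<epsilon> \<epsilon>) (b + 1)) \<longlongrightarrow> \<infinity>) (at_right 0)"
    proof -
      \<comment> \<open>Every positive \<epsilon> yields an admissible metric; the threshold 1 is
        arbitrary.\<close>
      have R: "\<forall>\<epsilon>. 0 < \<epsilon> \<and> \<epsilon> < 1 \<longrightarrow> riemannian_metric A (gc \<epsilon>) \<and> conformal A (gc \<epsilon>) g \<and>
          metrics_coincide_on A (bd \<union> (M - V)) (gc \<epsilon>) g"
      proof (intro allI impI conjI; elim conjE)
        fix \<epsilon> :: real assume e: "0 < \<epsilon>"
        show "riemannian_metric A (gc \<epsilon>)" "conformal A (gc \<epsilon>) g" by (rule gc_riemannian[OF e] gc_conformal[OF e])+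
        show "metrics_coincide_on A (bd \<union> (M - V)) (gc \<epsilon>) g"
          by (rule gc_coincide) (use phi_bd out W(3) in blast)
      qed
      have T: "((\<lambda>\<epsilon>. steklov_eigenvalue M A (gc \<epsilon>) (b + 1)) \<longlongrightarrow> \<infinity>) (at_right 0)"
        by (rule steklov_tendsto[OF count])
      show ?thesis
        by (rule exI[of _ "1::real"], rule conjI[OF zero_less_one], rule exI[of _ gc], rule conjI[OF R T])
    qed
  next
    \<comment> \<open>Covering all of \<open>M\<close> by bumps makes the potential positive in the
      whole interior, so a single Harnack chain links all boundary components.\<close>
    have Mo: "openin (top_of_set M) M" by simp
    obtain \<phi> N where cf: "collar_family M A g \<phi>"
      and N: "openin (top_of_set M) N" "M \<subseteq> N" "\<forall>p\<in>N - bd. 0 < \<phi> p"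
      using exists_conformal_potential[OF assms(5) dim assms(2) bd_sub Mo subset_refl] by blast
    interpret collar_family M A g \<phi> by (rule cf)
    have zero: "q \<in> bd" if "q \<in> M" "\<phi> q = 0" for q
      using N(2,3) that by (metis Diff_iff less_irrefl subsetD)
    have count: "\<exists>\<epsilon>1>0. \<forall>\<epsilon>. 0 < \<epsilon> \<and> \<epsilon> < \<epsilon>1 \<longrightarrow>
      \<not> (\<exists>S. finite S \<and> S \<subseteq> {..t} \<and> 2 \<le> (\<Sum>s\<in>S. steklov_multiplicity M A (gc \<epsilon>) s))" if t: "0 < t" for t
    proof -
      have "\<exists>\<epsilon>1>0. \<forall>\<epsilon>. 0 < \<epsilon> \<and> \<epsilon> < \<epsilon>1 \<longrightarrow>
        \<not> (\<exists>S. finite S \<and> S \<subseteq> {..t} \<and> card {()} + 1 \<le> (\<Sum>s\<in>S. steklov_multiplicity M A (gc \<epsilon>) s))"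
      \<comment> \<open>The index set \<open>{()}\<close> stands for the single pair, so one linear
        condition is imposed and two eigenvalues are excluded.\<close>
      proof (rule eigenvalue_count_bound[OF assms(2,3) ne _ t, where X="\<lambda>_. M" and Y="\<lambda>_. bd"])
        have "{q \<in> M. \<phi> q = 0 \<and> q \<notin> bd} = {}" using zero by blast
        then show "closedin (top_of_set M) {q \<in> M. \<phi> q = 0 \<and> q \<notin> bd}" by (metis closedin_empty)
      qed (use assms(3) cb ne bd_sub zero in auto)
      then show ?thesis by (simp add: numeral_2_eq_2)
    qed
    show "\<exists>\<epsilon>\<^sub>0>0. \<exists>g\<^sub>\<epsilon> :: real \<Rightarrow> ('a, 'm) metric. (\<forall>\<epsilon>. 0 < \<epsilon> \<and> \<epsilon> < \<epsilon>\<^sub>0 \<longrightarrow> riemannian_metric A (g\<^sub>\<epsilon> \<epsilon>) \<and> conformal A (g\<^sub>\<epsilon> \<epsilon>) g \<and>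
           metrics_coincide_on A bd (g\<^sub>\<epsilon> \<epsilon>) g) \<and>
        ((\<lambda>\<epsilon>. steklov_eigenvalue M A (g\<^sub>\<epsilon> \<epsilon>) 2) \<longlongrightarrow> \<infinity>) (at_right 0)"
    proof -
      have R: "\<forall>\<epsilon>. 0 < \<epsilon> \<and> \<epsilon> < 1 \<longrightarrow> riemannian_metric A (gc \<epsilon>) \<and> conformal A (gc \<epsilon>) g \<and>
          metrics_coincide_on A (bd) (gc \<epsilon>) g"
      proof (intro allI impI conjI; elim conjE)
        fix \<epsilon> :: real assume e: "0 < \<epsilon>"
        show "riemannian_metric A (gc \<epsilon>)" "conformal A (gc \<epsilon>) g" by (rule gc_riemannian[OF e] gc_conformal[OF e])+
        show "metrics_coincide_on A (bd) (gc \<epsilon>) g"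
          by (rule gc_coincide[OF phi_bd])
      qed
      have T: "((\<lambda>\<epsilon>. steklov_eigenvalue M A (gc \<epsilon>) 2) \<longlongrightarrow> \<infinity>) (at_right 0)"
        by (rule steklov_tendsto[OF count])
      show ?thesis
        by (rule exI[of _ "1::real"], rule conjI[OF zero_less_one], rule exI[of _ gc], rule conjI[OF R T])
    qed
  qed
qed

end
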